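(* (1) The mapping $\Phi_+$ is a bijection between the $\mathbb N$-biorientations in $\mathcal B$ and the $\mathbb N$-mobiles of positive excess. For $T=\Phi_+(O)$, the excess of $T$ equals the outer degree of $O$, and there are correspondences (bijections) from the inner faces of $O$ to the black vertices of $T$ preserving degree, from the vertices of $O$ to the white vertices of $T$ preserving weight, and from the edges of $O$ to the edges of $T$ preserving weight. (2) The mapping $\Phi_-$ is a bijection between the $\mathbb N$-biorientations in $\widetilde{\mathcal B}$ and the $\mathbb N$-mobiles of negative excess. For $T=\Phi_-(O)$, the excess of $T$ equals minus the outer degree of $O$, and there are correspondences from the inner faces of $O$ to the black vertices of $T$ preserving degree, from the inner vertices of $O$ to the white vertices of $T$ preserving weight, and from the inner edges of $O$ to the edges of $T$ preserving weight.
   Context: A map is a connected finite graph (loops and multiple edges allowed) embedded in the oriented sphere up to orientation-preserving homeomorphism; corners are angular sectors between consecutive half-edges around a vertex; the degree of a face is its number of corners. A face-rooted map has a marked root-face; the other faces are inner; vertices/edges incident to the root-face are outer, the others inner; the outer degree is the degree of the root-face. A biorientation assigns to each half-edge a direction, ingoing (toward its vertex) or outgoing; an edge is $i$-way if exactly $i$ of its half-edges are ingoing. Directed paths follow 2-way edges or 1-way edges toward their ingoing half-edge; a circuit is a simple closed directed path. In a face-rooted biorientation a circuit is counterclockwise if the root-face is on its right; the biorientation is minimal if it has no counterclockwise circuit, clockwise-minimal if moreover each outer edge is 2-way or 1-way with a non-root face on its right, and accessible if every vertex is reachable by a directed path from some outer vertex. A weighted biorientation gives a real weight to each half-edge; edge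 weight = sum of its two half-edge weights; vertex weight = sum of weights of incident ingoing half-edges. An $\mathbb N$-biorientation is a weighted biorientation with weights in $\{0,1,2,\dots\}$, positive on ingoing and zero on outgoing half-edges. It is admissible if the root-face contour is a simple cycle, every outer vertex has indegree $1$, and every outer edge is 1-way with weights $0$ (outgoing) and $1$ (ingoing). $\mathcal B$ is the set of clockwise-minimal accessible face-rooted weighted biorientations; $\widetilde{\mathcal B}$ its admissible subset. A mobile is a plane tree with vertices colored black or white (not necessarily properly), where black vertices may carry dangling half-edges (buds); its excess is the number of black-white edges plus twice the number of white-white edges minus the number of buds. An $\mathbb N$-mobile gives each non-bud half-edge a weight in $\{0,1,2,\dots\}$, positive if incident to a white vertex, zero if incident to a black vertex; the weight of a vertex is the sum of weights of its non-bud half-edges, the weight of an edge the sum of its two half-edge weights, and the degree of a black vertex counts all its half-edges including buds. Local transformations (a black vertex $b_g$ placed in each face $g$): for an edge $e$ with half-edges $h$ at $v$, $h'$ at $v'$, of weights $w,w'$, with $c,c'$ the corners preceding $h,h'$ clockwise around $v,v'$ lying in faces $f,f'$: if $e$ is 1-way with $h$ ingoing, create an edge $b_f$–$v$ in corner $c$ (weight $w$ at $v$, $w'$ at $b_f$), a bud at $b_{f'}$ toward $c'$, and delete $e$; if 0-way, create an edge $b_f$–$b_{f'}$ (weight $w'$ at $b_f$, $w$ at $b_{f'}$) and delete $e$; if 2-way, attach buds at $b_f$ and $b_{f'}$ toward $c$ and $c'$ and keep $e$. For $O\in\mathcal B$ with root-face $f_0$ (vertices white): $\Phi_+(O)$ is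 obtained by transforming every edge then deleting $b_{f_0}$ and its buds. For $O\in\widetilde{\mathcal B}$: $\Phi_-(O)$ is obtained by reversing every edge of the root-face contour, transforming every edge, then deleting $b_{f_0}$, the outer vertices and the edges between them. *)

theory Defs
  imports Main
begin

section \<open>Combinatorial encoding of face-rooted N-biorientations\<close>

text \<open>A map is encoded by a rotation system on a finite set of half-edges (darts):
  Ma is the fixed-point-free involution pairing the two half-edges of an edge,
  Ms is the permutation giving the next half-edge clockwise around its vertex.
  The corner associated with a dart d is the corner preceding d clockwise around its vertex.
  Faces are the orbits of phi = Ms o Ma acting on corners.  Mr is a dart whose corner lies
  in the root face.  Mw is the weight of each half-edge; in an N-biorientation a half-edge
  is ingoing iff its weight is positive.\<close>

record 'a bmap =
  Md :: "'a set"
  Ma :: "'a \<Rightarrow> 'a"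
  Ms :: "'a \<Rightarrow> 'a"
  Mr :: "'a"
  Mw :: "'a \<Rightarrow> nat"

definition orb :: "('a \<Rightarrow> 'a) \<Rightarrow> 'a \<Rightarrow> 'a set" where
  "orb f x = {(f ^^ n) x | n. True}"

definition phi :: "'a bmap \<Rightarrow> 'a \<Rightarrow> 'a" where
  "phi M = Ms M \<circ> Ma M"

definition vert :: "'a bmap \<Rightarrow> 'a \<Rightarrow> 'a set" where
  "vert M d = orb (Ms M) d"

definition face :: "'a bmap \<Rightarrow> 'a \<Rightarrow> 'a set" where
  "face M d = orb (phi M) d"

definition verts :: "'a bmap \<Rightarrow> 'a set set" where
  "verts M = vert M ` Md M"

definition faces :: "'a bmap \<Rightarrow> 'a set set" where
  "faces M = face M ` Md M"

definition edges :: "'a bmap \<Rightarrow> 'a set set" where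
  "edges M = (\<lambda>d. {d, Ma M d}) ` Md M"

definition rootface :: "'a bmap \<Rightarrow> 'a set" where
  "rootface M = face M (Mr M)"

definition inner_faces :: "'a bmap \<Rightarrow> 'a set set" where
  "inner_faces M = faces M - {rootface M}"

definition inner_verts :: "'a bmap \<Rightarrow> 'a set set" where
  "inner_verts M = {v \<in> verts M. v \<inter> rootface M = {}}"

definition inner_edges :: "'a bmap \<Rightarrow> 'a set set" where
  "inner_edges M = {e \<in> edges M. e \<inter> rootface M = {}}"

definition map_conn :: "'a bmap \<Rightarrow> ('a \<times> 'a) set" where
  "map_conn M = {(x, Ma M x) | x. x \<in> Md M} \<union> {(x, Ms M x) | x. x \<in> Md M}"

text \<open>Connected planar (genus 0, Euler formula V - E + F = 2 with E = |D|/2) face-rooted map.\<close>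
definition is_map :: "'a bmap \<Rightarrow> bool" where
  "is_map M \<longleftrightarrow> finite (Md M)
     \<and> (\<forall>d\<in>Md M. Ma M d \<in> Md M \<and> Ma M d \<noteq> d \<and> Ma M (Ma M d) = d)
     \<and> bij_betw (Ms M) (Md M) (Md M)
     \<and> (\<forall>x\<in>Md M. \<forall>y\<in>Md M. (x, y) \<in> (map_conn M)\<^sup>*)
     \<and> 2 * card (verts M) + 2 * card (faces M) = card (Md M) + 4
     \<and> Mr M \<in> Md M"

definition ing :: "'a bmap \<Rightarrow> 'a \<Rightarrow> bool" where
  "ing M d \<longleftrightarrow> 0 < Mw M d"

text \<open>A circuit: list of darts h_0..h_(k-1); h_i is traversed from its vertex to the vertex of
  Ma h_i, which requires the half-edge Ma h_i to be ingoing; vertices and edges distinct.\<close>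
definition circuit :: "'a bmap \<Rightarrow> 'a list \<Rightarrow> bool" where
  "circuit M hs \<longleftrightarrow> hs \<noteq> [] \<and> set hs \<subseteq> Md M
     \<and> (\<forall>i < length hs. ing M (Ma M (hs ! i))
          \<and> hs ! ((i + 1) mod length hs) \<in> vert M (Ma M (hs ! i)))
     \<and> distinct (map (vert M) hs)
     \<and> (\<forall>i < length hs. \<forall>j < length hs. i \<noteq> j \<longrightarrow>
          hs ! j \<noteq> hs ! i \<and> hs ! j \<noteq> Ma M (hs ! i))"

text \<open>Darts whose corners lie (clockwise) strictly after b up to and including a around a vertex.\<close>
definition between :: "'a bmap \<Rightarrow> 'a \<Rightarrow> 'a \<Rightarrow> 'a set" where
  "between M b a = {(Ms M ^^ j) b | j. 0 < j \<and> j \<le> (LEAST n. 0 < n \<and> (Ms M ^^ n) b = a)}"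

definition cyc_edge :: "'a bmap \<Rightarrow> 'a list \<Rightarrow> 'a \<Rightarrow> bool" where
  "cyc_edge M hs d \<longleftrightarrow> (\<exists>h\<in>set hs. d = h \<or> d = Ma M h)"

text \<open>Corners (darts) lying in the region on the right of the circuit.\<close>
inductive_set rside :: "'a bmap \<Rightarrow> 'a list \<Rightarrow> 'a set" for M hs where
  base: "i < length hs \<Longrightarrow> x \<in> between M (hs ! ((i + 1) mod length hs)) (Ma M (hs ! i))
          \<Longrightarrow> x \<in> rside M hs"
| fstep: "x \<in> rside M hs \<Longrightarrow> phi M x \<in> rside M hs"
| cross: "x \<in> rside M hs \<Longrightarrow> x \<in> Md M \<Longrightarrow> \<not> cyc_edge M hs x \<Longrightarrow> Ma M x \<in> rside M hs"

definition ccw_circuit :: "'a bmap \<Rightarrow> 'a list \<Rightarrow> bool" where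
  "ccw_circuit M hs \<longleftrightarrow> circuit M hs \<and> Mr M \<in> rside M hs"

definition minimal :: "'a bmap \<Rightarrow> bool" where
  "minimal M \<longleftrightarrow> \<not> (\<exists>hs. ccw_circuit M hs)"

text \<open>The edge of d is outer (incident to the root face); its two sides are face d and face (Ma d).\<close>
definition outer_dart :: "'a bmap \<Rightarrow> 'a \<Rightarrow> bool" where
  "outer_dart M d \<longleftrightarrow> d \<in> rootface M \<or> Ma M d \<in> rootface M"

text \<open>A 1-way edge with ingoing half x is traversed along Ma x, whose right side is face x.\<close>
definition cw_minimal :: "'a bmap \<Rightarrow> bool" where
  "cw_minimal M \<longleftrightarrow> minimal M \<and>
     (\<forall>d\<in>Md M. outer_dart M d \<longrightarrow>
        (ing M d \<and> ing M (Ma M d))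
      \<or> (ing M d \<and> \<not> ing M (Ma M d) \<and> d \<notin> rootface M)
      \<or> (ing M (Ma M d) \<and> \<not> ing M d \<and> Ma M d \<notin> rootface M))"

definition acc_step :: "'a bmap \<Rightarrow> ('a \<times> 'a) set" where
  "acc_step M = {(x, Ms M x) | x. x \<in> Md M} \<union> {(x, Ma M x) | x. x \<in> Md M \<and> ing M (Ma M x)}"

definition accessible :: "'a bmap \<Rightarrow> bool" where
  "accessible M \<longleftrightarrow> (\<forall>d\<in>Md M. \<exists>s\<in>Md M. vert M s \<inter> rootface M \<noteq> {} \<and> (s, d) \<in> (acc_step M)\<^sup>*)"

text \<open>N-biorientations in the class B.\<close>
definition inB :: "'a bmap \<Rightarrow> bool" where
  "inB M \<longleftrightarrow> is_map M \<and> cw_minimal M \<and> accessible M"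

definition admissible :: "'a bmap \<Rightarrow> bool" where
  "admissible M \<longleftrightarrow> inj_on (vert M) (rootface M)
     \<and> (\<forall>d\<in>rootface M. Ma M d \<notin> rootface M)
     \<and> (\<forall>d\<in>Md M. vert M d \<inter> rootface M \<noteq> {} \<longrightarrow> card {x \<in> vert M d. ing M x} = 1)
     \<and> (\<forall>d\<in>Md M. outer_dart M d \<longrightarrow>
          (Mw M d = 0 \<and> Mw M (Ma M d) = 1) \<or> (Mw M d = 1 \<and> Mw M (Ma M d) = 0))"

definition inBt :: "'a bmap \<Rightarrow> bool" where
  "inBt M \<longleftrightarrow> inB M \<and> admissible M"

definition map_iso :: "'a bmap \<Rightarrow> 'b bmap \<Rightarrow> bool" where
  "map_iso M N \<longleftrightarrow> (\<exists>\<psi>. bij_betw \<psi> (Md M) (Md N)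
     \<and> (\<forall>x\<in>Md M. \<psi> (Ma M x) = Ma N (\<psi> x) \<and> \<psi> (Ms M x) = Ms N (\<psi> x) \<and> Mw N (\<psi> x) = Mw M x)
     \<and> \<psi> ` rootface M = rootface N)"

section \<open>Mobiles\<close>

text \<open>A mobile: darts Td (including buds Tbud), Ta pairs non-bud darts into edges, Ts is the
  clockwise rotation around vertices, Tblack gives the colour of the vertex of a dart,
  Tw the weight of (non-bud) half-edges.\<close>
record 'a mobile =
  Td :: "'a set"
  Tbud :: "'a set"
  Ta :: "'a \<Rightarrow> 'a"
  Ts :: "'a \<Rightarrow> 'a"
  Tblack :: "'a \<Rightarrow> bool"
  Tw :: "'a \<Rightarrow> nat"

definition mvert :: "'a mobile \<Rightarrow> 'a \<Rightarrow> 'a set" where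
  "mvert T x = orb (Ts T) x"

definition mverts :: "'a mobile \<Rightarrow> 'a set set" where
  "mverts T = mvert T ` Td T"

definition black_verts :: "'a mobile \<Rightarrow> 'a set set" where
  "black_verts T = mvert T ` {x \<in> Td T. Tblack T x}"

definition white_verts :: "'a mobile \<Rightarrow> 'a set set" where
  "white_verts T = mvert T ` {x \<in> Td T. \<not> Tblack T x}"

definition medges :: "'a mobile \<Rightarrow> 'a set set" where
  "medges T = (\<lambda>x. {x, Ta T x}) ` (Td T - Tbud T)"

definition mob_conn :: "'a mobile \<Rightarrow> ('a \<times> 'a) set" where
  "mob_conn T = {(x, Ta T x) | x. x \<in> Td T - Tbud T} \<union> {(x, Ts T x) | x. x \<in> Td T}"

text \<open>N-mobile: plane tree (connected, #vertices = #edges + 1), buds only at black vertices,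
  weights positive at white and zero at black non-bud half-edges.\<close>
definition is_N_mobile :: "'a mobile \<Rightarrow> bool" where
  "is_N_mobile T \<longleftrightarrow> finite (Td T) \<and> Tbud T \<subseteq> Td T
     \<and> (\<forall>x\<in>Td T - Tbud T. Ta T x \<in> Td T - Tbud T \<and> Ta T x \<noteq> x \<and> Ta T (Ta T x) = x)
     \<and> bij_betw (Ts T) (Td T) (Td T)
     \<and> (\<forall>x\<in>Td T. Tblack T (Ts T x) = Tblack T x)
     \<and> (\<forall>x\<in>Tbud T. Tblack T x)
     \<and> (\<forall>x\<in>Td T. \<forall>y\<in>Td T. (x, y) \<in> (mob_conn T)\<^sup>*)
     \<and> 2 * card (mverts T) = card (Td T - Tbud T) + 2
     \<and> (\<forall>x\<in>Td T - Tbud T. (Tblack T x \<longrightarrow> Tw T x = 0) \<and> (\<not> Tblack T x \<longrightarrow> 0 < Tw T x))"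

text \<open>Excess: #black-white edges + 2 #white-white edges - #buds (counted via darts).\<close>
definition excess :: "'a mobile \<Rightarrow> int" where
  "excess T = int (card {x \<in> Td T - Tbud T. Tblack T x \<and> \<not> Tblack T (Ta T x)})
     + int (card {x \<in> Td T - Tbud T. \<not> Tblack T x \<and> \<not> Tblack T (Ta T x)})
     - int (card (Tbud T))"

definition mob_iso :: "'a mobile \<Rightarrow> 'b mobile \<Rightarrow> bool" where
  "mob_iso T U \<longleftrightarrow> (\<exists>\<psi>. bij_betw \<psi> (Td T) (Td U) \<and> \<psi> ` Tbud T = Tbud U
     \<and> (\<forall>x\<in>Td T. \<psi> (Ts T x) = Ts U (\<psi> x) \<and> Tblack U (\<psi> x) = Tblack T x)
     \<and> (\<forall>x\<in>Td T - Tbud T. \<psi> (Ta T x) = Ta U (\<psi> x) \<and> Tw U (\<psi> x) = Tw T x))"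

section \<open>The local transformations and Phi_+, Phi_-\<close>

text \<open>Items of the mobile: (d, Wh) is the white half-edge placed in corner d at the vertex of d
  (present iff d is ingoing); (d, Bl) is the half-edge (or bud, iff Ma d is ingoing) at the black
  vertex of the face containing corner d, pointing towards corner d.\<close>
datatype tag = Wh | Bl

definition nxt_in :: "'a bmap \<Rightarrow> 'a \<Rightarrow> 'a" where
  "nxt_in M d = (Ms M ^^ (LEAST k. 0 < k \<and> ing M ((Ms M ^^ k) d))) d"

definition phi_inv :: "'a bmap \<Rightarrow> 'a \<Rightarrow> 'a" where
  "phi_inv M d = Ma M (inv_into (Md M) (Ms M) d)"

definition transform :: "'a bmap \<Rightarrow> ('a \<Rightarrow> bool) \<Rightarrow> ('a \<times> tag) mobile" where
  "transform M keepW =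
    \<lparr> Td = {(d, Wh) | d. d \<in> Md M \<and> ing M d \<and> keepW d} \<union> {(d, Bl) | d. d \<in> Md M \<and> d \<notin> rootface M},
      Tbud = {(d, Bl) | d. d \<in> Md M \<and> d \<notin> rootface M \<and> ing M (Ma M d)},
      Ta = (\<lambda>(d, t). case t of
              Wh \<Rightarrow> (if ing M (Ma M d) then (Ma M d, Wh) else (d, Bl))
            | Bl \<Rightarrow> (if ing M d then (d, Wh) else (Ma M d, Bl))),
      Ts = (\<lambda>(d, t). case t of Wh \<Rightarrow> (nxt_in M d, Wh) | Bl \<Rightarrow> (phi_inv M d, Bl)),
      Tblack = (\<lambda>(d, t). t = Bl),
      Tw = (\<lambda>(d, t). case t of Wh \<Rightarrow> Mw M d | Bl \<Rightarrow> 0) \<rparr>"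

definition PhiP :: "'a bmap \<Rightarrow> ('a \<times> tag) mobile" where
  "PhiP M = transform M (\<lambda>_. True)"

text \<open>Reversing the outer edges: the weights of the two half-edges of each outer edge are swapped.\<close>
definition reverse_outer :: "'a bmap \<Rightarrow> 'a bmap" where
  "reverse_outer M = M\<lparr>Mw := (\<lambda>d. if outer_dart M d then Mw M (Ma M d) else Mw M d)\<rparr>"

definition PhiM :: "'a bmap \<Rightarrow> ('a \<times> tag) mobile" where
  "PhiM M = transform (reverse_outer M) (\<lambda>d. vert M d \<inter> rootface M = {})"

end

theory Submission
  imports Defs
begin

text \<open>From an ingoing half-edge h walk backwards along its edge and then counterclockwise to the next
  ingoing half-edge.  A face-rooted biorientation with the right outer edges is minimal and
  accessible iff this leftmost backward path always ends at the root face: a cycle of the path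
  yields a counterclockwise circuit or an inaccessible vertex, and conversely a path starting on a
  circuit stays on its left, by a discrete Jordan theorem.  That theorem and the fact that a plane
  tree has one contour both come from the genus inequality for two permutations.

  By induction on the length of backward paths, deepest first, each black half-edge of the mobile is
  connected to the vertex it points to; so the mobile is connected, and by Euler's formula it is a
  tree.  The same induction shows that the matching of buds with white corners is determined by the
  mobile.  Conversely, matching buds with white corners as parentheses along the contour closes a
  mobile of positive excess, the length of backward paths being the nesting depth of the matching
  and the unmatched corners forming the root face.  Finally, the mobile of an admissible
  biorientation under the second map is its mobile under the first one with the white leaves at the
  outer vertices turned into buds.\<close>

section \<open>Permutations of finite sets\<close>

text \<open>Planarity is available only as Euler's formula, so every topological fact has to become
  a count of cycles. Cutting the sphere along a circuit pushes the three cycle counts above what the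
  genus inequality allows for one component, which forces two sides.

  Three obstacles shape the rest. A cycle of the backward path may pass a vertex several times,
  whereas minimality forbids simple circuits only; therefore the right side of the whole closed walk
  is used, and every corner of it is shown to lie to the right of some simple circuit cut out of the
  walk. The mobile keeps no trace of the root face; its corners reappear as the white corners that
  no bud is matched with, in the order of the contour. Under the second map a bud that replaces a
  leaf looks like any other bud; the two kinds are told apart by showing that ordinary buds go to
  ordinary buds and comparing their numbers.

  The function \<open>c\<close>, the first closing parenthesis left open by a word, carries the
  closure: its recursion over the letters is the turn around a vertex of the closed map.\<close>

locale fperm =
  fixes f :: "'a \<Rightarrow> 'a" and D :: "'a set"
  assumes fin: "finite D" and bij: "bij_betw f D D"
begin

lemma mem: "x \<in> D \<Longrightarrow> f x \<in> D"
  using bij by (auto simp: bij_betw_def)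

lemma pow_mem: "x \<in> D \<Longrightarrow> (f ^^ n) x \<in> D"
  by (induction n) (auto simp: mem)

lemma inj: "x \<in> D \<Longrightarrow> y \<in> D \<Longrightarrow> f x = f y \<Longrightarrow> x = y"
  using bij by (auto simp: bij_betw_def inj_on_def)

lemma pow_inj: "x \<in> D \<Longrightarrow> y \<in> D \<Longrightarrow> (f ^^ n) x = (f ^^ n) y \<Longrightarrow> x = y"
proof (induction n)
  case (Suc n)
  thus ?case using inj[of "(f ^^ n) x" "(f ^^ n) y"] by (simp add: pow_mem)
qed simp

lemma pow_cancel:
  assumes "x \<in> D" "y \<in> D" "(f ^^ m) x = (f ^^ n) y" "m \<le> n"
  shows "x = (f ^^ (n - m)) y"
proof -
  have "(f ^^ n) y = (f ^^ m) ((f ^^ (n - m)) y)"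
    using assms(4) by (metis funpow_add le_add_diff_inverse o_apply)
  thus ?thesis using assms pow_inj pow_mem by metis
qed

lemma surj: "y \<in> D \<Longrightarrow> \<exists>x\<in>D. f x = y"
  using bij by (metis bij_betw_imp_surj_on imageE)

lemma period: assumes "x \<in> D" shows "\<exists>n>0. (f ^^ n) x = x"
proof -
  have "range (\<lambda>n. (f ^^ n) x) \<subseteq> D" using pow_mem[OF assms] by auto
  hence "finite (range (\<lambda>n. (f ^^ n) x))" using fin finite_subset by blast
  hence "\<not> inj (\<lambda>n. (f ^^ n) x)" using finite_imageD infinite_UNIV_nat by blast
  then obtain m n where "m < n" "(f ^^ m) x = (f ^^ n) x"
    unfolding inj_def by (metis (mono_tags, lifting) linorder_neqE_nat)
  hence "x = (f ^^ (n - m)) x" using pow_cancel[of x x m n] assms by simp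
  thus ?thesis using \<open>m < n\<close> by (metis zero_less_diff)
qed

lemma orb_refl: "x \<in> orb f x"
  unfolding orb_def by (rule CollectI, rule exI[of _ 0]) simp

lemma orb_step: "y \<in> orb f x \<Longrightarrow> f y \<in> orb f x"
  unfolding orb_def by (auto intro: exI[of _ "Suc _"])

lemma orb_f: "f x \<in> orb f x"
  by (rule orb_step[OF orb_refl])

lemma orb_least: "x \<in> S \<Longrightarrow> (\<And>y. y \<in> S \<Longrightarrow> f y \<in> S) \<Longrightarrow> orb f x \<subseteq> S"
proof
  fix y assume a: "x \<in> S" "\<And>y. y \<in> S \<Longrightarrow> f y \<in> S" "y \<in> orb f x"
  then obtain n where "y = (f ^^ n) x" by (auto simp: orb_def)
  moreover have "(f ^^ n) x \<in> S" by (induction n) (auto simp: a)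
  ultimately show "y \<in> S" by simp
qed

lemma orb_induct [consumes 1, case_names base step]:
  assumes "y \<in> orb f x" "P x" "\<And>y. y \<in> orb f x \<Longrightarrow> P y \<Longrightarrow> P (f y)"
  shows "P y"
proof -
  have "orb f x \<subseteq> {y \<in> orb f x. P y}"
    by (rule orb_least) (auto simp: assms orb_refl orb_step)
  thus ?thesis using assms(1) by auto
qed

lemma orb_sub: "x \<in> D \<Longrightarrow> orb f x \<subseteq> D"
  by (rule orb_least) (auto simp: mem)

lemma orb_subset: "y \<in> orb f x \<Longrightarrow> orb f y \<subseteq> orb f x"
  by (rule orb_least) (auto intro: orb_step)

lemma orb_sym: assumes "x \<in> D" "y \<in> orb f x" shows "x \<in> orb f y"
  using assms(2)
proof (induction rule: orb_induct)
  case base show ?case by (rule orb_refl)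
next
  case (step y)
  have "y \<in> D" using step(1) orb_sub assms(1) by auto
  then obtain n where n: "n > 0" "(f ^^ n) y = y" using period by blast
  then obtain k where "n = Suc k" by (cases n) auto
  hence "(f ^^ k) (f y) = y" using n by (simp add: funpow_swap1)
  hence "y \<in> orb f (f y)" unfolding orb_def by (metis (mono_tags) mem_Collect_eq)
  thus ?case using step(2) orb_subset by blast
qed

lemma orb_eq: "x \<in> D \<Longrightarrow> y \<in> orb f x \<Longrightarrow> orb f y = orb f x"
  using orb_sym orb_subset by (metis subset_antisym)

lemma orb_eq_iff: "x \<in> D \<Longrightarrow> y \<in> D \<Longrightarrow> orb f x = orb f y \<longleftrightarrow> y \<in> orb f x"
  using orb_eq orb_refl by metis

lemma orb_f_eq: "x \<in> D \<Longrightarrow> orb f (f x) = orb f x"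
  using orb_eq orb_f by metis

lemma orb_back: "y \<in> D \<Longrightarrow> x \<in> D \<Longrightarrow> f y \<in> orb f x \<Longrightarrow> y \<in> orb f x"
  using orb_f_eq orb_eq orb_refl mem by metis

lemma orb_disj: "x \<in> D \<Longrightarrow> y \<in> D \<Longrightarrow> orb f x \<inter> orb f y \<noteq> {} \<Longrightarrow> orb f x = orb f y"
  using orb_eq by (metis disjoint_iff)

lemma orb_pow: "(f ^^ n) x \<in> orb f x"
  unfolding orb_def by auto

lemma orb_rtrancl: "y \<in> orb f x \<Longrightarrow> x \<in> D \<Longrightarrow> (x, y) \<in> {(x, f x) |x. x \<in> D}\<^sup>*"
proof (induction rule: orb_induct)
  case (step y)
  hence "y \<in> D" using orb_sub by blast
  thus ?case using step by (blast intro: rtrancl.rtrancl_into_rtrancl)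
qed auto

lemma inv_mem: "x \<in> D \<Longrightarrow> inv_into D f x \<in> D"
  using bij by (metis bij_betw_imp_surj_on inv_into_into)

lemma f_inv: "x \<in> D \<Longrightarrow> f (inv_into D f x) = x"
  using bij by (metis bij_betw_inv_into_right)

lemma inv_f: "x \<in> D \<Longrightarrow> inv_into D f (f x) = x"
  using bij by (metis bij_betw_inv_into_left)

end

lemma fperm_restrict:
  assumes "fperm f D" "S \<subseteq> D" "\<And>x. x \<in> S \<Longrightarrow> f x \<in> S"
  shows "fperm f S"
proof -
  interpret fperm f D by fact
  have "finite S" using assms fin finite_subset by blast
  moreover have "inj_on f S" using bij assms by (meson bij_betw_def inj_on_subset)
  ultimately show ?thesis
    using assms by unfold_locales (auto simp: bij_betw_def endo_inj_surj image_subset_iff)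
qed

lemma fpermI:
  assumes "finite D" "\<And>x. x \<in> D \<Longrightarrow> f x \<in> D" "inj_on f D"
  shows "fperm f D"
  using assms by unfold_locales (auto simp: bij_betw_def endo_inj_surj image_subset_iff)

lemma fperm_comp: "fperm f D \<Longrightarrow> fperm g D \<Longrightarrow> fperm (f \<circ> g) D"
  by (auto simp: fperm_def intro: bij_betw_trans)

lemma orb_cong:
  assumes "\<And>y. y \<in> orb f x \<Longrightarrow> g y = f y"
  shows "orb g x = orb f x"
proof -
  have "(g ^^ n) x = (f ^^ n) x" for n
  proof (induction n)
    case (Suc n)
    have "(f ^^ n) x \<in> orb f x" by (auto simp: orb_def)
    thus ?case using Suc assms by simp
  qed simp
  thus ?thesis by (auto simp: orb_def)
qed

lemma orb_image:
  assumes "\<And>y. y \<in> orb f x \<Longrightarrow> k (f y) = g (k y)"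
  shows "orb g (k x) = k ` orb f x"
proof -
  have "(g ^^ n) (k x) = k ((f ^^ n) x)" for n
  proof (induction n)
    case (Suc n)
    have "(f ^^ n) x \<in> orb f x" by (auto simp: orb_def)
    thus ?case using Suc assms by simp
  qed simp
  thus ?thesis by (auto simp: orb_def)
qed

text \<open>For \<open>h\<close> in \<open>J\<close> these are the points met on leaving
  \<open>h\<close> along \<open>f\<close> up to and including the next point of \<open>J\<close>.
  With the rotation at a vertex and its ingoing half-edges this is the sector of corners between two
  consecutive ingoing half-edges: a corner is named by the half-edge that follows it, so the end
  belongs to the sector and the start does not, unless the two coincide.\<close>

inductive insec :: "('a \<Rightarrow> 'a) \<Rightarrow> 'a set \<Rightarrow> 'a \<Rightarrow> 'a \<Rightarrow> bool" for f J h where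
  start: "insec f J h (f h)"
| walk: "insec f J h x \<Longrightarrow> x \<notin> J \<Longrightarrow> insec f J h (f x)"

definition fret :: "('a \<Rightarrow> 'a) \<Rightarrow> 'a set \<Rightarrow> 'a \<Rightarrow> 'a" where
  "fret f J d = (f ^^ (LEAST k. 0 < k \<and> (f ^^ k) d \<in> J)) d"

context fperm
begin

lemma insec_orb: "insec f J h x \<Longrightarrow> x \<in> orb f h"
  by (induction rule: insec.induct) (auto intro: orb_step orb_f)

lemma insec_mem: "insec f J h x \<Longrightarrow> h \<in> D \<Longrightarrow> x \<in> D"
  using insec_orb orb_sub by blast

text \<open>Since \<open>f\<close> is injective, going backwards from \<open>x\<close> is
  deterministic, and the first point of \<open>J\<close> met is the origin. This makes the backward
  path well defined.\<close>

lemma insec_unique: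
  assumes "insec f J h x" "insec f J h' x" "h \<in> J" "h' \<in> J" "h \<in> D" "h' \<in> D"
  shows "h = h'"
  using assms
proof (induction rule: insec.induct)
  case start
  from start(1) show ?case
  proof cases
    case start with \<open>h \<in> D\<close> \<open>h' \<in> D\<close> show ?thesis using inj by auto
  next
    case (walk x)
    have "x \<in> D" using insec_mem[OF walk(2)] start by auto
    hence "h = x" using inj walk(1) start by blast
    thus ?thesis using walk(3) start by auto
  qed
next
  case (walk x)
  have xD: "x \<in> D" using insec_mem[OF walk(1)] walk.prems by auto
  from walk.prems(1) show ?case
  proof cases
    case start
    hence "h' = x" using inj xD walk.prems by blast
    thus ?thesis using walk.prems walk.hyps by auto
  next
    case w: (walk x')
    have "x' \<in> D" using insec_mem[OF w(2)] walk.prems by auto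
    hence "x' = x" using inj xD w(1) by blast
    thus ?thesis using walk.IH w(2) walk.prems by blast
  qed
qed

lemma insec_end_unique:
  assumes "insec f J h x" "insec f J h y" "x \<in> J" "y \<in> J"
  shows "x = y"
proof -
  have *: "insec f J h z \<Longrightarrow> \<exists>k>0. z = (f ^^ k) h \<and> (\<forall>i. 0 < i \<and> i < k \<longrightarrow> (f ^^ i) h \<notin> J)" for z
  proof (induction rule: insec.induct)
    case start show ?case by (rule exI[of _ 1]) auto
  next
    case (walk x)
    then obtain k where "k > 0" "x = (f ^^ k) h" "\<forall>i. 0 < i \<and> i < k \<longrightarrow> (f ^^ i) h \<notin> J" by auto
    thus ?case using walk(2) by (intro exI[of _ "Suc k"]) (auto simp: less_Suc_eq)
  qed
  from *[OF assms(1)] *[OF assms(2)] show ?thesis using assms(3,4) by (metis linorder_neqE_nat)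
qed

text \<open>The union of the sectors is closed under \<open>f\<close>: a sector that arrives in
  \<open>J\<close> is continued by the sector of the point it has reached.\<close>

lemma insec_exists:
  assumes "x \<in> D" "orb f x \<inter> J \<noteq> {}"
  shows "\<exists>h\<in>J \<inter> D. insec f J h x"
proof -
  obtain h0 where h0: "h0 \<in> orb f x" "h0 \<in> J" using assms by blast
  have hD: "h0 \<in> D" using h0 orb_sub assms by blast
  let ?S = "{y \<in> D. \<exists>h\<in>J \<inter> D. insec f J h y}"
  have "orb f (f h0) \<subseteq> ?S"
  proof (rule orb_least)
    show "f h0 \<in> ?S" using h0 hD by (auto intro: insec.start mem)
    fix y assume "y \<in> ?S"
    thus "f y \<in> ?S" by (cases "y \<in> J") (auto intro: insec.start insec.walk mem)
  qed
  moreover have "x \<in> orb f (f h0)" using h0 hD assms orb_f_eq orb_eq orb_refl by metis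
  ultimately show ?thesis by auto
qed

lemma fret:
  assumes "d \<in> D" "orb f d \<inter> J \<noteq> {}"
  shows "fret f J d \<in> J" "insec f J d (fret f J d)"
proof -
  obtain n where n: "n > 0" "(f ^^ n) d = d" using period assms by blast
  obtain m where m: "(f ^^ m) d \<in> J" using assms by (auto simp: orb_def)
  have "(f ^^ (m + n)) d \<in> J" using m n(2) by (simp add: funpow_add)
  hence ex: "\<exists>k. 0 < k \<and> (f ^^ k) d \<in> J" using n by (intro exI[of _ "m + n"]) auto
  define k where "k = (LEAST k. 0 < k \<and> (f ^^ k) d \<in> J)"
  have k: "0 < k" "(f ^^ k) d \<in> J" using LeastI_ex[OF ex] unfolding k_def by auto
  have lt: "i < k \<Longrightarrow> 0 < i \<Longrightarrow> (f ^^ i) d \<notin> J" for i unfolding k_def using not_less_Least by blast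
  have "i \<le> k \<Longrightarrow> 0 < i \<Longrightarrow> insec f J d ((f ^^ i) d)" for i
  proof (induction i)
    case (Suc i)
    show ?case
    proof (cases "i = 0")
      case True thus ?thesis using insec.start by simp
    next
      case False thus ?thesis using Suc lt[of i] insec.walk by fastforce
    qed
  qed auto
  thus "insec f J d (fret f J d)" "fret f J d \<in> J" using k unfolding fret_def k_def by auto
qed

lemma fret_eqI:
  assumes "d \<in> D" "insec f J d y" "y \<in> J"
  shows "fret f J d = y"
proof -
  have "orb f d \<inter> J \<noteq> {}" using assms insec_orb by blast
  thus ?thesis using fret[OF assms(1), of J] insec_end_unique[of J d _ y] assms(2,3) by simp
qed

lemma fret_fperm:
  assumes "J \<subseteq> D" shows "fperm (fret f J) J"
proof (rule fpermI)
  show "finite J" using assms fin finite_subset by blast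
  have ne: "orb f x \<inter> J \<noteq> {}" if "x \<in> J" for x using that orb_refl by auto
  show "fret f J x \<in> J" if "x \<in> J" for x using fret(1)[OF _ ne[OF that]] that assms by auto
  show "inj_on (fret f J) J"
  proof (rule inj_onI)
    fix x y assume a: "x \<in> J" "y \<in> J" "fret f J x = fret f J y"
    have "insec f J x (fret f J x)" "insec f J y (fret f J y)" using fret(2) ne a assms by blast+
    thus "x = y" using insec_unique[of J x "fret f J x" y] a assms by auto
  qed
qed

text \<open>First returns skip only points outside \<open>J\<close>, so their cycles are the traces
  of the cycles of \<open>f\<close>. Applied to ingoing half-edges this identifies white vertices of
  the mobile with vertices of the map.\<close>

lemma fret_orb:
  assumes "J \<subseteq> D" "h \<in> J" shows "orb (fret f J) h = orb f h \<inter> J"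
proof
  interpret r: fperm "fret f J" J using fret_fperm assms(1) .
  have hD: "h \<in> D" using assms by auto
  show "orb (fret f J) h \<subseteq> orb f h \<inter> J"
  proof (rule r.orb_least)
    show "h \<in> orb f h \<inter> J" using assms orb_refl by auto
    fix y assume y: "y \<in> orb f h \<inter> J"
    hence "orb f y \<inter> J \<noteq> {}" "y \<in> D" using orb_refl assms by auto
    hence "fret f J y \<in> J" "fret f J y \<in> orb f y" using fret[of y J] insec_orb by auto
    thus "fret f J y \<in> orb f h \<inter> J" using orb_subset[of y h] y by auto
  qed
  show "orb f h \<inter> J \<subseteq> orb (fret f J) h"
  proof
    fix y assume y: "y \<in> orb f h \<inter> J"
    let ?S = "{z. \<exists>k\<in>orb (fret f J) h. insec f J k z}"
    have st: "z \<in> orb (fret f J) h" if z: "z \<in> ?S" "z \<in> J" for z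
    proof -
      obtain k where k: "k \<in> orb (fret f J) h" "insec f J k z" using z by blast
      have "k \<in> D" using k r.orb_sub[OF assms(2)] assms(1) by blast
      hence "fret f J k = z" using fret_eqI k z by blast
      thus ?thesis using r.orb_step[OF k(1)] by simp
    qed
    have "orb f (f h) \<subseteq> ?S"
    proof (rule orb_least)
      show "f h \<in> ?S" using r.orb_refl by (auto intro: insec.start)
      fix z assume z: "z \<in> ?S"
      show "f z \<in> ?S"
      proof (cases "z \<in> J")
        case True
        show ?thesis using st[OF z True] by (auto intro: insec.start)
      next
        case False thus ?thesis using z by (auto intro: insec.walk)
      qed
    qed
    moreover have "y \<in> orb f (f h)" using y unfolding orb_f_eq[OF hD] by simp
    ultimately have "y \<in> ?S" by (rule subsetD)
    thus "y \<in> orb (fret f J) h" using y by (intro st) simp_all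
  qed
qed

end

section \<open>The genus inequality for a pair of permutations\<close>

definition graph_on :: "('a \<Rightarrow> 'a) \<Rightarrow> 'a set \<Rightarrow> ('a \<times> 'a) set" where
  "graph_on f D = {(x, f x) |x. x \<in> D}"

definition eqcl :: "('a \<times> 'a) set \<Rightarrow> ('a \<times> 'a) set" where
  "eqcl E = (E \<union> E\<inverse>)\<^sup>*"

definition comps :: "'a set \<Rightarrow> ('a \<times> 'a) set \<Rightarrow> nat" where
  "comps D E = card ((\<lambda>x. eqcl E `` {x}) ` D)"

lemma eqcl_refl: "(x, x) \<in> eqcl E"
  by (simp add: eqcl_def)

lemma eqcl_sym: "(x, y) \<in> eqcl E \<Longrightarrow> (y, x) \<in> eqcl E"
  unfolding eqcl_def by (metis converse_Un converse_converse rtrancl_converseD rtrancl_converseI sup_commute)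

lemma eqcl_trans: "(x, y) \<in> eqcl E \<Longrightarrow> (y, z) \<in> eqcl E \<Longrightarrow> (x, z) \<in> eqcl E"
  unfolding eqcl_def by (rule rtrancl_trans)

lemma eqcl_base: "(x, y) \<in> E \<Longrightarrow> (x, y) \<in> eqcl E"
  unfolding eqcl_def by blast

lemma eqcl_least: assumes "E \<subseteq> eqcl E'" shows "eqcl E \<subseteq> eqcl E'"
proof -
  have "E \<union> E\<inverse> \<subseteq> eqcl E'" using assms eqcl_sym[of _ _ E'] by blast
  hence "(E \<union> E\<inverse>)\<^sup>* \<subseteq> (eqcl E')\<^sup>*" by (rule rtrancl_mono)
  thus ?thesis by (simp add: eqcl_def)
qed

lemma eqcl_mono: "E \<subseteq> E' \<Longrightarrow> eqcl E \<subseteq> eqcl E'"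
  by (rule eqcl_least) (auto intro: eqcl_base)

lemma eqcl_class_eq: "eqcl E `` {x} = eqcl E `` {y} \<longleftrightarrow> (x, y) \<in> eqcl E"
proof
  assume "eqcl E `` {x} = eqcl E `` {y}"
  thus "(x, y) \<in> eqcl E" using eqcl_refl[of y E] by blast
next
  assume a: "(x, y) \<in> eqcl E"
  show "eqcl E `` {x} = eqcl E `` {y}"
    using eqcl_trans[OF a] eqcl_trans[OF eqcl_sym[OF a]] by blast
qed

lemma eqcl_closed_set:
  assumes "(x, y) \<in> eqcl E" "x \<in> S" "\<And>u v. (u, v) \<in> E \<Longrightarrow> u \<in> S \<longleftrightarrow> v \<in> S"
  shows "y \<in> S"
  using assms(1) unfolding eqcl_def
  by (induction rule: rtrancl_induct) (use assms in auto)

text \<open>Inclusion in the closure suffices, so one generating relation can be traded for another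
  with the same classes.\<close>

lemma comps_antimono:
  assumes "finite D" "E \<subseteq> eqcl E'" shows "comps D E' \<le> comps D E"
proof -
  have sub: "eqcl E \<subseteq> eqcl E'" by (rule eqcl_least[OF assms(2)])
  have "(\<lambda>x. eqcl E' `` {x}) ` D = (\<lambda>c. eqcl E' `` c) ` (\<lambda>x. eqcl E `` {x}) ` D"
  proof -
    have "eqcl E' `` {x} = eqcl E' `` (eqcl E `` {x})" for x
      using sub eqcl_refl[of x E] eqcl_trans[of x _ E'] by blast
    thus ?thesis by (simp add: image_image)
  qed
  thus ?thesis unfolding comps_def using card_image_le assms(1) finite_imageI by metis
qed

lemma comps_eq:
  assumes "finite D" "E \<subseteq> eqcl E'" "E' \<subseteq> eqcl E" shows "comps D E = comps D E'"
  using comps_antimono[OF assms(1)] assms by (metis le_antisym)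

lemma eqcl_insert_class:
  "eqcl (insert (x, y) E) `` {z} =
    (if (x, z) \<in> eqcl E \<or> (y, z) \<in> eqcl E then eqcl E `` {x} \<union> eqcl E `` {y} else eqcl E `` {z})"
proof -
  let ?E = "insert (x, y) E"
  have sub: "eqcl E \<subseteq> eqcl ?E" by (rule eqcl_mono) auto
  have xy: "(x, y) \<in> eqcl ?E" by (rule eqcl_base) auto
  note t = eqcl_trans[of _ _ ?E] and s = eqcl_sym[of _ _ ?E]
  show ?thesis
  proof (cases "(x, z) \<in> eqcl E \<or> (y, z) \<in> eqcl E")
    case True
    hence xz: "(x, z) \<in> eqcl ?E" using sub xy t by blast
    have "eqcl ?E `` {z} = eqcl ?E `` {x}" using xz s eqcl_class_eq by metis
    moreover have "eqcl ?E `` {x} = eqcl E `` {x} \<union> eqcl E `` {y}"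
    proof
      show "eqcl E `` {x} \<union> eqcl E `` {y} \<subseteq> eqcl ?E `` {x}" using sub xy t by blast
      show "eqcl ?E `` {x} \<subseteq> eqcl E `` {x} \<union> eqcl E `` {y}"
      proof
        fix w assume w: "w \<in> eqcl ?E `` {x}"
        have "w \<in> {w. (x, w) \<in> eqcl E \<or> (y, w) \<in> eqcl E}"
        proof (rule eqcl_closed_set)
          show "(x, w) \<in> eqcl ?E" using w by auto
          show "x \<in> {w. (x, w) \<in> eqcl E \<or> (y, w) \<in> eqcl E}" using eqcl_refl by auto
          fix u v assume "(u, v) \<in> ?E"
          thus "(u \<in> {w. (x, w) \<in> eqcl E \<or> (y, w) \<in> eqcl E}) = (v \<in> {w. (x, w) \<in> eqcl E \<or> (y, w) \<in> eqcl E})"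
            using eqcl_base[of u v E] eqcl_sym[of u v E] eqcl_trans[of _ u E v] eqcl_trans[of _ v E u] eqcl_refl[of _ E]
            by auto
        qed
        thus "w \<in> eqcl E `` {x} \<union> eqcl E `` {y}" by auto
      qed
    qed
    ultimately show ?thesis using True by simp
  next
    case False
    have "eqcl ?E `` {z} \<subseteq> eqcl E `` {z}"
    proof
      fix w assume w: "w \<in> eqcl ?E `` {z}"
      have "w \<in> {w. (z, w) \<in> eqcl E}"
      proof (rule eqcl_closed_set[of z w ?E])
        show "(z, w) \<in> eqcl ?E" using w by auto
        show "z \<in> {w. (z, w) \<in> eqcl E}" using eqcl_refl by auto
        fix u v assume "(u, v) \<in> ?E"
        thus "(u \<in> {w. (z, w) \<in> eqcl E}) = (v \<in> {w. (z, w) \<in> eqcl E})"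
          using False eqcl_sym[of z x E] eqcl_sym[of z y E] eqcl_base[of u v E] eqcl_sym[of u v E]
            eqcl_trans[of z u E v] eqcl_trans[of z v E u] by auto
      qed
      thus "w \<in> eqcl E `` {z}" by auto
    qed
    thus ?thesis using False sub by auto
  qed
qed

text \<open>The classes of \<open>x\<close> and \<open>y\<close> merge and all others persist; the
  union is not itself an old class, so exactly one class is lost.\<close>

lemma comps_insert:
  assumes "finite D" "x \<in> D" "y \<in> D" "(x, y) \<notin> eqcl E"
  shows "Suc (comps D (insert (x, y) E)) = comps D E"
proof -
  define C where "C = (\<lambda>x. eqcl E `` {x}) ` D"
  define A where "A = eqcl E `` {x}"
  define B where "B = eqcl E `` {y}"
  have fC: "finite C" unfolding C_def using assms by auto
  have AB: "A \<in> C" "B \<in> C" "A \<noteq> B" unfolding A_def B_def C_def using assms eqcl_class_eq[of E x y] by auto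
  have cl: "c \<in> C \<Longrightarrow> z \<in> c \<Longrightarrow> c = eqcl E `` {z}" for c z
    unfolding C_def using eqcl_class_eq[of E] by blast
  have xA: "x \<in> A" "y \<in> B" unfolding A_def B_def by (auto intro: eqcl_refl)
  have "A \<union> B \<notin> C" using cl[of "A \<union> B" x] cl[of "A \<union> B" y] xA AB(3) unfolding A_def B_def by blast
  have "(\<lambda>z. eqcl (insert (x, y) E) `` {z}) ` D = insert (A \<union> B) (C - {A, B})"
  proof (intro equalityI subsetI)
    fix c assume "c \<in> (\<lambda>z. eqcl (insert (x, y) E) `` {z}) ` D"
    then obtain z where z: "z \<in> D" "c = eqcl (insert (x, y) E) `` {z}" by auto
    show "c \<in> insert (A \<union> B) (C - {A, B})"
    proof (cases "(x, z) \<in> eqcl E \<or> (y, z) \<in> eqcl E")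
      case True thus ?thesis using z eqcl_insert_class[of x y E z] by (simp add: A_def B_def)
    next
      case False
      hence "c = eqcl E `` {z}" using z eqcl_insert_class[of x y E z] by simp
      moreover have "eqcl E `` {z} \<noteq> A" "eqcl E `` {z} \<noteq> B"
        using False eqcl_class_eq[of E x z] eqcl_class_eq[of E y z] unfolding A_def B_def by auto
      ultimately show ?thesis using z unfolding C_def by auto
    qed
  next
    fix c assume "c \<in> insert (A \<union> B) (C - {A, B})"
    thus "c \<in> (\<lambda>z. eqcl (insert (x, y) E) `` {z}) ` D"
    proof
      assume "c = A \<union> B"
      hence "c = eqcl (insert (x, y) E) `` {x}"
        using eqcl_insert_class[of x y E x] eqcl_refl[of x E] by (simp add: A_def B_def)
      thus ?thesis using assms by auto
    next
      assume c: "c \<in> C - {A, B}"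
      then obtain z where z: "z \<in> D" "c = eqcl E `` {z}" unfolding C_def by auto
      hence "\<not> ((x, z) \<in> eqcl E \<or> (y, z) \<in> eqcl E)"
        using c eqcl_class_eq[of E x z] eqcl_class_eq[of E y z] unfolding A_def B_def by auto
      hence "c = eqcl (insert (x, y) E) `` {z}" using z eqcl_insert_class[of x y E z] by simp
      thus ?thesis using z by auto
    qed
  qed
  hence "comps D (insert (x, y) E) = card (insert (A \<union> B) (C - {A, B}))" by (simp add: comps_def)
  also have "\<dots> = Suc (card (C - {A, B}))" using fC \<open>A \<union> B \<notin> C\<close> by simp
  also have "card (C - {A, B}) = card C - 2"
    using AB fC by (simp add: card_Diff_subset)
  finally have "comps D (insert (x, y) E) = Suc (card C - 2)" .
  moreover have "card C \<ge> 2"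
  proof -
    have "card {A, B} \<le> card C" using AB fC by (intro card_mono) auto
    thus ?thesis using AB by simp
  qed
  ultimately show ?thesis unfolding C_def comps_def by simp
qed

lemma comps_insert_ge:
  assumes "finite D" "x \<in> D" "y \<in> D"
  shows "comps D E \<le> Suc (comps D (insert (x, y) E))"
proof (cases "(x, y) \<in> eqcl E")
  case True
  hence "insert (x, y) E \<subseteq> eqcl E" using eqcl_base by auto
  hence "comps D E = comps D (insert (x, y) E)"
    using assms by (intro comps_eq) (auto intro: eqcl_base)
  thus ?thesis by simp
next
  case False thus ?thesis using comps_insert[OF assms] by simp
qed

section \<open>Cycles of a permutation and the effect of a transposition\<close>

context fperm
begin

lemma eqcl_graph: assumes "x \<in> D" shows "eqcl (graph_on f D) `` {x} = orb f x"
proof (intro equalityI subsetI)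
  fix y assume y: "y \<in> eqcl (graph_on f D) `` {x}"
  have "y \<in> {y \<in> D. y \<in> orb f x}"
  proof (rule eqcl_closed_set[of x y "graph_on f D"])
    show "(x, y) \<in> eqcl (graph_on f D)" using y by auto
    show "x \<in> {y \<in> D. y \<in> orb f x}" using assms orb_refl by auto
    fix u v assume "(u, v) \<in> graph_on f D"
    hence "u \<in> D" "v = f u" by (auto simp: graph_on_def)
    thus "(u \<in> {y \<in> D. y \<in> orb f x}) = (v \<in> {y \<in> D. y \<in> orb f x})"
      using orb_step[of u x] orb_back[of u x] assms mem by auto
  qed
  thus "y \<in> orb f x" by auto
next
  fix y assume y: "y \<in> orb f x"
  hence "(x, y) \<in> eqcl (graph_on f D)"
  proof (induction rule: orb_induct)
    case base show ?case by (rule eqcl_refl)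
  next
    case (step y)
    have "y \<in> D" using step(1) orb_sub[OF assms] by auto
    hence "(y, f y) \<in> eqcl (graph_on f D)" by (intro eqcl_base) (auto simp: graph_on_def)
    thus ?case using step eqcl_trans by metis
  qed
  thus "y \<in> eqcl (graph_on f D) `` {x}" by auto
qed

lemma comps_graph: "comps D (graph_on f D) = card (orb f ` D)"
  unfolding comps_def using eqcl_graph by (metis (no_types, lifting) image_cong)

lemma swap_fperm:
  assumes "x \<in> D" "y \<in> D" shows "fperm (f(x := f y, y := f x)) D"
proof (rule fpermI[OF fin])
  show "(f(x := f y, y := f x)) z \<in> D" if "z \<in> D" for z using that mem assms by auto
  show "inj_on (f(x := f y, y := f x)) D"
    using inj assms by (auto simp: inj_on_def)
qed

text \<open>\<open>f(x := f y, y := f x)\<close> is \<open>f\<close> composed with the transposition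
  of \<open>x\<close> and \<open>y\<close>. Its cycles stay inside the classes of \<open>f\<close>
  joined by the single pair \<open>(x, y)\<close>, and one pair costs at most one class.\<close>

lemma swap_ge:
  assumes "x \<in> D" "y \<in> D"
  shows "card (orb f ` D) \<le> Suc (card (orb (f(x := f y, y := f x)) ` D))"
proof -
  let ?g = "f(x := f y, y := f x)"
  interpret g: fperm ?g D using swap_fperm assms .
  let ?E = "insert (x, y) (graph_on f D)"
  have xy: "(x, y) \<in> eqcl ?E" by (rule eqcl_base) auto
  have st: "z \<in> D \<Longrightarrow> (z, f z) \<in> eqcl ?E" for z by (rule eqcl_base) (auto simp: graph_on_def)
  have "graph_on ?g D \<subseteq> eqcl ?E"
  proof
    fix p assume "p \<in> graph_on ?g D"
    then obtain z where z: "p = (z, ?g z)" "z \<in> D" by (auto simp: graph_on_def)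
    have "(x, f y) \<in> eqcl ?E" by (rule eqcl_trans[OF xy st[OF assms(2)]])
    moreover have "(y, f x) \<in> eqcl ?E" by (rule eqcl_trans[OF eqcl_sym[OF xy] st[OF assms(1)]])
    ultimately show "p \<in> eqcl ?E" using z st[of z] by auto
  qed
  hence "comps D ?E \<le> comps D (graph_on ?g D)" by (rule comps_antimono[OF fin])
  thus ?thesis using comps_insert_ge[OF fin assms, of "graph_on f D"] comps_graph g.comps_graph by simp
qed

text \<open>Equality in \<open>swap_ge\<close>: the new cycle of \<open>x\<close> runs through the
  whole old cycle of \<open>y\<close> and only then continues in the old cycle of
  \<open>x\<close>.\<close>

lemma swap_join:
  assumes "x \<in> D" "y \<in> D" "y \<notin> orb f x"
  shows "Suc (card (orb (f(x := f y, y := f x)) ` D)) = card (orb f ` D)"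
proof -
  let ?g = "f(x := f y, y := f x)"
  interpret g: fperm ?g D using swap_fperm assms(1,2) .
  let ?E = "insert (x, y) (graph_on f D)"
  have xy: "(x, y) \<in> eqcl ?E" by (rule eqcl_base) auto
  have st: "z \<in> D \<Longrightarrow> (z, f z) \<in> eqcl ?E" for z by (rule eqcl_base) (auto simp: graph_on_def)
  have sub: "graph_on ?g D \<subseteq> eqcl ?E"
  proof
    fix p assume "p \<in> graph_on ?g D"
    then obtain z where z: "p = (z, ?g z)" "z \<in> D" by (auto simp: graph_on_def)
    have "(x, f y) \<in> eqcl ?E" by (rule eqcl_trans[OF xy st[OF assms(2)]])
    moreover have "(y, f x) \<in> eqcl ?E" by (rule eqcl_trans[OF eqcl_sym[OF xy] st[OF assms(1)]])
    ultimately show "p \<in> eqcl ?E" using z st[of z] by auto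
  qed
  have gst: "z \<in> D \<Longrightarrow> (z, ?g z) \<in> eqcl (graph_on ?g D)" for z
    by (rule eqcl_base) (auto simp: graph_on_def)
  have gxy: "y \<in> orb ?g x"
  proof -
    obtain n where n: "n > 0" "(f ^^ n) y = y" using period assms by blast
    \<comment> \<open>The length of the cycle of \<open>y\<close>. Before it is completed the new
      permutation agrees with \<open>f\<close>, so the orbit of \<open>x\<close>, entering at
      \<open>f y\<close>, ends up at \<open>y\<close>.\<close>
    define n where "n = (LEAST n. n > 0 \<and> (f ^^ n) y = y)"
    have nn: "n > 0" "(f ^^ n) y = y" using LeastI_ex[of "\<lambda>n. n > 0 \<and> (f ^^ n) y = y"] n unfolding n_def by auto
    have lt: "0 < i \<Longrightarrow> i < n \<Longrightarrow> (f ^^ i) y \<noteq> y" for i unfolding n_def using not_less_Least by blast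
    have nx: "(f ^^ i) y \<noteq> x" for i using assms(3) orb_sym[OF assms(2), of x] orb_pow[of i y] by auto
    have "0 < i \<Longrightarrow> i \<le> n \<Longrightarrow> (f ^^ i) y \<in> orb ?g x" for i
    proof (induction i)
      case (Suc i)
      show ?case
      proof (cases "i = 0")
        case True
        have "?g x = f y" by simp
        thus ?thesis using True g.orb_f[of x] by (simp del: fun_upd_apply)
      next
        case False
        have "(f ^^ i) y \<in> orb ?g x" by (rule Suc.IH) (use Suc.prems False in auto)
        moreover have "(f ^^ i) y \<noteq> y" using Suc.prems False lt[of i] by auto
        moreover from calculation have "?g ((f ^^ i) y) = (f ^^ Suc i) y" using nx[of i] by simp
        ultimately show ?thesis using g.orb_step[of "(f ^^ i) y" x] by metis
      qed
    qed auto
    from this[of n] show ?thesis using nn by (simp del: fun_upd_apply)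
  qed
  have gxy': "(x, y) \<in> eqcl (graph_on ?g D)" using g.eqcl_graph[OF assms(1)] gxy by auto
  have "?E \<subseteq> eqcl (graph_on ?g D)"
  proof
    fix p assume "p \<in> ?E"
    then consider "p = (x, y)" | z where "p = (z, f z)" "z \<in> D" by (auto simp: graph_on_def)
    thus "p \<in> eqcl (graph_on ?g D)"
    proof cases
      case 1 thus ?thesis using gxy' by simp
    next
      case 2
      have "x \<noteq> y" using assms(3) orb_refl by auto
      have "(x, f x) \<in> eqcl (graph_on ?g D)"
        using eqcl_trans[OF gxy' gst[OF assms(2)]] by simp
      moreover have "(y, f y) \<in> eqcl (graph_on ?g D)"
        using eqcl_trans[OF eqcl_sym[OF gxy'] gst[OF assms(1)]] \<open>x \<noteq> y\<close> by simp
      ultimately show ?thesis using 2 gst[of z] by (cases "z = x"; cases "z = y") auto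
    qed
  qed
  hence "comps D ?E = comps D (graph_on ?g D)" using sub by (intro comps_eq[OF fin])
  moreover have "(x, y) \<notin> eqcl (graph_on f D)" using assms eqcl_graph by blast
  ultimately show ?thesis
    using comps_insert[OF fin assms(1,2), of "graph_on f D"] comps_graph g.comps_graph by simp
qed

text \<open>Swapping twice restores \<open>f\<close>, so it is enough that \<open>x\<close> and
  \<open>y\<close> are in different cycles after the swap; then \<open>swap_join\<close> applies in
  the other direction.\<close>

lemma swap_split:
  assumes "x \<in> D" "y \<in> D" "y \<in> orb f x" "x \<noteq> y"
  shows "card (orb (f(x := f y, y := f x)) ` D) = Suc (card (orb f ` D))"
proof -
  let ?g = "f(x := f y, y := f x)"
  interpret g: fperm ?g D using swap_fperm assms(1,2) .
  have "x \<in> orb f y" using orb_sym assms by blast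
  then obtain m where m: "x = (f ^^ m) y" by (auto simp: orb_def)
  hence "m > 0" using assms(4) by (cases m) auto
  \<comment> \<open>The first time that \<open>f\<close> leads from \<open>y\<close> to
    \<open>x\<close>. The new cycle of \<open>x\<close> is contained in the stretch from
    \<open>f y\<close> to \<open>x\<close>, which misses \<open>y\<close>.\<close>
  define n where "n = (LEAST n. n > 0 \<and> (f ^^ n) y = x)"
  have nn: "n > 0" "(f ^^ n) y = x"
    using LeastI_ex[of "\<lambda>n. n > 0 \<and> (f ^^ n) y = x"] m \<open>m > 0\<close> unfolding n_def by auto
  have lt: "0 < i \<Longrightarrow> i < n \<Longrightarrow> (f ^^ i) y \<noteq> x" for i unfolding n_def using not_less_Least by blast
  have ny: "(f ^^ i) y \<noteq> y" if "0 < i" "i < n" for i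
  proof
    assume a: "(f ^^ i) y = y"
    have "(f ^^ n) y = (f ^^ (n - i)) ((f ^^ i) y)" using that by (metis funpow_add le_add_diff_inverse2 less_imp_le o_apply)
    thus False using a nn lt[of "n - i"] that by simp
  qed
  have "orb ?g x \<subseteq> {(f ^^ i) y |i. 0 < i \<and> i \<le> n}"
  proof (rule g.orb_least)
    show "x \<in> {(f ^^ i) y |i. 0 < i \<and> i \<le> n}" using nn by auto
    fix z assume "z \<in> {(f ^^ i) y |i. 0 < i \<and> i \<le> n}"
    then obtain i where i: "z = (f ^^ i) y" "0 < i" "i \<le> n" by auto
    show "?g z \<in> {(f ^^ i) y |i. 0 < i \<and> i \<le> n}"
    proof (cases "i = n")
      case True
      hence "?g z = (f ^^ 1) y" using i nn assms(4) by simp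
      thus ?thesis using nn by (auto intro!: exI[of _ 1])
    next
      case False
      hence "z \<noteq> x" "z \<noteq> y" using i lt ny by auto
      hence "?g z = (f ^^ Suc i) y" using i by simp
      thus ?thesis using i False by fastforce
    qed
  qed
  moreover have "y \<notin> {(f ^^ i) y |i. 0 < i \<and> i \<le> n}"
  proof
    assume "y \<in> {(f ^^ i) y |i. 0 < i \<and> i \<le> n}"
    then obtain i where "y = (f ^^ i) y" "0 < i" "i \<le> n" by auto
    thus False using ny[of i] nn assms(4) by (cases "i = n") auto
  qed
  ultimately have "y \<notin> orb ?g x" by auto
  hence "Suc (card (orb (?g(x := ?g y, y := ?g x)) ` D)) = card (orb ?g ` D)"
    by (rule g.swap_join[OF assms(1,2)])
  moreover have "?g(x := ?g y, y := ?g x) = f" using assms(4) by auto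
  ultimately show ?thesis by simp
qed

end

text \<open>Nonnegativity of the genus of a hypermap whose vertices, hyperedges and faces are the
  cycles of \<open>s\<close>, \<open>p\<close> and \<open>s o p\<close>. A transposition is removed
  from \<open>p\<close>, which gains a cycle. If the component count stays, \<open>s o p\<close>
  changes by at most one cycle; if it rises, the removal also splits a cycle of
  \<open>s o p\<close>, and the two gains on the left equal the gain of 2 on the right.\<close>

theorem genus_inequality:
  assumes "fperm s D" "fperm p D"
  shows "card (orb s ` D) + card (orb p ` D) + card (orb (s \<circ> p) ` D)
    \<le> card D + 2 * comps D (graph_on s D \<union> graph_on p D)"
  using assms(2)
proof (induction "card {x \<in> D. p x \<noteq> x}" arbitrary: p rule: less_induct)
  case less
  show ?case
  proof (cases "{x \<in> D. p x \<noteq> x} = {}")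
  case True
  interpret s: fperm s D by fact
  interpret p: fperm p D by (rule less)
  have id: "\<And>x. x \<in> D \<Longrightarrow> p x = x" using True by auto
  have op: "orb p x = {x}" if "x \<in> D" for x
  proof
    show "orb p x \<subseteq> {x}" by (rule p.orb_least) (auto simp: that id)
    show "{x} \<subseteq> orb p x" using p.orb_refl by auto
  qed
  have "orb p ` D = (\<lambda>x. {x}) ` D" using op by (rule image_cong[OF refl])
  hence "card (orb p ` D) = card D" by (simp add: card_image)
  moreover have "orb (s \<circ> p) x = orb s x" if "x \<in> D" for x
    using that id s.orb_sub[OF that] by (intro orb_cong) (auto simp: subset_iff)
  hence "card (orb (s \<circ> p) ` D) = card (orb s ` D)"
    using image_cong[OF refl, of D "orb (s \<circ> p)" "orb s"] by simp
  moreover have "comps D (graph_on s D \<union> graph_on p D) = comps D (graph_on s D)"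
  proof (rule comps_eq[OF s.fin])
    show "graph_on s D \<union> graph_on p D \<subseteq> eqcl (graph_on s D)"
      using id by (auto simp: graph_on_def eqcl_refl intro: eqcl_base[unfolded graph_on_def])
    show "graph_on s D \<subseteq> eqcl (graph_on s D \<union> graph_on p D)" by (auto intro: eqcl_base)
  qed
  ultimately show ?thesis using s.comps_graph by linarith
next
  case False
  interpret s: fperm s D by fact
  interpret p: fperm p D by (rule less)
  from False obtain x where x: "x \<in> D" "p x \<noteq> x" by auto
  \<comment> \<open>With \<open>y\<close> the preimage of \<open>x\<close>, the swapped permutation
    \<open>q\<close> fixes \<open>x\<close> and moves fewer points, and \<open>p\<close> comes back
    by joining the fixed point \<open>x\<close> to the cycle of \<open>y\<close>.\<close>
  obtain y where y: "y \<in> D" "p y = x" using p.surj x by blast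
  have xy: "x \<noteq> y" using x y by auto
  define q where "q = p(x := p y, y := p x)"
  have pq: "p = q(x := q y, y := q x)" unfolding q_def using xy by auto
  interpret q: fperm q D unfolding q_def by (rule p.swap_fperm) fact+
  have qx: "q x = x" "q y = p x" using xy y by (auto simp: q_def)
  have "{z \<in> D. q z \<noteq> z} \<subseteq> {z \<in> D. p z \<noteq> z} - {x}"
    using y xy x by (auto simp: q_def)
  hence "{z \<in> D. q z \<noteq> z} \<subset> {z \<in> D. p z \<noteq> z}" using x by blast
  hence "card {z \<in> D. q z \<noteq> z} < card {z \<in> D. p z \<noteq> z}"
    using s.fin by (intro psubset_card_mono) auto
  note IH = less(1)[OF this q.fperm_axioms]
  interpret sq: fperm "s \<circ> q" D using fperm_comp s.fperm_axioms q.fperm_axioms .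
  have spq: "s \<circ> p = (s \<circ> q)(x := (s \<circ> q) y, y := (s \<circ> q) x)" unfolding pq by auto
  have oq: "y \<notin> orb q x"
  proof -
    have "orb q x \<subseteq> {x}" by (rule q.orb_least) (auto simp: qx)
    thus ?thesis using xy by auto
  qed
  have cp: "Suc (card (orb p ` D)) = card (orb q ` D)"
    using q.swap_join[OF x(1) y(1) oq] pq by simp
  let ?P = "graph_on s D \<union> graph_on p D" and ?Q = "graph_on s D \<union> graph_on q D"
  have PQ: "comps D ?P = comps D (insert (x, y) ?Q)"
  proof (rule comps_eq[OF s.fin])
    have b: "(u, v) \<in> eqcl (insert (x, y) ?Q)" if "(u, v) \<in> insert (x, y) ?Q" for u v
      using that by (rule eqcl_base)
    have xy': "(x, y) \<in> eqcl (insert (x, y) ?Q)" by (rule b) auto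
    have "(y, p x) \<in> eqcl (insert (x, y) ?Q)" using y qx by (intro b) (auto simp: graph_on_def)
    hence px: "(x, p x) \<in> eqcl (insert (x, y) ?Q)" using eqcl_trans xy' by metis
    have py: "(y, p y) \<in> eqcl (insert (x, y) ?Q)" using y eqcl_sym[OF xy'] by simp
    have "(z, p z) \<in> eqcl (insert (x, y) ?Q)" if "z \<in> D" for z
    proof (cases "z = x \<or> z = y")
      case True thus ?thesis using px py by auto
    next
      case False
      hence "p z = q z" by (auto simp: q_def)
      thus ?thesis using that by (intro b) (auto simp: graph_on_def)
    qed
    thus "?P \<subseteq> eqcl (insert (x, y) ?Q)" using b by (auto simp: graph_on_def)
    have c: "(u, v) \<in> eqcl ?P" if "(u, v) \<in> ?P" for u v using that by (rule eqcl_base)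
    have yx: "(y, x) \<in> eqcl ?P" using y by (intro c) (auto simp: graph_on_def)
    have xpx: "(x, p x) \<in> eqcl ?P" using x by (intro c) (auto simp: graph_on_def)
    have "(z, q z) \<in> eqcl ?P" if "z \<in> D" for z
    proof -
      consider "z = x" | "z = y" | "z \<noteq> x" "z \<noteq> y" by blast
      thus ?thesis
      proof cases
        case 1 thus ?thesis using qx by (simp add: eqcl_refl)
      next
        case 2 thus ?thesis using qx eqcl_trans[OF yx xpx] by simp
      next
        case 3
        hence "q z = p z" by (auto simp: q_def)
        thus ?thesis using that by (intro c) (auto simp: graph_on_def)
      qed
    qed
    thus "insert (x, y) ?Q \<subseteq> eqcl ?P" using c eqcl_sym[OF yx] by (auto simp: graph_on_def)
  qed
  show ?thesis
  proof (cases "(x, y) \<in> eqcl ?Q")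
    case True
    hence "comps D ?Q = comps D (insert (x, y) ?Q)"
      by (intro comps_eq[OF s.fin]) (auto intro: eqcl_base)
    moreover have "card (orb (s \<circ> p) ` D) \<le> Suc (card (orb (s \<circ> q) ` D))"
    proof -
      interpret sp: fperm "s \<circ> p" D using fperm_comp s.fperm_axioms p.fperm_axioms .
      have "(s \<circ> p)(x := (s \<circ> p) y, y := (s \<circ> p) x) = s \<circ> q" using xy by (auto simp: q_def)
      thus ?thesis using sp.swap_ge[OF x(1) y(1)] by simp
    qed
    ultimately show ?thesis using IH cp PQ by simp
  next
    \<comment> \<open>Points in different components are in different cycles of
      \<open>s o q\<close>, so here the swap is certainly a join.\<close>
    case False
    have "y \<notin> orb (s \<circ> q) x"
    proof
      assume "y \<in> orb (s \<circ> q) x"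
      hence "(x, y) \<in> eqcl ?Q"
      proof (induction rule: sq.orb_induct)
        case base show ?case by (rule eqcl_refl)
      next
        case (step z)
        have z: "z \<in> D" using step sq.orb_sub[OF x(1)] by auto
        have "(z, q z) \<in> eqcl ?Q" "(q z, s (q z)) \<in> eqcl ?Q"
          using z q.mem[OF z] by (auto intro!: eqcl_base simp: graph_on_def)
        hence "(z, (s \<circ> q) z) \<in> eqcl ?Q" using eqcl_trans by fastforce
        thus ?case using step eqcl_trans by metis
      qed
      thus False using False by simp
    qed
    hence "Suc (card (orb (s \<circ> p) ` D)) = card (orb (s \<circ> q) ` D)"
      using sq.swap_join[OF x(1) y(1)] spq by simp
    moreover have "Suc (comps D ?P) = comps D ?Q"
      using comps_insert[OF s.fin x(1) y(1) False] PQ by simp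
    ultimately show ?thesis using IH cp by simp
  qed
  qed
qed

section \<open>Maps\<close>

definition ings :: "'a bmap \<Rightarrow> 'a set" where
  "ings M = {d \<in> Md M. ing M d}"

text \<open>Connectedness and Euler's formula are split off because the closure of a mobile has to
  be handled as a rotation system before these two are established for it.\<close>

locale premap =
  fixes M :: "'a bmap"
  assumes fin_darts: "finite (Md M)"
    and Ma_mem: "d \<in> Md M \<Longrightarrow> Ma M d \<in> Md M"
    and Ma_neq: "d \<in> Md M \<Longrightarrow> Ma M d \<noteq> d"
    and Ma_Ma: "d \<in> Md M \<Longrightarrow> Ma M (Ma M d) = d"
    and bij_Ms: "bij_betw (Ms M) (Md M) (Md M)"
    and root_dart: "Mr M \<in> Md M"
begin

sublocale s: fperm "Ms M" "Md M"
  by unfold_locales (rule fin_darts, rule bij_Ms)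

sublocale a: fperm "Ma M" "Md M"
proof (rule fpermI)
  show "inj_on (Ma M) (Md M)" by (rule inj_onI) (metis Ma_Ma)
qed (auto simp: fin_darts Ma_mem)

sublocale p: fperm "phi M" "Md M"
  unfolding phi_def by (rule fperm_comp) unfold_locales

lemma vert_orb: "vert M d = orb (Ms M) d"
  by (simp add: vert_def)

lemma face_orb: "face M d = orb (phi M) d"
  by (simp add: face_def)

lemma rootface_orb: "rootface M = orb (phi M) (Mr M)"
  by (simp add: rootface_def face_def)

lemma root_sub: "rootface M \<subseteq> Md M"
  unfolding rootface_orb by (rule p.orb_sub[OF root_dart])

lemma root_step: "r \<in> rootface M \<Longrightarrow> phi M r \<in> rootface M"
  unfolding rootface_orb by (rule p.orb_step)

lemma root_back: "d \<in> Md M \<Longrightarrow> phi M d \<in> rootface M \<Longrightarrow> d \<in> rootface M"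
  unfolding rootface_orb using p.orb_back[OF _ root_dart] .

lemma phi_Ma: "d \<in> Md M \<Longrightarrow> phi M (Ma M d) = Ms M d"
  by (simp add: phi_def Ma_Ma)

lemma Ms_Ma: "Ms M (Ma M d) = phi M d"
  by (simp add: phi_def)

lemma ings_sub: "ings M \<subseteq> Md M"
  by (auto simp: ings_def)

lemma ings_D: "h \<in> ings M \<Longrightarrow> h \<in> Md M"
  by (auto simp: ings_def)

lemma phi_inv_phi: assumes "d \<in> Md M" shows "phi_inv M (phi M d) = d"
  using s.inv_f[OF Ma_mem[OF assms]] Ma_Ma[OF assms] by (simp add: phi_inv_def phi_def)

lemma phi_inv_mem: "d \<in> Md M \<Longrightarrow> phi_inv M d \<in> Md M"
  by (simp add: phi_inv_def Ma_mem s.inv_mem)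

lemma phi_phi_inv: assumes "d \<in> Md M" shows "phi M (phi_inv M d) = d"
  using s.f_inv[OF assms] Ma_Ma[OF s.inv_mem[OF assms]] by (simp add: phi_inv_def phi_def)

sublocale pi: fperm "phi_inv M" "Md M"
proof (rule fpermI)
  show "inj_on (phi_inv M) (Md M)" by (rule inj_onI) (metis phi_phi_inv)
qed (auto simp: fin_darts phi_inv_mem)

lemma orb_phi_inv: assumes "d \<in> Md M" shows "orb (phi_inv M) d = face M d"
proof
  have st: "phi_inv M x \<in> orb (phi M) d" if "x \<in> orb (phi M) d" for x
  proof -
    have "x \<in> Md M" using that p.orb_sub[OF assms] by auto
    thus ?thesis using p.orb_back[OF phi_inv_mem assms] phi_phi_inv that by simp
  qed
  show "orb (phi_inv M) d \<subseteq> face M d"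
    unfolding face_orb by (rule pi.orb_least[OF p.orb_refl st])
  have st: "phi M x \<in> orb (phi_inv M) d" if "x \<in> orb (phi_inv M) d" for x
  proof -
    have "x \<in> Md M" using that pi.orb_sub[OF assms] by auto
    thus ?thesis using pi.orb_back[OF p.mem assms] phi_inv_phi that by simp
  qed
  show "face M d \<subseteq> orb (phi_inv M) d"
    unfolding face_orb by (rule p.orb_least[OF pi.orb_refl st])
qed

lemma face_root: assumes "d \<in> Md M" shows "face M d = rootface M \<longleftrightarrow> d \<in> rootface M"
  unfolding rootface_def face_orb using p.orb_eq_iff[OF root_dart assms] by auto

lemma face_sub: "d \<in> Md M \<Longrightarrow> face M d \<subseteq> Md M"
  unfolding face_orb by (rule p.orb_sub)

lemma vert_sub: "d \<in> Md M \<Longrightarrow> vert M d \<subseteq> Md M"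
  unfolding vert_orb by (rule s.orb_sub)

lemma vert_Ms: "d \<in> Md M \<Longrightarrow> vert M (Ms M d) = vert M d"
  unfolding vert_orb by (rule s.orb_f_eq)

lemma vert_eq: "x \<in> Md M \<Longrightarrow> y \<in> vert M x \<Longrightarrow> vert M y = vert M x"
  unfolding vert_orb by (rule s.orb_eq)

lemma vert_refl: "x \<in> vert M x"
  unfolding vert_orb by (rule s.orb_refl)

lemma vert_sym: "x \<in> Md M \<Longrightarrow> y \<in> vert M x \<Longrightarrow> x \<in> vert M y"
  using vert_eq vert_refl by metis

end

locale rmap = premap +
  assumes conn: "x \<in> Md M \<Longrightarrow> y \<in> Md M \<Longrightarrow> (x, y) \<in> (map_conn M)\<^sup>*"
    and euler: "2 * card (verts M) + 2 * card (faces M) = card (Md M) + 4"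
begin

lemma conn_set:
  assumes "x \<in> Md M" "x \<in> S" "\<And>y. y \<in> Md M \<Longrightarrow> y \<in> S \<Longrightarrow> Ma M y \<in> S"
    "\<And>y. y \<in> Md M \<Longrightarrow> y \<in> S \<Longrightarrow> Ms M y \<in> S"
  shows "Md M \<subseteq> S"
proof
  fix y assume "y \<in> Md M"
  hence "(x, y) \<in> (map_conn M)\<^sup>*" using conn assms(1) by auto
  hence "y \<in> Md M \<inter> S"
    by (induction rule: rtrancl_induct) (use assms Ma_mem s.mem in \<open>auto simp: map_conn_def\<close>)
  thus "y \<in> S" by auto
qed

end

lemma is_map_rmap: "is_map M \<longleftrightarrow> rmap M"
  unfolding is_map_def rmap_def rmap_axioms_def premap_def by auto

text \<open>As a least fixed point this states that the backward path from the half-edge is finite.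
  In \<open>step\<close> the predecessor of \<open>h'\<close> is the ingoing \<open>h\<close> whose
  sector contains the corner of \<open>Ma M h'\<close>, that is, the first ingoing half-edge
  counterclockwise from the tail of the edge of \<open>h'\<close>.\<close>

inductive good :: "'a bmap \<Rightarrow> 'a \<Rightarrow> bool" for M where
  root: "h \<in> ings M \<Longrightarrow> Ma M h \<in> rootface M \<Longrightarrow> good M h"
| step: "good M h \<Longrightarrow> h \<in> ings M \<Longrightarrow> insec (Ms M) (ings M) h (Ma M h') \<Longrightarrow> h' \<in> ings M \<Longrightarrow> good M h'"

text \<open>Following the leftmost incoming edge backwards from any ingoing half-edge leads to the root
  face.  This is what minimality and accessibility amount to.\<close>
definition gmap :: "'a bmap \<Rightarrow> bool" where
  "gmap M \<longleftrightarrow> is_map M \<and> (\<forall>d\<in>rootface M. ing M (Ma M d))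
     \<and> (\<forall>d\<in>Md M. vert M d \<inter> ings M \<noteq> {}) \<and> (\<forall>h\<in>ings M. good M h)"

text \<open>\<open>outer\<close> condenses the three cases for outer edges in
  \<open>cw_minimal\<close>: seen from a root corner the opposite half-edge is ingoing.
  \<open>vin\<close> is what accessibility contributes before paths are studied; it gives every
  half-edge a predecessor and every vertex a white vertex.\<close>

locale omap = rmap +
  assumes outer: "d \<in> rootface M \<Longrightarrow> ing M (Ma M d)"
    and vin: "d \<in> Md M \<Longrightarrow> vert M d \<inter> ings M \<noteq> {}"
begin

text \<open>The root corner \<open>y\<close> with \<open>phi M y = r\<close> has an ingoing opposite
  by \<open>outer\<close>. Thus a root corner is always the first corner of its sector, which makes
  \<open>root_sector\<close> work.\<close>

lemma root_pred: assumes "r \<in> rootface M"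
  shows "\<exists>z\<in>ings M. Ms M z = r \<and> Ma M z \<in> rootface M"
proof -
  have rD: "r \<in> Md M" using assms root_sub by auto
  obtain y where y: "y \<in> Md M" "phi M y = r" using p.surj rD by blast
  have yR: "y \<in> rootface M" using root_back y assms by auto
  show ?thesis
  proof (intro bexI conjI)
    show "Ms M (Ma M y) = r" using y by (simp add: Ms_Ma)
    show "Ma M (Ma M y) \<in> rootface M" using y yR Ma_Ma by simp
    show "Ma M y \<in> ings M" using outer[OF yR] Ma_mem y by (auto simp: ings_def)
  qed
qed

lemma pred_ex: assumes "h' \<in> Md M"
  shows "\<exists>h\<in>ings M. insec (Ms M) (ings M) h (Ma M h')"
  using s.insec_exists[of "Ma M h'" "ings M"] vin[OF Ma_mem[OF assms]] Ma_mem[OF assms]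
  by (auto simp: vert_orb)

lemma root_sector:
  assumes "insec (Ms M) (ings M) h x" "x \<in> rootface M" "h \<in> ings M"
  shows "x = Ms M h" "Ma M h \<in> rootface M"
proof -
  obtain z where z: "z \<in> ings M" "Ms M z = x" "Ma M z \<in> rootface M" using root_pred assms by blast
  have hD: "h \<in> Md M" "z \<in> Md M" using assms z ings_D by auto
  have "h = z" using assms(1)
  proof cases
    case start thus ?thesis using s.inj hD z by metis
  next
    case (walk y)
    hence "y \<in> Md M" using s.insec_mem hD by blast
    hence "y = z" using walk(1) z s.inj hD by metis
    thus ?thesis using walk z by auto
  qed
  thus "x = Ms M h" "Ma M h \<in> rootface M" using z by auto
qed

end

text \<open>For \<open>vin\<close>: an outer vertex is entered by the root contour, and any other
  vertex by the directed path that makes it accessible.\<close>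

lemma inB_omap:
  assumes "inB M" shows "omap M"
proof -
  have im: "rmap M" using assms by (auto simp: inB_def is_map_rmap)
  interpret rmap M by fact
  have cw: "cw_minimal M" "accessible M" using assms by (auto simp: inB_def)
  have outer: "ing M (Ma M d)" if d: "d \<in> rootface M" for d
  proof -
    have "d \<in> Md M" "outer_dart M d" using d root_sub by (auto simp: outer_dart_def)
    thus ?thesis using cw(1) d by (auto simp: cw_minimal_def)
  qed
  have "vert M d \<inter> ings M \<noteq> {}" if d: "d \<in> Md M" for d
  proof -
    obtain s where s: "s \<in> Md M" "vert M s \<inter> rootface M \<noteq> {}" "(s, d) \<in> (acc_step M)\<^sup>*"
      using cw(2) d unfolding accessible_def by blast
    from s(3) have "d \<in> Md M \<and> vert M d \<inter> ings M \<noteq> {}"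
    proof (induction rule: rtrancl_induct)
      case base
      obtain r where r: "r \<in> vert M s" "r \<in> rootface M" using s by auto
      obtain y where y: "y \<in> Md M" "phi M y = r" using p.surj r root_sub by blast
      have yR: "y \<in> rootface M" using root_back y r by auto
      have "Ma M y \<in> ings M" using outer[OF yR] y Ma_mem by (auto simp: ings_def)
      moreover have "Ma M y \<in> vert M s"
        using s.orb_back[of "Ma M y" s] y r s(1) Ma_mem by (simp add: Ms_Ma vert_orb)
      ultimately show ?case using s by auto
    next
      case (step y z)
      from step(2) consider "z = Ms M y" | "z = Ma M y" "ing M (Ma M y)" by (auto simp: acc_step_def)
      thus ?case
      proof cases
        case 1 thus ?thesis using step vert_Ms s.mem by auto
      next
        case 2
        hence "z \<in> ings M" using step Ma_mem by (auto simp: ings_def)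
        thus ?thesis using vert_refl[of z] ings_D by auto
      qed
    qed
    thus ?thesis by auto
  qed
  thus ?thesis using outer im by (auto simp: omap_def omap_axioms_def)
qed

section \<open>Minimality and accessibility through leftmost backward paths\<close>

text \<open>Mutual successors exist only on cyclic lists of length at most two. This will exclude a
  closed walk that runs back along one of its edges.\<close>

lemma successors_mod:
  fixes i j n :: nat
  assumes "i < n" "j < n" "j = (i + 1) mod n" "i = (j + 1) mod n"
  shows "i = 0 \<or> j = 0"
proof -
  have i: "j = (if Suc i = n then 0 else Suc i)" using assms(1,3) by (simp add: mod_Suc)
  have j: "i = (if Suc j = n then 0 else Suc j)" using assms(2,4) by (simp add: mod_Suc)
  show ?thesis using i j by (metis Suc_n_not_le_n lessI less_imp_le)
qed

text \<open>Like \<open>rside\<close>, but with the edges of an arbitrary set \<open>W\<close> as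
  walls and arbitrary initial corners, so that it also makes sense for a walk with repeated
  vertices.\<close>

inductive_set rclos :: "'a bmap \<Rightarrow> 'a set \<Rightarrow> 'a set \<Rightarrow> 'a set" for M W B where
  base: "x \<in> B \<Longrightarrow> x \<in> rclos M W B"
| fstep: "x \<in> rclos M W B \<Longrightarrow> phi M x \<in> rclos M W B"
| cross: "x \<in> rclos M W B \<Longrightarrow> x \<in> Md M \<Longrightarrow> x \<notin> W \<Longrightarrow> Ma M x \<notin> W \<Longrightarrow> Ma M x \<in> rclos M W B"

text \<open>W is a cycle of the leftmost backward path.\<close>
locale pred_cycle = omap +
  fixes W :: "'a set" and p :: "'a \<Rightarrow> 'a" and n :: nat
  assumes W_ings: "W \<subseteq> ings M" and W_ne: "W \<noteq> {}"
    and p_W: "w \<in> W \<Longrightarrow> p w \<in> W"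
    and p_sec: "w \<in> W \<Longrightarrow> insec (Ms M) (ings M) (p w) (Ma M w)"
    and n_pos: "0 < n" and p_n: "w \<in> W \<Longrightarrow> (p ^^ n) w = w"
begin

lemma W_D: "w \<in> W \<Longrightarrow> w \<in> Md M"
  using W_ings ings_D by auto

lemma pw_W: "w \<in> W \<Longrightarrow> (p ^^ k) w \<in> W"
  by (induction k) (auto simp: p_W)

lemma p_vert: assumes "w \<in> W" shows "Ma M w \<in> vert M (p w)"
  using s.insec_orb[OF p_sec[OF assms]] by (simp add: vert_orb)

lemma p_surj: assumes "w \<in> W" shows "\<exists>w'\<in>W. p w' = w"
proof -
  obtain k where "n = Suc k" using n_pos by (cases n) auto
  thus ?thesis using p_n[OF assms] pw_W[OF assms, of k] by (intro bexI[of _ "(p ^^ k) w"]) auto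
qed

definition deps :: "'a set" where
  "deps = Ma M ` W"

lemma deps_iff: "d \<in> Md M \<Longrightarrow> d \<in> deps \<longleftrightarrow> Ma M d \<in> W"
  unfolding deps_def using Ma_Ma[of d] Ma_Ma[OF W_D] by (auto intro!: image_eqI[of d "Ma M" "Ma M d"])

text \<open>The corners on the left of the closed walk.\<close>
inductive_set lint :: "'a set" where
  dep: "w \<in> W \<Longrightarrow> Ma M w \<in> lint"
| prev: "Ms M z \<in> lint \<Longrightarrow> z \<in> Md M \<Longrightarrow> z \<notin> ings M \<Longrightarrow> z \<in> lint"

lemma lint_cases: "x \<in> lint \<Longrightarrow> x \<in> deps \<or> (x \<notin> ings M \<and> Ms M x \<in> lint)"
  by (cases rule: lint.cases) (auto simp: deps_def)

lemma lint_sec: "x \<in> lint \<Longrightarrow> \<exists>w\<in>W. insec (Ms M) (ings M) w x"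
proof (induction rule: lint.induct)
  case (dep w) thus ?case using p_W p_sec by blast
next
  case (prev z)
  then obtain w where w: "w \<in> W" "insec (Ms M) (ings M) w (Ms M z)" by blast
  from w(2) show ?case
  proof cases
    case start
    hence "w = z" using s.inj W_D w(1) prev(2) by metis
    thus ?thesis using w W_ings prev by auto
  next
    case (walk y)
    hence "y \<in> Md M" using s.insec_mem W_D w(1) by blast
    hence "y = z" using walk(1) prev(2) s.inj by metis
    thus ?thesis using walk w by auto
  qed
qed

text \<open>The corner after \<open>z\<close> lies in the sector of \<open>z\<close>, and as a left
  corner also in the sector of an arrival of the walk; sectors have one origin.\<close>

lemma lint_start: assumes "Ms M z \<in> lint" "z \<in> ings M" shows "z \<in> W"
proof -
  obtain w where w: "w \<in> W" "insec (Ms M) (ings M) w (Ms M z)" using lint_sec assms by blast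
  have "insec (Ms M) (ings M) z (Ms M z)" by (rule insec.start)
  hence "w = z" using s.insec_unique w assms W_ings ings_D by (metis subsetD)
  thus ?thesis using w by simp
qed

lemma W_lint: assumes "z \<in> W" shows "Ms M z \<in> lint"
proof -
  obtain w where w: "w \<in> W" "p w = z" using p_surj[OF assms] by auto
  have zD: "z \<in> Md M" using W_D assms .
  have "insec (Ms M) (ings M) z x \<Longrightarrow> x \<in> lint \<Longrightarrow> Ms M z \<in> lint" for x
  proof (induction rule: insec.induct)
    case (walk x)
    thus ?case using lint.prev[of x] s.insec_mem[OF walk(1) zD] by auto
  qed auto
  thus ?thesis using p_sec[OF w(1)] w lint.dep[OF w(1)] by auto
qed

text \<open>The corners at vertices of the walk that are on its left at none of its
  passages.\<close>

definition base_corners :: "'a set" where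
  "base_corners = {x \<in> Md M. vert M x \<inter> W \<noteq> {} \<and> x \<notin> lint}"

definition right_side :: "'a set" where
  "right_side = rclos M W base_corners"

text \<open>Turn counterclockwise from \<open>x\<close> to the nearest half-edge \<open>b\<close> of
  the walk. After an arrival all corners up to the next departure are left corners, so
  \<open>b\<close> must be a pure departure. The clause on \<open>W\<close> says that no arrival
  separates \<open>b\<close> from \<open>x\<close>.\<close>

lemma departure_before:
  assumes "x \<in> base_corners"
  shows "\<exists>b\<in>deps. b \<notin> W \<and> b \<in> Md M \<and> (\<exists>j>0. x = (Ms M ^^ j) b \<and> (\<forall>i. 0 < i \<and> i < j \<longrightarrow> (Ms M ^^ i) b \<notin> W))"
proof -
  have xD: "x \<in> Md M" and xl: "x \<notin> lint" using assms by (auto simp: base_corners_def)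
  have "orb (Ms M) x \<inter> (W \<union> deps) \<noteq> {}" using assms by (auto simp: base_corners_def vert_orb)
  then obtain b where b: "b \<in> W \<union> deps" "b \<in> Md M" "insec (Ms M) (W \<union> deps) b x"
    using s.insec_exists[OF xD, of "W \<union> deps"] by auto
  have pow: "insec (Ms M) (W \<union> deps) b y \<Longrightarrow>
      \<exists>j>0. y = (Ms M ^^ j) b \<and> (\<forall>i. 0 < i \<and> i < j \<longrightarrow> (Ms M ^^ i) b \<notin> W)" for y
  proof (induction rule: insec.induct)
    case start show ?case by (rule exI[of _ 1]) auto
  next
    case (walk y)
    then obtain j where "j > 0" "y = (Ms M ^^ j) b" "\<forall>i. 0 < i \<and> i < j \<longrightarrow> (Ms M ^^ i) b \<notin> W" by auto
    thus ?case using walk(2) by (intro exI[of _ "Suc j"]) (auto simp: less_Suc_eq)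
  qed
  have "b \<notin> W"
  proof
    assume bW: "b \<in> W"
    have "insec (Ms M) (W \<union> deps) b y \<Longrightarrow> y \<in> lint" for y
    proof (induction rule: insec.induct)
      case start show ?case by (rule W_lint[OF bW])
    next
      case (walk y) thus ?case using lint_cases by blast
    qed
    thus False using b xl by auto
  qed
  thus ?thesis using b pow[OF b(3)] by blast
qed

definition closed_walk :: "'a \<Rightarrow> 'a list \<Rightarrow> bool" where
  "closed_walk b hs \<longleftrightarrow> hs \<noteq> [] \<and> set hs \<subseteq> deps \<and> hs ! 0 = b
     \<and> (\<forall>i < length hs. hs ! ((i + 1) mod length hs) \<in> vert M (Ma M (hs ! i)))"

lemma deps_D: "b \<in> deps \<Longrightarrow> b \<in> Md M"
  unfolding deps_def using Ma_mem W_D by auto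

text \<open>\<open>p\<close> runs against the direction of the edges, hence the exponent
  \<open>n - k\<close>; periodicity turns entry 0 into \<open>b\<close>.\<close>

lemma closed_walk_ex: assumes "b \<in> deps" shows "\<exists>hs. closed_walk b hs"
proof -
  obtain w where w: "w \<in> W" "b = Ma M w" using assms by (auto simp: deps_def)
  let ?h = "\<lambda>k. Ma M ((p ^^ (n - k)) w)"
  let ?hs = "map ?h [0..<n]"
  have "closed_walk b ?hs"
    unfolding closed_walk_def
  proof (intro conjI allI impI)
    show "?hs \<noteq> []" using n_pos by simp
    show "set ?hs \<subseteq> deps" using pw_W[OF w(1)] by (auto simp: deps_def)
    show "?hs ! 0 = b" using n_pos w p_n by simp
    fix i assume "i < length ?hs"
    hence i: "i < n" by simp
    define m where "m = n - Suc i"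
    have nm: "n - i = Suc m" using i by (simp add: m_def)
    let ?u = "(p ^^ m) w"
    have u: "?u \<in> W" by (rule pw_W[OF w(1)])
    have "Ma M ?u \<in> vert M (p ?u)" by (rule p_vert[OF u])
    moreover have "Ma M (?hs ! i) = p ?u"
      using i nm Ma_Ma[OF W_D[OF p_W[OF u]]] by simp
    moreover have "?hs ! ((i + 1) mod length ?hs) = Ma M ?u"
    proof (cases "Suc i = n")
      case True
      thus ?thesis using n_pos w p_n by (simp add: m_def)
    next
      case False
      thus ?thesis using i by (simp add: m_def)
    qed
    ultimately show "?hs ! ((i + 1) mod length ?hs) \<in> vert M (Ma M (?hs ! i))" by simp
  qed
  thus ?thesis by blast
qed

text \<open>The detour between two visits of a vertex is cut out. The piece kept is the one
  containing entry 0, because the dart \<open>b\<close> must survive.\<close>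

lemma closed_walk_shorten:
  assumes cw: "closed_walk b hs" and ij: "i < j" "j < length hs" "vert M (hs ! i) = vert M (hs ! j)"
  shows "\<exists>hs'. closed_walk b hs' \<and> length hs' < length hs"
proof -
  have hs: "set hs \<subseteq> deps" "hs ! 0 = b" using cw by (auto simp: closed_walk_def)
  have st: "hs ! Suc k \<in> vert M (Ma M (hs ! k))" if "Suc k < length hs" for k
    using cw that unfolding closed_walk_def by (metis Suc_eq_plus1 Suc_lessD mod_less)
  have en: "hs ! 0 \<in> vert M (Ma M (hs ! (length hs - 1)))"
  proof -
    have "length hs - 1 < length hs" "(length hs - 1 + 1) mod length hs = 0"
      using ij by (cases hs; simp)+
    thus ?thesis using cw unfolding closed_walk_def by metis
  qed
  have mD: "Ma M (hs ! k) \<in> Md M" if "k < length hs" for k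
    using that hs deps_D Ma_mem nth_mem by blast
  have hD: "hs ! k \<in> Md M" if "k < length hs" for k
    using that hs deps_D nth_mem by blast
  show ?thesis
  proof (cases i)
    case 0
    have "closed_walk b (take j hs)"
      unfolding closed_walk_def
    proof (intro conjI allI impI)
      show "take j hs \<noteq> []" "take j hs ! 0 = b" using ij hs by auto
      show "set (take j hs) \<subseteq> deps" using hs set_take_subset by fast
      fix k assume "k < length (take j hs)"
      hence k: "k < j" using ij by simp
      show "take j hs ! ((k + 1) mod length (take j hs)) \<in> vert M (Ma M (take j hs ! k))"
      proof (cases "Suc k = j")
        case True
        have "hs ! j \<in> vert M (Ma M (hs ! k))" using st[of k] True ij by simp
        hence "vert M (hs ! j) = vert M (Ma M (hs ! k))" using vert_eq[OF mD] k ij by simp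
        hence "hs ! 0 \<in> vert M (Ma M (hs ! k))" using ij 0 vert_refl by metis
        thus ?thesis using True ij k by simp
      next
        case False
        thus ?thesis using st[of k] k ij by simp
      qed
    qed
    thus ?thesis using ij by (intro exI[of _ "take j hs"]) simp
  next
    case (Suc m)
    let ?hs = "take i hs @ drop j hs"
    have nth: "?hs ! k = (if k < i then hs ! k else hs ! (k - i + j))" if "k < length ?hs" for k
      using that ij by (auto simp: nth_append add.commute)
    have len: "length ?hs = i + (length hs - j)" using ij by simp
    have jm: "hs ! j \<in> vert M (Ma M (hs ! m))"
    proof -
      have "hs ! i \<in> vert M (Ma M (hs ! m))" using st[of m] Suc ij by simp
      hence "vert M (hs ! i) = vert M (Ma M (hs ! m))" by (intro vert_eq[OF mD]) (use Suc ij in auto)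
      thus ?thesis using ij vert_refl by metis
    qed
    have "closed_walk b ?hs"
      unfolding closed_walk_def
    proof (intro conjI allI impI)
      show "?hs \<noteq> []" using Suc ij by auto
      show "?hs ! 0 = b" using ij hs Suc nth[of 0] by simp
      show "set ?hs \<subseteq> deps" using hs set_take_subset[of i hs] set_drop_subset[of j hs] by auto
      fix k assume k: "k < length ?hs"
      show "?hs ! ((k + 1) mod length ?hs) \<in> vert M (Ma M (?hs ! k))"
      proof (cases "Suc k = length ?hs")
        case True
        hence "k - i + j = length hs - 1" "\<not> k < i" using len ij by auto
        hence "?hs ! k = hs ! (length hs - 1)" using nth[OF k] by simp
        moreover have "?hs ! ((k + 1) mod length ?hs) = hs ! 0"
        proof -
          have "(k + 1) mod length ?hs = 0" using True by simp
          thus ?thesis using nth[of 0] Suc ij len by simp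
        qed
        ultimately show ?thesis using en by simp
      next
        case False
        hence k1: "Suc k < length ?hs" using k by simp
        hence e: "?hs ! ((k + 1) mod length ?hs) = (if Suc k < i then hs ! Suc k else hs ! (Suc k - i + j))"
          using nth[OF k1] by simp
        consider "Suc k < i" | "Suc k = i" | "i \<le> k" by linarith
        thus ?thesis
        proof cases
          case 1 thus ?thesis using e nth[OF k] st[of k] ij by simp
        next
          case 2 thus ?thesis using e nth[OF k] jm Suc by simp
        next
          case 3
          hence "Suc (k - i + j) < length hs" using k1 len by simp
          thus ?thesis using e nth[OF k] st[of "k - i + j"] 3 by (simp add: Suc_diff_le)
        qed
      qed
    qed
    thus ?thesis using ij len by (intro exI[of _ ?hs]) simp
  qed
qed

text \<open>A shortest closed walk starting with \<open>b\<close> repeats no vertex. If it used an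
  edge in both directions, the two darts would follow each other cyclically, one of them would be
  \<open>b\<close>, and both would lie in \<open>W\<close>, contrary to
  \<open>b \<notin> W\<close>.\<close>

lemma simple_circuit:
  assumes b: "b \<in> deps" "b \<notin> W"
  shows "\<exists>hs. closed_walk b hs \<and> circuit M hs"
proof -
  define hs where "hs = arg_min length (closed_walk b)"
  have cw: "closed_walk b hs" and mn: "\<And>hs'. closed_walk b hs' \<Longrightarrow> length hs \<le> length hs'"
    using closed_walk_ex[OF b(1)] arg_min_nat_lemma[of "closed_walk b" _ length] unfolding hs_def by blast+
  have hs: "hs \<noteq> []" "set hs \<subseteq> deps" "hs ! 0 = b" using cw by (auto simp: closed_walk_def)
  have hD: "hs ! k \<in> Md M" if "k < length hs" for k
    using that hs deps_D nth_mem by blast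
  have st: "hs ! ((k + 1) mod length hs) \<in> vert M (Ma M (hs ! k))" if "k < length hs" for k
    using cw that unfolding closed_walk_def by blast
  have dist: "i = j" if "i < length hs" "j < length hs" "vert M (hs ! i) = vert M (hs ! j)" for i j
  proof (rule ccontr)
    assume "i \<noteq> j"
    then consider "i < j" | "j < i" by linarith
    thus False
    proof cases
      case 1 thus False using closed_walk_shorten[OF cw 1] that mn by fastforce
    next
      case 2 thus False using closed_walk_shorten[OF cw 2] that mn by fastforce
    qed
  qed
  have nx: "j = (i + 1) mod length hs" if "i < length hs" "j < length hs" "hs ! j = Ma M (hs ! i)" for i j
  proof -
    let ?k = "(i + 1) mod length hs"
    have k: "?k < length hs" using hs by simp
    have "vert M (hs ! ?k) = vert M (hs ! j)" using vert_eq[OF Ma_mem[OF hD[OF that(1)]] st[OF that(1)]] that by simp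
    thus ?thesis using dist[OF k that(2)] by simp
  qed
  have "circuit M hs"
    unfolding circuit_def
  proof (intro conjI allI impI)
    show "hs \<noteq> []" by fact
    show "set hs \<subseteq> Md M" using hs deps_D by auto
    show "distinct (map (vert M) hs)" using dist by (auto simp: distinct_conv_nth)
    show "ing M (Ma M (hs ! i))" if i: "i < length hs" for i
    proof -
      have "Ma M (hs ! i) \<in> W" using i hs nth_mem deps_iff hD by blast
      thus ?thesis using W_ings by (auto simp: ings_def)
    qed
    show "hs ! ((i + 1) mod length hs) \<in> vert M (Ma M (hs ! i))" if "i < length hs" for i
      using st that .
    show "hs ! j \<noteq> hs ! i" if "i < length hs" "j < length hs" "i \<noteq> j" for i j
      using dist that by metis
    show "hs ! j \<noteq> Ma M (hs ! i)" if ij: "i < length hs" "j < length hs" "i \<noteq> j" for i j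
    proof
      assume e: "hs ! j = Ma M (hs ! i)"
      hence e': "hs ! i = Ma M (hs ! j)" using Ma_Ma hD ij by metis
      have "j = (i + 1) mod length hs" "i = (j + 1) mod length hs"
        using nx[OF ij(1,2) e] nx[OF ij(2,1) e'] by auto
      hence "i = 0 \<or> j = 0" by (rule successors_mod[OF ij(1,2)])
      moreover have "hs ! k \<in> deps" if "k < length hs" for k using that hs nth_mem by blast
      hence "Ma M (hs ! k) \<in> W" if "k < length hs" for k using that deps_iff[OF hD[OF that]] by simp
      from this[OF ij(1)] this[OF ij(2)] have "hs ! i \<in> W" "hs ! j \<in> W"
        unfolding e[symmetric] e'[symmetric] by simp_all
      ultimately show False using hs b by auto
    qed
  qed
  thus ?thesis using cw by blast
qed

text \<open>For an initial corner \<open>x\<close> the circuit leaves by the departure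
  \<open>b\<close> found before \<open>x\<close>. Its arrival at that vertex is in \<open>W\<close>,
  so turning clockwise from \<open>b\<close> one meets it no earlier than \<open>x\<close>. The two
  closure rules keep the circuit, since its edges are edges of the walk and hence never
  crossed.\<close>

lemma right_side_circuit:
  assumes "x \<in> right_side" shows "\<exists>hs. circuit M hs \<and> set hs \<subseteq> deps \<and> x \<in> rside M hs"
  using assms unfolding right_side_def
proof (induction rule: rclos.induct)
  case (base x)
  obtain b j where b: "b \<in> deps" "b \<notin> W" "b \<in> Md M" "j > 0" "x = (Ms M ^^ j) b"
    and nW: "\<forall>i. 0 < i \<and> i < j \<longrightarrow> (Ms M ^^ i) b \<notin> W"
    using departure_before[OF base] by blast
  obtain hs where hs: "closed_walk b hs" "circuit M hs" using simple_circuit b by blast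
  have hs': "hs \<noteq> []" "set hs \<subseteq> deps" "hs ! 0 = b" using hs by (auto simp: closed_walk_def)
  let ?l = "length hs - 1"
  have l: "?l < length hs" "(?l + 1) mod length hs = 0" using hs' by (cases hs; simp)+
  let ?a = "Ma M (hs ! ?l)"
  have ld: "hs ! ?l \<in> deps" using l hs' nth_mem by blast
  have aW: "?a \<in> W" using deps_iff[OF deps_D[OF ld]] ld by blast
  have "hs ! ((?l + 1) mod length hs) \<in> vert M ?a" using hs(1) l(1) unfolding closed_walk_def by blast
  hence "b \<in> vert M ?a" unfolding l(2) hs'(3) .
  hence "?a \<in> vert M b" using vert_sym W_D aW by blast
  then obtain m where m: "?a = (Ms M ^^ m) b" by (auto simp: vert_orb orb_def)
  have "m > 0" using m aW b by (cases m) auto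
  hence ex: "\<exists>n>0. (Ms M ^^ n) b = ?a" using m by auto
  define L where "L = (LEAST n. 0 < n \<and> (Ms M ^^ n) b = ?a)"
  have L: "0 < L \<and> (Ms M ^^ L) b = ?a" unfolding L_def by (rule LeastI_ex[OF ex])
  have "j \<le> L"
  proof (rule ccontr)
    assume "\<not> j \<le> L"
    hence "0 < L \<and> L < j" using L by simp
    hence "(Ms M ^^ L) b \<notin> W" using nW by blast
    moreover have "(Ms M ^^ L) b \<in> W" using L aW by presburger
    ultimately show False by blast
  qed
  hence "x \<in> between M b ?a" unfolding between_def L_def[symmetric] using b by auto
  hence "x \<in> between M (hs ! ((?l + 1) mod length hs)) ?a" unfolding l(2) hs'(3) .
  hence "x \<in> rside M hs" by (rule rside.base[OF l(1)])
  thus ?case using hs hs' by blast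
next
  case (fstep x)
  then obtain hs where "circuit M hs" "set hs \<subseteq> deps" "x \<in> rside M hs" by blast
  thus ?case using rside.fstep[of x M hs] by (intro exI[of _ hs]) simp
next
  case (cross x)
  then obtain hs where hs: "circuit M hs" "set hs \<subseteq> deps" "x \<in> rside M hs" by blast
  have "\<not> cyc_edge M hs x"
  proof
    assume "cyc_edge M hs x"
    then obtain h where "h \<in> deps" "x = h \<or> x = Ma M h" using hs by (auto simp: cyc_edge_def)
    thus False using deps_iff deps_D cross by metis
  qed
  thus ?case using rside.cross[of x M hs] hs cross(2) by (intro exI[of _ hs]) simp
qed

lemma right_side_D: "x \<in> right_side \<Longrightarrow> x \<in> Md M"
  unfolding right_side_def
  by (induction rule: rclos.induct) (auto simp: base_corners_def Ma_mem p.mem)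

text \<open>One turn around a vertex is the crossing of an edge followed by a face step, and at a
  vertex without arrivals no edge is a wall.\<close>

lemma right_side_vert:
  assumes "x \<in> right_side" "vert M x \<inter> W = {}" shows "vert M x \<subseteq> right_side"
  unfolding vert_orb
proof
  fix y assume "y \<in> orb (Ms M) x"
  thus "y \<in> right_side"
  proof (induction rule: s.orb_induct)
    case base show ?case by fact
  next
    case (step y)
    have yD: "y \<in> Md M" using step right_side_D by auto
    have "y \<notin> W" using step assms by (auto simp: vert_orb)
    moreover have "Ma M y \<notin> W"
    proof
      assume aW: "Ma M y \<in> W"
      hence "y \<in> vert M (p (Ma M y))" using p_vert[OF aW] Ma_Ma yD by simp
      hence "p (Ma M y) \<in> vert M y" using vert_sym W_D p_W aW by blast
      moreover have "vert M y = vert M x"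
        using step vert_eq[of x y] right_side_D assms by (simp add: vert_orb)
      ultimately show False using p_W[OF aW] assms by auto
    qed
    ultimately have "Ma M y \<in> right_side" using rclos.cross step yD unfolding right_side_def by metis
    hence "phi M (Ma M y) \<in> right_side" using rclos.fstep unfolding right_side_def by metis
    thus ?case using phi_Ma yD by simp
  qed
qed

text \<open>The vertices with neither an arrival nor a right-hand corner include all outer vertices
  and are closed under directed steps. An edge entering the walk from its left would end in an
  ingoing half-edge among the left corners, and the only such half-edges are departures, whose edges
  already belong to the walk. So no vertex of the walk is reached.\<close>

lemma not_accessible:
  assumes nr: "Mr M \<notin> right_side" and nroot: "\<And>w. w \<in> W \<Longrightarrow> Ma M w \<notin> rootface M"
  shows "\<not> accessible M"
proof
  assume acc: "accessible M"
  define Out where "Out = {d \<in> Md M. vert M d \<inter> W = {} \<and> vert M d \<inter> right_side = {}}"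
  have rr: "r \<notin> right_side" if "r \<in> rootface M" for r
  proof
    assume r: "r \<in> right_side"
    have "orb (phi M) r \<subseteq> right_side"
      by (rule p.orb_least[OF r]) (auto simp: right_side_def intro: rclos.fstep)
    moreover have "Mr M \<in> orb (phi M) r" using that p.orb_sym root_dart unfolding rootface_orb by blast
    ultimately show False using nr by auto
  qed
  obtain w where w: "w \<in> W" using W_ne by auto
  obtain s where s: "s \<in> Md M" "vert M s \<inter> rootface M \<noteq> {}" "(s, w) \<in> (acc_step M)\<^sup>*"
    using acc W_D[OF w] unfolding accessible_def by blast
  obtain r where r: "r \<in> vert M s" "r \<in> rootface M" using s by auto
  have vr: "vert M r = vert M s" using vert_eq s r by auto
  have rD: "r \<in> Md M" using r root_sub by auto
  have "vert M s \<inter> W = {}"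
  proof (rule ccontr)
    assume "vert M s \<inter> W \<noteq> {}"
    hence "r \<in> lint" using rr[OF r(2)] rclos.base[of r base_corners M W] vr rD
      unfolding right_side_def base_corners_def by auto
    moreover obtain z where z: "z \<in> ings M" "Ms M z = r" "Ma M z \<in> rootface M"
      using root_pred[OF r(2)] by blast
    ultimately have "z \<in> W" using lint_start by auto
    thus False using nroot z by auto
  qed
  moreover have "vert M s \<inter> right_side = {}"
  proof (rule ccontr)
    assume "vert M s \<inter> right_side \<noteq> {}"
    then obtain y where y: "y \<in> vert M s" "y \<in> right_side" by auto
    have "vert M y = vert M s" using vert_eq s y by auto
    hence "r \<in> right_side" using right_side_vert[OF y(2)] calculation r by auto
    thus False using rr r by auto
  qed
  ultimately have sO: "s \<in> Out" using s by (auto simp: Out_def)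
  from s(3) have "w \<in> Out"
  proof (induction rule: rtrancl_induct)
    case base show ?case by (rule sO)
  next
    case (step y z)
    have yD: "y \<in> Md M" and yv: "vert M y \<inter> W = {}" "vert M y \<inter> right_side = {}"
      using step by (auto simp: Out_def)
    from step(2) consider "z = Ms M y" | "z = Ma M y" "ing M (Ma M y)" by (auto simp: acc_step_def)
    thus ?case
    proof cases
      case 1 thus ?thesis using yD yv vert_Ms s.mem by (auto simp: Out_def)
    next
      case 2
      have zD: "z \<in> Md M" using 2 yD Ma_mem by simp
      have zI: "z \<in> ings M" using 2 zD by (simp add: ings_def)
      have az: "Ma M z = y" using 2 yD Ma_Ma by simp
      have yW: "y \<notin> W" "y \<notin> right_side" using yv vert_refl by auto
      have zW: "z \<notin> W"
      proof
        assume zW: "z \<in> W"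
        hence "y \<in> vert M (p z)" using p_vert az by metis
        hence "p z \<in> vert M y" using vert_sym p_W[OF zW] W_D by metis
        thus False using p_W[OF zW] yv by auto
      qed
      have nX: "z \<notin> right_side"
        using rclos.cross[of z M W base_corners] zD zW yW az unfolding right_side_def by auto
      have "vert M z \<inter> W = {}"
      proof (rule ccontr)
        assume "vert M z \<inter> W \<noteq> {}"
        hence "z \<in> lint" using nX rclos.base[of z base_corners M W] zD
          unfolding right_side_def base_corners_def by auto
        hence "z \<in> deps" using lint_cases zI by auto
        thus False using deps_iff[OF zD] az yW by simp
      qed
      moreover have "vert M z \<inter> right_side = {}"
      proof (rule ccontr)
        assume "vert M z \<inter> right_side \<noteq> {}"
        then obtain u where u: "u \<in> vert M z" "u \<in> right_side" by auto
        have "vert M u = vert M z" using vert_eq zD u by auto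
        hence "z \<in> right_side" using right_side_vert[OF u(2)] calculation vert_refl[of z] by auto
        thus False using nX by auto
      qed
      ultimately show ?thesis using zD by (auto simp: Out_def)
    qed
  qed
  thus False using w vert_refl[of w] by (auto simp: Out_def)
qed

end

text \<open>A path that never ends stays among finitely many half-edges and becomes periodic. Its
  cycle contradicts minimality if the root corner is on the right, and accessibility if it is
  not.\<close>

lemma inB_good:
  assumes B: "inB M" and h: "h \<in> ings M" shows "good M h"
proof (rule ccontr)
  assume bad: "\<not> good M h"
  interpret omap M by (rule inB_omap[OF B])
  define Bad where "Bad = {h \<in> ings M. \<not> good M h}"
  define p where "p h' = (SOME h. h \<in> ings M \<and> insec (Ms M) (ings M) h (Ma M h'))" for h'
  have p: "p h' \<in> ings M \<and> insec (Ms M) (ings M) (p h') (Ma M h')" if "h' \<in> ings M" for h'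
    unfolding p_def by (rule someI_ex) (use pred_ex[of h'] that ings_D in blast)
  have pB: "p h' \<in> Bad" if "h' \<in> Bad" for h'
    using p[of h'] that good.step[of M "p h'" h'] by (auto simp: Bad_def)
  have "finite Bad" unfolding Bad_def using fin_darts ings_sub finite_subset by fastforce
  have pk: "(p ^^ k) h \<in> Bad" for k using bad h pB by (induction k) (auto simp: Bad_def)
  hence "finite (range (\<lambda>k. (p ^^ k) h))" using \<open>finite Bad\<close> finite_subset by (metis image_subsetI)
  hence "\<not> inj (\<lambda>k. (p ^^ k) h)" using finite_imageD infinite_UNIV_nat by blast
  then obtain i j where ij: "i < j" "(p ^^ i) h = (p ^^ j) h"
    unfolding inj_def by (metis (mono_tags, lifting) linorder_neqE_nat)
  define w where "w = (p ^^ i) h"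
  define n where "n = j - i"
  have pw: "(p ^^ n) w = w"
  proof -
    have "(p ^^ n) w = (p ^^ (n + i)) h" by (simp add: w_def funpow_add)
    thus ?thesis using ij by (simp add: n_def w_def)
  qed
  define W where "W = {(p ^^ k) w |k. True}"
  have WB: "W \<subseteq> Bad" unfolding W_def w_def using pk by (auto simp flip: funpow_add[unfolded o_def, THEN fun_cong])
  interpret pred_cycle M W p n
  proof
    show "W \<subseteq> ings M" using WB by (auto simp: Bad_def)
    have "(p ^^ 0) w \<in> W" unfolding W_def by blast
    thus "W \<noteq> {}" by auto
    show "0 < n" using ij by (simp add: n_def)
    fix u assume u: "u \<in> W"
    then obtain k where k: "u = (p ^^ k) w" by (auto simp: W_def)
    hence "p u = (p ^^ Suc k) w" by simp
    thus "p u \<in> W" unfolding W_def by blast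
    show "insec (Ms M) (ings M) (p u) (Ma M u)" using p u WB by (auto simp: Bad_def)
    have "(p ^^ n) u = (p ^^ k) ((p ^^ n) w)" unfolding k by (metis add.commute funpow_add o_apply)
    thus "(p ^^ n) u = u" using pw k by simp
  qed
  have "\<not> accessible M"
  proof (rule not_accessible)
    show "Mr M \<notin> right_side"
    proof
      assume "Mr M \<in> right_side"
      then obtain hs where "circuit M hs" "Mr M \<in> rside M hs" using right_side_circuit by blast
      thus False using B by (auto simp: inB_def cw_minimal_def minimal_def ccw_circuit_def)
    qed
    show "Ma M w \<notin> rootface M" if "w \<in> W" for w
      using that WB good.root[of w M] by (auto simp: Bad_def)
  qed
  thus False using B by (simp add: inB_def)
qed

section \<open>A discrete Jordan curve theorem\<close>

fun swl :: "('a \<Rightarrow> 'a) \<Rightarrow> ('a \<times> 'a) list \<Rightarrow> 'a \<Rightarrow> 'a" where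
  "swl f [] = f"
| "swl f ((x, y) # ps) = swl (f(x := f y, y := f x)) ps"

lemma swl_other: "z \<notin> fst ` set ps \<Longrightarrow> z \<notin> snd ` set ps \<Longrightarrow> swl f ps z = f z"
  by (induction f ps rule: swl.induct) auto

lemma swl_pair:
  assumes "distinct (map fst ps @ map snd ps)" "(x, y) \<in> set ps"
  shows "swl f ps x = f y" "swl f ps y = f x"
proof -
  have "swl f ps x = f y \<and> swl f ps y = f x"
    using assms
  proof (induction f ps rule: swl.induct)
    case (2 f u v ps)
    let ?f = "f(u := f v, v := f u)"
    show ?case
    proof (cases "(x, y) = (u, v)")
      case True
      hence nn: "x \<notin> fst ` set ps" "x \<notin> snd ` set ps" "y \<notin> fst ` set ps" "y \<notin> snd ` set ps" "x \<noteq> y"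
        using 2(2) by auto
      show ?thesis using True swl_other[of x ps ?f] swl_other[of y ps ?f] nn by auto
    next
      case False
      hence xy: "(x, y) \<in> set ps" using 2 by auto
      hence "x \<in> fst ` set ps" "y \<in> snd ` set ps" by force+
      hence "x \<noteq> u" "x \<noteq> v" "y \<noteq> u" "y \<noteq> v" using 2(2) by auto
      moreover have "swl ?f ps x = ?f y \<and> swl ?f ps y = ?f x" by (rule 2(1)) (use 2(2) xy in auto)
      ultimately show ?thesis by simp
    qed
  qed simp
  thus "swl f ps x = f y" "swl f ps y = f x" by auto
qed

lemma swl_fperm:
  "fperm f D \<Longrightarrow> fst ` set ps \<subseteq> D \<Longrightarrow> snd ` set ps \<subseteq> D \<Longrightarrow> fperm (swl f ps) D"
proof (induction f ps rule: swl.induct)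
  case (2 f x y ps)
  have "fperm (f(x := f y, y := f x)) D" using fperm.swap_fperm[OF 2(2)] 2(3,4) by auto
  thus ?case using 2 by (simp del: fun_upd_apply)
qed simp

text \<open>Each pair has a cycle of \<open>f\<close> to itself, so every transposition splits a
  cycle that the others leave alone.\<close>

lemma swl_count:
  "fperm f D \<Longrightarrow> fst ` set ps \<subseteq> D \<Longrightarrow> snd ` set ps \<subseteq> D \<Longrightarrow> distinct (map (\<lambda>q. orb f (fst q)) ps)
   \<Longrightarrow> (\<And>x y. (x, y) \<in> set ps \<Longrightarrow> x \<noteq> y \<and> y \<in> orb f x)
   \<Longrightarrow> card (orb (swl f ps) ` D) = card (orb f ` D) + length ps"
proof (induction f ps rule: swl.induct)
  case (2 f x y ps)
  interpret fperm f D by fact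
  let ?f = "f(x := f y, y := f x)"
  have xy: "x \<in> D" "y \<in> D" "x \<noteq> y" "y \<in> orb f x" using 2(3,4) 2(6)[of x y] by simp_all
  have oxy: "orb f y = orb f x" by (rule orb_eq) fact+
  have oe: "orb ?f (fst q) = orb f (fst q)" if q: "q \<in> set ps" for q
  proof (rule orb_cong)
    fix z assume z: "z \<in> orb f (fst q)"
    have qD: "fst q \<in> D" using q 2(3) by auto
    have "orb f z = orb f (fst q)" using orb_eq[OF qD z] .
    moreover have "orb f x \<noteq> orb f (fst q)" using 2(5) q by auto
    ultimately have "z \<noteq> x" "z \<noteq> y" using oxy by auto
    thus "?f z = f z" by simp
  qed
  have "card (orb (swl ?f ps) ` D) = card (orb ?f ` D) + length ps"
  proof (rule 2(1))
    show "fperm ?f D" by (rule swap_fperm) fact+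
    show "fst ` set ps \<subseteq> D" "snd ` set ps \<subseteq> D" using 2 by auto
    have e: "map (\<lambda>q. orb ?f (fst q)) ps = map (\<lambda>q. orb f (fst q)) ps"
      by (rule map_cong[OF refl oe])
    have "distinct (map (\<lambda>q. orb f (fst q)) ps)" using 2(5) by simp
    thus "distinct (map (\<lambda>q. orb ?f (fst q)) ps)" unfolding e .
    fix u v assume uv: "(u, v) \<in> set ps"
    have "u \<noteq> v \<and> v \<in> orb f u" using 2(6) uv by auto
    thus "u \<noteq> v \<and> v \<in> orb ?f u" using oe[OF uv] by (simp del: fun_upd_apply)
  qed
  moreover have "card (orb ?f ` D) = Suc (card (orb f ` D))" by (rule swap_split) fact+
  ultimately show ?case by (simp del: fun_upd_apply)
qed simp

lemma card_pairs:
  assumes fS: "finite S" and inv: "\<And>d. d \<in> S \<Longrightarrow> a d \<in> S \<and> a d \<noteq> d \<and> a (a d) = d"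
  shows "card S = 2 * card ((\<lambda>d. {d, a d}) ` S)"
proof -
  let ?C = "(\<lambda>d. {d, a d}) ` S"
  have U: "\<Union>?C = S" using inv by auto
  have "2 * card ?C = card (\<Union>?C)"
  proof (rule card_partition)
    show "finite ?C" "finite (\<Union>?C)" using fS U by auto
    fix c assume "c \<in> ?C"
    then obtain d where d: "d \<in> S" "c = {d, a d}" by auto
    hence "a d \<noteq> d" using inv by blast
    thus "card c = 2" using d by auto
  next
    fix c1 c2 assume "c1 \<in> ?C" "c2 \<in> ?C" "c1 \<noteq> c2"
    then obtain d e where "d \<in> S" "e \<in> S" "c1 = {d, a d}" "c2 = {e, a e}" by auto
    moreover from this have aa: "a (a d) = d" "a (a e) = e" using inv by auto
    have "a d \<noteq> a e" if "d \<noteq> e" using aa that by metis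
    moreover have "d \<noteq> e" "d \<noteq> a e" using \<open>c1 \<noteq> c2\<close> calculation aa by auto
    moreover from this have "e \<noteq> a d" using aa by auto
    ultimately show "c1 \<inter> c2 = {}" by auto
  qed
  thus ?thesis using U by simp
qed

locale circ = rmap +
  fixes hs assumes circ: "circuit M hs"
begin

text \<open>The rotation by one puts the arrival at each vertex of the circuit next to the departure
  from the same vertex.\<close>

definition ps :: "('a \<times> 'a) list" where
  "ps = zip (map (Ma M) hs) (rotate1 hs)"

definition arrs :: "'a set" where
  "arrs = Ma M ` set hs"

lemma hs_ne: "hs \<noteq> []" and hs_D: "set hs \<subseteq> Md M"
  using circ by (auto simp: circuit_def)

lemma hs_nth_D: "i < length hs \<Longrightarrow> hs ! i \<in> Md M"
  using hs_D nth_mem by blast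

lemma hs_vert: "i < length hs \<Longrightarrow> hs ! (Suc i mod length hs) \<in> vert M (Ma M (hs ! i))"
  using circ by (auto simp: circuit_def)

lemma hs_ing: "h \<in> set hs \<Longrightarrow> Ma M h \<in> ings M"
proof -
  assume h: "h \<in> set hs"
  then obtain i where "i < length hs" "h = hs ! i" by (auto simp: in_set_conv_nth)
  hence "ing M (Ma M h)" using circ by (auto simp: circuit_def)
  thus "Ma M h \<in> ings M" using h hs_D Ma_mem by (auto simp: ings_def)
qed

lemma distinct_vert: "distinct (map (vert M) hs)"
  using circ by (auto simp: circuit_def)

lemma distinct_hs: "distinct hs"
  using distinct_vert by (simp add: distinct_map)

lemma arr_disj: "arrs \<inter> set hs = {}"
proof (rule ccontr)
  assume "arrs \<inter> set hs \<noteq> {}"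
  then obtain i j where ij: "i < length hs" "j < length hs" "hs ! j = Ma M (hs ! i)"
    unfolding arrs_def by (auto simp: in_set_conv_nth)
  have "i = j"
  proof (rule ccontr)
    assume "i \<noteq> j"
    hence "hs ! j \<noteq> Ma M (hs ! i)" using circ ij(1,2) unfolding circuit_def by blast
    thus False using ij by simp
  qed
  thus False using ij Ma_neq[OF hs_nth_D[OF ij(1)]] by simp
qed

lemma ps_len: "length ps = length hs"
  by (simp add: ps_def)

lemma map_fst_ps: "map fst ps = map (Ma M) hs" and map_snd_ps: "map snd ps = rotate1 hs"
  by (simp_all add: ps_def)

lemma fst_ps: "fst ` set ps = arrs" and snd_ps: "snd ` set ps = set hs"
  using arg_cong[OF map_fst_ps, of set] arg_cong[OF map_snd_ps, of set] by (simp_all add: arrs_def)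

lemma arrs_D: "arrs \<subseteq> Md M"
  unfolding arrs_def using hs_D Ma_mem by auto

lemma distinct_ps: "distinct (map fst ps @ map snd ps)"
proof -
  have "distinct (map (Ma M) hs)"
    using distinct_hs hs_D a.bij by (auto simp: distinct_map bij_betw_def intro: inj_on_subset)
  thus ?thesis using distinct_hs arr_disj by (simp add: map_fst_ps map_snd_ps arrs_def del: distinct_map)
qed

lemma ps_nth: assumes "(x, y) \<in> set ps"
  shows "\<exists>i < length hs. x = Ma M (hs ! i) \<and> y = hs ! (Suc i mod length hs)"
  using assms unfolding ps_def by (auto simp: in_set_zip nth_rotate1)

lemma ps_vert: assumes "(x, y) \<in> set ps" shows "y \<in> vert M x"
  using ps_nth[OF assms] hs_vert by auto

definition sw :: "'a \<Rightarrow> 'a" where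
  "sw = swl id ps"

lemma sw_pair: "(x, y) \<in> set ps \<Longrightarrow> sw x = y" "(x, y) \<in> set ps \<Longrightarrow> sw y = x"
  unfolding sw_def using swl_pair[OF distinct_ps] by auto

lemma sw_other: "z \<notin> arrs \<Longrightarrow> z \<notin> set hs \<Longrightarrow> sw z = z"
  unfolding sw_def using swl_other[of z ps id] fst_ps snd_ps by simp

lemma sw_arr: assumes "z \<in> arrs" shows "(z, sw z) \<in> set ps" "sw z \<in> set hs"
proof -
  obtain y where "(z, y) \<in> set ps" using assms fst_ps by force
  thus "(z, sw z) \<in> set ps" using sw_pair by auto
  thus "sw z \<in> set hs" using snd_ps by force
qed

lemma sw_dep: assumes "z \<in> set hs" shows "(sw z, z) \<in> set ps" "sw z \<in> arrs"
proof -
  obtain x where "(x, z) \<in> set ps" using assms snd_ps by force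
  thus "(sw z, z) \<in> set ps" using sw_pair by auto
  thus "sw z \<in> arrs" using fst_ps by force
qed

lemma sw_sw: "sw (sw z) = z"
proof (cases "z \<in> arrs \<or> z \<in> set hs")
  case True thus ?thesis using sw_arr(1)[of z] sw_dep(1)[of z] sw_pair by auto
next
  case False thus ?thesis using sw_other by auto
qed

text \<open>Cutting the sphere along the circuit: each of its vertices is split in two, and its edges
  are merged into one hyperedge on either side.\<close>
definition cs :: "'a \<Rightarrow> 'a" where
  "cs = swl (Ms M) ps"

definition ca :: "'a \<Rightarrow> 'a" where
  "ca = sw \<circ> Ma M"

lemma cs_sw: "cs z = Ms M (sw z)"
proof (cases "z \<in> arrs \<or> z \<in> set hs")
  case True thus ?thesis
    unfolding cs_def using swl_pair[OF distinct_ps, of _ _ "Ms M"] sw_arr(1)[of z] sw_dep(1)[of z] by auto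
next
  case False thus ?thesis unfolding cs_def using sw_other[of z] swl_other[of z ps "Ms M"] fst_ps snd_ps by simp
qed

lemma cs_ca: "cs \<circ> ca = phi M"
  by (auto simp: fun_eq_iff cs_sw ca_def sw_sw phi_def)

lemma cs_fperm: "fperm cs (Md M)"
  unfolding cs_def by (rule swl_fperm[OF s.fperm_axioms]) (use fst_ps snd_ps arrs_D hs_D in auto)

lemma sw_fperm: "fperm sw (Md M)"
proof -
  have "fperm id (Md M)" by (rule fpermI) (auto simp: fin_darts)
  thus ?thesis unfolding sw_def by (rule swl_fperm) (use fst_ps snd_ps arrs_D hs_D in auto)
qed

lemma ca_fperm: "fperm ca (Md M)"
  unfolding ca_def by (rule fperm_comp[OF sw_fperm a.fperm_axioms])

lemma cs_count: "card (orb cs ` Md M) = card (verts M) + length hs"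
proof -
  have "card (orb (swl (Ms M) ps) ` Md M) = card (orb (Ms M) ` Md M) + length ps"
  proof (rule swl_count[OF s.fperm_axioms])
    show "fst ` set ps \<subseteq> Md M" "snd ` set ps \<subseteq> Md M" using fst_ps snd_ps arrs_D hs_D by auto
    have "map (\<lambda>q. orb (Ms M) (fst q)) ps = map (\<lambda>q. vert M (snd q)) ps"
    proof (rule map_cong[OF refl])
      fix q assume q: "q \<in> set ps"
      have "fst q \<in> Md M" using q fst_ps arrs_D by auto
      moreover have "snd q \<in> vert M (fst q)" using q ps_vert[of "fst q" "snd q"] by simp
      ultimately show "orb (Ms M) (fst q) = vert M (snd q)" using vert_eq vert_orb by metis
    qed
    also have "\<dots> = map (vert M) (map snd ps)" by simp
    also have "\<dots> = rotate1 (map (vert M) hs)" by (simp only: map_snd_ps rotate1_map)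
    finally show "distinct (map (\<lambda>q. orb (Ms M) (fst q)) ps)" using distinct_vert by simp
    fix x y assume xy: "(x, y) \<in> set ps"
    have "x \<in> arrs" "y \<in> set hs" using xy fst_ps snd_ps by force+
    hence "x \<noteq> y" using arr_disj by auto
    thus "x \<noteq> y \<and> y \<in> orb (Ms M) x" using ps_vert[OF xy] by (simp add: vert_orb)
  qed
  moreover have "vert M ` Md M = orb (Ms M) ` Md M" by (rule image_cong) (auto simp: vert_orb)
  ultimately show ?thesis by (simp add: cs_def verts_def ps_len)
qed

lemma ca_other: "d \<in> Md M \<Longrightarrow> d \<notin> arrs \<Longrightarrow> d \<notin> set hs \<Longrightarrow> ca d = Ma M d \<and> Ma M d \<notin> arrs \<and> Ma M d \<notin> set hs"
proof -
  assume d: "d \<in> Md M" "d \<notin> arrs" "d \<notin> set hs"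
  have "Ma M d \<notin> set hs" using d Ma_Ma[of d] unfolding arrs_def by (metis image_eqI)
  moreover have "Ma M d \<notin> arrs"
  proof
    assume "Ma M d \<in> arrs"
    then obtain h where "h \<in> set hs" "Ma M d = Ma M h" unfolding arrs_def by auto
    hence "d = h" using Ma_Ma d hs_D by (metis subsetD)
    thus False using d \<open>h \<in> set hs\<close> by simp
  qed
  ultimately show ?thesis using sw_other by (simp add: ca_def)
qed

lemma ca_arr: "d \<in> arrs \<Longrightarrow> ca d \<in> arrs"
proof -
  assume "d \<in> arrs"
  then obtain h where h: "h \<in> set hs" "d = Ma M h" unfolding arrs_def by auto
  hence "Ma M d = h" using Ma_Ma hs_D by auto
  thus ?thesis using sw_dep h by (simp add: ca_def)
qed

lemma ca_dep: "d \<in> set hs \<Longrightarrow> ca d \<in> set hs"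
  using sw_arr[of "Ma M d"] by (simp add: ca_def arrs_def)

text \<open>Let k be the length of the circuit. The half-edges off the circuit form |D|/2 - k
  two-cycles, and since arrivals and departures are kept apart, the circuit adds at least two more
  cycles.\<close>

lemma ca_count: "card (Md M) + 4 \<le> 2 * card (orb ca ` Md M) + 2 * length hs"
proof -
  interpret ca: fperm ca "Md M" by (rule ca_fperm)
  let ?C = "arrs \<union> set hs"
  let ?P = "(\<lambda>d. {d, Ma M d}) ` (Md M - ?C)"
  obtain b where b: "b \<in> set hs" using hs_ne by (cases hs) auto
  have a: "Ma M b \<in> arrs" using b by (simp add: arrs_def)
  have cC: "card ?C = 2 * length hs"
  proof -
    have "card arrs = card (set hs)" unfolding arrs_def
      using a.bij hs_D by (intro card_image) (auto simp: bij_betw_def intro: inj_on_subset)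
    moreover have "card (set hs) = length hs" using distinct_hs distinct_card by blast
    moreover have "card ?C = card arrs + card (set hs)"
      using arr_disj by (intro card_Un_disjoint) (auto simp: arrs_def)
    ultimately show ?thesis by simp
  qed
  have "card (Md M - ?C) = 2 * card ?P"
    using ca_other fin_darts by (intro card_pairs) (auto simp: Ma_mem Ma_neq Ma_Ma)
  moreover have "card (Md M - ?C) = card (Md M) - 2 * length hs"
    using cC arrs_D hs_D fin_darts by (subst card_Diff_subset) (auto intro: finite_subset)
  moreover have "card ?C \<le> card (Md M)" using arrs_D hs_D fin_darts by (intro card_mono) auto
  ultimately have P: "card (Md M) = 2 * card ?P + 2 * length hs" using cC by linarith
  have oa: "orb ca (Ma M b) \<subseteq> arrs" by (rule ca.orb_least[OF a ca_arr])
  have ob: "orb ca b \<subseteq> set hs" by (rule ca.orb_least[OF b ca_dep])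
  have "orb ca d = {d, Ma M d}" if d: "d \<in> Md M - ?C" for d
  proof
    have d1: "ca d = Ma M d" using ca_other d by auto
    have "ca (Ma M d) = Ma M (Ma M d)" using ca_other[of "Ma M d"] ca_other[of d] d Ma_mem by auto
    hence d2: "ca (Ma M d) = d" using d Ma_Ma by auto
    show "orb ca d \<subseteq> {d, Ma M d}" by (rule ca.orb_least) (auto simp: d1 d2)
    show "{d, Ma M d} \<subseteq> orb ca d" using ca.orb_f[of d] ca.orb_refl[of d] d1 by auto
  qed
  hence sub: "?P \<subseteq> orb ca ` Md M" by (auto intro!: image_eqI)
  have sub3: "insert (orb ca (Ma M b)) (insert (orb ca b) ?P) \<subseteq> orb ca ` Md M"
    using sub b hs_D Ma_mem by auto
  have n1: "orb ca b \<notin> ?P" using ob ca.orb_refl[of b] by auto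
  have n2: "orb ca (Ma M b) \<notin> insert (orb ca b) ?P"
    using oa ob ca.orb_refl[of b] ca.orb_refl[of "Ma M b"] arr_disj a by auto
  have "card (insert (orb ca (Ma M b)) (insert (orb ca b) ?P)) = Suc (Suc (card ?P))"
    using n1 n2 fin_darts by simp
  hence "Suc (Suc (card ?P)) \<le> card (orb ca ` Md M)"
    using card_mono[OF _ sub3] fin_darts by simp
  thus ?thesis using P by simp
qed

definition gen :: "('a \<times> 'a) set" where
  "gen = graph_on cs (Md M) \<union> graph_on ca (Md M)"

text \<open>Cutting gives V + k vertices, at least |D|/2 - k + 2 hyperedges and the old F faces, by
  Euler's formula |D| + 4 cycles or more. The genus inequality admits this only with two
  components.\<close>

lemma two_comps: "2 \<le> comps (Md M) gen"
proof -
  have "card (orb cs ` Md M) + card (orb ca ` Md M) + card (orb (cs \<circ> ca) ` Md M)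
    \<le> card (Md M) + 2 * comps (Md M) gen"
    unfolding gen_def by (rule genus_inequality[OF cs_fperm ca_fperm])
  moreover have "orb (cs \<circ> ca) ` Md M = faces M"
    unfolding faces_def cs_ca by (rule image_cong) (auto simp: face_orb)
  ultimately show ?thesis using cs_count ca_count euler by simp
qed

lemma gen_cs: "d \<in> Md M \<Longrightarrow> (d, cs d) \<in> eqcl gen"
  by (rule eqcl_base) (auto simp: gen_def graph_on_def)

lemma gen_ca: "d \<in> Md M \<Longrightarrow> (d, ca d) \<in> eqcl gen"
  by (rule eqcl_base) (auto simp: gen_def graph_on_def)

lemma gen_arrs: assumes "x \<in> arrs" "y \<in> arrs" shows "(x, y) \<in> eqcl gen"
proof -
  have st: "(Ma M (hs ! Suc i), Ma M (hs ! i)) \<in> eqcl gen" if i: "Suc i < length hs" for i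
  proof -
    let ?z = "Ma M (hs ! Suc i)"
    have "Ma M ?z = hs ! Suc i" using Ma_Ma hs_nth_D i by simp
    moreover have "(Ma M (hs ! i), hs ! Suc i) \<in> set ps"
      using i by (auto simp: ps_def in_set_zip nth_rotate1 intro!: exI[of _ i])
    ultimately have "ca ?z = Ma M (hs ! i)" using sw_pair by (simp add: ca_def)
    moreover have "?z \<in> Md M" using i hs_nth_D Ma_mem by auto
    ultimately show ?thesis using gen_ca by metis
  qed
  have "i < length hs \<Longrightarrow> (Ma M (hs ! i), Ma M (hs ! 0)) \<in> eqcl gen" for i
  proof (induction i)
    case (Suc i) thus ?case using st[of i] eqcl_trans by force
  qed (rule eqcl_refl)
  hence all: "z \<in> arrs \<Longrightarrow> (z, Ma M (hs ! 0)) \<in> eqcl gen" for z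
    unfolding arrs_def by (auto simp: in_set_conv_nth)
  show ?thesis by (rule eqcl_trans[OF all[OF assms(1)] eqcl_sym[OF all[OF assms(2)]]])
qed

lemma gen_deps: assumes "x \<in> set hs" "y \<in> set hs" shows "(x, y) \<in> eqcl gen"
proof -
  have st: "(hs ! i, hs ! Suc i) \<in> eqcl gen" if i: "Suc i < length hs" for i
  proof -
    have "(Ma M (hs ! i), hs ! Suc i) \<in> set ps"
      using i by (auto simp: ps_def in_set_zip nth_rotate1 intro!: exI[of _ i])
    hence "ca (hs ! i) = hs ! Suc i" using sw_pair by (simp add: ca_def)
    thus ?thesis using gen_ca hs_nth_D i by (metis Suc_lessD)
  qed
  have "i < length hs \<Longrightarrow> (hs ! 0, hs ! i) \<in> eqcl gen" for i
  proof (induction i)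
    case (Suc i) thus ?case using st[of i] eqcl_trans by force
  qed (rule eqcl_refl)
  hence all: "z \<in> set hs \<Longrightarrow> (hs ! 0, z) \<in> eqcl gen" for z
    by (auto simp: in_set_conv_nth)
  show ?thesis by (rule eqcl_trans[OF eqcl_sym[OF all[OF assms(1)]] all[OF assms(2)]])
qed

text \<open>Left goes with the departures and right with the arrivals: \<open>cs\<close> sends an
  arrival \<open>a\<close> to the corner after the departure \<open>b\<close> at its vertex, so the
  corners clockwise from \<open>b\<close> to \<open>a\<close>, which are on the right, come to lie
  on the cycle of \<open>a\<close>.\<close>

definition lside :: "'a set" where
  "lside = eqcl gen `` {hd hs}"

definition rcl :: "'a set" where
  "rcl = eqcl gen `` {Ma M (hd hs)}"

lemma hs_lside: "set hs \<subseteq> lside"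
  unfolding lside_def using gen_deps hs_ne by auto

lemma arrs_rcl: "arrs \<subseteq> rcl"
  unfolding rcl_def using gen_arrs hs_ne by (auto simp: arrs_def)

lemma cl_step:
  assumes "S = lside \<or> S = rcl" "(x, y) \<in> eqcl gen" shows "x \<in> S \<longleftrightarrow> y \<in> S"
  using assms eqcl_trans[OF _ assms(2)] eqcl_trans[OF _ eqcl_sym[OF assms(2)]]
  unfolding lside_def rcl_def by auto

lemma cl_cs: "S = lside \<or> S = rcl \<Longrightarrow> d \<in> Md M \<Longrightarrow> cs d \<in> S \<longleftrightarrow> d \<in> S"
  using cl_step[OF _ gen_cs] by blast

lemma cl_ca: "S = lside \<or> S = rcl \<Longrightarrow> d \<in> Md M \<Longrightarrow> ca d \<in> S \<longleftrightarrow> d \<in> S"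
  using cl_step[OF _ gen_ca] by blast

text \<open>If both classes were equal, undoing the cut would not lead out of that class, and
  connectedness of the map would make it the only one.\<close>

lemma lside_rcl_disjoint: "lside \<inter> rcl = {}"
proof (rule ccontr)
  assume ne: "lside \<inter> rcl \<noteq> {}"
  have hD: "hd hs \<in> Md M" using hs_D hs_ne by auto
  have eq: "lside = rcl"
    using ne eqcl_class_eq[of gen] unfolding lside_def rcl_def by blast
  have sub: "Md M \<subseteq> lside"
  proof (rule conn_set)
    show "hd hs \<in> Md M" "hd hs \<in> lside" using hD hs_lside hs_ne by auto
    fix y assume y: "y \<in> Md M" "y \<in> lside"
    have C: "arrs \<union> set hs \<subseteq> lside" using eq hs_lside arrs_rcl by auto
    show "Ma M y \<in> lside"
    proof (cases "y \<in> arrs \<union> set hs")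
      case True
      hence "Ma M y \<in> arrs \<union> set hs" unfolding arrs_def using Ma_Ma hs_D by auto
      thus ?thesis using C by auto
    next
      case False
      hence "ca y = Ma M y" using ca_other y by auto
      thus ?thesis using cl_ca[of lside y] y by simp
    qed
    show "Ms M y \<in> lside"
    proof -
      have "sw y \<in> lside"
        using C sw_arr(2)[of y] sw_dep(2)[of y] sw_other[of y] y by (cases "y \<in> arrs \<union> set hs") auto
      moreover have "sw y \<in> Md M" using fperm.mem[OF sw_fperm] y by auto
      moreover have "cs (sw y) = Ms M y" by (simp add: cs_sw sw_sw)
      ultimately show ?thesis using cl_cs[of lside "sw y"] by simp
    qed
  qed
  have "eqcl gen `` {x} = lside" if "x \<in> Md M" for x
    using that sub eqcl_class_eq[of gen "hd hs" x] unfolding lside_def by blast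
  hence "(\<lambda>x. eqcl gen `` {x}) ` Md M \<subseteq> {lside}" by auto
  hence "comps (Md M) gen \<le> card {lside}" unfolding comps_def by (intro card_mono) auto
  thus False using two_comps by simp
qed

lemma between_rcl:
  assumes i: "i < length hs" and x: "x \<in> between M (hs ! ((i + 1) mod length hs)) (Ma M (hs ! i))"
  shows "x \<in> rcl"
proof -
  define b where "b = hs ! ((i + 1) mod length hs)"
  define a where "a = Ma M (hs ! i)"
  have ab: "(a, b) \<in> set ps"
    using i by (auto simp: a_def b_def ps_def in_set_zip nth_rotate1 intro!: exI[of _ i])
  have aA: "a \<in> arrs" and bB: "b \<in> set hs" using ab fst_ps snd_ps by force+
  have bv: "b \<in> vert M a" using ps_vert ab by auto
  hence "a \<in> vert M b" using vert_sym arrs_D aA by blast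
  then obtain m where m: "a = (Ms M ^^ m) b" by (auto simp: vert_orb orb_def)
  have "a \<noteq> b" using aA bB arr_disj by auto
  hence "m > 0" using m by (cases m) auto
  hence ex: "\<exists>n. 0 < n \<and> (Ms M ^^ n) b = a" using m by auto
  define L where "L = (LEAST n. 0 < n \<and> (Ms M ^^ n) b = a)"
  have L: "0 < L \<and> (Ms M ^^ L) b = a" unfolding L_def by (rule LeastI_ex[OF ex])
  have lt: "0 < j \<Longrightarrow> j < L \<Longrightarrow> (Ms M ^^ j) b \<noteq> a" for j unfolding L_def using not_less_Least by blast
  have bD: "b \<in> Md M" using bB hs_D by auto
  have nb: "(Ms M ^^ j) b \<noteq> b" if "0 < j" "j < L" for j
  proof
    assume e: "(Ms M ^^ j) b = b"
    have "(Ms M ^^ L) b = (Ms M ^^ (L - j)) ((Ms M ^^ j) b)"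
      using that by (metis funpow_add le_add_diff_inverse2 less_imp_le o_apply)
    thus False using e L lt[of "L - j"] that by simp
  qed
  \<comment> \<open>The vertices of a circuit are distinct, so \<open>a\<close> and \<open>b\<close>
    are its only half-edges here and \<open>cs\<close> agrees with \<open>Ms\<close> strictly
    between them.\<close>
  have nC: "(Ms M ^^ j) b \<notin> arrs \<union> set hs" if j: "0 < j" "j < L" for j
  proof
    let ?z = "(Ms M ^^ j) b"
    assume z: "?z \<in> arrs \<union> set hs"
    have zv: "?z \<in> vert M b" using s.orb_pow by (simp add: vert_orb)
    define c where "c = (if ?z \<in> set hs then ?z else sw ?z)"
    have cB: "c \<in> set hs" using z sw_arr by (auto simp: c_def)
    have vz: "vert M ?z = vert M b" using vert_eq bD zv by simp
    have "c \<in> vert M ?z" using z ps_vert[OF sw_arr(1)[of ?z]] vert_refl by (auto simp: c_def)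
    hence "vert M c = vert M b" using vert_eq[of ?z c] s.pow_mem[OF bD] vz by simp
    hence cb: "c = b" using cB bB distinct_vert by (auto simp: distinct_map inj_on_def)
    have "?z = b \<or> ?z = sw b" using cb sw_sw[of ?z] by (auto simp: c_def split: if_splits)
    moreover have "sw b = a" using sw_pair ab by auto
    ultimately show False using nb lt j by metis
  qed
  have "0 < j \<Longrightarrow> j \<le> L \<Longrightarrow> (Ms M ^^ j) b \<in> rcl" for j
  proof (induction j)
    case (Suc j)
    show ?case
    proof (cases "j = 0")
      case True
      have "cs a = Ms M b" using sw_pair ab cs_sw by auto
      moreover have "a \<in> rcl" using aA arrs_rcl by auto
      ultimately show ?thesis using True cl_cs[of rcl a] aA arrs_D by auto
    next
      case False
      let ?z = "(Ms M ^^ j) b"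
      have "?z \<in> rcl" using Suc False by simp
      moreover have "cs ?z = Ms M ?z" using nC[of j] sw_other[of ?z] False Suc by (simp add: cs_sw)
      ultimately show ?thesis using cl_cs[of rcl ?z] s.pow_mem[OF bD, of j] by simp
    qed
  qed simp
  thus ?thesis using x unfolding between_def a_def[symmetric] b_def[symmetric] L_def[symmetric] by auto
qed

lemma rside_rcl: "x \<in> rside M hs \<Longrightarrow> x \<in> Md M \<and> x \<in> rcl"
proof (induction rule: rside.induct)
  case (base i x)
  have "(i + 1) mod length hs < length hs" using hs_ne by simp
  hence "hs ! ((i + 1) mod length hs) \<in> Md M" by (rule hs_nth_D)
  hence "x \<in> Md M" using base(2) s.pow_mem unfolding between_def by blast
  thus ?case using between_rcl base by blast
next
  case (fstep x)
  have "cs (ca x) \<in> rcl" using cl_cs[of rcl "ca x"] cl_ca[of rcl x] fperm.mem[OF ca_fperm, of x] fstep by simp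
  thus ?case using fun_cong[OF cs_ca, of x] fstep p.mem by simp
next
  case (cross x)
  have "x \<notin> arrs" "x \<notin> set hs" using cross(3) by (auto simp: cyc_edge_def arrs_def)
  hence "ca x = Ma M x" using ca_other cross by auto
  thus ?case using cl_ca[of rcl x] cross Ma_mem by simp
qed

text \<open>The turn back to the origin of the sector stays on the left: it cannot run over a
  departure, whose partner under \<open>sw\<close> belongs to the right, and an arrival, being
  ingoing, stops it.\<close>

lemma lside_pred:
  assumes "insec (Ms M) (ings M) h x" "x \<in> lside" "h \<in> ings M"
  shows "h \<in> arrs \<or> (h \<in> lside \<and> h \<notin> set hs \<and> h \<notin> arrs)"
proof -
  have hD: "h \<in> Md M" using assms ings_D by auto
  have st: "z \<in> arrs \<or> (z \<in> lside \<and> z \<notin> set hs \<and> z \<notin> arrs)" if z: "z \<in> Md M" "Ms M z \<in> lside" for z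
  proof (rule ccontr)
    assume c: "\<not> ?thesis"
    have e: "cs (sw z) = Ms M z" by (simp add: cs_sw sw_sw)
    have "sw z \<in> Md M" using fperm.mem[OF sw_fperm] z by auto
    hence swl: "sw z \<in> lside" using cl_cs[of lside "sw z"] z e by simp
    show False
    proof (cases "z \<in> set hs")
      case True
      hence "sw z \<in> rcl" using sw_dep arrs_rcl by auto
      thus False using swl lside_rcl_disjoint by auto
    next
      case False
      thus False using c sw_other swl by auto
    qed
  qed
  show ?thesis using assms(1,2)
  proof (induction rule: insec.induct)
    case start thus ?case using st hD by blast
  next
    case (walk x)
    have xD: "x \<in> Md M" using s.insec_mem walk hD by blast
    have "x \<notin> arrs" using walk(2) hs_ing unfolding arrs_def by blast
    thus ?case using st[OF xD] walk by blast
  qed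
qed

text \<open>A backward path starting at an arrival of the circuit only meets arrivals of the circuit
  and half-edges on the left, while all root corners are on the right.\<close>

lemma ccw_not_good:
  assumes ccw: "Mr M \<in> rside M hs" and g: "\<And>h. h \<in> ings M \<Longrightarrow> good M h"
  shows False
proof -
  have rt: "r \<notin> lside" if "r \<in> rootface M" for r
  proof -
    have "r \<in> rside M hs" using that unfolding rootface_orb
      by (induction rule: p.orb_induct) (auto intro: ccw rside.fstep)
    thus ?thesis using rside_rcl lside_rcl_disjoint by auto
  qed
  have "good M h \<Longrightarrow> h \<in> arrs \<or> (h \<in> lside \<and> h \<notin> set hs \<and> h \<notin> arrs) \<Longrightarrow> False" for h
  proof (induction rule: good.induct)
    case (root h)
    have "Ma M h \<in> lside"
    proof (cases "h \<in> arrs")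
      case True
      hence "Ma M h \<in> set hs" unfolding arrs_def using Ma_Ma hs_D by auto
      thus ?thesis using hs_lside by auto
    next
      case False
      hence "ca h = Ma M h" using ca_other root ings_D by auto
      thus ?thesis using cl_ca[of lside h] ings_D[OF root(1)] root False by simp
    qed
    thus False using rt root by auto
  next
    case (step h h')
    have "Ma M h' \<in> lside"
    proof (cases "h' \<in> arrs")
      case True
      hence "Ma M h' \<in> set hs" unfolding arrs_def using Ma_Ma hs_D by auto
      thus ?thesis using hs_lside by auto
    next
      case False
      hence "ca h' = Ma M h'" using ca_other step ings_D by auto
      thus ?thesis using cl_ca[of lside h'] ings_D[OF step(4)] step False by simp
    qed
    hence "h \<in> arrs \<or> (h \<in> lside \<and> h \<notin> set hs \<and> h \<notin> arrs)" using lside_pred step by blast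
    thus False using step by blast
  qed
  moreover have "Ma M (hd hs) \<in> arrs" "Ma M (hd hs) \<in> ings M" using hs_ne hs_ing by (auto simp: arrs_def)
  ultimately show False using g by blast
qed

end

theorem inB_iff_gmap: "inB M \<longleftrightarrow> gmap M"
proof
  assume B: "inB M"
  interpret omap M by (rule inB_omap[OF B])
  show "gmap M" unfolding gmap_def
    using B inB_good[OF B] outer vin by (auto simp: inB_def)
next
  assume G: "gmap M"
  interpret rmap M using G by (simp add: gmap_def is_map_rmap)
  interpret omap M by unfold_locales (use G in \<open>auto simp: gmap_def\<close>)
  have g: "h \<in> ings M \<Longrightarrow> good M h" for h using G by (auto simp: gmap_def)
  have "minimal M"
    unfolding minimal_def
  proof
    assume "\<exists>hs. ccw_circuit M hs"
    then obtain hs where hs: "circuit M hs" "Mr M \<in> rside M hs" by (auto simp: ccw_circuit_def)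
    interpret circ M hs by unfold_locales (rule hs)
    show False by (rule ccw_not_good[OF hs(2) g])
  qed
  moreover have "(ing M d \<and> ing M (Ma M d)) \<or> (ing M d \<and> \<not> ing M (Ma M d) \<and> d \<notin> rootface M)
      \<or> (ing M (Ma M d) \<and> \<not> ing M d \<and> Ma M d \<notin> rootface M)" if d: "d \<in> Md M" "outer_dart M d" for d
    using outer[of d] outer[of "Ma M d"] Ma_Ma[OF d(1)] d(2) by (auto simp: outer_dart_def)
  ultimately have "cw_minimal M" by (simp add: cw_minimal_def)
  moreover have "accessible M"
    unfolding accessible_def
  proof
    fix d assume d: "d \<in> Md M"
    have srt: "{(x, Ms M x) |x. x \<in> Md M}\<^sup>* \<subseteq> (acc_step M)\<^sup>*"
      by (rule rtrancl_mono) (auto simp: acc_step_def)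
    have so: "(x, y) \<in> (acc_step M)\<^sup>*" if "x \<in> Md M" "y \<in> orb (Ms M) x" for x y
      using s.orb_rtrancl[OF that(2,1)] srt by auto
    \<comment> \<open>Read forwards, the backward path of \<open>h\<close> is a directed path from
      an outer vertex to the vertex of \<open>h\<close>.\<close>
    have ex: "good M h \<Longrightarrow> \<exists>s\<in>Md M. vert M s \<inter> rootface M \<noteq> {} \<and> (s, h) \<in> (acc_step M)\<^sup>*" for h
    proof (induction rule: good.induct)
      case (root h)
      have hD: "h \<in> Md M" using root ings_D by auto
      have "Ms M h \<in> rootface M" using root_step[OF root(2)] phi_Ma[OF hD] by simp
      moreover have "Ms M h \<in> vert M h" using s.orb_f by (simp add: vert_orb)
      ultimately show ?case using hD by auto
    next
      case (step h h')
      then obtain s where s: "s \<in> Md M" "vert M s \<inter> rootface M \<noteq> {}" "(s, h) \<in> (acc_step M)\<^sup>*" by blast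
      have h'D: "h' \<in> Md M" and hD: "h \<in> Md M" using step ings_D by auto
      have "(h, Ma M h') \<in> (acc_step M)\<^sup>*" using so[OF hD s.insec_orb[OF step(3)]] .
      moreover have "(Ma M h', h') \<in> acc_step M"
        using Ma_Ma[OF h'D] Ma_mem[OF h'D] step(4) by (auto simp: acc_step_def ings_def)
      ultimately show ?case using s by (meson rtrancl.rtrancl_into_rtrancl rtrancl_trans)
    qed
    obtain h where h: "h \<in> vert M d" "h \<in> ings M" using vin[OF d] by auto
    have "d \<in> orb (Ms M) h" using s.orb_sym[OF d] h by (simp add: vert_orb)
    hence "(h, d) \<in> (acc_step M)\<^sup>*" using so ings_D h by blast
    thus "\<exists>s\<in>Md M. vert M s \<inter> rootface M \<noteq> {} \<and> (s, d) \<in> (acc_step M)\<^sup>*"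
      using ex[OF g[OF h(2)]] by (meson rtrancl_trans)
  qed
  ultimately show "inB M" using G by (simp add: inB_def gmap_def)
qed

section \<open>Mobiles\<close>

locale premob =
  fixes T :: "'a mobile"
  assumes finT: "finite (Td T)" and bud_sub: "Tbud T \<subseteq> Td T"
    and Ta_props: "x \<in> Td T - Tbud T \<Longrightarrow> Ta T x \<in> Td T - Tbud T \<and> Ta T x \<noteq> x \<and> Ta T (Ta T x) = x"
    and bijT: "bij_betw (Ts T) (Td T) (Td T)"
    and col: "x \<in> Td T \<Longrightarrow> Tblack T (Ts T x) = Tblack T x"
    and bud_black: "x \<in> Tbud T \<Longrightarrow> Tblack T x"
begin

sublocale t: fperm "Ts T" "Td T"
  by unfold_locales (rule finT, rule bijT)

definition sim :: "'a \<Rightarrow> 'a \<Rightarrow> bool" where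
  "sim x y \<longleftrightarrow> (x, y) \<in> (mob_conn T)\<^sup>*"

lemma sim_refl: "sim x x"
  by (simp add: sim_def)

lemma sim_trans: "sim x y \<Longrightarrow> sim y z \<Longrightarrow> sim x z"
  unfolding sim_def by (rule rtrancl_trans)

lemma sim_Ta: "x \<in> Td T \<Longrightarrow> x \<notin> Tbud T \<Longrightarrow> sim x (Ta T x)"
  unfolding sim_def mob_conn_def by (rule r_into_rtrancl) auto

lemma sim_orb: assumes "x \<in> Td T" "y \<in> orb (Ts T) x" shows "sim x y"
proof -
  have "{(x, Ts T x) |x. x \<in> Td T}\<^sup>* \<subseteq> (mob_conn T)\<^sup>*"
    by (rule rtrancl_mono) (auto simp: mob_conn_def)
  thus ?thesis using t.orb_rtrancl[OF assms(2,1)] by (auto simp: sim_def)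
qed

lemma sim_Ts: "x \<in> Td T \<Longrightarrow> sim x (Ts T x)"
  by (rule sim_orb[OF _ t.orb_f])

lemma sim_sym: assumes "sim x y" shows "sim y x"
  using assms unfolding sim_def
proof (induction rule: rtrancl_induct)
  case (step y z)
  have "sim z y"
    using step(2) unfolding mob_conn_def
  proof
    assume "(y, z) \<in> {(x, Ta T x) |x. x \<in> Td T - Tbud T}"
    hence "z = Ta T y" "y \<in> Td T - Tbud T" by auto
    thus ?thesis using Ta_props[of y] sim_Ta[of z] by auto
  next
    assume "(y, z) \<in> {(x, Ts T x) |x. x \<in> Td T}"
    hence "z = Ts T y" "y \<in> Td T" by auto
    thus ?thesis using sim_orb[of z y] t.mem[of y] t.orb_sym[OF _ t.orb_f, of y] by auto
  qed
  thus ?case using step(3) unfolding sim_def by (rule rtrancl_trans)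
qed simp

text \<open>A black-white edge has one white half-edge and a white-white edge has two. In this form
  the excess is the total of the contour word.\<close>

lemma excess_alt:
  "excess T = int (card {x \<in> Td T. \<not> Tblack T x}) - int (card (Tbud T))"
proof -
  let ?A = "{x \<in> Td T - Tbud T. Tblack T x \<and> \<not> Tblack T (Ta T x)}"
  let ?B = "{x \<in> Td T - Tbud T. \<not> Tblack T x \<and> Tblack T (Ta T x)}"
  let ?C = "{x \<in> Td T - Tbud T. \<not> Tblack T x \<and> \<not> Tblack T (Ta T x)}"
  have "bij_betw (Ta T) ?A ?B"
  proof (rule bij_betw_byWitness[where f' = "Ta T"])
    have a: "x \<in> ?A \<Longrightarrow> Ta T x \<in> ?B \<and> Ta T (Ta T x) = x"
      and b: "x \<in> ?B \<Longrightarrow> Ta T x \<in> ?A \<and> Ta T (Ta T x) = x" for x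
      using Ta_props[of x] by simp_all
    show "\<forall>x\<in>?A. Ta T (Ta T x) = x" "\<forall>x\<in>?B. Ta T (Ta T x) = x" using a b by blast+
    show "Ta T ` ?A \<subseteq> ?B" "Ta T ` ?B \<subseteq> ?A" using a b by blast+
  qed
  hence "card ?A = card ?B" by (rule bij_betw_same_card)
  moreover have "{x \<in> Td T. \<not> Tblack T x} = ?B \<union> ?C" using bud_black by auto
  moreover have "card (?B \<union> ?C) = card ?B + card ?C" using finT by (intro card_Un_disjoint) auto
  ultimately show ?thesis unfolding excess_def by simp
qed

lemma mvert_col: assumes "x \<in> Td T" "y \<in> mvert T x" shows "Tblack T y = Tblack T x"
  using assms(2) unfolding mvert_def
proof (induction rule: t.orb_induct)
  case (step y)
  have "y \<in> Td T" using step t.orb_sub[OF assms(1)] by auto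
  thus ?case using col step by simp
qed simp

lemma card_mverts: "card (mverts T) = card (white_verts T) + card (black_verts T)"
proof -
  have "mverts T = white_verts T \<union> black_verts T"
    unfolding mverts_def white_verts_def black_verts_def by auto
  moreover have "white_verts T \<inter> black_verts T = {}"
  proof (rule ccontr)
    assume "white_verts T \<inter> black_verts T \<noteq> {}"
    then obtain x y where xy: "x \<in> Td T" "y \<in> Td T" "\<not> Tblack T x" "Tblack T y" "mvert T x = mvert T y"
      unfolding white_verts_def black_verts_def by auto
    have "x \<in> mvert T y" using xy(5) t.orb_refl[of x] by (simp add: mvert_def)
    thus False using mvert_col[of y x] xy by simp
  qed
  moreover have "finite (white_verts T)" "finite (black_verts T)"
    using finT unfolding white_verts_def black_verts_def by auto
  ultimately show ?thesis by (simp add: card_Un_disjoint)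
qed

end

locale nmob = premob +
  assumes connT: "x \<in> Td T \<Longrightarrow> y \<in> Td T \<Longrightarrow> sim x y"
    and tree: "2 * card (mverts T) = card (Td T - Tbud T) + 2"
    and wt: "x \<in> Td T - Tbud T \<Longrightarrow> (Tblack T x \<longrightarrow> Tw T x = 0) \<and> (\<not> Tblack T x \<longrightarrow> 0 < Tw T x)"

lemma is_N_mobile_nmob: "is_N_mobile T \<longleftrightarrow> nmob T"
proof
  assume N: "is_N_mobile T"
  interpret premob T using N unfolding is_N_mobile_def by unfold_locales auto
  show "nmob T" using N unfolding is_N_mobile_def by unfold_locales (auto simp: sim_def)
next
  assume "nmob T"
  then interpret nmob T .
  show "is_N_mobile T" unfolding is_N_mobile_def
    using finT bud_sub Ta_props bijT col bud_black connT tree wt unfolding sim_def by auto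
qed

section \<open>The mobile of a biorientation\<close>

lemma transform_sel [simp]:
  "(d, Wh) \<in> Td (transform M k) \<longleftrightarrow> d \<in> ings M \<and> k d"
  "(d, Bl) \<in> Td (transform M k) \<longleftrightarrow> d \<in> Md M \<and> d \<notin> rootface M"
  "(d, Wh) \<notin> Tbud (transform M k)"
  "(d, Bl) \<in> Tbud (transform M k) \<longleftrightarrow> d \<in> Md M \<and> d \<notin> rootface M \<and> ing M (Ma M d)"
  "Ta (transform M k) (d, Wh) = (if ing M (Ma M d) then (Ma M d, Wh) else (d, Bl))"
  "Ta (transform M k) (d, Bl) = (if ing M d then (d, Wh) else (Ma M d, Bl))"
  "Ts (transform M k) (d, Wh) = (nxt_in M d, Wh)"
  "Ts (transform M k) (d, Bl) = (phi_inv M d, Bl)"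
  "Tblack (transform M k) (d, t) \<longleftrightarrow> t = Bl"
  "Tw (transform M k) (d, Wh) = Mw M d"
  "Tw (transform M k) (d, Bl) = 0"
  by (auto simp: transform_def ings_def)

lemma Td_transform:
  "Td (transform M k) = (\<lambda>d. (d, Wh)) ` {d \<in> ings M. k d} \<union> (\<lambda>d. (d, Bl)) ` (Md M - rootface M)"
  by (auto simp: transform_def ings_def)

lemma Tbud_transform:
  "Tbud (transform M k) = (\<lambda>d. (d, Bl)) ` {d \<in> Md M - rootface M. ing M (Ma M d)}"
  by (auto simp: transform_def)

lemma PhiP_sel [simp]:
  "(d, Wh) \<in> Td (PhiP M) \<longleftrightarrow> d \<in> ings M"
  "(d, Bl) \<in> Td (PhiP M) \<longleftrightarrow> d \<in> Md M \<and> d \<notin> rootface M"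
  "(d, Wh) \<notin> Tbud (PhiP M)"
  "(d, Bl) \<in> Tbud (PhiP M) \<longleftrightarrow> d \<in> Md M \<and> d \<notin> rootface M \<and> ing M (Ma M d)"
  "Ta (PhiP M) (d, Wh) = (if ing M (Ma M d) then (Ma M d, Wh) else (d, Bl))"
  "Ta (PhiP M) (d, Bl) = (if ing M d then (d, Wh) else (Ma M d, Bl))"
  "Ts (PhiP M) (d, Wh) = (nxt_in M d, Wh)"
  "Ts (PhiP M) (d, Bl) = (phi_inv M d, Bl)"
  "Tblack (PhiP M) (d, t) \<longleftrightarrow> t = Bl"
  "Tw (PhiP M) (d, Wh) = Mw M d"
  "Tw (PhiP M) (d, Bl) = 0"
  by (simp_all add: PhiP_def)

lemma Td_PhiP: "Td (PhiP M) = (\<lambda>d. (d, Wh)) ` ings M \<union> (\<lambda>d. (d, Bl)) ` (Md M - rootface M)"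
  by (simp add: PhiP_def Td_transform)

lemma Tbud_PhiP: "Tbud (PhiP M) = (\<lambda>d. (d, Bl)) ` {d \<in> Md M - rootface M. ing M (Ma M d)}"
  by (simp add: PhiP_def Tbud_transform)

context premap
begin

lemma nxt_in_fret: assumes "d \<in> Md M" shows "nxt_in M d = fret (Ms M) (ings M) d"
proof -
  have "(Ms M ^^ k) d \<in> ings M \<longleftrightarrow> ing M ((Ms M ^^ k) d)" for k
    using s.pow_mem[OF assms] by (simp add: ings_def)
  thus ?thesis by (simp add: nxt_in_def fret_def)
qed

sublocale n: fperm "fret (Ms M) (ings M)" "ings M"
  by (rule s.fret_fperm[OF ings_sub])

lemma nxt_in_mem: "h \<in> ings M \<Longrightarrow> nxt_in M h \<in> ings M"
  using n.mem nxt_in_fret ings_D by metis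

lemma orb_nxt_in: assumes "h \<in> ings M" shows "orb (nxt_in M) h = vert M h \<inter> ings M"
proof -
  have "orb (nxt_in M) h = orb (fret (Ms M) (ings M)) h"
    by (rule orb_cong) (use n.orb_sub[OF assms] nxt_in_fret ings_D in blast)
  thus ?thesis using s.fret_orb[OF ings_sub assms] by (simp add: vert_orb)
qed

lemma insec_nxt: "h \<in> ings M \<Longrightarrow> insec (Ms M) (ings M) h (nxt_in M h)"
  using s.fret(2)[of h "ings M"] s.orb_refl[of h] ings_D nxt_in_fret by (metis IntI empty_iff)

lemma ing_ings: "d \<in> Md M \<Longrightarrow> ing M d \<longleftrightarrow> d \<in> ings M"
  by (simp add: ings_def)

lemma root_phi_inv: "d \<in> Md M \<Longrightarrow> d \<notin> rootface M \<Longrightarrow> phi_inv M d \<notin> rootface M"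
  using root_step[of "phi_inv M d"] phi_phi_inv by auto

lemma mvert_W: assumes "h \<in> ings M" shows "mvert (PhiP M) (h, Wh) = (\<lambda>d. (d, Wh)) ` (vert M h \<inter> ings M)"
proof -
  have "orb (Ts (PhiP M)) (h, Wh) = (\<lambda>d. (d, Wh)) ` orb (nxt_in M) h"
    by (rule orb_image) simp
  thus ?thesis using orb_nxt_in assms by (simp add: mvert_def)
qed

lemma mvert_B: assumes "d \<in> Md M" shows "mvert (PhiP M) (d, Bl) = (\<lambda>d. (d, Bl)) ` face M d"
proof -
  have "orb (Ts (PhiP M)) (d, Bl) = (\<lambda>d. (d, Bl)) ` orb (phi_inv M) d"
    by (rule orb_image) simp
  thus ?thesis using orb_phi_inv assms by (simp add: mvert_def)
qed

end

context omap
begin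

lemma ing_root: "r \<in> rootface M \<Longrightarrow> Ma M r \<in> ings M"
  using outer[of r] Ma_mem[of r] root_sub by (auto simp: ings_def)

lemma premob_PhiP: "premob (PhiP M)"
proof
  let ?T = "PhiP M"
  show "finite (Td ?T)" unfolding Td_PhiP using fin_darts ings_sub finite_subset by blast
  show "Tbud ?T \<subseteq> Td ?T" unfolding Td_PhiP Tbud_PhiP by auto
  show "Tblack ?T x" if "x \<in> Tbud ?T" for x using that by (cases x) (auto simp: Tbud_PhiP)
  show "Tblack ?T (Ts ?T x) = Tblack ?T x" if "x \<in> Td ?T" for x
    using that unfolding Td_PhiP by auto
  show "Ta ?T x \<in> Td ?T - Tbud ?T \<and> Ta ?T x \<noteq> x \<and> Ta ?T (Ta ?T x) = x"
    if x: "x \<in> Td ?T - Tbud ?T" for x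
  proof (cases x)
    case (Pair d t)
    show ?thesis
    proof (cases t)
      case Wh
      hence d: "d \<in> ings M" "d \<in> Md M" using x Pair ings_D by auto
      have aa: "Ma M (Ma M d) = d" "Ma M d \<noteq> d" "Ma M d \<in> Md M" using d Ma_Ma Ma_neq Ma_mem by auto
      have "d \<notin> rootface M" if "\<not> ing M (Ma M d)" using that outer by auto
      thus ?thesis using Pair Wh d aa by (auto simp: ing_ings)
    next
      case Bl
      hence d: "d \<in> Md M" "d \<notin> rootface M" "\<not> ing M (Ma M d)" using x Pair by auto
      have aa: "Ma M (Ma M d) = d" "Ma M d \<noteq> d" "Ma M d \<in> Md M" using d Ma_Ma Ma_neq Ma_mem by auto
      have "Ma M d \<notin> rootface M" if "\<not> ing M d" using that outer[of "Ma M d"] aa by auto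
      thus ?thesis using Pair Bl d aa by (auto simp: ing_ings)
    qed
  qed
  have "fperm (Ts ?T) (Td ?T)"
  proof (rule fpermI)
    show "finite (Td ?T)" unfolding Td_PhiP using fin_darts ings_sub finite_subset by blast
    show "Ts ?T x \<in> Td ?T" if "x \<in> Td ?T" for x
      using that nxt_in_mem phi_inv_mem root_phi_inv unfolding Td_PhiP by auto
    show "inj_on (Ts ?T) (Td ?T)"
    proof (rule inj_onI)
      fix x y assume a: "x \<in> Td ?T" "y \<in> Td ?T" "Ts ?T x = Ts ?T y"
      obtain d t e u where xy: "x = (d, t)" "y = (e, u)" by (cases x; cases y)
      have "t = u" using a(3) xy by (cases t; cases u) auto
      show "x = y"
      proof (cases t)
        case Wh
        hence "d \<in> ings M" "e \<in> ings M" "nxt_in M d = nxt_in M e" using a xy \<open>t = u\<close> by auto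
        hence "d = e" using n.inj nxt_in_fret ings_D by metis
        thus ?thesis using xy \<open>t = u\<close> by simp
      next
        case Bl
        hence "d \<in> Md M" "e \<in> Md M" "phi_inv M d = phi_inv M e" using a xy \<open>t = u\<close> by auto
        hence "d = e" using pi.inj by metis
        thus ?thesis using xy \<open>t = u\<close> by simp
      qed
    qed
  qed
  thus "bij_betw (Ts ?T) (Td ?T) (Td ?T)" by (simp add: fperm_def)
qed

sublocale T: premob "PhiP M"
  by (rule premob_PhiP)

lemma card_ings: "card (ings M) = card {d \<in> Md M. ing M (Ma M d)}"
proof (rule bij_betw_same_card[of "Ma M"])
  show "bij_betw (Ma M) (ings M) {d \<in> Md M. ing M (Ma M d)}"
    by (rule bij_betw_byWitness[where f' = "Ma M"]) (auto simp: ings_def Ma_mem Ma_Ma)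
qed

text \<open>Each ingoing half-edge creates a bud in the corner opposite to it, and those in root
  corners vanish with the black vertex of the root face.\<close>

lemma card_buds: "card {d \<in> Md M - rootface M. ing M (Ma M d)} + card (rootface M) = card (ings M)"
proof -
  have "{d \<in> Md M. ing M (Ma M d)} = {d \<in> Md M - rootface M. ing M (Ma M d)} \<union> rootface M"
    using outer root_sub by auto
  thus ?thesis unfolding card_ings using fin_darts root_sub
    by (subst card_Un_disjoint[symmetric]) (auto intro: finite_subset)
qed

lemma excess_PhiP: "excess (PhiP M) = int (card (rootface M))"
proof -
  have "{x \<in> Td (PhiP M). \<not> Tblack (PhiP M) x} = (\<lambda>d. (d, Wh)) ` ings M"
    unfolding Td_PhiP by auto
  hence "card {x \<in> Td (PhiP M). \<not> Tblack (PhiP M) x} = card (ings M)"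
    by (simp add: card_image inj_on_def)
  moreover have "card (Tbud (PhiP M)) = card {d \<in> Md M - rootface M. ing M (Ma M d)}"
    unfolding Tbud_PhiP by (rule card_image) (auto simp: inj_on_def)
  ultimately show ?thesis unfolding T.excess_alt using card_buds by simp
qed

lemma card_root_pos: "0 < card (rootface M)"
proof -
  have "Mr M \<in> rootface M" unfolding rootface_orb by (rule p.orb_refl)
  thus ?thesis using finite_subset[OF root_sub fin_darts] by (auto simp: card_gt_0_iff)
qed

lemma white_verts_PhiP: "white_verts (PhiP M) = (\<lambda>v. (\<lambda>d. (d, Wh)) ` (v \<inter> ings M)) ` verts M"
proof -
  have "{x \<in> Td (PhiP M). \<not> Tblack (PhiP M) x} = (\<lambda>d. (d, Wh)) ` ings M"
    unfolding Td_PhiP by auto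
  hence "white_verts (PhiP M) = (\<lambda>h. mvert (PhiP M) (h, Wh)) ` ings M"
    unfolding white_verts_def by (simp add: image_image)
  also have "\<dots> = (\<lambda>h. (\<lambda>d. (d, Wh)) ` (vert M h \<inter> ings M)) ` ings M"
    by (rule image_cong) (auto simp: mvert_W)
  also have "\<dots> = (\<lambda>v. (\<lambda>d. (d, Wh)) ` (v \<inter> ings M)) ` vert M ` ings M" by (simp add: image_image)
  also have "vert M ` ings M = verts M"
  proof
    show "vert M ` ings M \<subseteq> verts M" unfolding verts_def using ings_sub by auto
    show "verts M \<subseteq> vert M ` ings M"
    proof
      fix v assume "v \<in> verts M"
      then obtain d where d: "d \<in> Md M" "v = vert M d" by (auto simp: verts_def)
      then obtain h where h: "h \<in> vert M d" "h \<in> ings M" using vin by blast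
      have "v = vert M h" using vert_eq[OF d(1) h(1)] d by simp
      thus "v \<in> vert M ` ings M" using h by blast
    qed
  qed
  finally show ?thesis .
qed

lemma verts_inj: "inj_on (\<lambda>v. (\<lambda>d. (d, Wh)) ` (v \<inter> ings M)) (verts M)"
proof (rule inj_onI)
  fix u v assume a: "u \<in> verts M" "v \<in> verts M"
    "(\<lambda>d. (d, Wh)) ` (u \<inter> ings M) = (\<lambda>d. (d, Wh)) ` (v \<inter> ings M)"
  obtain x y where xy: "x \<in> Md M" "y \<in> Md M" "u = vert M x" "v = vert M y" using a by (auto simp: verts_def)
  have "u \<inter> ings M = v \<inter> ings M" using a(3) by (simp add: inj_image_eq_iff inj_def)
  hence "u \<inter> v \<noteq> {}" using vin[of x] xy by auto
  thus "u = v" using s.orb_disj xy by (simp add: vert_orb)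
qed

lemma verts_bij:
  "bij_betw (\<lambda>v. (\<lambda>d. (d, Wh)) ` (v \<inter> ings M)) (verts M) (white_verts (PhiP M))"
  unfolding bij_betw_def using verts_inj white_verts_PhiP by auto

lemma black_verts_PhiP: "black_verts (PhiP M) = (\<lambda>f. (\<lambda>d. (d, Bl)) ` f) ` inner_faces M"
proof -
  have "{x \<in> Td (PhiP M). Tblack (PhiP M) x} = (\<lambda>d. (d, Bl)) ` (Md M - rootface M)"
    unfolding Td_PhiP by auto
  hence "black_verts (PhiP M) = (\<lambda>d. mvert (PhiP M) (d, Bl)) ` (Md M - rootface M)"
    unfolding black_verts_def by (simp add: image_image)
  also have "\<dots> = (\<lambda>d. (\<lambda>d. (d, Bl)) ` face M d) ` (Md M - rootface M)"
    by (rule image_cong) (auto simp: mvert_B)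
  also have "\<dots> = (\<lambda>f. (\<lambda>d. (d, Bl)) ` f) ` face M ` (Md M - rootface M)" by (simp add: image_image)
  also have "face M ` (Md M - rootface M) = inner_faces M"
    unfolding inner_faces_def faces_def using face_root by auto
  finally show ?thesis .
qed

lemma faces_bij: "bij_betw (\<lambda>f. (\<lambda>d. (d, Bl)) ` f) (inner_faces M) (black_verts (PhiP M))"
  unfolding bij_betw_def black_verts_PhiP by (auto simp: inj_on_def inj_image_eq_iff)

lemma vert_weight:
  assumes "v \<in> verts M"
  shows "sum (Tw (PhiP M)) ((\<lambda>d. (d, Wh)) ` (v \<inter> ings M) - Tbud (PhiP M)) = sum (Mw M) v"
proof -
  have vD: "v \<subseteq> Md M" using assms vert_sub by (auto simp: verts_def)
  have "(\<lambda>d. (d, Wh)) ` (v \<inter> ings M) - Tbud (PhiP M) = (\<lambda>d. (d, Wh)) ` (v \<inter> ings M)" by auto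
  hence "sum (Tw (PhiP M)) ((\<lambda>d. (d, Wh)) ` (v \<inter> ings M) - Tbud (PhiP M)) = sum (Mw M) (v \<inter> ings M)"
    by (simp add: sum.reindex inj_on_def)
  also have "\<dots> = sum (Mw M) v"
    using vD fin_darts finite_subset by (intro sum.mono_neutral_left) (auto simp: ings_def ing_def)
  finally show ?thesis .
qed

text \<open>The half-edge of the mobile that inherits the weight of \<open>d\<close>. By the rules
  for 1-way and 0-way edges an outgoing half-edge hands its weight to the black half-edge pointing
  to the opposite corner.\<close>

definition hedge :: "'a \<Rightarrow> 'a \<times> tag" where
  "hedge d = (if ing M d then (d, Wh) else (Ma M d, Bl))"

lemma hedge_Ta: "d \<in> Md M \<Longrightarrow> Ta (PhiP M) (hedge d) = hedge (Ma M d)"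
  by (auto simp: hedge_def Ma_Ma)

lemma hedge_bij: "bij_betw hedge (Md M) (Td (PhiP M) - Tbud (PhiP M))"
  unfolding bij_betw_def
proof
  show "inj_on hedge (Md M)"
    by (rule inj_onI) (auto simp: hedge_def split: if_splits dest: arg_cong[of _ _ "Ma M"] simp: Ma_Ma)
  show "hedge ` Md M = Td (PhiP M) - Tbud (PhiP M)"
  proof (intro equalityI subsetI)
    fix x assume "x \<in> hedge ` Md M"
    then obtain d where d: "d \<in> Md M" "x = hedge d" by auto
    show "x \<in> Td (PhiP M) - Tbud (PhiP M)"
      using d outer[of "Ma M d"] Ma_Ma Ma_mem by (auto simp: hedge_def ings_def)
  next
    fix x assume x: "x \<in> Td (PhiP M) - Tbud (PhiP M)"
    obtain d t where dt: "x = (d, t)" by (cases x)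
    show "x \<in> hedge ` Md M"
    proof (cases t)
      case Wh
      hence "d \<in> Md M" "x = hedge d" using x dt by (auto simp: hedge_def ings_def)
      thus ?thesis by auto
    next
      case Bl
      hence "Ma M d \<in> Md M" "x = hedge (Ma M d)" using x dt Ma_mem Ma_Ma by (auto simp: hedge_def)
      thus ?thesis by auto
    qed
  qed
qed

lemma hedge_weight: "Tw (PhiP M) (hedge d) = Mw M d"
  by (auto simp: hedge_def ing_def)

lemma edges_bij: "bij_betw ((`) hedge) (edges M) (medges (PhiP M))"
proof -
  have "inj_on ((`) hedge) (edges M)"
  proof (rule inj_on_image)
    have "\<Union> (edges M) \<subseteq> Md M" unfolding edges_def using Ma_mem by auto
    thus "inj_on hedge (\<Union> (edges M))" using hedge_bij by (auto simp: bij_betw_def intro: inj_on_subset)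
  qed
  moreover have "(`) hedge ` edges M = medges (PhiP M)"
  proof -
    have "medges (PhiP M) = (\<lambda>x. {x, Ta (PhiP M) x}) ` hedge ` Md M"
      unfolding medges_def using hedge_bij by (simp add: bij_betw_def)
    also have "\<dots> = (\<lambda>d. {hedge d, Ta (PhiP M) (hedge d)}) ` Md M" by (simp add: image_image)
    also have "\<dots> = (\<lambda>d. {hedge d, hedge (Ma M d)}) ` Md M"
      by (rule image_cong) (auto simp: hedge_Ta)
    finally show ?thesis by (simp add: edges_def image_image)
  qed
  ultimately show ?thesis by (simp add: bij_betw_def)
qed

lemma edge_weight: assumes "e \<in> edges M" shows "sum (Tw (PhiP M)) (hedge ` e) = sum (Mw M) e"
proof -
  have "e \<subseteq> Md M" using assms Ma_mem by (auto simp: edges_def)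
  hence "inj_on hedge e" using hedge_bij by (auto simp: bij_betw_def intro: inj_on_subset)
  thus ?thesis by (simp add: sum.reindex hedge_weight)
qed

text \<open>There are V white and F - 1 black vertices and as many edges as in the map, so this is
  Euler's formula.\<close>

lemma tree_count: "2 * card (mverts (PhiP M)) = card (Td (PhiP M) - Tbud (PhiP M)) + 2"
proof -
  have "card (white_verts (PhiP M)) = card (verts M)" using bij_betw_same_card[OF verts_bij] by simp
  moreover have "card (black_verts (PhiP M)) = card (inner_faces M)" using bij_betw_same_card[OF faces_bij] by simp
  moreover have "Suc (card (inner_faces M)) = card (faces M)"
  proof -
    have "rootface M \<in> faces M" unfolding faces_def rootface_def using root_dart by auto
    moreover have "finite (faces M)" unfolding faces_def using fin_darts by auto
    ultimately show ?thesis unfolding inner_faces_def by (metis card_Suc_Diff1)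
  qed
  moreover have "card (Td (PhiP M) - Tbud (PhiP M)) = card (Md M)" using bij_betw_same_card[OF hedge_bij] by simp
  ultimately show ?thesis using T.card_mverts euler by simp
qed

end

section \<open>Connectedness of the mobile\<close>

locale gm = omap +
  assumes all_good: "h \<in> ings M \<Longrightarrow> good M h"
begin

text \<open>\<open>h\<close> is the predecessor of \<open>h'\<close>, and the path does not end at
  \<open>h'\<close>. Induction along this relation proves a claim for \<open>h\<close> from the
  claim for all half-edges whose backward path passes through \<open>h\<close> next.\<close>

definition deeper :: "('a \<times> 'a) set" where
  "deeper = {(h', h). h' \<in> ings M \<and> h \<in> ings M \<and> insec (Ms M) (ings M) h (Ma M h') \<and> Ma M h' \<notin> rootface M}"

lemma wf_deeper: "wf deeper"
proof (rule finite_acyclic_wf)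
  have "finite (ings M \<times> ings M)" using fin_darts ings_sub finite_subset by blast
  moreover have "deeper \<subseteq> ings M \<times> ings M" by (auto simp: deeper_def)
  ultimately show "finite deeper" using finite_subset by blast
  have "(h, h) \<notin> deeper\<^sup>+" if "good M h" for h
    using that
  proof (induction rule: good.induct)
    case (root h)
    show ?case
    proof
      assume "(h, h) \<in> deeper\<^sup>+"
      then obtain k where "(h, k) \<in> deeper" by (meson tranclD)
      thus False using root by (auto simp: deeper_def)
    qed
  next
    case (step h h')
    show ?case
    proof
      assume "(h', h') \<in> deeper\<^sup>+"
      then obtain k where k: "(h', k) \<in> deeper" "(k, h') \<in> deeper\<^sup>*" by (meson tranclD)
      have "k = h" using k(1) step s.insec_unique ings_D unfolding deeper_def by blast
      hence "(h, h) \<in> deeper\<^sup>+" using k by auto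
      thus False using step by simp
    qed
  qed
  moreover have "h \<in> ings M" if "(h, h) \<in> deeper\<^sup>+" for h
    using tranclD[OF that] by (auto simp: deeper_def)
  ultimately show "acyclic deeper" unfolding acyclic_def using all_good by blast
qed

text \<open>Turning past \<open>x\<close> leads from one face to a neighbouring one. Across a 0-way
  edge their black vertices are adjacent. If \<open>x\<close> is the tail of a 1-way edge, the face
  behind it is joined to the white head of the edge, and \<open>out\<close> joins the bud in front
  to the same head.\<close>

lemma black_step:
  assumes x: "x \<in> Md M" "x \<notin> rootface M" "x \<notin> ings M"
    and out: "\<And>h. h \<in> ings M \<Longrightarrow> Ma M h = x \<Longrightarrow> T.sim (x, Bl) (h, Wh)"
  shows "T.sim (x, Bl) (Ms M x, Bl) \<and> Ms M x \<notin> rootface M"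
proof -
  let ?y = "Ma M x"
  have yD: "?y \<in> Md M" and yy: "Ma M ?y = x" using x Ma_mem Ma_Ma by auto
  have nx: "\<not> ing M x" using x ing_ings by auto
  have yR: "?y \<notin> rootface M" using outer[of ?y] yy nx by auto
  have "T.sim (x, Bl) (?y, Bl)"
  proof (cases "?y \<in> ings M")
    case True
    have "T.sim (?y, Wh) (?y, Bl)" using T.sim_Ta[of "(?y, Wh)"] True yy nx by simp
    thus ?thesis using out[OF True yy] T.sim_trans by blast
  next
    case False
    hence "\<not> ing M ?y" using yD ing_ings by auto
    thus ?thesis using T.sim_Ta[of "(x, Bl)"] x nx by simp
  qed
  moreover have sR: "Ms M x \<notin> rootface M" using root_back[OF yD] yR phi_Ma[OF x(1)] by (auto simp: phi_def yy)
  moreover have "T.sim (?y, Bl) (Ms M x, Bl)"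
  proof -
    have "Ts (PhiP M) (Ms M x, Bl) = (?y, Bl)" using phi_inv_phi[OF yD] by (simp add: phi_def yy)
    thus ?thesis using T.sim_sym[OF T.sim_Ts[of "(Ms M x, Bl)"]] sR s.mem x by simp
  qed
  ultimately show ?thesis using T.sim_trans by blast
qed

text \<open>The steps continue up to the ingoing half-edge at the end of the sector, whose own edge
  leads to the white vertex. \<open>out\<close> speaks of the half-edges with predecessor
  \<open>h\<close>, exactly those covered by the induction hypothesis of
  \<open>sim_partner\<close>.\<close>

lemma black_run:
  assumes h: "h \<in> ings M" and x: "insec (Ms M) (ings M) h x" "x \<notin> rootface M"
    and out: "\<And>h' z. h' \<in> ings M \<Longrightarrow> insec (Ms M) (ings M) h z \<Longrightarrow> Ma M h' = z \<Longrightarrow> z \<notin> rootface M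
      \<Longrightarrow> T.sim (z, Bl) (h', Wh)"
  shows "T.sim (x, Bl) (nxt_in M h, Wh)"
proof -
  have hD: "h \<in> Md M" using h ings_D by auto
  have xD: "x \<in> Md M" using s.insec_mem[OF x(1) hD] .
  have "orb (Ms M) x \<inter> ings M \<noteq> {}" using vin[OF xD] by (simp add: vert_orb)
  then obtain k where k: "(Ms M ^^ k) x \<in> ings M" by (auto simp: orb_def)
  have hit: "T.sim (x, Bl) (nxt_in M h, Wh)"
    if x: "insec (Ms M) (ings M) h x" "x \<notin> rootface M" and xI: "x \<in> ings M" for x
  proof -
    have xD: "x \<in> Md M" using ings_D xI by simp
    have e: "x = nxt_in M h"
      using s.insec_end_unique[OF x(1) insec_nxt[OF h] xI nxt_in_mem[OF h]] .
    have "T.sim (x, Bl) (x, Wh)"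
    proof (cases "Ma M x \<in> ings M")
      case True
      have yy: "Ma M (Ma M x) = x" using Ma_Ma xD by simp
      have "T.sim (x, Bl) (Ma M x, Wh)" using out[OF True x(1) yy x(2)] .
      moreover have "T.sim (Ma M x, Wh) (x, Wh)"
        using T.sim_Ta[of "(Ma M x, Wh)"] True yy xI by (simp add: ings_def)
      ultimately show ?thesis using T.sim_trans by blast
    next
      case False
      thus ?thesis using T.sim_Ta[of "(x, Bl)"] xD x(2) xI Ma_mem by (simp add: ings_def)
    qed
    thus ?thesis using e by simp
  qed
  from x k show ?thesis
  proof (induction k arbitrary: x)
    case 0 thus ?case using hit by simp
  next
    case (Suc k x)
    have xD: "x \<in> Md M" using s.insec_mem[OF Suc(2) hD] .
    show ?case
    proof (cases "x \<in> ings M")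
      case True thus ?thesis using hit Suc by blast
    next
      case False
      have st: "T.sim (x, Bl) (Ms M x, Bl) \<and> Ms M x \<notin> rootface M"
        by (rule black_step[OF xD Suc(3) False]) (use out Suc in blast)
      have "T.sim (Ms M x, Bl) (nxt_in M h, Wh)"
      proof (rule Suc.IH)
        show "insec (Ms M) (ings M) h (Ms M x)" by (rule insec.walk[OF Suc(2) False])
        show "Ms M x \<notin> rootface M" using st by simp
        show "(Ms M ^^ k) (Ms M x) \<in> ings M" using Suc(4) by (simp add: funpow_swap1)
      qed
      thus ?thesis using st T.sim_trans by blast
    qed
  qed
qed

text \<open>The bud in the corner of \<open>Ma M h\<close> shares its face with
  \<open>Ms M h\<close>, the first corner of the sector of \<open>h\<close>; running through this
  sector ends at the white vertex of \<open>h\<close>.\<close>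

lemma sim_partner: "h \<in> ings M \<Longrightarrow> Ma M h \<notin> rootface M \<Longrightarrow> T.sim (Ma M h, Bl) (h, Wh)"
proof (induction h rule: wf_induct_rule[OF wf_deeper])
  case (1 h)
  have hD: "h \<in> Md M" using 1 ings_D by auto
  have sR: "Ms M h \<notin> rootface M" using root_back[OF Ma_mem[OF hD]] 1(3) phi_Ma[OF hD] by auto
  have "Ts (PhiP M) (Ms M h, Bl) = (Ma M h, Bl)"
    using phi_inv_phi[OF Ma_mem[OF hD]] phi_Ma[OF hD] by simp
  hence "T.sim (Ma M h, Bl) (Ms M h, Bl)"
    using T.sim_sym[OF T.sim_Ts[of "(Ms M h, Bl)"]] sR s.mem hD by simp
  moreover have "T.sim (Ms M h, Bl) (nxt_in M h, Wh)"
  proof (rule black_run[OF 1(2) insec.start sR])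
    fix h' z assume "h' \<in> ings M" "insec (Ms M) (ings M) h z" "Ma M h' = z" "z \<notin> rootface M"
    thus "T.sim (z, Bl) (h', Wh)" using 1 by (auto simp: deeper_def)
  qed
  moreover have "T.sim (nxt_in M h, Wh) (h, Wh)"
    using T.sim_sym[OF T.sim_Ts[of "(h, Wh)"]] 1(2) by simp
  ultimately show ?case using T.sim_trans by blast
qed

lemma white_white:
  assumes "x \<in> ings M" "y \<in> ings M" "y \<in> vert M x" shows "T.sim (x, Wh) (y, Wh)"
proof (rule T.sim_orb)
  show "(x, Wh) \<in> Td (PhiP M)" using assms by simp
  show "(y, Wh) \<in> orb (Ts (PhiP M)) (x, Wh)" using mvert_W[OF assms(1)] assms by (auto simp: mvert_def)
qed

lemma black_white:
  assumes "d \<in> Md M" "d \<notin> rootface M" "y \<in> ings M" "y \<in> vert M d" shows "T.sim (d, Bl) (y, Wh)"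
proof -
  obtain h where h: "h \<in> ings M" "insec (Ms M) (ings M) h d"
    using s.insec_exists[of d "ings M"] vin[OF assms(1)] assms(1) by (auto simp: vert_orb)
  have n: "nxt_in M h \<in> ings M" "insec (Ms M) (ings M) h (nxt_in M h)" using nxt_in_mem insec_nxt h by auto
  have "T.sim (d, Bl) (nxt_in M h, Wh)"
    by (rule black_run[OF h assms(2)]) (use sim_partner in auto)
  moreover have "vert M d = vert M h" "vert M (nxt_in M h) = vert M h"
    using s.insec_orb h(2) n(2) vert_eq ings_D[OF h(1)] by (auto simp: vert_orb)
  hence "T.sim (nxt_in M h, Wh) (y, Wh)" using white_white n assms by simp
  ultimately show ?thesis using T.sim_trans by blast
qed

text \<open>If one side of an edge is an inner face, its black vertex links the white vertices at
  both ends. If both sides are the root face, \<open>outer\<close> makes the edge 2-way, and it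
  survives as a white-white edge.\<close>

lemma PhiP_conn:
  assumes y0: "y0 \<in> ings M"
  shows "Md M \<subseteq> {d. \<forall>y\<in>ings M. y \<in> vert M d \<longrightarrow> T.sim (y0, Wh) (y, Wh)}"
proof (rule conn_set)
  let ?S = "{d. \<forall>y\<in>ings M. y \<in> vert M d \<longrightarrow> T.sim (y0, Wh) (y, Wh)}"
  show "y0 \<in> Md M" using y0 ings_D by auto
  show "y0 \<in> ?S" using white_white y0 by auto
  fix d assume d: "d \<in> Md M" "d \<in> ?S"
  show "Ms M d \<in> ?S" using d vert_Ms by simp
  have aD: "Ma M d \<in> Md M" and aa: "Ma M (Ma M d) = d" using d Ma_mem Ma_Ma by auto
  have link: "T.sim (y, Wh) (z, Wh)"
    if x: "x \<in> Md M" "x \<notin> rootface M" "y \<in> ings M" "y \<in> vert M x" "z \<in> ings M" "z \<in> vert M (Ma M x)" for x y z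
  proof -
    have pR: "phi M x \<notin> rootface M" using root_back x by auto
    have "Ts (PhiP M) (phi M x, Bl) = (x, Bl)" using phi_inv_phi[OF x(1)] by simp
    hence "T.sim (phi M x, Bl) (x, Bl)" using T.sim_Ts[of "(phi M x, Bl)"] pR p.mem[OF x(1)] by simp
    moreover have "vert M (phi M x) = vert M (Ma M x)"
      using vert_Ms[OF Ma_mem[OF x(1)]] by (simp add: Ms_Ma)
    hence "T.sim (phi M x, Bl) (z, Wh)" using black_white[OF p.mem[OF x(1)] pR] x by simp
    moreover have "T.sim (x, Bl) (y, Wh)" using black_white x by blast
    ultimately show ?thesis using T.sim_sym T.sim_trans by blast
  qed
  show "Ma M d \<in> ?S"
  proof (intro CollectI ballI impI)
    fix z assume z: "z \<in> ings M" "z \<in> vert M (Ma M d)"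
    obtain y where y: "y \<in> vert M d" "y \<in> ings M" using vin[OF d(1)] by auto
    have "T.sim (y, Wh) (z, Wh)"
    proof (cases "d \<in> rootface M")
      case False thus ?thesis using link[OF d(1)] y z by blast
    next
      case dR: True
      show ?thesis
      proof (cases "Ma M d \<in> rootface M")
        case False thus ?thesis using link[OF aD, of z y] y z aa T.sim_sym by simp
      next
        case True
        have I: "d \<in> ings M" "Ma M d \<in> ings M" using ing_root[OF dR] ing_root[OF True] aa by auto
        have "T.sim (d, Wh) (Ma M d, Wh)" using T.sim_Ta[of "(d, Wh)"] I by (simp add: ings_def)
        moreover have "T.sim (y, Wh) (d, Wh)" using white_white[OF I(1) y(2)] y T.sim_sym by auto
        moreover have "T.sim (Ma M d, Wh) (z, Wh)" using white_white[OF I(2)] z by auto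
        ultimately show ?thesis using T.sim_trans by blast
      qed
    qed
    thus "T.sim (y0, Wh) (z, Wh)" using d y T.sim_trans by blast
  qed
qed

lemma nmob_PhiP: "nmob (PhiP M)"
proof
  obtain y0 where y0: "y0 \<in> ings M" using vin[OF root_dart] by auto
  have all: "T.sim (y0, Wh) x" if x: "x \<in> Td (PhiP M)" for x
  proof -
    obtain d t where dt: "x = (d, t)" by (cases x)
    have dD: "d \<in> Md M" using x dt by (cases t) (auto simp: ings_def)
    show ?thesis
    proof (cases t)
      case Wh thus ?thesis using PhiP_conn[OF y0] x dt dD vert_refl[of d] by auto
    next
      case Bl
      obtain y where y: "y \<in> vert M d" "y \<in> ings M" using vin[OF dD] by auto
      have "T.sim (y0, Wh) (y, Wh)" using PhiP_conn[OF y0] y dD by auto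
      moreover have "T.sim (d, Bl) (y, Wh)" using black_white[OF dD] y x dt Bl by simp
      ultimately show ?thesis using dt Bl T.sim_sym T.sim_trans by blast
    qed
  qed
  show "T.sim x y" if "x \<in> Td (PhiP M)" "y \<in> Td (PhiP M)" for x y
    using all[OF that(1)] all[OF that(2)] T.sim_sym T.sim_trans by blast
  show "2 * card (mverts (PhiP M)) = card (Td (PhiP M) - Tbud (PhiP M)) + 2" by (rule tree_count)
  show "(Tblack (PhiP M) x \<longrightarrow> Tw (PhiP M) x = 0) \<and> (\<not> Tblack (PhiP M) x \<longrightarrow> 0 < Tw (PhiP M) x)"
    if "x \<in> Td (PhiP M) - Tbud (PhiP M)" for x
    using that unfolding Td_PhiP by (auto simp: ings_def ing_def)
qed

end

lemma gmap_gm: "gmap M \<Longrightarrow> gm M"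
  unfolding gmap_def gm_def gm_axioms_def omap_def omap_axioms_def is_map_rmap by auto

section \<open>The mobile determines the matching\<close>

text \<open>Satisfied by the empty set and by the arrivals of the outer edges of an admissible
  biorientation, so one rigidity argument serves both mappings. The last clause says that the tails
  of these edges are vertices of the same kind.\<close>

definition leafset :: "'a bmap \<Rightarrow> 'a set \<Rightarrow> bool" where
  "leafset M L \<longleftrightarrow> L \<subseteq> ings M \<and> (\<forall>x\<in>L. Ma M x \<in> rootface M \<and> \<not> ing M (Ma M x)
     \<and> vert M x \<inter> ings M = {x} \<and> vert M (Ma M x) \<inter> ings M \<subseteq> L)"

text \<open>An isomorphism between the mobiles of two maps after the white leaves at L1 and L2 have been
  replaced by buds; psiW and psiB are its components on white and on black half-edges.\<close>
locale piso = A: gm M1 + B: gm M2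
  for M1 :: "'a bmap" and M2 :: "'b bmap" +
  fixes psiW psiB :: "'a \<Rightarrow> 'b" and L1 :: "'a set" and L2 :: "'b set"
  assumes leaf1: "leafset M1 L1" and leaf2: "leafset M2 L2"
    and bW: "bij_betw psiW (ings M1 - L1) (ings M2 - L2)"
    and bB: "bij_betw psiB (Md M1 - rootface M1) (Md M2 - rootface M2)"
    and nW: "h \<in> ings M1 - L1 \<Longrightarrow> psiW (nxt_in M1 h) = nxt_in M2 (psiW h)"
    and nB: "d \<in> Md M1 - rootface M1 \<Longrightarrow> psiB (phi_inv M1 d) = phi_inv M2 (psiB d)"
    and bud: "d \<in> Md M1 - rootface M1 \<Longrightarrow>
      ing M1 (Ma M1 d) \<or> d \<in> L1 \<longleftrightarrow> ing M2 (Ma M2 (psiB d)) \<or> psiB d \<in> L2"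
    and aW2: "h \<in> ings M1 - L1 \<Longrightarrow> ing M1 (Ma M1 h) \<Longrightarrow>
      ing M2 (Ma M2 (psiW h)) \<and> psiW (Ma M1 h) = Ma M2 (psiW h)"
    and aW1: "h \<in> ings M1 - L1 \<Longrightarrow> \<not> ing M1 (Ma M1 h) \<Longrightarrow>
      \<not> ing M2 (Ma M2 (psiW h)) \<and> psiB h = psiW h"
    and aB: "d \<in> Md M1 - rootface M1 \<Longrightarrow> \<not> ing M1 d \<Longrightarrow> \<not> ing M1 (Ma M1 d) \<Longrightarrow>
      \<not> ing M2 (psiB d) \<and> psiB (Ma M1 d) = Ma M2 (psiB d)"
    and wtW: "h \<in> ings M1 - L1 \<Longrightarrow> Mw M2 (psiW h) = Mw M1 h"
begin

lemma psiW_mem: "h \<in> ings M1 - L1 \<Longrightarrow> psiW h \<in> ings M2 - L2"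
  using bW by (auto simp: bij_betw_def)

lemma psiB_mem: "d \<in> Md M1 - rootface M1 \<Longrightarrow> psiB d \<in> Md M2 - rootface M2"
  using bB by (auto simp: bij_betw_def)

lemma psiB_phi:
  assumes "d \<in> Md M1 - rootface M1" shows "phi M1 d \<in> Md M1 - rootface M1" "psiB (phi M1 d) = phi M2 (psiB d)"
proof -
  show p: "phi M1 d \<in> Md M1 - rootface M1" using assms A.p.mem A.root_back by blast
  have "psiB d = phi_inv M2 (psiB (phi M1 d))"
    using nB[OF p] A.phi_inv_phi[of d] assms by simp
  thus "psiB (phi M1 d) = phi M2 (psiB d)" using B.phi_phi_inv[of "psiB (phi M1 d)"] psiB_mem[OF p] by simp
qed

lemma nonroot_notL: "h \<in> ings M1 \<Longrightarrow> Ma M1 h \<notin> rootface M1 \<Longrightarrow> h \<notin> L1"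
  using leaf1 by (auto simp: leafset_def)

text \<open>The sector of \<open>h\<close> is transported corner by corner, the half-edges whose
  tails lie in it being matched correctly by induction. The image starts behind \<open>g\<close> and
  ends at the image of \<open>nxt_in M1 h\<close>. Since a sector is determined by its end,
  \<open>g\<close> is the image of \<open>h\<close> as soon as it is known to be ingoing.\<close>

lemma psi_partner:
  "h \<in> ings M1 \<Longrightarrow> Ma M1 h \<notin> rootface M1 \<Longrightarrow> Ma M2 (psiB (Ma M1 h)) = psiW h"
proof (induction h rule: wf_induct_rule[OF A.wf_deeper])
  case (1 h)
  have hD: "h \<in> Md M1" using 1 A.ings_D by auto
  have hL: "h \<in> ings M1 - L1" using 1 nonroot_notL by auto
  define b where "b = Ma M1 h"
  have bD: "b \<in> Md M1 - rootface M1" using 1 A.Ma_mem hD by (auto simp: b_def)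
  have ab: "Ma M1 b = h" using A.Ma_Ma hD by (simp add: b_def)
  define g where "g = Ma M2 (psiB b)"
  have b2: "psiB b \<in> Md M2 - rootface M2" using psiB_mem bD .
  have gD: "g \<in> Md M2" and ag: "Ma M2 g = psiB b" using b2 B.Ma_mem B.Ma_Ma by (auto simp: g_def)
  have IH: "Ma M2 (psiB x) = psiW h'" if "insec (Ms M1) (ings M1) h x" "h' \<in> ings M1" "Ma M1 h' = x" "x \<notin> rootface M1" for x h'
    using 1(1)[of h'] that 1(2) by (auto simp: A.deeper_def)
  have nr: "x \<in> Md M1 - rootface M1" if x: "insec (Ms M1) (ings M1) h x" for x
    using A.root_sector(2)[OF x _ 1(2)] 1(3) A.s.insec_mem[OF x hD] by blast
  have sec: "insec (Ms M1) (ings M1) h x \<Longrightarrow> insec (Ms M2) (ings M2) g (psiB x)" for x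
  proof (induction rule: insec.induct)
    case start
    have "psiB (Ms M1 h) = Ms M2 g"
      using psiB_phi(2)[OF bD] A.phi_Ma[OF hD] B.phi_Ma[OF gD] by (simp add: b_def[symmetric] ag)
    thus ?case using insec.start[of "Ms M2"] by metis
  next
    case (walk x)
    have x: "x \<in> Md M1 - rootface M1" using nr walk by blast
    have nx: "\<not> ing M1 x" using walk(2) x A.ing_ings by auto
    define y where "y = Ma M1 x"
    have yD: "y \<in> Md M1" and ay: "Ma M1 y = x" using x A.Ma_mem A.Ma_Ma by (auto simp: y_def)
    have yR: "y \<in> Md M1 - rootface M1" using A.outer[of y] ay nx yD by auto
    have sy: "Ms M1 x = phi M1 y" using A.phi_Ma x by (simp add: y_def)
    have px: "psiB x \<in> Md M2" using psiB_mem x by auto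
    have "\<not> ing M2 (psiB x) \<and> psiB y = Ma M2 (psiB x)"
    proof (cases "y \<in> ings M1")
      case True
      hence yL: "y \<in> ings M1 - L1" using nonroot_notL ay x by auto
      have e: "Ma M2 (psiB x) = psiW y" using IH walk True ay x by blast
      have "\<not> ing M2 (Ma M2 (psiW y)) \<and> psiB y = psiW y" using aW1[OF yL] ay nx by auto
      thus ?thesis using e B.Ma_Ma[OF px] by metis
    next
      case False
      hence "\<not> ing M1 (Ma M1 x)" using yD A.ing_ings by (auto simp: y_def)
      thus ?thesis using aB[OF x nx] by (simp add: y_def)
    qed
    hence "psiB x \<notin> ings M2" "psiB (Ms M1 x) = Ms M2 (psiB x)"
      using psiB_phi(2)[OF yR] sy B.phi_Ma[OF px] by (auto simp: ings_def)
    thus ?case using insec.walk[OF walk.IH] by metis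
  qed
  define y where "y = nxt_in M1 h"
  have y: "y \<in> ings M1" "insec (Ms M1) (ings M1) h y"
    using A.nxt_in_mem A.insec_nxt 1(2) by (auto simp: y_def)
  have yv: "h \<in> vert M1 y"
    using A.s.insec_orb[OF y(2)] A.s.orb_sym[OF hD] by (auto simp: vert_def)
  have "y \<notin> L1"
  proof
    assume "y \<in> L1"
    hence "vert M1 y \<inter> ings M1 = {y}" using leaf1 by (simp add: leafset_def)
    hence "h = y" using yv 1(2) by blast
    thus False using hL \<open>y \<in> L1\<close> by simp
  qed
  hence yL: "y \<in> ings M1 - L1" using y by simp
  have yR: "y \<in> Md M1 - rootface M1" using nr y by blast
  have psy: "psiB y = psiW y"
  proof (cases "ing M1 (Ma M1 y)")
    case True
    define z where "z = Ma M1 y"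
    have z: "z \<in> ings M1" "Ma M1 z = y" using True yR A.Ma_mem A.Ma_Ma by (auto simp: z_def ings_def)
    have zL: "z \<in> ings M1 - L1" using nonroot_notL z yR by auto
    have "Ma M2 (psiB y) = psiW z" using IH[OF y(2) z] yR by auto
    moreover have "psiW y = Ma M2 (psiW z)" using aW2[OF zL] z y by (auto simp: ings_def)
    ultimately show ?thesis using B.Ma_Ma[of "psiB y"] psiB_mem[OF yR] by simp
  next
    case False thus ?thesis using aW1[OF yL] by simp
  qed
  have psh: "psiW h \<in> ings M2 - L2" and psy2: "psiW y \<in> ings M2 - L2" using psiW_mem hL yL by auto
  have yn: "psiW y = nxt_in M2 (psiW h)" using nW hL by (simp add: y_def)
  have s1: "insec (Ms M2) (ings M2) g (psiW y)" using sec[OF y(2)] psy by simp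
  have s2: "insec (Ms M2) (ings M2) (psiW h) (psiW y)" using B.insec_nxt[of "psiW h"] psh yn by simp
  \<comment> \<open>Otherwise the image of the bud replaces a removed leaf. The other end of that
    edge carries removed ingoing half-edges only, but the sector found at that vertex ends in one
    that remains.\<close>
  have "g \<in> ings M2"
  proof -
    have "ing M2 (Ma M2 (psiB b)) \<or> psiB b \<in> L2"
      using bud[OF bD] ab 1(2) by (auto simp: ings_def)
    moreover have "psiB b \<notin> L2"
    proof
      assume l: "psiB b \<in> L2"
      have "psiW y \<in> vert M2 g" using B.s.insec_orb[OF s1] by (simp add: vert_def)
      moreover have "vert M2 g \<inter> ings M2 \<subseteq> L2" using l leaf2 by (simp add: leafset_def g_def)
      ultimately show False using psy2 by blast
    qed
    ultimately show ?thesis using gD by (simp add: ings_def g_def)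
  qed
  hence "g = psiW h" using B.s.insec_unique[OF s1 s2] psh B.ings_D by blast
  thus ?case by (simp add: g_def b_def)
qed

end

locale piso0 = piso M1 M2 psiW psiB "{}" "{}"
  for M1 :: "'a bmap" and M2 :: "'b bmap" and psiW psiB
begin

text \<open>An outgoing half-edge may lie in a root corner, where the mobile has no black half-edge,
  so its image is defined through the opposite half-edge, which is ingoing or lies in an inner
  corner.\<close>

definition th :: "'a \<Rightarrow> 'b" where
  "th d = (if d \<in> ings M1 then psiW d else Ma M2 (if Ma M1 d \<in> ings M1 then psiW (Ma M1 d) else psiB (Ma M1 d)))"

lemma W_mem: "h \<in> ings M1 \<Longrightarrow> psiW h \<in> ings M2"
  using psiW_mem by auto

lemma nonroot_out: "d \<in> Md M1 \<Longrightarrow> d \<notin> ings M1 \<Longrightarrow> Ma M1 d \<in> Md M1 - rootface M1"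
  using A.outer[of "Ma M1 d"] A.Ma_mem A.Ma_Ma A.ing_ings by auto

lemma th_ing: "h \<in> ings M1 \<Longrightarrow> th h = psiW h"
  by (simp add: th_def)

lemma th_Ma: assumes "d \<in> Md M1" shows "th (Ma M1 d) = Ma M2 (th d)"
proof -
  have aD: "Ma M1 d \<in> Md M1" and aa: "Ma M1 (Ma M1 d) = d" using assms A.Ma_mem A.Ma_Ma by auto
  consider "d \<in> ings M1" "Ma M1 d \<in> ings M1" | "d \<in> ings M1" "Ma M1 d \<notin> ings M1"
    | "d \<notin> ings M1" "Ma M1 d \<in> ings M1" | "d \<notin> ings M1" "Ma M1 d \<notin> ings M1" by blast
  thus ?thesis
  proof cases
    case 1 thus ?thesis using aW2[of d] by (auto simp: th_def ings_def)
  next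
    case 2 thus ?thesis by (simp add: th_def aa)
  next
    case 3
    have "psiW (Ma M1 d) \<in> Md M2" using W_mem 3 B.ings_D by auto
    thus ?thesis using 3 B.Ma_Ma by (simp add: th_def aa)
  next
    case 4
    have d: "Ma M1 d \<in> Md M1 - rootface M1" "d \<in> Md M1 - rootface M1"
      using nonroot_out[OF assms 4(1)] nonroot_out[OF aD 4(2)] aa by auto
    have "psiB d = Ma M2 (psiB (Ma M1 d))"
      using aB[OF d(1)] 4 aa assms aD by (simp add: A.ing_ings)
    moreover have "Ma M2 (Ma M2 (psiB (Ma M1 d))) = psiB (Ma M1 d)" using B.Ma_Ma psiB_mem d by blast
    ultimately show ?thesis using 4 by (simp add: th_def aa)
  qed
qed

lemma th_nonroot: assumes "d \<in> Md M1 - rootface M1" shows "psiB d = th d"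
proof -
  have dD: "d \<in> Md M1" using assms by auto
  have aD: "Ma M1 d \<in> Md M1" and aa: "Ma M1 (Ma M1 d) = d" using assms A.Ma_mem A.Ma_Ma by auto
  have pD: "psiB d \<in> Md M2" using psiB_mem assms by auto
  show ?thesis
  proof (cases "Ma M1 d \<in> ings M1")
    case True
    have "Ma M2 (psiB d) = psiW (Ma M1 d)" using psi_partner[OF True] aa assms by simp
    hence "Ma M2 (psiB d) = Ma M2 (th d)" using th_Ma[OF dD] th_ing[OF True] by simp
    moreover have "th d \<in> Md M2"
      using True W_mem B.ings_D B.Ma_mem by (auto simp: th_def)
    ultimately show ?thesis using B.a.inj pD by metis
  next
    case False
    show ?thesis
    proof (cases "d \<in> ings M1")
      case True thus ?thesis using aW1[of d] False aD by (auto simp: th_def ings_def)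
    next
      case dI: False
      have "psiB (Ma M1 d) = Ma M2 (psiB d)" using aB[OF assms] dI False dD aD by (simp add: A.ing_ings)
      thus ?thesis using dI False B.Ma_Ma[OF pD] by (simp add: th_def)
    qed
  qed
qed

lemma th_mem: assumes "d \<in> Md M1" shows "th d \<in> Md M2"
proof (cases "d \<in> rootface M1")
  case True
  hence "Ma M1 d \<in> ings M1" using A.ing_root by simp
  thus ?thesis using W_mem B.ings_D B.Ma_mem by (auto simp: th_def)
next
  case False thus ?thesis using th_nonroot[of d] psiB_mem[of d] assms by simp
qed

lemma th_ings: assumes "d \<in> Md M1" shows "th d \<in> ings M2 \<longleftrightarrow> d \<in> ings M1"
proof
  show "th d \<in> ings M2" if "d \<in> ings M1" using that W_mem th_ing by simp
  assume t: "th d \<in> ings M2"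
  show "d \<in> ings M1"
  proof (rule ccontr)
    assume d: "d \<notin> ings M1"
    have aD: "Ma M1 d \<in> Md M1" and aa: "Ma M1 (Ma M1 d) = d" using assms A.Ma_mem A.Ma_Ma by auto
    show False
    proof (cases "Ma M1 d \<in> ings M1")
      case True
      hence "\<not> ing M2 (Ma M2 (psiW (Ma M1 d)))" using aW1[of "Ma M1 d"] aa d assms by (simp add: A.ing_ings)
      moreover have "th d = Ma M2 (psiW (Ma M1 d))" using d True by (simp add: th_def)
      ultimately show False using t by (simp add: ings_def)
    next
      case False
      have dR: "d \<in> Md M1 - rootface M1" using nonroot_out[OF aD False] aa by simp
      have "\<not> ing M2 (psiB d)" using aB[OF dR] d False assms aD by (simp add: A.ing_ings)
      thus False using t th_nonroot[OF dR] by (simp add: ings_def)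
    qed
  qed
qed

lemma th_inj: "inj_on th (Md M1)"
proof (rule inj_onI)
  fix x y assume xy: "x \<in> Md M1" "y \<in> Md M1" "th x = th y"
  have W: "u = v" if "u \<in> ings M1" "v \<in> ings M1" "th u = th v" for u v
    using bW that th_ing by (auto simp: bij_betw_def inj_on_def)
  have e: "x \<in> ings M1 \<longleftrightarrow> y \<in> ings M1" using th_ings xy by metis
  have e': "Ma M1 x \<in> ings M1 \<longleftrightarrow> Ma M1 y \<in> ings M1"
    using th_ings[OF A.Ma_mem] th_Ma xy by metis
  have B: "u = v" if "u \<in> Md M1 - rootface M1" "v \<in> Md M1 - rootface M1" "th u = th v" for u v
    using bB th_nonroot that by (auto simp: bij_betw_def inj_on_def)
  consider "x \<in> ings M1" | "x \<notin> ings M1" "Ma M1 x \<in> ings M1" | "x \<notin> ings M1" "Ma M1 x \<notin> ings M1" by blast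
  thus "x = y"
  proof cases
    case 1 thus ?thesis using W e xy by blast
  next
    case 2
    hence "Ma M1 x = Ma M1 y" using W[of "Ma M1 x" "Ma M1 y"] e' th_Ma xy by simp
    thus ?thesis using A.a.inj xy by blast
  next
    case 3
    have "Ma M1 x \<in> Md M1 - rootface M1" "Ma M1 y \<in> Md M1 - rootface M1"
      using nonroot_out e xy 3 by blast+
    hence "Ma M1 x = Ma M1 y" using B th_Ma xy by metis
    thus ?thesis using A.a.inj xy by blast
  qed
qed

lemma th_surj: assumes "y \<in> Md M2" shows "y \<in> th ` Md M1"
proof -
  have W: "z \<in> th ` Md M1" if "z \<in> ings M2" for z
  proof -
    obtain h where h: "h \<in> ings M1" "z = psiW h" using bW \<open>z \<in> ings M2\<close> by (auto simp: bij_betw_def)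
    hence "z = th h" using th_ing by simp
    thus ?thesis using h A.ings_D by blast
  qed
  show ?thesis
  proof (cases "y \<in> rootface M2")
    case True
    then obtain h where h: "h \<in> Md M1" "Ma M2 y = th h" using W B.ing_root by blast
    have "y = th (Ma M1 h)" using th_Ma h B.Ma_Ma[OF assms] by simp
    thus ?thesis using h A.Ma_mem by blast
  next
    case False
    then obtain d where d: "d \<in> Md M1 - rootface M1" "y = psiB d"
      using bB assms by (auto simp: bij_betw_def)
    hence "y = th d" using th_nonroot by simp
    thus ?thesis using d by blast
  qed
qed

lemma th_bij: "bij_betw th (Md M1) (Md M2)"
  unfolding bij_betw_def using th_inj th_mem th_surj by auto

lemma th_root: assumes "d \<in> Md M1" shows "th d \<in> rootface M2 \<longleftrightarrow> d \<in> rootface M1"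
proof
  show "d \<in> rootface M1" if "th d \<in> rootface M2"
    using that th_nonroot[of d] psiB_mem[of d] assms by auto
  assume d: "d \<in> rootface M1"
  show "th d \<in> rootface M2"
  proof (rule ccontr)
    assume "th d \<notin> rootface M2"
    hence "th d \<in> Md M2 - rootface M2" using th_mem assms by simp
    then obtain e where e: "e \<in> Md M1 - rootface M1" "th d = psiB e"
      using bB by (auto simp: bij_betw_def)
    hence "d = e" using th_nonroot th_inj assms by (auto simp: inj_on_def)
    thus False using e d by simp
  qed
qed

lemma th_root_image: "th ` rootface M1 = rootface M2"
proof
  show "th ` rootface M1 \<subseteq> rootface M2" using th_root A.root_sub by blast
  show "rootface M2 \<subseteq> th ` rootface M1"
    using th_surj th_root B.root_sub by blast
qed

lemma th_phi: assumes "d \<in> Md M1 - rootface M1" shows "th (phi M1 d) = phi M2 (th d)"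
  using psiB_phi[OF assms] th_nonroot assms by simp

text \<open>Next to inner faces the rotation is visible in the mobile through \<open>phi\<close>.
  Along the root face nothing is recorded: there the image of \<open>Ms M1 d\<close> is a root
  corner, hence follows some ingoing \<open>z\<close>, and the sectors of \<open>z\<close> and of
  \<open>th d\<close> have the same end.\<close>

lemma th_Ms: assumes "d \<in> Md M1" shows "th (Ms M1 d) = Ms M2 (th d)"
proof -
  have st: "th (Ms M1 x) = Ms M2 (th x)" if x: "x \<in> Md M1" "Ma M1 x \<notin> rootface M1" for x
  proof -
    have "Ma M1 x \<in> Md M1 - rootface M1" using x A.Ma_mem by simp
    hence "th (phi M1 (Ma M1 x)) = phi M2 (th (Ma M1 x))" by (rule th_phi)
    thus ?thesis using A.phi_Ma th_Ma B.phi_Ma[OF th_mem] x by simp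
  qed
  show ?thesis
  proof (cases "Ma M1 d \<in> rootface M1")
    case False thus ?thesis using st assms by blast
  next
    case True
    have h: "d \<in> ings M1" using A.ing_root[OF True] A.Ma_Ma assms by simp
    have "Ms M1 d \<in> rootface M1" using A.root_step[OF True] A.phi_Ma assms by simp
    hence "th (Ms M1 d) \<in> rootface M2" using th_root_image by blast
    then obtain z where z: "z \<in> ings M2" "Ms M2 z = th (Ms M1 d)" using B.root_pred by blast
    have "insec (Ms M1) (ings M1) d x \<Longrightarrow> insec (Ms M2) (ings M2) z (th x)" for x
    proof (induction rule: insec.induct)
      case start show ?case using insec.start[of "Ms M2" "ings M2" z] z by simp
    next
      case (walk x)
      have xD: "x \<in> Md M1" using A.s.insec_mem walk(1) assms by blast
      hence "Ma M1 x \<notin> rootface M1" using nonroot_out walk by blast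
      hence "th (Ms M1 x) = Ms M2 (th x)" using st xD by blast
      moreover have "th x \<notin> ings M2" using th_ings xD walk by blast
      ultimately show ?case using insec.walk[OF walk.IH] by metis
    qed
    hence "insec (Ms M2) (ings M2) z (th (nxt_in M1 d))" using A.insec_nxt h by blast
    moreover have "th (nxt_in M1 d) = nxt_in M2 (th d)" using nW[of d] h th_ing A.nxt_in_mem by simp
    moreover have tI: "th d \<in> ings M2" using th_ings h assms by blast
    ultimately have "z = th d" using B.insec_nxt[OF tI] B.s.insec_unique z(1) B.ings_D by metis
    thus ?thesis using z by simp
  qed
qed

lemma th_wt: assumes "d \<in> Md M1" shows "Mw M2 (th d) = Mw M1 d"
proof (cases "d \<in> ings M1")
  case True thus ?thesis using wtW th_ing by simp
next
  case False
  hence "th d \<notin> ings M2" using th_ings assms by blast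
  thus ?thesis using False assms th_mem[OF assms] by (simp add: ings_def ing_def)
qed

lemma iso: "map_iso M1 M2"
  unfolding map_iso_def using th_bij th_Ma th_Ms th_wt th_root_image by blast

end

section \<open>Mobile isomorphisms and the pruning of white leaves\<close>

definition mob_isof :: "('a \<Rightarrow> 'b) \<Rightarrow> 'a mobile \<Rightarrow> 'b mobile \<Rightarrow> bool" where
  "mob_isof \<psi> T U \<longleftrightarrow> bij_betw \<psi> (Td T) (Td U) \<and> \<psi> ` Tbud T = Tbud U
     \<and> (\<forall>x\<in>Td T. \<psi> (Ts T x) = Ts U (\<psi> x) \<and> Tblack U (\<psi> x) = Tblack T x)
     \<and> (\<forall>x\<in>Td T - Tbud T. \<psi> (Ta T x) = Ta U (\<psi> x) \<and> Tw U (\<psi> x) = Tw T x)"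

lemma mob_iso_isof: "mob_iso T U \<longleftrightarrow> (\<exists>\<psi>. mob_isof \<psi> T U)"
  by (simp add: mob_iso_def mob_isof_def)

text \<open>\<open>T'\<close> is \<open>T\<close> with the white leaves \<open>Lf\<close> cut off;
  the half-edge from which a leaf hung stays behind as a bud.\<close>

definition pruned :: "'a mobile \<Rightarrow> 'a set \<Rightarrow> 'a mobile \<Rightarrow> bool" where
  "pruned T Lf T' \<longleftrightarrow> Td T' = Td T - Lf \<and> Tbud T' = Tbud T \<union> Ta T ` Lf
     \<and> (\<forall>x\<in>Td T'. Ts T' x = Ts T x \<and> Tblack T' x = Tblack T x)
     \<and> (\<forall>x\<in>Td T' - Tbud T'. Ta T' x = Ta T x \<and> Tw T' x = Tw T x)"

lemma mob_isof_pruned: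
  assumes iso: "mob_isof \<psi> T U" and P: "pruned T Lf T'" and Q: "pruned U Lg U'"
    and Lf: "Lf \<subseteq> Td T - Tbud T" and im: "\<psi> ` Lf = Lg"
    and Bs: "Tbud T' \<subseteq> Td T"
  shows "mob_isof \<psi> T' U'"
proof -
  have inj: "inj_on \<psi> (Td T)" and sur: "\<psi> ` Td T = Td U"
    using iso by (auto simp: mob_isof_def bij_betw_def)
  have bd: "\<psi> ` Tbud T = Tbud U" using iso by (simp add: mob_isof_def)
  have s: "\<And>x. x \<in> Td T \<Longrightarrow> \<psi> (Ts T x) = Ts U (\<psi> x) \<and> Tblack U (\<psi> x) = Tblack T x"
    and a: "\<And>x. x \<in> Td T \<Longrightarrow> x \<notin> Tbud T \<Longrightarrow> \<psi> (Ta T x) = Ta U (\<psi> x) \<and> Tw U (\<psi> x) = Tw T x"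
    using iso by (auto simp: mob_isof_def)
  have P': "Td T' = Td T - Lf" "Tbud T' = Tbud T \<union> Ta T ` Lf"
    "\<And>x. x \<in> Td T' \<Longrightarrow> Ts T' x = Ts T x \<and> Tblack T' x = Tblack T x"
    "\<And>x. x \<in> Td T' \<Longrightarrow> x \<notin> Tbud T' \<Longrightarrow> Ta T' x = Ta T x \<and> Tw T' x = Tw T x"
    using P by (auto simp: pruned_def)
  have Q': "Td U' = Td U - Lg" "Tbud U' = Tbud U \<union> Ta U ` Lg"
    "\<And>x. x \<in> Td U' \<Longrightarrow> Ts U' x = Ts U x \<and> Tblack U' x = Tblack U x"
    "\<And>x. x \<in> Td U' \<Longrightarrow> x \<notin> Tbud U' \<Longrightarrow> Ta U' x = Ta U x \<and> Tw U' x = Tw U x"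
    using Q by (auto simp: pruned_def)
  have td: "\<psi> ` Td T' = Td U'"
    unfolding P'(1) Q'(1) using inj_on_image_set_diff[OF inj, of "Td T" Lf] Lf im sur by auto
  have bj: "bij_betw \<psi> (Td T') (Td U')"
    using td inj P'(1) unfolding bij_betw_def by (auto intro: inj_on_subset)
  have bud: "\<psi> ` Tbud T' = Tbud U'"
  proof -
    have "\<psi> ` Ta T ` Lf = Ta U ` \<psi> ` Lf"
      unfolding image_image by (rule image_cong) (use a Lf in auto)
    thus ?thesis unfolding P'(2) Q'(2) using bd im by (simp add: image_Un)
  qed
  have mem: "\<psi> x \<in> Td U'" if "x \<in> Td T'" for x using that td by auto
  have nb: "\<psi> x \<notin> Tbud U'" if x: "x \<in> Td T'" "x \<notin> Tbud T'" for x
  proof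
    assume "\<psi> x \<in> Tbud U'"
    then obtain y where "y \<in> Tbud T'" "\<psi> x = \<psi> y" using bud by auto
    thus False using inj x P'(1) Bs by (auto simp: inj_on_def)
  qed
  show ?thesis
    unfolding mob_isof_def
  proof (intro conjI ballI)
    show "bij_betw \<psi> (Td T') (Td U')" "\<psi> ` Tbud T' = Tbud U'" by fact+
    fix x assume x: "x \<in> Td T'"
    hence xT: "x \<in> Td T" using P'(1) by auto
    show "\<psi> (Ts T' x) = Ts U' (\<psi> x)" "Tblack U' (\<psi> x) = Tblack T' x"
      using s[OF xT] P'(3)[OF x] Q'(3)[OF mem[OF x]] by auto
  next
    fix x assume x: "x \<in> Td T' - Tbud T'"
    hence xT: "x \<in> Td T" "x \<notin> Tbud T" using P' by auto
    show "\<psi> (Ta T' x) = Ta U' (\<psi> x)" "Tw U' (\<psi> x) = Tw T' x"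
      using a[OF xT] P'(4)[of x] Q'(4)[OF mem[of x] nb[of x]] x by auto
  qed
qed

locale prune = nmob T for T :: "'a mobile" +
  fixes Lf :: "'a set" and T' :: "'a mobile"
  assumes pr: "pruned T Lf T'"
    and Lf_sub: "Lf \<subseteq> Td T" and Lf_white: "w \<in> Lf \<Longrightarrow> \<not> Tblack T w"
    and Lf_leaf: "w \<in> Lf \<Longrightarrow> Ts T w = w" and Lf_black: "w \<in> Lf \<Longrightarrow> Tblack T (Ta T w)"
begin

lemma Td': "Td T' = Td T - Lf" and Tbud': "Tbud T' = Tbud T \<union> Ta T ` Lf"
  and Ts': "x \<in> Td T' \<Longrightarrow> Ts T' x = Ts T x" and Tblack': "x \<in> Td T' \<Longrightarrow> Tblack T' x = Tblack T x"
  and Ta': "x \<in> Td T' \<Longrightarrow> x \<notin> Tbud T' \<Longrightarrow> Ta T' x = Ta T x"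
  and Tw': "x \<in> Td T' \<Longrightarrow> x \<notin> Tbud T' \<Longrightarrow> Tw T' x = Tw T x"
  using pr by (auto simp: pruned_def)

lemma Lf_nb: "w \<in> Lf \<Longrightarrow> w \<in> Td T - Tbud T"
  using Lf_sub Lf_white bud_black by auto

lemma Lf_Ta: "w \<in> Lf \<Longrightarrow> Ta T w \<in> Td T - Tbud T \<and> Ta T (Ta T w) = w \<and> Ta T w \<notin> Lf"
  using Ta_props[OF Lf_nb] Lf_black Lf_white by blast

lemma Ts_stay: assumes "x \<in> Td T'" shows "Ts T x \<in> Td T'"
proof -
  have "Ts T x \<notin> Lf"
  proof
    assume l: "Ts T x \<in> Lf"
    hence "Ts T (Ts T x) = Ts T x" by (rule Lf_leaf)
    hence "Ts T x = x" using t.inj assms t.mem by (auto simp: Td')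
    thus False using l assms by (simp add: Td')
  qed
  thus ?thesis using assms t.mem by (simp add: Td')
qed

lemma Tbud'_sub: "Tbud T' \<subseteq> Td T'"
  using bud_sub Lf_Ta Lf_nb by (auto simp: Td' Tbud')

lemma Ta_stay: assumes "x \<in> Td T' - Tbud T'" shows "Ta T x \<in> Td T' - Tbud T'"
proof -
  have x: "x \<in> Td T - Tbud T" "x \<notin> Lf" "x \<notin> Ta T ` Lf" using assms by (auto simp: Td' Tbud')
  have "Ta T x \<notin> Lf" using x Ta_props[of x] by (metis image_eqI)
  moreover have "Ta T x \<notin> Ta T ` Lf"
  proof
    assume "Ta T x \<in> Ta T ` Lf"
    then obtain w where "w \<in> Lf" "Ta T x = Ta T w" by auto
    hence "x = w" using Lf_Ta[of w] Ta_props[of x] x by auto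
    thus False using \<open>w \<in> Lf\<close> x by simp
  qed
  ultimately show ?thesis using Ta_props[of x] x by (simp add: Td' Tbud')
qed

lemma orb_Ts': assumes "x \<in> Td T'" shows "mvert T' x = mvert T x"
  unfolding mvert_def
proof (rule orb_cong)
  fix y assume y: "y \<in> orb (Ts T) x"
  have "orb (Ts T) x \<subseteq> Td T'" by (rule t.orb_least) (use assms Ts_stay in auto)
  thus "Ts T' y = Ts T y" using y Ts' by auto
qed

lemma mvert_leaf: assumes "w \<in> Lf" shows "mvert T w = {w}"
proof
  show "mvert T w \<subseteq> {w}" unfolding mvert_def by (rule t.orb_least) (auto simp: Lf_leaf assms)
  show "{w} \<subseteq> mvert T w" unfolding mvert_def using t.orb_refl by auto
qed

lemma premob': "premob T'"
proof
  show "finite (Td T')" using finT by (simp add: Td')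
  show "Tbud T' \<subseteq> Td T'" by (rule Tbud'_sub)
  show "Ta T' x \<in> Td T' - Tbud T' \<and> Ta T' x \<noteq> x \<and> Ta T' (Ta T' x) = x" if x: "x \<in> Td T' - Tbud T'" for x
  proof -
    have "x \<in> Td T - Tbud T" using x by (auto simp: Td' Tbud')
    thus ?thesis using Ta_stay[OF x] x Ta'[of x] Ta'[of "Ta T x"] Ta_props[of x] by auto
  qed
  show "Tblack T' (Ts T' x) = Tblack T' x" if "x \<in> Td T'" for x
    using that Ts' Tblack' Ts_stay col by (simp add: Td')
  show "Tblack T' x" if "x \<in> Tbud T'" for x
    using that Tbud'_sub Tblack'[of x] bud_black[of x] Lf_black by (auto simp: Tbud')
  have "fperm (Ts T) (Td T')" by (rule fperm_restrict[OF t.fperm_axioms]) (use Ts_stay in \<open>auto simp: Td'\<close>)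
  hence "bij_betw (Ts T) (Td T') (Td T')" by (simp add: fperm_def)
  thus "bij_betw (Ts T') (Td T') (Td T')" using bij_betw_cong[of "Td T'" "Ts T'" "Ts T"] Ts' by blast
qed

sublocale P: premob T' by (rule premob')

lemma card_Lf_bud: "card (Ta T ` Lf) = card Lf" "Tbud T \<inter> Ta T ` Lf = {}"
proof -
  show "card (Ta T ` Lf) = card Lf" by (rule card_image, rule inj_onI) (use Lf_Ta in metis)
  show "Tbud T \<inter> Ta T ` Lf = {}" using Lf_Ta by blast
qed

lemma finLf: "finite Lf"
  using Lf_sub finT finite_subset by auto

text \<open>Each cut removes one white half-edge and creates one bud.\<close>

lemma excess': "excess T' = excess T - 2 * int (card Lf)"
proof -
  have "{x \<in> Td T'. \<not> Tblack T' x} = {x \<in> Td T. \<not> Tblack T x} - Lf"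
    using Tblack' by (auto simp: Td')
  moreover have "Lf \<subseteq> {x \<in> Td T. \<not> Tblack T x}" using Lf_sub Lf_white by auto
  ultimately have "card {x \<in> Td T'. \<not> Tblack T' x} = card {x \<in> Td T. \<not> Tblack T x} - card Lf"
    "card Lf \<le> card {x \<in> Td T. \<not> Tblack T x}"
    using finLf finT by (auto simp: card_Diff_subset intro: card_mono)
  moreover have "card (Tbud T') = card (Tbud T) + card Lf"
    unfolding Tbud' using card_Lf_bud finLf finT bud_sub finite_subset
    by (subst card_Un_disjoint) auto
  ultimately show ?thesis unfolding P.excess_alt excess_alt by simp
qed

lemma mverts': "mverts T' = mverts T - (\<lambda>w. {w}) ` Lf"
proof (intro equalityI subsetI)
  fix v assume "v \<in> mverts T'"
  then obtain x where x: "x \<in> Td T'" "v = mvert T x" using orb_Ts' by (auto simp: mverts_def)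
  have "x \<in> v" using x t.orb_refl by (simp add: mvert_def)
  thus "v \<in> mverts T - (\<lambda>w. {w}) ` Lf" using x by (auto simp: mverts_def Td')
next
  fix v assume v: "v \<in> mverts T - (\<lambda>w. {w}) ` Lf"
  then obtain x where x: "x \<in> Td T" "v = mvert T x" by (auto simp: mverts_def)
  have "x \<notin> Lf" using v x mvert_leaf by auto
  hence "x \<in> Td T'" using x by (simp add: Td')
  thus "v \<in> mverts T'" using x orb_Ts' by (auto simp: mverts_def)
qed

lemma nmob': "nmob T'"
proof
  \<comment> \<open>Paths are transported by the retraction that moves a leaf to the black half-edge
    it hangs from.\<close>
  have step: "P.sim (if x \<in> Lf then Ta T x else x) (if y \<in> Lf then Ta T y else y)"
    if "(x, y) \<in> mob_conn T" for x y
  proof -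
    from that consider "x \<in> Td T - Tbud T" "y = Ta T x" | "x \<in> Td T" "y = Ts T x"
      by (auto simp: mob_conn_def)
    thus ?thesis
    proof cases
      case 1
      show ?thesis
      proof (cases "x \<in> Lf \<or> y \<in> Lf")
        case True
        thus ?thesis
        proof
          assume "x \<in> Lf" thus ?thesis using 1 Lf_Ta[of x] P.sim_refl by simp
        next
          assume y: "y \<in> Lf"
          hence "Ta T y = x" using 1 Ta_props by auto
          moreover have "x \<notin> Lf" using Lf_Ta[OF y] calculation by auto
          ultimately show ?thesis using y P.sim_refl by simp
        qed
      next
        case False
        have "x \<notin> Ta T ` Lf" using False 1 Ta_props[of x] Lf_Ta by auto
        hence "x \<in> Td T' - Tbud T'" using 1 False by (simp add: Td' Tbud')
        thus ?thesis using False 1 P.sim_Ta[of x] Ta'[of x] by simp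
      qed
    next
      case 2
      show ?thesis
      proof (cases "x \<in> Lf")
        case True thus ?thesis using 2 Lf_leaf P.sim_refl by simp
      next
        case False
        hence x: "x \<in> Td T'" using 2 by (simp add: Td')
        hence "y \<notin> Lf" using Ts_stay[OF x] 2 by (simp add: Td')
        thus ?thesis using False 2 P.sim_Ts[OF x] Ts'[OF x] by simp
      qed
    qed
  qed
  have "(x, y) \<in> (mob_conn T)\<^sup>* \<Longrightarrow> P.sim (if x \<in> Lf then Ta T x else x) (if y \<in> Lf then Ta T y else y)" for x y
  proof (induction rule: rtrancl_induct)
    case base show ?case by (rule P.sim_refl)
  next
    case (step y z) thus ?case using P.sim_trans \<open>\<And>y x. (x, y) \<in> mob_conn T \<Longrightarrow> _ x y\<close> by blast
  qed
  thus "P.sim x y" if "x \<in> Td T'" "y \<in> Td T'" for x y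
    using connT[of x y] that unfolding sim_def Td' by fastforce
  have nbs: "Td T' - Tbud T' = (Td T - Tbud T) - (Lf \<union> Ta T ` Lf)" by (auto simp: Td' Tbud')
  have ls: "Lf \<union> Ta T ` Lf \<subseteq> Td T - Tbud T" using Lf_nb Lf_Ta by blast
  have "card (Lf \<union> Ta T ` Lf) = 2 * card Lf"
    using Lf_Ta finLf card_Lf_bud by (subst card_Un_disjoint) auto
  hence nb: "card (Td T' - Tbud T') = card (Td T - Tbud T) - 2 * card Lf" "2 * card Lf \<le> card (Td T - Tbud T)"
    unfolding nbs using ls finT finLf card_mono[OF _ ls] by (auto simp: card_Diff_subset)
  have lv: "(\<lambda>w. {w}) ` Lf \<subseteq> mverts T"
    unfolding mverts_def using mvert_leaf Lf_sub by auto
  have "card ((\<lambda>w. {w}) ` Lf) = card Lf" by (rule card_image) (auto simp: inj_on_def)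
  hence "card (mverts T') = card (mverts T) - card Lf" "card Lf \<le> card (mverts T)"
    unfolding mverts' using lv finT finLf card_mono[OF _ lv] by (auto simp: card_Diff_subset mverts_def)
  thus "2 * card (mverts T') = card (Td T' - Tbud T') + 2" using tree nb by simp
  show "(Tblack T' x \<longrightarrow> Tw T' x = 0) \<and> (\<not> Tblack T' x \<longrightarrow> 0 < Tw T' x)" if "x \<in> Td T' - Tbud T'" for x
    using that wt[of x] Tw'[of x] Tblack'[of x] by (auto simp: Td' Tbud')
qed

end

section \<open>Isomorphic maps and isomorphic mobiles\<close>

lemma map_iso_PhiP:
  assumes "premap M" "premap N" "bij_betw \<psi> (Md M) (Md N)"
    and a: "\<And>x. x \<in> Md M \<Longrightarrow> \<psi> (Ma M x) = Ma N (\<psi> x)"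
    and s: "\<And>x. x \<in> Md M \<Longrightarrow> \<psi> (Ms M x) = Ms N (\<psi> x)"
    and w: "\<And>x. x \<in> Md M \<Longrightarrow> Mw N (\<psi> x) = Mw M x"
    and r: "\<psi> ` rootface M = rootface N"
  shows "mob_isof (\<lambda>(d, t). (\<psi> d, t)) (PhiP M) (PhiP N)"
proof -
  interpret A: premap M by fact
  interpret B: premap N by fact
  let ?f = "\<lambda>(d, t). (\<psi> d, t :: tag)"
  have mem: "x \<in> Md M \<Longrightarrow> \<psi> x \<in> Md N" for x using assms(3) by (auto simp: bij_betw_def)
  have inj: "inj_on \<psi> (Md M)" and sur: "\<psi> ` Md M = Md N" using assms(3) by (auto simp: bij_betw_def)
  have i: "ing N (\<psi> x) = ing M x" if "x \<in> Md M" for x using w that by (simp add: ing_def)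
  have ii: "\<psi> x \<in> ings N \<longleftrightarrow> x \<in> ings M" if "x \<in> Md M" for x using i mem that by (simp add: ings_def)
  have rr: "\<psi> x \<in> rootface N \<longleftrightarrow> x \<in> rootface M" if "x \<in> Md M" for x
    using inj that r A.root_sub by (metis inj_on_image_mem_iff)
  have pw: "\<psi> ((Ms M ^^ k) x) = (Ms N ^^ k) (\<psi> x)" if "x \<in> Md M" for k x
    using that s A.s.pow_mem by (induction k) auto
  have nx: "\<psi> (nxt_in M x) = nxt_in N (\<psi> x)" if "x \<in> Md M" for x
  proof -
    have "ing M ((Ms M ^^ k) x) = ing N ((Ms N ^^ k) (\<psi> x))" for k
      using i[OF A.s.pow_mem[OF that]] pw[OF that] by simp
    thus ?thesis using pw[OF that] by (simp add: nxt_in_def)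
  qed
  have pi: "\<psi> (phi_inv M x) = phi_inv N (\<psi> x)" if x: "x \<in> Md M" for x
  proof -
    have "phi N (\<psi> (phi_inv M x)) = \<psi> (phi M (phi_inv M x))"
      using a s A.phi_inv_mem[OF x] A.Ma_mem by (simp add: phi_def)
    hence "phi N (\<psi> (phi_inv M x)) = \<psi> x" using A.phi_phi_inv x by simp
    thus ?thesis using B.phi_inv_phi[of "\<psi> (phi_inv M x)"] mem A.phi_inv_mem[OF x] by simp
  qed
  have td: "?f ` Td (PhiP M) = Td (PhiP N)"
  proof -
    have "\<psi> ` ings M = ings N"
    proof
      show "\<psi> ` ings M \<subseteq> ings N" using ii A.ings_D by blast
      show "ings N \<subseteq> \<psi> ` ings M"
      proof
        fix y assume y: "y \<in> ings N"
        hence "y \<in> \<psi> ` Md M" using sur B.ings_D by simp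
        then obtain x where "x \<in> Md M" "y = \<psi> x" by auto
        thus "y \<in> \<psi> ` ings M" using ii y by auto
      qed
    qed
    moreover have "\<psi> ` (Md M - rootface M) = Md N - rootface N"
      using inj_on_image_set_diff[OF inj, of "Md M" "rootface M"] sur r A.root_sub by auto
    ultimately show ?thesis unfolding Td_PhiP by (auto simp: image_Un image_image)
  qed
  have tb: "?f ` Tbud (PhiP M) = Tbud (PhiP N)"
  proof -
    have "\<psi> ` {d \<in> Md M - rootface M. ing M (Ma M d)} = {d \<in> Md N - rootface N. ing N (Ma N d)}"
    proof (intro equalityI subsetI)
      fix y assume "y \<in> \<psi> ` {d \<in> Md M - rootface M. ing M (Ma M d)}"
      thus "y \<in> {d \<in> Md N - rootface N. ing N (Ma N d)}"
        using rr mem i[OF A.Ma_mem] a by auto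
    next
      fix y assume y: "y \<in> {d \<in> Md N - rootface N. ing N (Ma N d)}"
      then obtain x where "x \<in> Md M" "y = \<psi> x" using sur by auto
      thus "y \<in> \<psi> ` {d \<in> Md M - rootface M. ing M (Ma M d)}"
        using y rr i[OF A.Ma_mem] a by auto
    qed
    thus ?thesis unfolding Tbud_PhiP by (auto simp: image_image)
  qed
  have "inj_on ?f (Td (PhiP M))"
    using inj unfolding Td_PhiP by (auto simp: inj_on_def ings_def)
  moreover have "?f (Ts (PhiP M) x) = Ts (PhiP N) (?f x) \<and> Tblack (PhiP N) (?f x) = Tblack (PhiP M) x"
    if "x \<in> Td (PhiP M)" for x
    using that nx pi unfolding Td_PhiP by (auto simp: ings_def)
  moreover have "?f (Ta (PhiP M) x) = Ta (PhiP N) (?f x) \<and> Tw (PhiP N) (?f x) = Tw (PhiP M) x"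
    if "x \<in> Td (PhiP M) - Tbud (PhiP M)" for x
    using that i a w i[OF A.Ma_mem] unfolding Td_PhiP by (auto simp: ings_def)
  ultimately show ?thesis unfolding mob_isof_def bij_betw_def using td tb by auto
qed

text \<open>Preservation of colours splits the isomorphism into a white and a black component. In
  \<open>piso\<close> the condition on buds is a disjunction because after pruning an ordinary bud
  and a cut leaf are the same thing.\<close>

lemma mob_iso_piso:
  assumes "gm M1" "gm M2" "leafset M1 L1" "leafset M2 L2"
    and P: "pruned (PhiP M1) ((\<lambda>x. (x, Wh)) ` L1) T1" and Q: "pruned (PhiP M2) ((\<lambda>x. (x, Wh)) ` L2) T2"
    and iso: "mob_iso T1 T2"
  shows "\<exists>psiW psiB. piso M1 M2 psiW psiB L1 L2"
proof -
  interpret A: gm M1 by fact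
  interpret B: gm M2 by fact
  obtain \<psi> where ps: "mob_isof \<psi> T1 T2" using iso mob_iso_isof by blast
  have td1: "(d, Wh) \<in> Td T1 \<longleftrightarrow> d \<in> ings M1 - L1" "(d, Bl) \<in> Td T1 \<longleftrightarrow> d \<in> Md M1 - rootface M1" for d
    using P by (auto simp: pruned_def)
  have td2: "(d, Wh) \<in> Td T2 \<longleftrightarrow> d \<in> ings M2 - L2" "(d, Bl) \<in> Td T2 \<longleftrightarrow> d \<in> Md M2 - rootface M2" for d
    using Q by (auto simp: pruned_def)
  have Tal1: "Ta (PhiP M1) ` (\<lambda>x. (x, Wh)) ` L1 = (\<lambda>x. (x, Bl)) ` L1"
    using assms(3) by (force simp: leafset_def image_image)
  have Tal2: "Ta (PhiP M2) ` (\<lambda>x. (x, Wh)) ` L2 = (\<lambda>x. (x, Bl)) ` L2"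
    using assms(4) by (force simp: leafset_def image_image)
  have tb1: "(d, Wh) \<notin> Tbud T1" "d \<in> Md M1 - rootface M1 \<Longrightarrow> (d, Bl) \<in> Tbud T1 \<longleftrightarrow> ing M1 (Ma M1 d) \<or> d \<in> L1" for d
    using P Tal1 by (auto simp: pruned_def)
  have tb2: "(d, Wh) \<notin> Tbud T2" "d \<in> Md M2 - rootface M2 \<Longrightarrow> (d, Bl) \<in> Tbud T2 \<longleftrightarrow> ing M2 (Ma M2 d) \<or> d \<in> L2" for d
    using Q Tal2 by (auto simp: pruned_def)
  have bl1: "x \<in> Td T1 \<Longrightarrow> Tblack T1 x \<longleftrightarrow> snd x = Bl" for x
    using P by (cases x) (auto simp: pruned_def)
  have bl2: "x \<in> Td T2 \<Longrightarrow> Tblack T2 x \<longleftrightarrow> snd x = Bl" for x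
    using Q by (cases x) (auto simp: pruned_def)
  have inj: "inj_on \<psi> (Td T1)" and sur: "\<psi> ` Td T1 = Td T2" using ps by (auto simp: mob_isof_def bij_betw_def)
  have mem: "x \<in> Td T1 \<Longrightarrow> \<psi> x \<in> Td T2" for x using sur by auto
  define psiW where "psiW d = fst (\<psi> (d, Wh))" for d
  define psiB where "psiB d = fst (\<psi> (d, Bl))" for d
  have colr: "x \<in> Td T1 \<Longrightarrow> snd (\<psi> x) = snd x" for x
  proof -
    assume x: "x \<in> Td T1"
    have "Tblack T2 (\<psi> x) = Tblack T1 x" using ps x by (simp add: mob_isof_def)
    hence "(snd (\<psi> x) = Bl) = (snd x = Bl)" using bl1[OF x] bl2[OF mem[OF x]] by simp
    thus ?thesis by (metis tag.exhaust)
  qed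
  have eW: "d \<in> ings M1 - L1 \<Longrightarrow> \<psi> (d, Wh) = (psiW d, Wh)" for d
    using colr[of "(d, Wh)"] td1 by (simp add: psiW_def prod_eq_iff)
  have eB: "d \<in> Md M1 - rootface M1 \<Longrightarrow> \<psi> (d, Bl) = (psiB d, Bl)" for d
    using colr[of "(d, Bl)"] td1 by (simp add: psiB_def prod_eq_iff)
  have mW: "d \<in> ings M1 - L1 \<Longrightarrow> psiW d \<in> ings M2 - L2" for d
    using mem[of "(d, Wh)"] eW td1 td2 by simp
  have mB: "d \<in> Md M1 - rootface M1 \<Longrightarrow> psiB d \<in> Md M2 - rootface M2" for d
    using mem[of "(d, Bl)"] eB td1 td2 by simp
  have bud: "x \<in> Td T1 \<Longrightarrow> \<psi> x \<in> Tbud T2 \<longleftrightarrow> x \<in> Tbud T1" for x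
  proof -
    assume x: "x \<in> Td T1"
    have "Tbud T1 \<subseteq> Td T1"
    proof
      fix y assume y: "y \<in> Tbud T1"
      obtain d t where dt: "y = (d, t)" by (cases y)
      show "y \<in> Td T1" using y dt P Tal1 assms(3) A.outer[of d] by (cases t) (auto simp: pruned_def leafset_def ings_def)
    qed
    thus ?thesis using ps x inj unfolding mob_isof_def by (metis inj_on_image_mem_iff)
  qed
  have sT: "x \<in> Td T1 \<Longrightarrow> \<psi> (Ts (PhiP M1) x) = Ts (PhiP M2) (\<psi> x)" for x
    using ps P Q mem[of x] by (auto simp: mob_isof_def pruned_def)
  have aT: "x \<in> Td T1 \<Longrightarrow> x \<notin> Tbud T1 \<Longrightarrow> \<psi> (Ta (PhiP M1) x) = Ta (PhiP M2) (\<psi> x) \<and> Tw (PhiP M2) (\<psi> x) = Tw (PhiP M1) x" for x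
    using ps P Q mem[of x] bud[of x] unfolding mob_isof_def pruned_def by (metis DiffI)
  have nxm: "nxt_in M1 h \<in> ings M1 - L1" if h: "h \<in> ings M1 - L1" for h
  proof -
    have n: "nxt_in M1 h \<in> ings M1" using A.nxt_in_mem h by simp
    have "h \<in> vert M1 (nxt_in M1 h)"
      using A.s.insec_orb[OF A.insec_nxt[of h]] A.s.orb_sym[of h] h A.ings_D by (simp add: vert_def)
    hence "nxt_in M1 h \<in> L1 \<Longrightarrow> h = nxt_in M1 h" using assms(3) h by (auto simp: leafset_def)
    thus ?thesis using n h by auto
  qed
  have "piso M1 M2 psiW psiB L1 L2"
  proof
    show "leafset M1 L1" "leafset M2 L2" by fact+
    show "bij_betw psiW (ings M1 - L1) (ings M2 - L2)"
      unfolding bij_betw_def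
    proof
      show "inj_on psiW (ings M1 - L1)"
      proof (rule inj_onI)
        fix x y assume xy: "x \<in> ings M1 - L1" "y \<in> ings M1 - L1" "psiW x = psiW y"
        hence "\<psi> (x, Wh) = \<psi> (y, Wh)" using eW by simp
        hence "(x, Wh) = (y, Wh)" using inj td1 xy unfolding inj_on_def by blast
        thus "x = y" by simp
      qed
      show "psiW ` (ings M1 - L1) = ings M2 - L2"
      proof
        show "psiW ` (ings M1 - L1) \<subseteq> ings M2 - L2" using mW by auto
        show "ings M2 - L2 \<subseteq> psiW ` (ings M1 - L1)"
        proof
          fix y assume y: "y \<in> ings M2 - L2"
          hence "(y, Wh) \<in> \<psi> ` Td T1" using sur td2 by simp
          then obtain x where x: "x \<in> Td T1" "\<psi> x = (y, Wh)" by auto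
          have "x = (fst x, Wh)" using colr[OF x(1)] x(2) by (simp add: prod_eq_iff)
          hence "fst x \<in> ings M1 - L1" "y = psiW (fst x)" using x td1 by (metis, metis fst_conv psiW_def)
          thus "y \<in> psiW ` (ings M1 - L1)" by blast
        qed
      qed
    qed
    show "bij_betw psiB (Md M1 - rootface M1) (Md M2 - rootface M2)"
      unfolding bij_betw_def
    proof
      show "inj_on psiB (Md M1 - rootface M1)"
      proof (rule inj_onI)
        fix x y assume xy: "x \<in> Md M1 - rootface M1" "y \<in> Md M1 - rootface M1" "psiB x = psiB y"
        hence "\<psi> (x, Bl) = \<psi> (y, Bl)" using eB by simp
        hence "(x, Bl) = (y, Bl)" using inj td1 xy unfolding inj_on_def by blast
        thus "x = y" by simp
      qed
      show "psiB ` (Md M1 - rootface M1) = Md M2 - rootface M2"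
      proof
        show "psiB ` (Md M1 - rootface M1) \<subseteq> Md M2 - rootface M2" using mB by auto
        show "Md M2 - rootface M2 \<subseteq> psiB ` (Md M1 - rootface M1)"
        proof
          fix y assume y: "y \<in> Md M2 - rootface M2"
          hence "(y, Bl) \<in> \<psi> ` Td T1" using sur td2 by simp
          then obtain x where x: "x \<in> Td T1" "\<psi> x = (y, Bl)" by auto
          have "x = (fst x, Bl)" using colr[OF x(1)] x(2) by (simp add: prod_eq_iff)
          hence "fst x \<in> Md M1 - rootface M1" "y = psiB (fst x)" using x td1 by (metis, metis fst_conv psiB_def)
          thus "y \<in> psiB ` (Md M1 - rootface M1)" by blast
        qed
      qed
    qed
    show "psiW (nxt_in M1 h) = nxt_in M2 (psiW h)" if h: "h \<in> ings M1 - L1" for h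
      using sT[of "(h, Wh)"] td1 eW[OF h] eW[OF nxm[OF h]] h by simp
    show "psiB (phi_inv M1 d) = phi_inv M2 (psiB d)" if d: "d \<in> Md M1 - rootface M1" for d
      using sT[of "(d, Bl)"] td1 eB[OF d] eB[of "phi_inv M1 d"] A.phi_inv_mem A.root_phi_inv d by simp
    show "ing M1 (Ma M1 d) \<or> d \<in> L1 \<longleftrightarrow> ing M2 (Ma M2 (psiB d)) \<or> psiB d \<in> L2"
      if d: "d \<in> Md M1 - rootface M1" for d
      using bud[of "(d, Bl)"] tb1(2)[OF d] tb2(2)[OF mB[OF d]] eB[OF d] td1 d by simp
    show "ing M2 (Ma M2 (psiW h)) \<and> psiW (Ma M1 h) = Ma M2 (psiW h)"
      if h: "h \<in> ings M1 - L1" and i: "ing M1 (Ma M1 h)" for h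
    proof -
      have hD: "h \<in> Md M1" using h A.ings_D by auto
      have "Ma M1 h \<notin> L1" using assms(3) A.Ma_Ma[OF hD] h by (auto simp: leafset_def ings_def)
      hence m: "Ma M1 h \<in> ings M1 - L1" using i A.Ma_mem[OF hD] by (simp add: ings_def)
      have "(psiW (Ma M1 h), Wh) = Ta (PhiP M2) (psiW h, Wh)"
        using aT[of "(h, Wh)"] tb1(1) td1 h i eW[OF h] eW[OF m] by simp
      thus ?thesis by (auto split: if_splits)
    qed
    show "\<not> ing M2 (Ma M2 (psiW h)) \<and> psiB h = psiW h"
      if h: "h \<in> ings M1 - L1" and i: "\<not> ing M1 (Ma M1 h)" for h
    proof -
      have m: "h \<in> Md M1 - rootface M1" using h A.outer[of h] i A.ings_D by auto
      have "(psiB h, Bl) = Ta (PhiP M2) (psiW h, Wh)"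
        using aT[of "(h, Wh)"] tb1(1) td1 h i eW[OF h] eB[OF m] by simp
      thus ?thesis by (auto split: if_splits)
    qed
    show "\<not> ing M2 (psiB d) \<and> psiB (Ma M1 d) = Ma M2 (psiB d)"
      if d: "d \<in> Md M1 - rootface M1" and i: "\<not> ing M1 d" "\<not> ing M1 (Ma M1 d)" for d
    proof -
      have aa: "Ma M1 (Ma M1 d) = d" using d A.Ma_Ma by simp
      have m: "Ma M1 d \<in> Md M1 - rootface M1" using d A.Ma_mem A.outer[of "Ma M1 d"] aa i by auto
      have "d \<notin> L1" using i assms(3) by (auto simp: leafset_def ings_def)
      hence "(psiB (Ma M1 d), Bl) = Ta (PhiP M2) (psiB d, Bl)"
        using aT[of "(d, Bl)"] tb1(2)[OF d] td1 d i eB[OF d] eB[OF m] by simp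
      thus ?thesis by (auto split: if_splits)
    qed
    show "Mw M2 (psiW h) = Mw M1 h" if h: "h \<in> ings M1 - L1" for h
      using aT[of "(h, Wh)"] tb1(1) td1 h eW[OF h] by simp
  qed
  thus ?thesis by blast
qed

context piso
begin

text \<open>By \<open>psi_partner\<close> ordinary buds go to ordinary buds. Both maps have equally
  many of them, namely \<open>card (ings M) - card (rootface M)\<close>, and this is the number of
  unpruned white half-edges because \<open>L\<close> has the size of the root face. So cut leaves go
  to cut leaves, and each leaf can follow its bud.\<close>

lemma extend:
  assumes c1: "card L1 = card (rootface M1)" and c2: "card L2 = card (rootface M2)"
    and w1: "\<And>x. x \<in> L1 \<Longrightarrow> Mw M1 x = 1" and w2: "\<And>x. x \<in> L2 \<Longrightarrow> Mw M2 x = 1"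
  shows "piso M1 M2 (\<lambda>h. if h \<in> L1 then psiB h else psiW h) psiB {} {}"
proof -
  let ?B1 = "{d \<in> Md M1 - rootface M1. ing M1 (Ma M1 d)}"
  let ?B2 = "{d \<in> Md M2 - rootface M2. ing M2 (Ma M2 d)}"
  have l1: "L1 \<subseteq> ings M1" "x \<in> L1 \<Longrightarrow> \<not> ing M1 (Ma M1 x) \<and> vert M1 x \<inter> ings M1 = {x}"
    and l2: "L2 \<subseteq> ings M2" "y \<in> L2 \<Longrightarrow> \<not> ing M2 (Ma M2 y) \<and> vert M2 y \<inter> ings M2 = {y}" for x y
    using leaf1 leaf2 by (auto simp: leafset_def)
  have L1R: "L1 \<subseteq> Md M1 - rootface M1" using l1 A.outer A.ings_D by blast
  have L2R: "L2 \<subseteq> Md M2 - rootface M2" using l2 B.outer B.ings_D by blast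
  have inj: "inj_on psiB (Md M1 - rootface M1)" using bB by (simp add: bij_betw_def)
  have "psiB ` ?B1 \<subseteq> ?B2"
  proof (intro image_subsetI)
    fix d assume d: "d \<in> ?B1"
    hence h: "Ma M1 d \<in> ings M1" "Ma M1 (Ma M1 d) = d" using A.Ma_mem A.Ma_Ma by (auto simp: ings_def)
    have "Ma M2 (psiB d) = psiW (Ma M1 d)" using psi_partner[OF h(1)] h(2) d by simp
    moreover have "psiW (Ma M1 d) \<in> ings M2" using psiW_mem[of "Ma M1 d"] nonroot_notL[OF h(1)] h d by simp
    ultimately show "psiB d \<in> ?B2" using psiB_mem[of d] d by (simp add: ings_def)
  qed
  moreover have "card ?B2 \<le> card (psiB ` ?B1)"
  proof -
    have "card (psiB ` ?B1) = card ?B1" by (rule card_image) (use inj in \<open>auto intro: inj_on_subset\<close>)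
    moreover have "card (ings M1 - L1) = card (ings M2 - L2)" using bij_betw_same_card[OF bW] .
    moreover have "card (ings M1 - L1) = card (ings M1) - card L1" "card (ings M2 - L2) = card (ings M2) - card L2"
      using l1(1) l2(1) finite_subset[OF L1R] finite_subset[OF L2R] A.fin_darts B.fin_darts
      by (auto intro!: card_Diff_subset)
    ultimately show ?thesis using A.card_buds B.card_buds c1 c2 by linarith
  qed
  moreover have "finite ?B2" using B.fin_darts by simp
  ultimately have B: "psiB ` ?B1 = ?B2" using card_seteq[of ?B2 "psiB ` ?B1"] by blast
  have bud': "ing M1 (Ma M1 d) \<longleftrightarrow> ing M2 (Ma M2 (psiB d))" if d: "d \<in> Md M1 - rootface M1" for d
  proof
    assume "ing M1 (Ma M1 d)"
    thus "ing M2 (Ma M2 (psiB d))" using d B by blast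
  next
    assume i: "ing M2 (Ma M2 (psiB d))"
    hence "psiB d \<in> psiB ` ?B1" using d psiB_mem[OF d] B by simp
    then obtain e where "e \<in> ?B1" "psiB d = psiB e" by auto
    hence "d = e" using inj d by (auto simp: inj_on_def)
    thus "ing M1 (Ma M1 d)" using \<open>e \<in> ?B1\<close> by simp
  qed
  have LL: "d \<in> L1 \<longleftrightarrow> psiB d \<in> L2" if d: "d \<in> Md M1 - rootface M1" for d
    using bud[OF d] bud'[OF d] l1(2)[of d] l2(2)[of "psiB d"] by blast
  have LB: "bij_betw psiB L1 L2"
    unfolding bij_betw_def
  proof
    show "inj_on psiB L1" using inj L1R by (rule inj_on_subset)
    show "psiB ` L1 = L2"
    proof
      show "psiB ` L1 \<subseteq> L2" using LL L1R by blast
      show "L2 \<subseteq> psiB ` L1"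
      proof
        fix y assume y: "y \<in> L2"
        then obtain d where d: "d \<in> Md M1 - rootface M1" "y = psiB d" using L2R bB unfolding bij_betw_def by blast
        thus "y \<in> psiB ` L1" using LL y by blast
      qed
    qed
  qed
  let ?W = "\<lambda>h. if h \<in> L1 then psiB h else psiW h"
  have nxl1: "nxt_in M1 h = h" if "h \<in> L1" for h
  proof -
    have "nxt_in M1 h \<in> vert M1 h \<inter> ings M1"
      using A.nxt_in_mem A.s.insec_orb[OF A.insec_nxt[of h]] that l1 by (auto simp: vert_def)
    thus ?thesis using l1(2)[OF that] by simp
  qed
  have nxl2: "nxt_in M2 h = h" if "h \<in> L2" for h
  proof -
    have "nxt_in M2 h \<in> vert M2 h \<inter> ings M2"
      using B.nxt_in_mem B.s.insec_orb[OF B.insec_nxt[of h]] that l2 by (auto simp: vert_def)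
    thus ?thesis using l2(2)[OF that] by simp
  qed
  have nxm: "nxt_in M1 h \<notin> L1" if h: "h \<in> ings M1 - L1" for h
  proof
    assume n: "nxt_in M1 h \<in> L1"
    have "h \<in> vert M1 (nxt_in M1 h)"
      using A.s.insec_orb[OF A.insec_nxt[of h]] A.s.orb_sym[of h] h A.ings_D by (simp add: vert_def)
    hence "h = nxt_in M1 h" using l1(2)[OF n] h by blast
    thus False using n h by simp
  qed
  show ?thesis
  proof
    show "leafset M1 {}" "leafset M2 {}" by (auto simp: leafset_def)
    have "bij_betw ?W L1 L2" using LB by (rule bij_betw_cong[THEN iffD1, rotated]) simp
    moreover have "bij_betw ?W (ings M1 - L1) (ings M2 - L2)" using bW by (rule bij_betw_cong[THEN iffD1, rotated]) simp
    ultimately have "bij_betw ?W (L1 \<union> (ings M1 - L1)) (L2 \<union> (ings M2 - L2))" by (rule bij_betw_combine) auto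
    moreover have "L1 \<union> (ings M1 - L1) = ings M1 - {}" "L2 \<union> (ings M2 - L2) = ings M2 - {}" using l1 l2 by auto
    ultimately show "bij_betw ?W (ings M1 - {}) (ings M2 - {})" by simp
    show "bij_betw psiB (Md M1 - rootface M1) (Md M2 - rootface M2)" by (rule bB)
    show "?W (nxt_in M1 h) = nxt_in M2 (?W h)" if h: "h \<in> ings M1 - {}" for h
    proof (cases "h \<in> L1")
      case True
      hence "psiB h \<in> L2" using LL L1R by blast
      thus ?thesis using True nxl1 nxl2 by simp
    next
      case False thus ?thesis using nxm[of h] nW[of h] h by simp
    qed
    show "psiB (phi_inv M1 d) = phi_inv M2 (psiB d)" if "d \<in> Md M1 - rootface M1" for d using nB that .
    show "ing M1 (Ma M1 d) \<or> d \<in> {} \<longleftrightarrow> ing M2 (Ma M2 (psiB d)) \<or> psiB d \<in> {}"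
      if "d \<in> Md M1 - rootface M1" for d using bud'[OF that] by simp
    show "ing M2 (Ma M2 (?W h)) \<and> ?W (Ma M1 h) = Ma M2 (?W h)"
      if h: "h \<in> ings M1 - {}" and i: "ing M1 (Ma M1 h)" for h
    proof -
      have "h \<notin> L1" using l1(2) i by blast
      moreover have "Ma M1 h \<notin> L1" using l1(2)[of "Ma M1 h"] A.Ma_Ma[of h] h by (auto simp: ings_def)
      ultimately show ?thesis using aW2[of h] h i by simp
    qed
    show "\<not> ing M2 (Ma M2 (?W h)) \<and> psiB h = ?W h"
      if h: "h \<in> ings M1 - {}" and i: "\<not> ing M1 (Ma M1 h)" for h
    proof (cases "h \<in> L1")
      case True
      hence "psiB h \<in> L2" using LL L1R by blast
      thus ?thesis using True l2(2) by simp
    next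
      case False thus ?thesis using aW1[of h] h i by simp
    qed
    show "\<not> ing M2 (psiB d) \<and> psiB (Ma M1 d) = Ma M2 (psiB d)"
      if "d \<in> Md M1 - rootface M1" "\<not> ing M1 d" "\<not> ing M1 (Ma M1 d)" for d using aB that .
    show "Mw M2 (?W h) = Mw M1 h" if h: "h \<in> ings M1 - {}" for h
    proof (cases "h \<in> L1")
      case True
      hence "psiB h \<in> L2" using LL L1R by blast
      thus ?thesis using True w1 w2 by simp
    next
      case False thus ?thesis using wtW[of h] h by simp
    qed
  qed
qed

end

section \<open>Admissible biorientations\<close>

text \<open>In an admissible biorientation these are the ingoing halves of the outer edges, one at
  each outer vertex; they become the white leaves to be pruned.\<close>

definition outs :: "'a bmap \<Rightarrow> 'a set" where
  "outs M = Ma M ` rootface M"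

context omap
begin

lemma outs_ings: "outs M \<subseteq> ings M"
  unfolding outs_def using ing_root by auto

lemma Ma_outs: "x \<in> outs M \<Longrightarrow> Ma M x \<in> rootface M"
  unfolding outs_def using Ma_Ma root_sub by auto

lemma outs_iff: "d \<in> Md M \<Longrightarrow> d \<in> outs M \<longleftrightarrow> Ma M d \<in> rootface M"
  using Ma_outs Ma_Ma[of d] by (auto simp: outs_def intro!: image_eqI[of d "Ma M" "Ma M d"])

lemma root_pred_outs: assumes "r \<in> rootface M" shows "\<exists>z\<in>outs M. Ms M z = r \<and> vert M z = vert M r"
proof -
  obtain z where z: "z \<in> ings M" "Ms M z = r" "Ma M z \<in> rootface M" using root_pred assms by blast
  hence "z \<in> outs M" using outs_iff ings_D by blast
  thus ?thesis using z vert_Ms[OF ings_D[OF z(1)]] by auto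
qed

lemma outs_outer: assumes "x \<in> outs M" shows "vert M x \<inter> rootface M \<noteq> {}"
proof -
  have "x \<in> Md M" using assms outs_ings ings_D by auto
  hence "Ms M x \<in> rootface M" using root_step[OF Ma_outs[OF assms]] phi_Ma by simp
  moreover have "Ms M x \<in> vert M x" using s.orb_f by (simp add: vert_def)
  ultimately show ?thesis by auto
qed

lemma card_outs: "card (outs M) = card (rootface M)"
  unfolding outs_def using a.bij root_sub by (intro card_image) (auto simp: bij_betw_def intro: inj_on_subset)

text \<open>Simplicity of the contour: root corners directly follow half-edges of
  \<open>outs M\<close>, and a vertex carrying one of these has no second ingoing half-edge.\<close>

lemma admissibleI:
  assumes x: "\<And>x. x \<in> outs M \<Longrightarrow> \<not> ing M (Ma M x) \<and> Mw M x = 1 \<and> vert M x \<inter> ings M = {x}"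
  shows "admissible M"
  unfolding admissible_def
proof (intro conjI ballI impI)
  show "inj_on (vert M) (rootface M)"
  proof (rule inj_onI)
    fix d e assume de: "d \<in> rootface M" "e \<in> rootface M" "vert M d = vert M e"
    obtain z where z: "z \<in> outs M" "Ms M z = d" "vert M z = vert M d" using root_pred_outs de by blast
    obtain w where w: "w \<in> outs M" "Ms M w = e" "vert M w = vert M e" using root_pred_outs de by blast
    have "w \<in> vert M z \<inter> ings M" using w z de vert_refl outs_ings by auto
    hence "w = z" using x[OF z(1)] by simp
    thus "d = e" using z w by simp
  qed
  fix d
  show "Ma M d \<notin> rootface M" if d: "d \<in> rootface M"
  proof
    assume "Ma M d \<in> rootface M"
    hence "ing M d" using outer[of "Ma M d"] Ma_Ma d root_sub by auto
    moreover have "Ma M d \<in> outs M" using d by (simp add: outs_def)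
    ultimately show False using x[of "Ma M d"] Ma_Ma d root_sub by auto
  qed
  show "card {y \<in> vert M d. ing M y} = 1" if d: "d \<in> Md M" "vert M d \<inter> rootface M \<noteq> {}"
  proof -
    obtain r where r: "r \<in> vert M d" "r \<in> rootface M" using d by auto
    obtain z where z: "z \<in> outs M" "Ms M z = r" "vert M z = vert M r" using root_pred_outs r by blast
    have "vert M r = vert M d" using vert_eq d r by auto
    hence "{y \<in> vert M d. ing M y} = vert M z \<inter> ings M" using z vert_sub[OF d(1)] by (auto simp: ings_def)
    thus ?thesis using x[OF z(1)] by simp
  qed
  show "Mw M d = 0 \<and> Mw M (Ma M d) = 1 \<or> Mw M d = 1 \<and> Mw M (Ma M d) = 0"
    if d: "d \<in> Md M" "outer_dart M d"
    using d(2) unfolding outer_dart_def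
  proof
    assume "d \<in> rootface M"
    hence "Ma M d \<in> outs M" by (simp add: outs_def)
    thus ?thesis using x[of "Ma M d"] Ma_Ma d by (auto simp: ing_def)
  next
    assume "Ma M d \<in> rootface M"
    hence "d \<in> outs M" using outs_iff d by simp
    thus ?thesis using x[of d] by (auto simp: ing_def)
  qed
qed

end

section \<open>The second mapping as a pruning of the first\<close>

locale adm = gm +
  assumes adm: "admissible M"
begin

lemma outs_props:
  assumes "x \<in> outs M"
  shows "\<not> ing M (Ma M x)" "Mw M x = 1" "vert M x \<inter> ings M = {x}"
proof -
  have xI: "x \<in> ings M" and xD: "x \<in> Md M" using assms outs_ings ings_D by auto
  have "outer_dart M x" using Ma_outs[OF assms] by (simp add: outer_dart_def)
  hence w: "Mw M x = 0 \<and> Mw M (Ma M x) = 1 \<or> Mw M x = 1 \<and> Mw M (Ma M x) = 0"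
    using adm xD by (simp add: admissible_def)
  thus "\<not> ing M (Ma M x)" "Mw M x = 1" using xI by (auto simp: ings_def ing_def)
  have "card {y \<in> vert M x. ing M y} = 1" using adm xD outs_outer[OF assms] by (simp add: admissible_def)
  moreover have "{y \<in> vert M x. ing M y} = vert M x \<inter> ings M" using vert_sub[OF xD] by (auto simp: ings_def)
  moreover have "x \<in> vert M x \<inter> ings M" using xI vert_refl by simp
  ultimately show "vert M x \<inter> ings M = {x}" by (metis card_1_singletonE singletonD)
qed

lemma outer_vert_ings:
  assumes "d \<in> Md M" "vert M d \<inter> rootface M \<noteq> {}" shows "vert M d \<inter> ings M \<subseteq> outs M"
proof -
  obtain r where r: "r \<in> vert M d" "r \<in> rootface M" using assms by auto
  obtain z where z: "z \<in> outs M" "vert M z = vert M r" using root_pred_outs r by blast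
  have "vert M r = vert M d" using vert_eq assms r by auto
  thus ?thesis using outs_props(3)[OF z(1)] z by simp
qed

lemma leafset_outs: "leafset M (outs M)"
proof -
  have "vert M (Ma M x) \<inter> ings M \<subseteq> outs M" if "x \<in> outs M" for x
  proof (rule outer_vert_ings)
    show "Ma M x \<in> Md M" using Ma_outs[OF that] root_sub by auto
    show "vert M (Ma M x) \<inter> rootface M \<noteq> {}" using Ma_outs[OF that] vert_refl[of "Ma M x"] by auto
  qed
  thus ?thesis using outs_ings Ma_outs outs_props by (auto simp: leafset_def)
qed

lemma root_not_ing: "r \<in> rootface M \<Longrightarrow> \<not> ing M r"
  using outs_props(1)[of "Ma M r"] Ma_Ma root_sub by (auto simp: outs_def)

lemma outs_nonroot: "x \<in> outs M \<Longrightarrow> x \<notin> rootface M"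
  using root_not_ing outs_ings by (auto simp: ings_def)

lemma reverse_sel [simp]: "Md (reverse_outer M) = Md M" "Ma (reverse_outer M) = Ma M"
  "Ms (reverse_outer M) = Ms M" "rootface (reverse_outer M) = rootface M" "phi_inv (reverse_outer M) = phi_inv M"
  by (auto simp: reverse_outer_def rootface_def face_def phi_def phi_inv_def)

lemma ing_reverse:
  assumes "d \<in> Md M" shows "ing (reverse_outer M) d \<longleftrightarrow> d \<in> rootface M \<or> (ing M d \<and> d \<notin> outs M)"
proof (cases "d \<in> rootface M")
  case True
  hence "Ma M d \<in> outs M" by (simp add: outs_def)
  thus ?thesis using True outs_props(2) by (simp add: ing_def reverse_outer_def outer_dart_def)
next
  case False
  thus ?thesis using outs_iff[OF assms] outs_props(1)[of d]
    by (auto simp: ing_def reverse_outer_def outer_dart_def)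
qed

lemma inner_ing: assumes "d \<in> Md M" "vert M d \<inter> rootface M = {}" "y \<in> vert M d"
  shows "ing (reverse_outer M) y \<longleftrightarrow> ing M y"
proof -
  have yD: "y \<in> Md M" using assms vert_sub by auto
  have "vert M y = vert M d" using vert_eq assms by auto
  hence "y \<notin> rootface M" "y \<notin> outs M" using assms outs_outer[of y] vert_refl[of y] by auto
  thus ?thesis using ing_reverse[OF yD] by simp
qed

lemma inner_iff: assumes "d \<in> ings M" shows "d \<notin> outs M \<longleftrightarrow> vert M d \<inter> rootface M = {}"
  using outs_outer[of d] outer_vert_ings[of d] assms ings_D vert_refl[of d] by blast

lemma ings_reverse: "{d \<in> ings (reverse_outer M). vert M d \<inter> rootface M = {}} = ings M - outs M"
proof (intro equalityI subsetI)
  fix d assume d: "d \<in> {d \<in> ings (reverse_outer M). vert M d \<inter> rootface M = {}}"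
  hence "d \<in> Md M" "vert M d \<inter> rootface M = {}" "ing (reverse_outer M) d" by (auto simp: ings_def)
  thus "d \<in> ings M - outs M" using inner_ing[of d d] vert_refl[of d] outs_outer[of d] by (auto simp: ings_def)
next
  fix d assume d: "d \<in> ings M - outs M"
  hence "d \<in> Md M" "vert M d \<inter> rootface M = {}" using inner_iff ings_D by auto
  thus "d \<in> {d \<in> ings (reverse_outer M). vert M d \<inter> rootface M = {}}"
    using d inner_ing[of d d] vert_refl[of d] by (auto simp: ings_def)
qed

definition leaves :: "('a \<times> tag) set" where
  "leaves = (\<lambda>x. (x, Wh)) ` outs M"

lemma Ta_leaves: "Ta (PhiP M) ` leaves = (\<lambda>x. (x, Bl)) ` outs M"
  unfolding leaves_def image_image by (rule image_cong) (auto simp: outs_props)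

lemma Td_PhiM: "Td (PhiM M) = Td (PhiP M) - leaves"
  unfolding PhiM_def Td_transform ings_reverse reverse_sel Td_PhiP leaves_def by auto

lemma Tbud_PhiM: "Tbud (PhiM M) = Tbud (PhiP M) \<union> Ta (PhiP M) ` leaves"
proof -
  have "{d \<in> Md M - rootface M. ing (reverse_outer M) (Ma M d)}
    = {d \<in> Md M - rootface M. ing M (Ma M d)} \<union> outs M"
  proof (intro equalityI subsetI)
    fix d assume "d \<in> {d \<in> Md M - rootface M. ing (reverse_outer M) (Ma M d)}"
    thus "d \<in> {d \<in> Md M - rootface M. ing M (Ma M d)} \<union> outs M"
      using ing_reverse[OF Ma_mem] outs_iff by auto
  next
    fix d assume d: "d \<in> {d \<in> Md M - rootface M. ing M (Ma M d)} \<union> outs M"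
    hence dD: "d \<in> Md M" "d \<notin> rootface M" using outs_ings ings_D outs_nonroot by auto
    have "Ma M d \<notin> outs M" using outs_iff[OF Ma_mem[OF dD(1)]] Ma_Ma dD by simp
    thus "d \<in> {d \<in> Md M - rootface M. ing (reverse_outer M) (Ma M d)}"
      using d dD ing_reverse[OF Ma_mem[OF dD(1)]] outs_iff[OF dD(1)] by auto
  qed
  thus ?thesis unfolding PhiM_def Tbud_transform reverse_sel Tbud_PhiP Ta_leaves by auto
qed

text \<open>Reversing an outer edge replaces the black-white edge in the inner face by a bud there,
  and its white end was an outer vertex, which is deleted. Elsewhere nothing changes, since an inner
  vertex is incident to no outer edge.\<close>

lemma pruned_PhiM: "pruned (PhiP M) leaves (PhiM M)"
  unfolding pruned_def
proof (intro conjI ballI)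
  show "Td (PhiM M) = Td (PhiP M) - leaves" by (rule Td_PhiM)
  show "Tbud (PhiM M) = Tbud (PhiP M) \<union> Ta (PhiP M) ` leaves" by (rule Tbud_PhiM)
  fix x assume x: "x \<in> Td (PhiM M)"
  obtain d t where dt: "x = (d, t)" by (cases x)
  show "Tblack (PhiM M) x = Tblack (PhiP M) x" using dt by (simp add: PhiM_def)
  show "Ts (PhiM M) x = Ts (PhiP M) x"
  proof (cases t)
    case Wh
    hence "d \<in> ings M - outs M" using x dt by (auto simp: Td_PhiM leaves_def)
    hence d: "d \<in> Md M" "vert M d \<inter> rootface M = {}" using inner_iff ings_D by auto
    have "ing (reverse_outer M) ((Ms M ^^ k) d) = ing M ((Ms M ^^ k) d)" for k
      by (rule inner_ing[OF d]) (simp add: vert_def s.orb_pow)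
    hence "nxt_in (reverse_outer M) d = nxt_in M d" by (simp add: nxt_in_def)
    thus ?thesis using dt Wh by (simp add: PhiM_def)
  next
    case Bl thus ?thesis using dt by (simp add: PhiM_def)
  qed
next
  fix x assume x: "x \<in> Td (PhiM M) - Tbud (PhiM M)"
  obtain d t where dt: "x = (d, t)" by (cases x)
  have "Ta (PhiM M) x = Ta (PhiP M) x \<and> Tw (PhiM M) x = Tw (PhiP M) x"
  proof (cases t)
    case Wh
    hence d: "d \<in> ings M" "d \<notin> outs M" using x dt by (auto simp: Td_PhiM leaves_def)
    have dD: "d \<in> Md M" using d ings_D by simp
    have r: "d \<notin> rootface M" "Ma M d \<notin> rootface M"
      using root_not_ing[of d] d outs_iff[OF dD] by (auto simp: ings_def)
    have "Ma M d \<notin> outs M" using outs_iff[OF Ma_mem[OF dD]] Ma_Ma[OF dD] r by simp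
    hence "ing (reverse_outer M) (Ma M d) = ing M (Ma M d)" using ing_reverse[OF Ma_mem[OF dD]] r by simp
    moreover have "Mw (reverse_outer M) d = Mw M d" using r by (simp add: reverse_outer_def outer_dart_def)
    ultimately show ?thesis using dt Wh by (simp add: PhiM_def)
  next
    case Bl
    hence d: "d \<in> Md M" "d \<notin> rootface M" using x dt by (auto simp: Td_PhiM)
    have "d \<notin> outs M" using x dt Bl by (auto simp: Tbud_PhiM Ta_leaves)
    hence "ing (reverse_outer M) d = ing M d" using ing_reverse d by simp
    thus ?thesis using dt Bl by (simp add: PhiM_def)
  qed
  thus "Ta (PhiM M) x = Ta (PhiP M) x" "Tw (PhiM M) x = Tw (PhiP M) x" by auto
qed

lemma nxt_outs: assumes "x \<in> outs M" shows "nxt_in M x = x"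
proof -
  have "nxt_in M x \<in> vert M x \<inter> ings M"
    using nxt_in_mem s.insec_orb[OF insec_nxt[of x]] assms outs_ings by (auto simp: vert_def)
  thus ?thesis using outs_props(3)[OF assms] by simp
qed

sublocale N: nmob "PhiP M"
  by (rule nmob_PhiP)

sublocale Q: prune "PhiP M" leaves "PhiM M"
proof
  show "pruned (PhiP M) leaves (PhiM M)" by (rule pruned_PhiM)
  show "leaves \<subseteq> Td (PhiP M)" using outs_ings by (auto simp: leaves_def)
  fix w assume "w \<in> leaves"
  then obtain x where "x \<in> outs M" "w = (x, Wh)" by (auto simp: leaves_def)
  thus "\<not> Tblack (PhiP M) w" "Ts (PhiP M) w = w" "Tblack (PhiP M) (Ta (PhiP M) w)"
    using nxt_outs outs_props(1) by auto
qed

text \<open>As many leaves are pruned as the root face has corners, which takes the excess from the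
  outer degree to its negative.\<close>

lemma excess_PhiM: "excess (PhiM M) = - int (card (rootface M))"
proof -
  have "card leaves = card (rootface M)"
    unfolding leaves_def using card_outs by (simp add: card_image inj_on_def)
  thus ?thesis using Q.excess' excess_PhiP by simp
qed

lemma black_verts_PhiM: "black_verts (PhiM M) = black_verts (PhiP M)"
proof -
  have "{x \<in> Td (PhiM M). Tblack (PhiM M) x} = {x \<in> Td (PhiP M). Tblack (PhiP M) x}"
    using Q.Tblack' Q.Lf_white by (auto simp: Td_PhiM)
  moreover have "mvert (PhiM M) x = mvert (PhiP M) x" if "x \<in> {x \<in> Td (PhiM M). Tblack (PhiM M) x}" for x
    using Q.orb_Ts' that by simp
  ultimately show ?thesis unfolding black_verts_def using image_cong[OF refl] by (metis (no_types, lifting))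
qed

lemma inner_verts_bij:
  "bij_betw (\<lambda>v. (\<lambda>d. (d, Wh)) ` (v \<inter> ings M)) (inner_verts M) (white_verts (PhiM M))"
proof -
  have "inner_verts M \<subseteq> verts M" by (auto simp: inner_verts_def)
  hence inj: "inj_on (\<lambda>v. (\<lambda>d. (d, Wh)) ` (v \<inter> ings M)) (inner_verts M)" using verts_inj inj_on_subset by blast
  have "{x \<in> Td (PhiM M). \<not> Tblack (PhiM M) x} = (\<lambda>d. (d, Wh)) ` (ings M - outs M)"
    by (auto simp: PhiM_def Td_transform ings_reverse)
  hence "white_verts (PhiM M) = mvert (PhiM M) ` (\<lambda>d. (d, Wh)) ` (ings M - outs M)"
    by (simp add: white_verts_def)
  hence "white_verts (PhiM M) = (\<lambda>h. mvert (PhiM M) (h, Wh)) ` (ings M - outs M)" by (simp add: image_image)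
  also have "\<dots> = (\<lambda>h. (\<lambda>d. (d, Wh)) ` (vert M h \<inter> ings M)) ` (ings M - outs M)"
  proof (rule image_cong[OF refl])
    fix h assume h: "h \<in> ings M - outs M"
    have "mvert (PhiM M) (h, Wh) = mvert (PhiP M) (h, Wh)"
      by (rule Q.orb_Ts') (use h in \<open>auto simp: Td_PhiM leaves_def\<close>)
    thus "mvert (PhiM M) (h, Wh) = (\<lambda>d. (d, Wh)) ` (vert M h \<inter> ings M)" using mvert_W h by simp
  qed
  also have "\<dots> = (\<lambda>v. (\<lambda>d. (d, Wh)) ` (v \<inter> ings M)) ` vert M ` (ings M - outs M)" by (simp add: image_image)
  also have "vert M ` (ings M - outs M) = inner_verts M"
  proof
    show "vert M ` (ings M - outs M) \<subseteq> inner_verts M"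
      using inner_iff ings_D by (auto simp: inner_verts_def verts_def)
    show "inner_verts M \<subseteq> vert M ` (ings M - outs M)"
    proof
      fix v assume v: "v \<in> inner_verts M"
      then obtain d where d: "d \<in> Md M" "v = vert M d" by (auto simp: inner_verts_def verts_def)
      obtain h where h: "h \<in> vert M d" "h \<in> ings M" using vin d by blast
      have e: "vert M h = v" using vert_eq d h by simp
      hence "h \<notin> outs M" using inner_iff[OF h(2)] v by (simp add: inner_verts_def)
      thus "v \<in> vert M ` (ings M - outs M)" using h e by blast
    qed
  qed
  finally show ?thesis using inj by (simp add: bij_betw_def)
qed

lemma inner_vert_weight:
  assumes "v \<in> inner_verts M"
  shows "sum (Tw (PhiM M)) ((\<lambda>d. (d, Wh)) ` (v \<inter> ings M) - Tbud (PhiM M)) = sum (Mw M) v"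
proof -
  have v: "v \<in> verts M" "v \<inter> rootface M = {}" using assms by (auto simp: inner_verts_def)
  have no: "d \<notin> outs M" if "d \<in> v \<inter> ings M" for d
  proof -
    obtain e where "e \<in> Md M" "v = vert M e" using v by (auto simp: verts_def)
    hence "vert M d = v" using that vert_eq by auto
    thus ?thesis using inner_iff[of d] that v by auto
  qed
  have nb: "(\<lambda>d. (d, Wh)) ` (v \<inter> ings M) - Tbud (PhiM M) = (\<lambda>d. (d, Wh)) ` (v \<inter> ings M)"
    by (auto simp: Tbud_PhiM Ta_leaves)
  have nb': "(\<lambda>d. (d, Wh)) ` (v \<inter> ings M) - Tbud (PhiP M) = (\<lambda>d. (d, Wh)) ` (v \<inter> ings M)" by auto
  have "sum (Tw (PhiM M)) ((\<lambda>d. (d, Wh)) ` (v \<inter> ings M)) = sum (Tw (PhiP M)) ((\<lambda>d. (d, Wh)) ` (v \<inter> ings M))"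
  proof (rule sum.cong[OF refl])
    fix x assume x: "x \<in> (\<lambda>d. (d, Wh)) ` (v \<inter> ings M)"
    hence "x \<in> Td (PhiM M)" using no by (auto simp: Td_PhiM leaves_def)
    moreover have "x \<notin> Tbud (PhiM M)" using x unfolding Tbud_PhiM Ta_leaves by auto
    ultimately show "Tw (PhiM M) x = Tw (PhiP M) x" by (rule Q.Tw')
  qed
  thus ?thesis using vert_weight[OF v(1)] nb nb' by simp
qed

lemma inner_edges_alt: "inner_edges M = (\<lambda>d. {d, Ma M d}) ` {d \<in> Md M. d \<notin> rootface M \<and> Ma M d \<notin> rootface M}"
  unfolding inner_edges_def edges_def by auto

lemma nonbud_PhiM:
  "Td (PhiM M) - Tbud (PhiM M) = hedge ` {d \<in> Md M. d \<notin> rootface M \<and> Ma M d \<notin> rootface M}"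
proof -
  have "Td (PhiM M) - Tbud (PhiM M) = (Td (PhiP M) - Tbud (PhiP M)) - (leaves \<union> Ta (PhiP M) ` leaves)"
    by (auto simp: Td_PhiM Tbud_PhiM)
  also have "\<dots> = hedge ` Md M - (leaves \<union> Ta (PhiP M) ` leaves)" using hedge_bij by (simp add: bij_betw_def)
  also have "leaves = hedge ` outs M"
    unfolding leaves_def using outs_ings by (intro image_cong) (auto simp: hedge_def ings_def)
  also have "Ta (PhiP M) ` hedge ` outs M = hedge ` rootface M"
  proof -
    have "Ta (PhiP M) ` hedge ` outs M = (\<lambda>x. hedge (Ma M x)) ` outs M"
      unfolding image_image using outs_ings ings_D by (intro image_cong) (auto simp: hedge_Ta)
    also have "\<dots> = hedge ` Ma M ` outs M" by (simp add: image_image)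
    also have "Ma M ` outs M = rootface M"
      unfolding outs_def image_image using Ma_Ma root_sub by (auto intro!: image_eqI)
    finally show ?thesis .
  qed
  also have "hedge ` Md M - (hedge ` outs M \<union> hedge ` rootface M) = hedge ` (Md M - (outs M \<union> rootface M))"
  proof -
    have "outs M \<union> rootface M \<subseteq> Md M" using outs_ings ings_D root_sub by auto
    thus ?thesis using inj_on_image_set_diff[of hedge "Md M" "Md M" "outs M \<union> rootface M"] hedge_bij
      by (simp add: bij_betw_def image_Un)
  qed
  also have "Md M - (outs M \<union> rootface M) = {d \<in> Md M. d \<notin> rootface M \<and> Ma M d \<notin> rootface M}"
    using outs_iff by auto
  finally show ?thesis .
qed

lemma inner_edges_bij: "bij_betw ((`) hedge) (inner_edges M) (medges (PhiM M))"
proof -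
  let ?D = "{d \<in> Md M. d \<notin> rootface M \<and> Ma M d \<notin> rootface M}"
  have "inj_on ((`) hedge) (inner_edges M)"
    using edges_bij by (auto simp: bij_betw_def inner_edges_def intro: inj_on_subset)
  moreover have "(`) hedge ` inner_edges M = medges (PhiM M)"
  proof -
    have "medges (PhiM M) = (\<lambda>x. {x, Ta (PhiM M) x}) ` hedge ` ?D"
      unfolding medges_def nonbud_PhiM ..
    also have "\<dots> = (\<lambda>x. {x, Ta (PhiP M) x}) ` hedge ` ?D"
    proof (rule image_cong[OF refl])
      fix x assume "x \<in> hedge ` ?D"
      hence "x \<in> Td (PhiM M) - Tbud (PhiM M)" using nonbud_PhiM by simp
      thus "{x, Ta (PhiM M) x} = {x, Ta (PhiP M) x}" using Q.Ta' by simp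
    qed
    also have "\<dots> = (\<lambda>d. {hedge d, hedge (Ma M d)}) ` ?D"
      unfolding image_image by (rule image_cong) (auto simp: hedge_Ta)
    finally show ?thesis by (simp add: inner_edges_alt image_image)
  qed
  ultimately show ?thesis by (simp add: bij_betw_def)
qed

lemma inner_edge_weight: assumes "e \<in> inner_edges M" shows "sum (Tw (PhiM M)) (hedge ` e) = sum (Mw M) e"
proof -
  have e: "e \<in> edges M" using assms by (auto simp: inner_edges_def)
  have "sum (Tw (PhiM M)) (hedge ` e) = sum (Tw (PhiP M)) (hedge ` e)"
  proof (rule sum.cong[OF refl])
    fix x assume x: "x \<in> hedge ` e"
    obtain d where d: "d \<in> Md M" "d \<notin> rootface M" "Ma M d \<notin> rootface M" "e = {d, Ma M d}"
      using assms inner_edges_alt by auto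
    have "x \<in> Td (PhiM M) - Tbud (PhiM M)"
      unfolding nonbud_PhiM using x d Ma_mem Ma_Ma by auto
    thus "Tw (PhiM M) x = Tw (PhiP M) x" using Q.Tw' by simp
  qed
  thus ?thesis using edge_weight[OF e] by simp
qed

end

lemma inBt_adm: "inBt M \<Longrightarrow> adm M"
  by (simp add: inBt_def inB_iff_gmap gmap_gm adm_def adm_axioms_def)

section \<open>Cyclic words and parenthesis matching\<close>

text \<open>A cyclic word with -1 as opening parenthesis, 1 as closing parenthesis and 0 as neutral
  letter. For a mobile these will be the buds, the white corners and the other black half-edges
  along the contour.\<close>

locale word = fperm r X for r :: "'a \<Rightarrow> 'a" and X +
  fixes v :: "'a \<Rightarrow> int"
  assumes single: "x \<in> X \<Longrightarrow> y \<in> X \<Longrightarrow> y \<in> orb r x"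
    and vals: "x \<in> X \<Longrightarrow> v x = -1 \<or> v x = 0 \<or> v x = 1"
begin

definition P :: "'a \<Rightarrow> nat \<Rightarrow> int" where
  "P x n = (\<Sum>i<n. v ((r ^^ i) x))"

lemma P_0 [simp]: "P x 0 = 0"
  by (simp add: P_def)

lemma P_Suc: "P x (Suc n) = P x n + v ((r ^^ n) x)"
  by (simp add: P_def)

lemma P_add: "P x (n + m) = P x n + P ((r ^^ n) x) m"
proof (induction m)
  case (Suc m)
  have "(r ^^ (n + m)) x = (r ^^ m) ((r ^^ n) x)" by (metis add.commute comp_apply funpow_add)
  thus ?case using Suc by (simp add: P_Suc)
qed simp

lemma P_front: "P x (Suc n) = v x + P (r x) n"
  using P_add[of x 1 n] by (simp add: P_Suc)

lemma enum: assumes "x \<in> X"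
  shows "bij_betw (\<lambda>i. (r ^^ i) x) {..<card X} X" "(r ^^ card X) x = x"
proof -
  define n where "n = (LEAST n. 0 < n \<and> (r ^^ n) x = x)"
  have n: "0 < n \<and> (r ^^ n) x = x" unfolding n_def by (rule LeastI_ex) (use period[OF assms] in blast)
  have lt: "0 < i \<Longrightarrow> i < n \<Longrightarrow> (r ^^ i) x \<noteq> x" for i unfolding n_def using not_less_Least by blast
  have inj: "inj_on (\<lambda>i. (r ^^ i) x) {..<n}"
  proof (rule linorder_inj_onI)
    fix i j assume ij: "i < j" "i \<in> {..<n}" "j \<in> {..<n}"
    show "(r ^^ i) x \<noteq> (r ^^ j) x"
    proof
      assume "(r ^^ i) x = (r ^^ j) x"
      hence "x = (r ^^ (j - i)) x" using pow_cancel assms ij(1) by simp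
      moreover have "0 < j - i" "j - i < n" using ij by auto
      ultimately show False using lt[of "j - i"] by simp
    qed
  qed auto
  have im: "(\<lambda>i. (r ^^ i) x) ` {..<n} = X"
  proof
    show "(\<lambda>i. (r ^^ i) x) ` {..<n} \<subseteq> X" using pow_mem assms by auto
    have "orb r x \<subseteq> (\<lambda>i. (r ^^ i) x) ` {..<n}"
    proof (rule orb_least)
      show "x \<in> (\<lambda>i. (r ^^ i) x) ` {..<n}" using n by (intro image_eqI[of _ _ 0]) auto
      fix y assume "y \<in> (\<lambda>i. (r ^^ i) x) ` {..<n}"
      then obtain i where i: "i < n" "y = (r ^^ i) x" by auto
      show "r y \<in> (\<lambda>i. (r ^^ i) x) ` {..<n}"
      proof (cases "Suc i = n")
        case True
        hence "r y = (r ^^ 0) x" using i n by auto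
        thus ?thesis using n by (intro image_eqI[of _ _ 0]) auto
      next
        case False thus ?thesis using i by (intro image_eqI[of _ _ "Suc i"]) auto
      qed
    qed
    thus "X \<subseteq> (\<lambda>i. (r ^^ i) x) ` {..<n}" using single assms by blast
  qed
  have "card X = n" using card_image[OF inj] im by simp
  thus "bij_betw (\<lambda>i. (r ^^ i) x) {..<card X} X" "(r ^^ card X) x = x"
    using inj im n by (auto simp: bij_betw_def)
qed

lemma P_total: "x \<in> X \<Longrightarrow> P x (card X) = sum v X"
  unfolding P_def using sum.reindex_bij_betw[OF enum(1)] .

text \<open>\<open>b\<close> and \<open>y\<close> are matching parentheses: the word from
  \<open>b\<close> to \<open>y\<close> has sum zero, and every shorter nonempty prefix is
  negative.\<close>

definition arc :: "'a \<Rightarrow> 'a \<Rightarrow> bool" where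
  "arc b y \<longleftrightarrow> (\<exists>n. (r ^^ n) b = y \<and> P b (Suc n) = 0 \<and> (\<forall>m. 0 < m \<and> m \<le> n \<longrightarrow> P b m \<le> -1))"

lemma arc_inj:
  assumes "arc b y" "arc b' y" "b \<in> X" "b' \<in> X" shows "b = b'"
proof -
  have *: "b = b'" if n: "(r ^^ n) b = y" "P b (Suc n) = 0"
    and m: "(r ^^ m) b' = y" "P b' (Suc m) = 0" "\<forall>k. 0 < k \<and> k \<le> m \<longrightarrow> P b' k \<le> -1"
    and le: "n \<le> m" and D: "b \<in> X" "b' \<in> X" for b b' n m
  proof (cases "n = m")
    case True thus ?thesis using n m D pow_inj by metis
  next
    case False
    have b: "b = (r ^^ (m - n)) b'" using pow_cancel[OF D] n m le by simp
    have "P b' (Suc m) = P b' (m - n) + P b (Suc n)"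
      using P_add[of b' "m - n" "Suc n"] le unfolding b[symmetric] by simp
    hence "P b' (m - n) = 0" using n m by simp
    thus ?thesis using m(3)[rule_format, of "m - n"] False le by simp
  qed
  obtain n m where n: "(r ^^ n) b = y" "P b (Suc n) = 0" "\<forall>k. 0 < k \<and> k \<le> n \<longrightarrow> P b k \<le> -1"
    and m: "(r ^^ m) b' = y" "P b' (Suc m) = 0" "\<forall>k. 0 < k \<and> k \<le> m \<longrightarrow> P b' k \<le> -1"
    using assms unfolding arc_def by blast
  show ?thesis using *[OF n(1,2) m _ assms(3,4)] *[OF m(1,2) n _ assms(4,3)] by (cases "n \<le> m") auto
qed

lemma arc_fun:
  assumes "arc b y" "arc b y'" shows "y = y'"
proof -
  obtain n m where n: "(r ^^ n) b = y" "P b (Suc n) = 0" "\<forall>k. 0 < k \<and> k \<le> n \<longrightarrow> P b k \<le> -1"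
    and m: "(r ^^ m) b = y'" "P b (Suc m) = 0" "\<forall>k. 0 < k \<and> k \<le> m \<longrightarrow> P b k \<le> -1"
    using assms unfolding arc_def by blast
  have "\<not> n < m" using m(3)[rule_format, of "Suc n"] n(2) by auto
  moreover have "\<not> m < n" using n(3)[rule_format, of "Suc m"] m(2) by auto
  ultimately show ?thesis using n m by simp
qed

text \<open>Take the shortest word ending at \<open>y\<close> with sum at most zero. Its proper
  suffixes are positive, so its first letter is -1, its sum is exactly zero and its proper prefixes
  are negative.\<close>

lemma arc_ex:
  assumes y: "y \<in> X" "v y = 1" and z: "z \<in> X" "(r ^^ n) z = y" "P z (Suc n) \<le> 0"
  shows "\<exists>b\<in>X. v b = -1 \<and> arc b y"
proof -
  let ?Q = "\<lambda>n. \<exists>z\<in>X. (r ^^ n) z = y \<and> P z (Suc n) \<le> 0"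
  define k where "k = (LEAST n. ?Q n)"
  have "?Q k" unfolding k_def by (rule LeastI_ex) (use z in blast)
  then obtain b where b: "b \<in> X" "(r ^^ k) b = y" "P b (Suc k) \<le> 0" by blast
  have mn: "\<not> ?Q i" if "i < k" for i using that not_less_Least unfolding k_def by blast
  have suf: "P ((r ^^ m) b) (Suc (k - m)) \<ge> 1" if "0 < m" "m \<le> k" for m
  proof -
    have "(r ^^ (k - m)) ((r ^^ m) b) = y" using b(2) that by (metis comp_apply funpow_add le_add_diff_inverse2)
    moreover have "(r ^^ m) b \<in> X" using pow_mem b by simp
    ultimately show ?thesis using mn[of "k - m"] that by force
  qed
  have k: "k > 0"
  proof (rule ccontr)
    assume "\<not> k > 0"
    thus False using b y by (simp add: P_Suc)
  qed
  have "P b (Suc k) = v b + P (r b) k" by (rule P_front)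
  moreover have "P (r b) k \<ge> 1" using suf[of 1] k by simp
  ultimately have vb: "v b = -1" "P b (Suc k) = 0" using b(3) vals[OF b(1)] by auto
  have "P b m \<le> -1" if m: "0 < m" "m \<le> k" for m
    using P_add[of b m "Suc (k - m)"] suf[OF m] vb m by (simp add: Suc_diff_le)
  hence "arc b y" unfolding arc_def using b vb by blast
  thus ?thesis using b vb by blast
qed

text \<open>The unmatched closing parentheses; by \<open>arc_ex\<close> every word ending in one of
  them has positive sum.\<close>

definition U :: "'a set" where
  "U = {y \<in> X. v y = 1 \<and> \<not> (\<exists>b\<in>X. v b = -1 \<and> arc b y)}"

lemma U_suffix: "y \<in> U \<Longrightarrow> z \<in> X \<Longrightarrow> (r ^^ n) z = y \<Longrightarrow> P z (Suc n) \<ge> 1"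
  using arc_ex[of y z n] unfolding U_def by force

lemma U_X: "u \<in> U \<Longrightarrow> u \<in> X"
  by (simp add: U_def)

end

locale posword = word +
  assumes total_pos: "sum v X > 0"
begin

text \<open>First passage to level 1, which exists because a full turn has positive sum. The letter
  \<open>c x\<close> reached then is the first closing parenthesis not matched within the word read
  from \<open>x\<close>.\<close>

definition n1 :: "'a \<Rightarrow> nat" where
  "n1 x = (LEAST n. P x n \<ge> 1)"

definition c :: "'a \<Rightarrow> 'a" where
  "c x = (r ^^ (n1 x - 1)) x"

lemma n1: assumes "x \<in> X" shows "P x (n1 x) = 1" "i < n1 x \<Longrightarrow> P x i \<le> 0" "0 < n1 x"
proof -
  have "P x (card X) \<ge> 1" using P_total[OF assms] total_pos by simp
  hence ge: "P x (n1 x) \<ge> 1" unfolding n1_def by (rule LeastI)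
  show lt: "P x i \<le> 0" if "i < n1 x" for i using not_less_Least[of i "\<lambda>n. P x n \<ge> 1"] that unfolding n1_def by simp
  show pos: "0 < n1 x" using ge by (cases "n1 x") auto
  then obtain k where k: "n1 x = Suc k" by (cases "n1 x") auto
  have "P x k \<le> 0" using lt k by simp
  moreover have "v ((r ^^ k) x) \<le> 1" using vals[OF pow_mem[OF assms, of k]] by auto
  ultimately show "P x (n1 x) = 1" using ge k by (simp add: P_Suc)
qed

lemma n1_eqI: "P x n = 1 \<Longrightarrow> (\<And>i. i < n \<Longrightarrow> P x i \<le> 0) \<Longrightarrow> n1 x = n"
  unfolding n1_def by (rule Least_equality) (auto simp: not_le[symmetric] intro: ccontr, force)

lemma c_mem: "x \<in> X \<Longrightarrow> c x \<in> X"
  unfolding c_def by (rule pow_mem)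

lemma r_c: assumes "x \<in> X" shows "r (c x) = (r ^^ n1 x) x"
  using n1(3)[OF assms] unfolding c_def by (cases "n1 x") auto

lemma c_white: assumes "x \<in> X" shows "v (c x) = 1"
proof -
  obtain k where k: "n1 x = Suc k" using n1(3)[OF assms] by (cases "n1 x") auto
  have "P x k \<le> 0" "P x (Suc k) = 1" using n1[OF assms] k by auto
  thus ?thesis using vals[OF pow_mem[OF assms, of k]] k by (auto simp: c_def P_Suc)
qed

lemma c_1: assumes "x \<in> X" "v x = 1" shows "c x = x" "n1 x = 1"
proof -
  show "n1 x = 1" by (rule n1_eqI) (use assms in \<open>auto simp: P_Suc\<close>)
  thus "c x = x" by (simp add: c_def)
qed

lemma c_0: assumes "x \<in> X" "v x = 0" shows "c x = c (r x)" "n1 x = Suc (n1 (r x))"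
proof -
  have rX: "r x \<in> X" using mem assms by simp
  show e: "n1 x = Suc (n1 (r x))"
  proof (rule n1_eqI)
    show "P x (Suc (n1 (r x))) = 1" using P_front n1(1)[OF rX] assms by simp
    show "P x i \<le> 0" if "i < Suc (n1 (r x))" for i
      using that n1(2)[OF rX] assms by (cases i) (auto simp: P_front)
  qed
  have "(r ^^ n1 (r x)) x = (r ^^ (n1 (r x) - 1)) (r x)"
    using n1(3)[OF rX] by (cases "n1 (r x)") (auto simp: funpow_swap1)
  thus "c x = c (r x)" using e by (simp add: c_def)
qed

text \<open>From level -1 the sums first return to 0, at the partner \<open>c (r x)\<close> of
  \<open>x\<close>, and afterwards need one more first passage. The decrease of \<open>n1\<close> is
  the measure for the induction around vertices of the closure.\<close>

lemma c_m1: assumes "x \<in> X" "v x = -1"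
  shows "c x = c (r (c (r x)))" "n1 (r (c (r x))) < n1 x"
proof -
  have rX: "r x \<in> X" using mem assms by simp
  define y where "y = r (c (r x))"
  have yX: "y \<in> X" using mem c_mem rX by (simp add: y_def)
  have y: "y = (r ^^ n1 (r x)) (r x)" using r_c[OF rX] by (simp add: y_def)
  have e: "n1 x = Suc (n1 (r x) + n1 y)"
  proof (rule n1_eqI)
    show "P x (Suc (n1 (r x) + n1 y)) = 1"
      using P_front P_add[of "r x" "n1 (r x)" "n1 y"] n1(1)[OF rX] n1(1)[OF yX] assms y by simp
    show "P x i \<le> 0" if i: "i < Suc (n1 (r x) + n1 y)" for i
    proof (cases i)
      case (Suc j)
      show ?thesis
      proof (cases "j < n1 (r x)")
        case True
        have "P (r x) j \<le> 0" by (rule n1(2)[OF rX True])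
        thus ?thesis using Suc assms by (simp add: P_front)
      next
        case False
        define k where "k = j - n1 (r x)"
        have "j = n1 (r x) + k" "k < n1 y" using False i Suc by (auto simp: k_def)
        thus ?thesis using Suc P_front[of x j] P_add[of "r x" "n1 (r x)" k] n1(1)[OF rX] n1(2)[OF yX, of k] assms y by simp
      qed
    qed simp
  qed
  show "n1 (r (c (r x))) < n1 x" using e by (simp add: y_def)
  have "c x = (r ^^ (n1 (r x) + n1 y)) x" using e by (simp add: c_def)
  also have "\<dots> = (r ^^ (n1 (r x) + (n1 y - 1))) (r x)"
    using n1(3)[OF yX] by (cases "n1 y") (auto simp: funpow_swap1)
  also have "\<dots> = (r ^^ (n1 y - 1)) y"
    unfolding y by (metis add.commute comp_apply funpow_add)
  finally show "c x = c (r (c (r x)))" by (simp add: c_def y_def)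
qed

lemma arc_c: assumes "b \<in> X" "v b = -1" shows "arc b (c (r b))"
  unfolding arc_def
proof (intro exI[of _ "n1 (r b)"] conjI allI impI)
  have rX: "r b \<in> X" using mem assms by simp
  show "(r ^^ n1 (r b)) b = c (r b)"
    using n1(3)[OF rX] unfolding c_def by (cases "n1 (r b)") (auto simp: funpow_swap1)
  show "P b (Suc (n1 (r b))) = 0" using P_front n1(1)[OF rX] assms by simp
  show "P b m \<le> -1" if "0 < m \<and> m \<le> n1 (r b)" for m
    using that n1(2)[OF rX] assms by (cases m) (auto simp: P_front)
qed

text \<open>The parent function of the nesting: an opening parenthesis goes to its partner, a
  closing one to the closing parenthesis of the pair directly around it, or to the next unmatched
  one if no pair surrounds it.\<close>

definition q :: "'a \<Rightarrow> 'a" where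
  "q y = c (r y)"

lemma q_pos: assumes "y \<in> X" shows "q y = (r ^^ n1 (r y)) y"
  using n1(3)[OF mem[OF assms]] unfolding q_def c_def by (cases "n1 (r y)") (auto simp: funpow_swap1)

lemma q_mem: "y \<in> X \<Longrightarrow> q y \<in> X"
  by (simp add: q_def c_mem mem)

text \<open>A word ending at \<open>q y\<close> that starts after \<open>y\<close> is a suffix of a
  first passage to level 1 and hence positive. A word that contains \<open>y\<close> gets exactly 1
  from the part after \<open>y\<close>.\<close>

lemma q_suffix:
  assumes y: "y \<in> X" and z: "z \<in> X" "(r ^^ k) z = q y"
  shows "(k < n1 (r y) \<and> P z (Suc k) \<ge> 1) \<or>
    (n1 (r y) \<le> k \<and> (r ^^ (k - n1 (r y))) z = y \<and> P z (Suc k) = P z (Suc (k - n1 (r y))) + 1)"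
proof -
  let ?n = "n1 (r y)"
  have rX: "r y \<in> X" using mem y by simp
  have e: "(r ^^ k) z = (r ^^ ?n) y" using z q_pos y by simp
  show ?thesis
  proof (cases "k < ?n")
    case True
    have "z = (r ^^ (?n - k)) y" using pow_cancel[OF z(1) y e] True by simp
    moreover have "?n - k = Suc (?n - k - 1)" using True by simp
    ultimately have z': "z = (r ^^ (?n - k - 1)) (r y)" by (metis funpow_swap1 funpow.simps(2) comp_apply)
    have "P (r y) ((?n - k - 1) + Suc k) = P (r y) (?n - k - 1) + P z (Suc k)"
      unfolding z' by (rule P_add)
    moreover have "(?n - k - 1) + Suc k = ?n" using True by simp
    ultimately show ?thesis using n1(1)[OF rX] n1(2)[OF rX, of "?n - k - 1"] True by simp
  next
    case False
    have y': "y = (r ^^ (k - ?n)) z" using pow_cancel[OF y z(1) e[symmetric]] False by simp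
    have "P z (Suc (k - ?n) + ?n) = P z (Suc (k - ?n)) + P (r y) ?n"
      using P_add[of z "Suc (k - ?n)" ?n] y' by simp
    moreover have "Suc (k - ?n) + ?n = Suc k" using False by simp
    ultimately show ?thesis using False y' n1(1)[OF rX] by simp
  qed
qed

lemma not_U_if: "y \<in> X \<Longrightarrow> v y = 1 \<Longrightarrow> y \<notin> U \<Longrightarrow> \<exists>b\<in>X. v b = -1 \<and> c (r b) = y"
  using arc_c arc_fun unfolding U_def by blast

lemma U_I: assumes "y \<in> X" "v y = 1" "\<And>z n. z \<in> X \<Longrightarrow> (r ^^ n) z = y \<Longrightarrow> P z (Suc n) \<ge> 1" shows "y \<in> U"
proof -
  have "\<not> arc b y" if b: "b \<in> X" for b
  proof
    assume "arc b y"
    then obtain n where "(r ^^ n) b = y" "P b (Suc n) = 0" by (auto simp: arc_def)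
    thus False using assms(3)[OF b] by force
  qed
  thus ?thesis using assms by (auto simp: U_def)
qed

lemma q_U: assumes "y \<in> U" shows "q y \<in> U"
proof (rule U_I)
  have yX: "y \<in> X" using assms U_X by simp
  show "q y \<in> X" by (rule q_mem[OF yX])
  show "v (q y) = 1" unfolding q_def by (rule c_white[OF mem[OF yX]])
  show "P z (Suc n) \<ge> 1" if z: "z \<in> X" "(r ^^ n) z = q y" for z n
    using q_suffix[OF yX z] U_suffix[OF assms z(1)] by fastforce
qed

lemma q_inj: "inj_on q U"
proof -
  have *: "y = y'" if yy: "y \<in> U" "y' \<in> U" "q y = q y'" and le: "n1 (r y) \<le> n1 (r y')" for y y'
  proof -
    let ?n = "n1 (r y)" and ?m = "n1 (r y')"
    have X: "y \<in> X" "y' \<in> X" using yy U_X by auto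
    have e: "(r ^^ ?n) y = (r ^^ ?m) y'" using q_pos X yy by simp
    hence y: "y = (r ^^ (?m - ?n)) y'" using pow_cancel[OF X e le] by simp
    show ?thesis
    proof (cases "?n = ?m")
      case True thus ?thesis using y by simp
    next
      case False
      hence s: "?m - ?n = Suc (?m - ?n - 1)" using le by simp
      have "(r ^^ (?m - ?n - 1)) (r y') = y" using y s by (metis funpow_swap1 funpow.simps(2) comp_apply)
      hence "P (r y') (?m - ?n) \<ge> 1" using U_suffix[OF yy(1) mem[OF X(2)]] s by metis
      moreover have "?m - ?n < ?m" using n1(3)[OF mem[OF X(1)]] le by simp
      ultimately show ?thesis using n1(2)[OF mem[OF X(2)]] by force
    qed
  qed
  show ?thesis
  proof (rule inj_onI)
    fix x y assume "x \<in> U" "y \<in> U" "q x = q y"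
    thus "x = y" using *[of x y] *[of y x] by (cases "n1 (r x) \<le> n1 (r y)") auto
  qed
qed

lemma q_fperm: "fperm q U"
proof (rule fpermI)
  show "finite U" using fin by (auto simp: U_def)
qed (use q_U q_inj in auto)

text \<open>On \<open>U\<close> the map \<open>q\<close> proceeds to the next unmatched parenthesis.
  None is skipped: words ending in \<open>U\<close> are positive, while the sums before a first
  passage are not. This cycle becomes the contour of the root face.\<close>

lemma U_cycle:
  assumes "y \<in> U" "u \<in> U" shows "u \<in> orb q y"
proof -
  interpret u: fperm q U by (rule q_fperm)
  obtain t where t: "u = (r ^^ t) y" using single[of y u] assms U_X by (auto simp: orb_def)
  from assms(1) t show ?thesis
  proof (induction t arbitrary: y rule: less_induct)
    case (less t y)
    have yX: "y \<in> X" using less U_X by simp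
    let ?n = "n1 (r y)"
    show ?case
    proof (cases "t = 0")
      case True thus ?thesis using less(3) u.orb_refl by simp
    next
      case False
      have "?n \<le> t"
      proof (rule ccontr)
        assume a: "\<not> ?n \<le> t"
        obtain k where k: "t = Suc k" using False by (cases t) auto
        have "(r ^^ k) (r y) = u" using less(3) k by (simp add: funpow_swap1)
        hence "P (r y) t \<ge> 1" using U_suffix[OF assms(2) mem[OF yX]] k by simp
        thus False using n1(2)[OF mem[OF yX], of t] a by simp
      qed
      have "u = (r ^^ (t - ?n)) (q y)"
        using less(3) \<open>?n \<le> t\<close> q_pos[OF yX] by (metis comp_apply funpow_add le_add_diff_inverse2)
      moreover have "t - ?n < t" using n1(3)[OF mem[OF yX]] False by simp
      ultimately have "u \<in> orb q (q y)" using less(1) q_U[OF less(2)] by blast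
      thus ?thesis using u.orb_f_eq[OF less(2)] by simp
    qed
  qed
qed

text \<open>Each application of \<open>q\<close> makes the words of one more length that end at the
  current letter positive. Once all lengths up to a full turn are covered, longer words only add the
  positive total.\<close>

lemma reach_U: assumes "y \<in> X" "v y = 1" shows "\<exists>n. (q ^^ n) y \<in> U"
proof -
  define H where "H m y \<longleftrightarrow> y \<in> X \<and> v y = 1 \<and> (\<forall>z\<in>X. \<forall>k<m. (r ^^ k) z = y \<longrightarrow> P z (Suc k) \<ge> 1)" for m y
  have st: "H (Suc m) (q y)" if h: "H m y" for m y
  proof -
    have yX: "y \<in> X" using h by (simp add: H_def)
    have "P z (Suc k) \<ge> 1" if z: "z \<in> X" "(r ^^ k) z = q y" and k: "k < Suc m" for z k
    proof -
      have "n1 (r y) \<le> k \<Longrightarrow> k - n1 (r y) < m" using n1(3)[OF mem[OF yX]] k by simp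
      thus ?thesis using q_suffix[OF yX z] h z(1) unfolding H_def by fastforce
    qed
    thus ?thesis using q_mem[OF yX] c_white[OF mem[OF yX]] by (simp add: H_def q_def)
  qed
  have "H 0 y" using assms by (simp add: H_def)
  hence HN: "H n ((q ^^ n) y)" for n by (induction n) (auto intro: st)
  let ?y = "(q ^^ card X) y"
  have h: "H (card X) ?y" by (rule HN)
  have "?y \<in> U"
  proof (rule U_I)
    show "?y \<in> X" "v ?y = 1" using h by (auto simp: H_def)
    show "P z (Suc n) \<ge> 1" if z: "z \<in> X" "(r ^^ n) z = ?y" for z n
      using z(2)
    proof (induction n rule: less_induct)
      case (less n)
      show ?case
      proof (cases "n < card X")
        case True thus ?thesis using h z less by (simp add: H_def)
      next
        case False
        hence n: "n = card X + (n - card X)" by simp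
        have "(r ^^ n) z = (r ^^ (n - card X)) ((r ^^ card X) z)"
          using n by (metis add.commute comp_apply funpow_add)
        hence e: "(r ^^ (n - card X)) z = ?y" using enum(2)[OF z(1)] less(2) by simp
        have "card X > 0" using z fin by (auto simp: card_gt_0_iff)
        hence "P z (Suc (n - card X)) \<ge> 1" using less(1)[OF _ e] n by simp
        moreover have "P z (card X + Suc (n - card X)) = P z (card X) + P z (Suc (n - card X))"
          using P_add[of z "card X" "Suc (n - card X)"] enum(2)[OF z(1)] by simp
        hence "P z (Suc n) = sum v X + P z (Suc (n - card X))" using n P_total[OF z(1)] by simp
        ultimately show ?thesis using total_pos by simp
      qed
    qed
  qed
  thus ?thesis by blast
qed

definition V1 :: "'a set" where
  "V1 = {b \<in> X. v b = -1} \<union> U"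

lemma V1_X: "x \<in> V1 \<Longrightarrow> x \<in> X"
  by (auto simp: V1_def U_X)

text \<open>Every closing parenthesis is the partner of one opening parenthesis or belongs to
  \<open>U\<close>, where \<open>q\<close> is a permutation.\<close>

lemma q_bij: "bij_betw q V1 {y \<in> X. v y = 1}"
  unfolding bij_betw_def
proof
  have nb: "q b \<notin> U" if "b \<in> X" "v b = -1" for b
    using arc_c[OF that] that unfolding U_def q_def by blast
  show "inj_on q V1"
  proof (rule inj_onI)
    fix x y assume xy: "x \<in> V1" "y \<in> V1" "q x = q y"
    have ex: "x \<in> U \<longleftrightarrow> y \<in> U" using xy nb q_U unfolding V1_def by (metis (mono_tags, lifting) UnE mem_Collect_eq)
    show "x = y"
    proof (cases "x \<in> U")
      case True thus ?thesis using ex xy q_inj by (auto simp: inj_on_def)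
    next
      case False
      hence b: "x \<in> X" "v x = -1" "y \<in> X" "v y = -1" using ex xy by (auto simp: V1_def)
      have "arc x (q x)" "arc y (q x)" using arc_c[OF b(1,2)] arc_c[OF b(3,4)] xy(3) by (simp_all add: q_def)
      thus ?thesis using arc_inj b by blast
    qed
  qed
  show "q ` V1 = {y \<in> X. v y = 1}"
  proof
    show "q ` V1 \<subseteq> {y \<in> X. v y = 1}" using q_mem c_white mem V1_X by (auto simp: q_def)
    show "{y \<in> X. v y = 1} \<subseteq> q ` V1"
    proof
      fix y assume y: "y \<in> {y \<in> X. v y = 1}"
      show "y \<in> q ` V1"
      proof (cases "y \<in> U")
        case True
        then obtain u where "u \<in> U" "q u = y" using fperm.surj[OF q_fperm] by blast
        thus ?thesis by (auto simp: V1_def)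
      next
        case False
        then obtain b where "b \<in> X" "v b = -1" "q b = y" using not_U_if y unfolding q_def by blast
        thus ?thesis by (auto simp: V1_def)
      qed
    qed
  qed
qed

lemma q_U_iff: assumes "x \<in> V1" shows "q x \<in> U \<longleftrightarrow> x \<in> U"
  using assms arc_c[of x] q_U[of x] unfolding V1_def U_def q_def by blast

lemma U_ne: assumes "X \<noteq> {}" shows "U \<noteq> {}"
proof -
  obtain x where "x \<in> X" using assms by blast
  hence "c x \<in> X" "v (c x) = 1" using c_mem c_white by auto
  thus ?thesis using reach_U by blast
qed

end

section \<open>The tour of a mobile\<close>

lemma (in fperm) fperm_inv: "fperm (inv_into D f) D"
  using fin bij bij_betw_inv_into by unfold_locales

lemma (in fperm) orb_inv: assumes "x \<in> D" shows "orb (inv_into D f) x = orb f x"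
proof
  interpret i: fperm "inv_into D f" D by (rule fperm_inv)
  have st: "inv_into D f y \<in> orb f x" if "y \<in> orb f x" for y
  proof -
    have "y \<in> D" using that orb_sub[OF assms] by auto
    thus ?thesis using orb_back[OF inv_mem assms] f_inv that by simp
  qed
  show "orb (inv_into D f) x \<subseteq> orb f x" by (rule i.orb_least[OF orb_refl st])
  have st: "f y \<in> orb (inv_into D f) x" if "y \<in> orb (inv_into D f) x" for y
  proof -
    have "y \<in> D" using that i.orb_sub[OF assms] by auto
    thus ?thesis using i.orb_back[OF mem assms] inv_f that by simp
  qed
  show "orb f x \<subseteq> orb (inv_into D f) x" by (rule orb_least[OF i.orb_refl st])
qed

context premob
begin

definition tap :: "'a \<Rightarrow> 'a" where
  "tap x = (if x \<in> Tbud T then x else Ta T x)"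

text \<open>One step of the tour around the mobile: back to the half-edge preceding \<open>x\<close>
  at its vertex and across the edge of that half-edge. At a bud there is nothing to cross and the
  tour remains at the vertex.\<close>

definition rho :: "'a \<Rightarrow> 'a" where
  "rho = tap \<circ> inv_into (Td T) (Ts T)"

definition val :: "'a \<Rightarrow> int" where
  "val x = (if x \<in> Tbud T then -1 else if Tblack T x then 0 else 1)"

lemma tap_fperm: "fperm tap (Td T)"
proof (rule fpermI[OF finT])
  have tt: "tap x \<in> Td T \<and> tap (tap x) = x" if "x \<in> Td T" for x
    using that Ta_props[of x] by (auto simp: tap_def)
  show "tap x \<in> Td T" if "x \<in> Td T" for x using tt that by blast
  show "inj_on tap (Td T)" by (rule inj_onI) (metis tt)
qed

lemma rho_fperm: "fperm rho (Td T)"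
  unfolding rho_def by (rule fperm_comp[OF tap_fperm t.fperm_inv])

lemma rho_Ts: "x \<in> Td T \<Longrightarrow> rho (Ts T x) = tap x"
  by (simp add: rho_def t.inv_f)

lemma sum_val: "sum val (Td T) = excess T"
proof -
  have "sum val (Td T) = (\<Sum>x\<in>Td T. (if \<not> Tblack T x then 1 else 0) - (if x \<in> Tbud T then 1 else 0))"
    using bud_black by (intro sum.cong) (auto simp: val_def)
  also have "\<dots> = (\<Sum>x\<in>Td T. if \<not> Tblack T x then 1 else 0) - (\<Sum>x\<in>Td T. if x \<in> Tbud T then 1 else 0)"
    by (rule sum_subtractf)
  also have "(\<Sum>x\<in>Td T. if \<not> Tblack T x then 1 else 0) = int (card {x \<in> Td T. \<not> Tblack T x})"
    using finT by (simp add: sum.If_cases Int_def)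
  also have "(\<Sum>x\<in>Td T. if x \<in> Tbud T then 1 else 0) = int (card (Tbud T))"
    using finT bud_sub by (simp add: sum.If_cases Int_absorb1)
  finally show ?thesis by (simp add: excess_alt)
qed

lemma val_1: "x \<in> Td T \<Longrightarrow> val x = 1 \<longleftrightarrow> \<not> Tblack T x"
  using bud_black by (auto simp: val_def)

lemma val_m1: "val x = -1 \<longleftrightarrow> x \<in> Tbud T"
  by (auto simp: val_def)

lemma inv_col: "x \<in> Td T \<Longrightarrow> Tblack T (inv_into (Td T) (Ts T) x) = Tblack T x"
  using col[OF t.inv_mem] t.f_inv by metis

end

context nmob
begin

lemma nonempty: "Td T \<noteq> {}"
  using tree by (auto simp: mverts_def)

text \<open>A tree has a single contour; this is the genus inequality once more.\<close>
lemma rho_single: assumes "x \<in> Td T" "y \<in> Td T" shows "y \<in> orb rho x"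
proof -
  interpret r: fperm rho "Td T" by (rule rho_fperm)
  interpret tp: fperm tap "Td T" by (rule tap_fperm)
  let ?i = "inv_into (Td T) (Ts T)"
  let ?G = "graph_on tap (Td T) \<union> graph_on ?i (Td T)"
  let ?N = "Td T - Tbud T"
  have "comps (Td T) ?G \<le> 1"
  proof -
    have st: "(u, v) \<in> eqcl ?G" if "(u, v) \<in> mob_conn T" for u v
    proof -
      from that consider "u \<in> Td T - Tbud T" "v = Ta T u" | "u \<in> Td T" "v = Ts T u"
        by (auto simp: mob_conn_def)
      thus ?thesis
      proof cases
        case 1 thus ?thesis by (intro eqcl_base) (auto simp: graph_on_def tap_def)
      next
        case 2
        hence "(v, u) \<in> graph_on ?i (Td T)" using t.mem t.inv_f by (auto simp: graph_on_def)
        thus ?thesis using eqcl_sym[OF eqcl_base[of v u ?G]] by auto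
      qed
    qed
    have "(u, v) \<in> (mob_conn T)\<^sup>* \<Longrightarrow> (u, v) \<in> eqcl ?G" for u v
    proof (induction rule: rtrancl_induct)
      case base show ?case by (rule eqcl_refl)
    next
      case (step y z)
      show ?case by (rule eqcl_trans[OF step(3) st[OF step(2)]])
    qed
    hence "eqcl ?G `` {z} = eqcl ?G `` {x}" if "z \<in> Td T" for z
      using connT[OF that assms(1)] eqcl_class_eq[of ?G z x] by (simp add: sim_def)
    hence "(\<lambda>z. eqcl ?G `` {z}) ` Td T \<subseteq> {eqcl ?G `` {x}}" by auto
    hence "card ((\<lambda>z. eqcl ?G `` {z}) ` Td T) \<le> card {eqcl ?G `` {x}}" by (intro card_mono) auto
    thus ?thesis by (simp add: comps_def)
  qed
  moreover have "card (orb ?i ` Td T) = card (mverts T)"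
  proof -
    have "orb ?i ` Td T = mverts T"
      unfolding mverts_def by (rule image_cong) (auto simp: mvert_def t.orb_inv)
    thus ?thesis by simp
  qed
  moreover have "2 * card (Tbud T) + card ?N \<le> 2 * card (orb tap ` Td T)"
  proof -
    let ?C = "(\<lambda>d. {d, Ta T d}) ` ?N"
    let ?B = "(\<lambda>d. {d}) ` Tbud T"
    have "card ?N = 2 * card ?C" using finT Ta_props by (intro card_pairs) auto
    moreover have "card ?B = card (Tbud T)" by (rule card_image) (auto simp: inj_on_def)
    moreover have "card (?B \<union> ?C) = card ?B + card ?C"
      using finT bud_sub finite_subset by (intro card_Un_disjoint) auto
    moreover have "?B \<union> ?C \<subseteq> orb tap ` Td T"
    proof -
      have "orb tap d = {d}" if "d \<in> Tbud T" for d
      proof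
        show "orb tap d \<subseteq> {d}" by (rule tp.orb_least) (auto simp: tap_def that)
        show "{d} \<subseteq> orb tap d" using tp.orb_refl by auto
      qed
      moreover have "orb tap d = {d, Ta T d}" if "d \<in> ?N" for d
      proof
        show "orb tap d \<subseteq> {d, Ta T d}" by (rule tp.orb_least) (use that Ta_props[OF that] in \<open>auto simp: tap_def\<close>)
        show "{d, Ta T d} \<subseteq> orb tap d" using tp.orb_refl[of d] tp.orb_f[of d] that by (auto simp: tap_def)
      qed
      ultimately show ?thesis using bud_sub by (auto intro!: image_eqI)
    qed
    hence "card (?B \<union> ?C) \<le> card (orb tap ` Td T)" using finT by (intro card_mono) auto
    ultimately show ?thesis by simp
  qed
  moreover have "card (orb tap ` Td T) + card (orb ?i ` Td T) + card (orb rho ` Td T)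
    \<le> card (Td T) + 2 * comps (Td T) ?G"
    unfolding rho_def by (rule genus_inequality[OF tap_fperm t.fperm_inv])
  moreover have "card (Td T) = card (Tbud T) + card ?N"
    using finT bud_sub finite_subset by (metis card_Diff_subset card_mono le_add_diff_inverse)
  \<comment> \<open>With B buds and 2m other half-edges there are m + 1 vertices and at least B + m
    cycles of \<open>tap\<close>, so the bound B + 2m + 2 leaves room for one cycle of
    \<open>rho\<close>.\<close>
  ultimately have "card (orb rho ` Td T) \<le> 1" using tree by linarith
  moreover have "orb rho x \<in> orb rho ` Td T" "orb rho y \<in> orb rho ` Td T" using assms by auto
  ultimately have "orb rho x = orb rho y" using finT by (metis card_le_Suc0_iff_eq finite_imageI One_nat_def)
  thus ?thesis using r.orb_refl[of y] by simp
qed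

sublocale w: word rho "Td T" val
proof -
  interpret r: fperm rho "Td T" by (rule rho_fperm)
  show "word rho (Td T) val" by unfold_locales (auto simp: rho_single val_def)
qed

end

section \<open>Closure of mobiles of positive excess\<close>

locale posmob = nmob +
  assumes pos: "0 < excess T"
begin

sublocale w: posword rho "Td T" val
  by unfold_locales (simp add: sum_val pos)

abbreviation Nb :: "'a set" where
  "Nb \<equiv> Td T - Tbud T"

abbreviation tsi :: "'a \<Rightarrow> 'a" where
  "tsi \<equiv> inv_into (Td T) (Ts T)"

text \<open>The dart that a bud turns into: the bud completes the edge of the white half-edge just
  before its matched corner, and \<open>rho\<close> leads from that corner to the other half of this
  edge.\<close>

definition g :: "'a \<Rightarrow> 'a" where
  "g x = (if x \<in> Tbud T then rho (w.c (rho x)) else x)"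

definition e :: "'a \<Rightarrow> 'a" where
  "e z = (if Tblack T z then z else inv_into w.V1 w.q (Ts T z))"

text \<open>The half-edge of \<open>T\<close> that will play the part of \<open>(d, Bl)\<close> in
  the mobile of the closure. If \<open>Ta T d\<close> is white, it is the bud matched with the
  corner after \<open>Ta T d\<close>. If that corner is not the partner of a bud, the value is an
  element of \<open>U\<close> and marks \<open>d\<close> as a root corner.\<close>

definition E :: "'a \<Rightarrow> 'a" where
  "E d = e (Ta T d)"

text \<open>The edges of the closure are those of \<open>T\<close>, each bud being merged into one
  of them, so the non-bud half-edges serve as darts. \<open>Ms\<close> is chosen to make the face
  step equal to \<open>g (rho (E d))\<close>.\<close>

definition cmap :: "'a bmap" where
  "cmap = \<lparr> Md = Nb, Ma = Ta T, Ms = (\<lambda>z. g (rho (e z))), Mr = (SOME d. d \<in> Nb \<and> E d \<in> w.U), Mw = Tw T \<rparr>"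

lemma cmap_sel [simp]: "Md cmap = Nb" "Ma cmap = Ta T" "Mw cmap = Tw T"
  by (simp_all add: cmap_def)

lemma Ms_cmap: "Ms cmap z = g (rho (e z))"
  by (simp add: cmap_def)

definition Wt :: "'a set" where
  "Wt = {z \<in> Td T. \<not> Tblack T z}"

lemma ings_cmap: "ings cmap = Wt"
  using wt bud_black by (auto simp: ings_def ing_def Wt_def)

lemma Wt_Nb: "z \<in> Wt \<Longrightarrow> z \<in> Nb"
  using bud_black by (auto simp: Wt_def)

lemma Wt_val: "{y \<in> Td T. val y = 1} = Wt"
  using val_1 by (auto simp: Wt_def)

lemma Ta_Nb: "z \<in> Nb \<Longrightarrow> Ta T z \<in> Nb" "z \<in> Nb \<Longrightarrow> Ta T (Ta T z) = z"
  using Ta_props by auto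

lemma Ts_Wt: "z \<in> Wt \<Longrightarrow> Ts T z \<in> Wt"
  using col t.mem by (auto simp: Wt_def)

lemma tsi_Wt: "z \<in> Wt \<Longrightarrow> tsi z \<in> Wt"
  using inv_col t.inv_mem by (auto simp: Wt_def)

lemma rho_Wt: assumes "y \<in> Wt" shows "rho y = Ta T (tsi y)"
proof -
  have "tsi y \<in> Nb" using Wt_Nb tsi_Wt assms by blast
  thus ?thesis by (simp add: rho_def tap_def)
qed

lemma rho_Wt_Nb: "y \<in> Wt \<Longrightarrow> rho y \<in> Nb"
  using rho_Wt Ta_Nb Wt_Nb tsi_Wt by metis

lemma c_Wt: "x \<in> Td T \<Longrightarrow> w.c x \<in> Wt"
  using w.c_mem w.c_white Wt_val by blast

lemma g_Nb: "x \<in> Td T \<Longrightarrow> g x \<in> Nb"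
  unfolding g_def using rho_Wt_Nb c_Wt w.mem by auto

lemma U_Wt: "u \<in> w.U \<Longrightarrow> u \<in> Wt"
  using Wt_val by (auto simp: w.U_def)

lemma V1_alt: "w.V1 = Tbud T \<union> w.U"
  using bud_sub val_m1 by (auto simp: w.V1_def)

lemma q_bij: "bij_betw w.q w.V1 Wt"
  using w.q_bij by (simp add: Wt_val)

lemma e_Wt: assumes "z \<in> Wt" shows "e z \<in> w.V1" "w.q (e z) = Ts T z"
proof -
  have "Ts T z \<in> w.q ` w.V1" using q_bij Ts_Wt[OF assms] by (simp add: bij_betw_def)
  thus "e z \<in> w.V1" "w.q (e z) = Ts T z"
    using assms by (auto simp: e_def Wt_def inv_into_into f_inv_into_f)
qed

definition Cod :: "'a set" where
  "Cod = {x \<in> Td T. Tblack T x} \<union> w.U"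

lemma Cod_Td: "x \<in> Cod \<Longrightarrow> x \<in> Td T"
  using U_Wt by (auto simp: Cod_def Wt_def)

lemma e_bij: "bij_betw e Nb Cod"
proof -
  have "bij_betw e Wt w.V1"
  proof -
    have 1: "bij_betw (Ts T) Wt Wt"
      using fperm_restrict[OF t.fperm_axioms, of Wt] Ts_Wt by (auto simp: Wt_def fperm_def)
    have "bij_betw (inv_into w.V1 w.q) Wt w.V1" by (rule bij_betw_inv_into[OF q_bij])
    hence "bij_betw (inv_into w.V1 w.q \<circ> Ts T) Wt w.V1" by (rule bij_betw_trans[OF 1])
    moreover have "e z = (inv_into w.V1 w.q \<circ> Ts T) z" if "z \<in> Wt" for z using that by (simp add: e_def Wt_def)
    ultimately show ?thesis using bij_betw_cong[of Wt e "inv_into w.V1 w.q \<circ> Ts T" w.V1] by blast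
  qed
  moreover have "bij_betw e {x \<in> Nb. Tblack T x} {x \<in> Nb. Tblack T x}"
    by (auto simp: bij_betw_def inj_on_def e_def)
  moreover have "w.V1 \<inter> {x \<in> Nb. Tblack T x} = {}" using V1_alt U_Wt by (auto simp: Wt_def)
  ultimately have "bij_betw e (Wt \<union> {x \<in> Nb. Tblack T x}) (w.V1 \<union> {x \<in> Nb. Tblack T x})"
    by (rule bij_betw_combine)
  moreover have "Wt \<union> {x \<in> Nb. Tblack T x} = Nb" using Wt_Nb by (auto simp: Wt_def)
  moreover have "w.V1 \<union> {x \<in> Nb. Tblack T x} = Cod"
    using V1_alt bud_sub bud_black by (auto simp: Cod_def)
  ultimately show ?thesis by simp
qed

lemma E_bij: "bij_betw E Nb Cod"
proof -
  have "bij_betw (Ta T) Nb Nb"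
    by (rule bij_betw_byWitness[where f' = "Ta T"]) (use Ta_Nb in auto)
  thus ?thesis using bij_betw_trans[OF _ e_bij] by (simp add: E_def[abs_def] comp_def)
qed

lemma E_Cod: "d \<in> Nb \<Longrightarrow> E d \<in> Cod"
  using E_bij by (auto simp: bij_betw_def)

lemma E_inj: "d \<in> Nb \<Longrightarrow> d' \<in> Nb \<Longrightarrow> E d = E d' \<Longrightarrow> d = d'"
  using E_bij by (auto simp: bij_betw_def inj_on_def)

lemma E_surj: "x \<in> Cod \<Longrightarrow> \<exists>d\<in>Nb. E d = x"
  using E_bij by (metis bij_betw_imp_surj_on imageE)

lemma E_black: "d \<in> Nb \<Longrightarrow> Tblack T (Ta T d) \<Longrightarrow> E d = Ta T d"
  by (simp add: E_def e_def)

lemma E_U: assumes "d \<in> Nb" "E d \<in> w.U" shows "Ta T d \<in> Wt"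
  using assms E_black[of d] U_Wt Ta_Nb(1)[of d] by (auto simp: Wt_def)

lemma U_not_black: "u \<in> w.U \<Longrightarrow> \<not> Tblack T u"
  using U_Wt by (auto simp: Wt_def)

lemma phi_cmap: "phi cmap d = g (rho (E d))"
  by (simp add: phi_def E_def Ms_cmap)

lemma phi_Nb: "d \<in> Nb \<Longrightarrow> phi cmap d \<in> Nb"
  unfolding phi_cmap using g_Nb w.mem Cod_Td E_Cod by blast

text \<open>Under E, the inner faces of the closure are the black vertices of the mobile, and its root
  face is the cycle of the unmatched corners.\<close>
lemma E_phi_black:
  assumes d: "d \<in> Nb" "Tblack T (E d)" shows "E (phi cmap d) = tsi (E d)"
proof -
  have xT: "E d \<in> Td T" using Cod_Td E_Cod d by blast
  let ?y = "tsi (E d)"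
  have y: "?y \<in> Td T" "Tblack T ?y" using t.inv_mem xT inv_col d by auto
  show ?thesis
  proof (cases "?y \<in> Tbud T")
    case False
    hence yN: "?y \<in> Nb" using y by simp
    have "rho (E d) = Ta T ?y" using False by (simp add: rho_def tap_def)
    hence "phi cmap d = Ta T ?y" using Ta_Nb(1)[OF yN] by (simp add: phi_cmap g_def)
    thus ?thesis using Ta_Nb(2)[OF yN] y by (simp add: E_def e_def)
  next
    case True
    hence "rho (E d) = ?y" by (simp add: rho_def tap_def)
    hence p: "phi cmap d = rho (w.q ?y)" using True by (simp add: phi_cmap g_def w.q_def)
    have qW: "w.q ?y \<in> Wt" unfolding w.q_def using c_Wt w.mem y by blast
    define h where "h = tsi (w.q ?y)"
    have h: "h \<in> Wt" "Ts T h = w.q ?y" using tsi_Wt qW t.f_inv[of "w.q ?y"] by (auto simp: h_def Wt_def)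
    have hN: "h \<in> Nb" using Wt_Nb h by blast
    have "phi cmap d = Ta T h" using p rho_Wt[OF qW] by (simp add: h_def)
    hence "E (phi cmap d) = e h" using Ta_Nb(2)[OF hN] by (simp add: E_def)
    also have "\<dots> = inv_into w.V1 w.q (w.q ?y)" using h by (simp add: e_def Wt_def)
    also have "\<dots> = ?y" using True V1_alt q_bij by (intro bij_betw_inv_into_left[of w.q w.V1 Wt]) auto
    finally show ?thesis .
  qed
qed

lemma E_phi_U:
  assumes d: "d \<in> Nb" "E d \<in> w.U" shows "E (phi cmap d) \<in> w.U" "w.q (E (phi cmap d)) = E d"
proof -
  have xW: "E d \<in> Wt" using U_Wt d by blast
  let ?h = "tsi (E d)"
  have h: "?h \<in> Wt" "Ts T ?h = E d" using tsi_Wt xW t.f_inv[of "E d"] by (auto simp: Wt_def)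
  have hN: "?h \<in> Nb" using Wt_Nb h by blast
  have "phi cmap d = Ta T ?h"
    using rho_Wt[OF xW] Ta_Nb(1)[OF hN] by (simp add: phi_cmap g_def)
  hence e: "E (phi cmap d) = e ?h" using Ta_Nb(2)[OF hN] by (simp add: E_def)
  thus "w.q (E (phi cmap d)) = E d" using e_Wt(2)[OF h(1)] h by simp
  thus "E (phi cmap d) \<in> w.U" using w.q_U_iff[OF e_Wt(1)[OF h(1)]] e d by simp
qed

lemma phi_inj: "inj_on (phi cmap) Nb"
proof (rule inj_onI)
  fix d d' assume a: "d \<in> Nb" "d' \<in> Nb" "phi cmap d = phi cmap d'"
  have bl: "Tblack T (E (phi cmap z)) \<longleftrightarrow> Tblack T (E z)" if z: "z \<in> Nb" for z
  proof (cases "Tblack T (E z)")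
    case True
    thus ?thesis using E_phi_black[OF z] inv_col Cod_Td E_Cod z by metis
  next
    case False
    hence "E z \<in> w.U" using E_Cod[OF z] by (auto simp: Cod_def)
    thus ?thesis using E_phi_U(1)[OF z] False U_not_black by blast
  qed
  have "E d = E d'"
  proof (cases "Tblack T (E d)")
    case True
    hence b': "Tblack T (E d')" using bl a by metis
    have "tsi (E d) = tsi (E d')" using E_phi_black[OF a(1) True] E_phi_black[OF a(2) b'] a by simp
    thus ?thesis using t.f_inv Cod_Td E_Cod a by metis
  next
    case False
    hence "\<not> Tblack T (E d')" using bl a by metis
    hence "E d \<in> w.U" "E d' \<in> w.U" using E_Cod a False by (auto simp: Cod_def)
    thus ?thesis using E_phi_U(2)[OF a(1)] E_phi_U(2)[OF a(2)] a(3) by metis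
  qed
  thus "d = d'" using E_inj a by blast
qed

lemma root_some: "Mr cmap \<in> Nb" "E (Mr cmap) \<in> w.U"
proof -
  obtain u where u: "u \<in> w.U" using w.U_ne nonempty by blast
  hence "\<exists>d. d \<in> Nb \<and> E d \<in> w.U" using E_surj[of u] by (auto simp: Cod_def)
  hence "Mr cmap \<in> Nb \<and> E (Mr cmap) \<in> w.U" unfolding cmap_def bmap.simps by (rule someI_ex)
  thus "Mr cmap \<in> Nb" "E (Mr cmap) \<in> w.U" by auto
qed

lemma premap_cmap: "premap cmap"
proof
  have fN: "finite Nb" using finT by simp
  have f: "fperm (phi cmap) Nb" by (rule fpermI[OF fN phi_Nb phi_inj])
  have "fperm (Ta T) Nb" by (rule fpermI[OF fN]) (use Ta_Nb in \<open>auto simp: inj_on_def, metis\<close>)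
  hence "fperm (phi cmap \<circ> Ta T) Nb" by (rule fperm_comp[OF f])
  hence "bij_betw (phi cmap \<circ> Ta T) Nb Nb" by (simp add: fperm_def)
  moreover have "(phi cmap \<circ> Ta T) z = Ms cmap z" if "z \<in> Nb" for z
    using Ta_Nb[OF that] by (simp add: phi_def)
  ultimately have "bij_betw (Ms cmap) Nb Nb" using bij_betw_cong[of Nb "phi cmap \<circ> Ta T" "Ms cmap" Nb] by blast
  thus "bij_betw (Ms cmap) (Md cmap) (Md cmap)" by simp
  show "finite (Md cmap)" using fN by simp
  show "Mr cmap \<in> Md cmap" using root_some by simp
  fix d assume "d \<in> Md cmap"
  thus "Ma cmap d \<in> Md cmap" "Ma cmap d \<noteq> d" "Ma cmap (Ma cmap d) = d" using Ta_props[of d] by auto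
qed

sublocale m: premap cmap by (rule premap_cmap)

text \<open>By \<open>E_phi_U\<close> the face step acts on unmatched corners as the inverse of
  \<open>q\<close>, and \<open>q\<close> is a single cycle on \<open>U\<close>; hence one face
  collects them all.\<close>

lemma root_iff: assumes "d \<in> Nb" shows "d \<in> rootface cmap \<longleftrightarrow> E d \<in> w.U"
proof
  show "E d \<in> w.U" if "d \<in> rootface cmap"
    using that unfolding m.rootface_orb
  proof (induction rule: m.p.orb_induct)
    case base show ?case by (rule root_some)
  next
    case (step y)
    have "y \<in> Nb" using step(1) m.p.orb_sub[OF m.root_dart] by auto
    thus ?case using E_phi_U(1) step by blast
  qed
  assume u: "E d \<in> w.U"
  have "(w.q ^^ k) (E d) = E (Mr cmap) \<Longrightarrow> d \<in> Nb \<Longrightarrow> E d \<in> w.U \<Longrightarrow> d \<in> orb (phi cmap) (Mr cmap)" for k d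
  proof (induction k arbitrary: d)
    case 0
    hence "d = Mr cmap" using E_inj root_some(1) by simp
    thus ?case using m.p.orb_refl by simp
  next
    case (Suc k)
    have qU: "w.q (E d) \<in> w.U" using w.q_U Suc by blast
    then obtain d' where d': "d' \<in> Nb" "E d' = w.q (E d)" using E_surj by (auto simp: Cod_def)
    have "(w.q ^^ k) (E d') = E (Mr cmap)" using Suc(2) d' by (simp add: funpow_swap1)
    hence "d' \<in> orb (phi cmap) (Mr cmap)" using Suc.IH d' qU by simp
    moreover have "phi cmap d' = d"
    proof -
      have "w.q (E (phi cmap d')) = w.q (E d)" "E (phi cmap d') \<in> w.U" using E_phi_U d' qU by auto
      hence "E (phi cmap d') = E d" using w.q_inj Suc by (auto simp: inj_on_def)
      thus ?thesis using E_inj phi_Nb d' Suc by blast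
    qed
    ultimately show ?case using m.p.orb_step by blast
  qed
  moreover obtain k where "E (Mr cmap) = (w.q ^^ k) (E d)"
    using w.U_cycle[OF u root_some(2)] by (auto simp: orb_def)
  ultimately show "d \<in> rootface cmap" unfolding m.rootface_orb using assms u by metis
qed

lemma root_E: "E ` rootface cmap = w.U"
proof
  show "E ` rootface cmap \<subseteq> w.U" using root_iff m.root_sub by auto
  show "w.U \<subseteq> E ` rootface cmap"
  proof
    fix u assume u: "u \<in> w.U"
    then obtain d where "d \<in> Nb" "E d = u" using E_surj by (auto simp: Cod_def)
    thus "u \<in> E ` rootface cmap" using root_iff u by auto
  qed
qed

lemma face_E: assumes d: "d \<in> Nb" "Tblack T (E d)" shows "E ` face cmap d = mvert T (E d)"
proof -
  have bl: "y \<in> Nb \<and> Tblack T (E y)" if "y \<in> orb (phi cmap) d" for y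
    using that
  proof (induction rule: m.p.orb_induct)
    case base show ?case using d by simp
  next
    case (step y)
    thus ?case using E_phi_black[of y] inv_col[of "E y"] phi_Nb[of y] Cod_Td E_Cod by auto
  qed
  have "orb tsi (E d) = E ` orb (phi cmap) d"
    by (rule orb_image) (use bl E_phi_black in blast)
  thus ?thesis using t.orb_inv[of "E d"] Cod_Td E_Cod d by (simp add: face_def mvert_def)
qed

lemma faces_count: "card (faces cmap) = Suc (card (black_verts T))"
proof -
  have "card ((`) E ` faces cmap) = card (faces cmap)"
  proof (rule card_image, rule inj_on_image)
    have "\<Union> (faces cmap) \<subseteq> Nb" using m.face_sub by (auto simp: faces_def)
    thus "inj_on E (\<Union> (faces cmap))" using E_bij by (auto simp: bij_betw_def intro: inj_on_subset)
  qed
  moreover have "(`) E ` faces cmap = insert w.U (black_verts T)"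
  proof (intro equalityI subsetI)
    fix F assume "F \<in> (`) E ` faces cmap"
    then obtain d where d: "d \<in> Nb" "F = E ` face cmap d" by (auto simp: faces_def)
    show "F \<in> insert w.U (black_verts T)"
    proof (cases "Tblack T (E d)")
      case True thus ?thesis using face_E d Cod_Td[OF E_Cod[OF d(1)]] by (auto simp: black_verts_def)
    next
      case False
      hence "d \<in> rootface cmap" using root_iff d E_Cod by (auto simp: Cod_def)
      hence "face cmap d = rootface cmap" using m.face_root d by simp
      thus ?thesis using d root_E by simp
    qed
  next
    fix F assume "F \<in> insert w.U (black_verts T)"
    thus "F \<in> (`) E ` faces cmap"
    proof
      assume "F = w.U"
      hence "F = E ` rootface cmap" using root_E by simp
      thus ?thesis using root_some by (auto simp: faces_def rootface_def)
    next
      assume "F \<in> black_verts T"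
      then obtain x where x: "x \<in> Td T" "Tblack T x" "F = mvert T x" by (auto simp: black_verts_def)
      then obtain d where d: "d \<in> Nb" "E d = x" using E_surj by (auto simp: Cod_def)
      hence "F = E ` face cmap d" using face_E x by simp
      thus ?thesis using d by (auto simp: faces_def)
    qed
  qed
  moreover have "w.U \<notin> black_verts T"
  proof
    assume "w.U \<in> black_verts T"
    then obtain x where "Tblack T x" "w.U = mvert T x" by (auto simp: black_verts_def)
    thus False using t.orb_refl[of x] U_not_black by (auto simp: mvert_def)
  qed
  moreover have "finite (black_verts T)" using finT by (simp add: black_verts_def)
  ultimately show ?thesis by simp
qed

text \<open>The recursion of \<open>c\<close> is a turn around a vertex of the closure: it stops at
  a white corner, a black half-edge is one step of \<open>Ms\<close>, and a bud is exchanged for its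
  dart, which is the jump over its arc.\<close>

lemma sector_walk:
  assumes st: "\<And>z. z \<in> Nb \<Longrightarrow> Tblack T z \<Longrightarrow> Q z \<Longrightarrow> Q (Ms cmap z)"
  shows "x \<in> Td T \<Longrightarrow> Q (g x) \<Longrightarrow> Q (w.c x)"
proof (induction "w.n1 x" arbitrary: x rule: less_induct)
  case less
  consider "x \<in> Tbud T" | "x \<in> Nb" "Tblack T x" | "x \<in> Wt" using less(2) by (auto simp: Wt_def)
  thus ?case
  proof cases
    case 1
    have v: "val x = -1" using 1 val_m1 by simp
    let ?x = "rho (w.c (rho x))"
    have xN: "?x \<in> Nb" using rho_Wt_Nb c_Wt w.mem less by blast
    hence "g ?x = ?x" by (simp add: g_def)
    moreover have "g x = ?x" using 1 by (simp add: g_def)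
    ultimately have "Q (w.c ?x)" using less(1)[of ?x] w.c_m1(2)[OF less(2) v] xN less(3) by simp
    thus ?thesis using w.c_m1(1)[OF less(2) v] by simp
  next
    case 2
    have v: "val x = 0" using 2 by (simp add: val_def)
    have "Q (Ms cmap x)" using st[OF 2] less(3) 2 by (simp add: g_def)
    hence "Q (g (rho x))" using 2 by (simp add: Ms_cmap e_def)
    hence "Q (w.c (rho x))" using less(1)[of "rho x"] w.c_0(2)[OF less(2) v] w.mem less(2) by simp
    thus ?thesis using w.c_0(1)[OF less(2) v] by simp
  next
    case 3
    hence "val x = 1" using val_1 by (auto simp: Wt_def)
    moreover have "g x = x" using Wt_Nb[OF 3] by (simp add: g_def)
    ultimately show ?thesis using w.c_1(1)[OF less(2)] less(3) by simp
  qed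
qed

lemma insec_c: "x \<in> Td T \<Longrightarrow> insec (Ms cmap) Wt h (g x) \<Longrightarrow> insec (Ms cmap) Wt h (w.c x)"
  by (rule sector_walk) (auto simp: Wt_def intro: insec.walk)

text \<open>The sector of \<open>h\<close> in the closure ends at the half-edge after
  \<open>h\<close> in the mobile, so the rotation at white vertices is recovered.\<close>

lemma insec_Ts: assumes "h \<in> Wt" shows "insec (Ms cmap) Wt h (Ts T h)"
proof -
  have eV: "e h \<in> Td T" using e_Wt(1)[OF assms] w.V1_X by blast
  have "insec (Ms cmap) Wt h (g (rho (e h)))" using insec.start[of "Ms cmap" Wt h] by (simp add: Ms_cmap[of h])
  hence "insec (Ms cmap) Wt h (w.c (rho (e h)))" using insec_c w.mem eV by blast
  thus ?thesis using e_Wt(2)[OF assms] by (simp add: w.q_def)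
qed

lemma fret_Ts: "h \<in> Wt \<Longrightarrow> fret (Ms cmap) Wt h = Ts T h"
  using m.s.fret_eqI[of h Wt "Ts T h"] insec_Ts Ts_Wt Wt_Nb by simp

lemma nxt_Ts: "h \<in> Wt \<Longrightarrow> nxt_in cmap h = Ts T h"
  using m.nxt_in_fret[of h] fret_Ts Wt_Nb ings_cmap by simp

lemma vert_Wt: assumes "d \<in> Nb" shows "vert cmap d \<inter> Wt \<noteq> {}"
proof -
  have "w.c d \<in> orb (Ms cmap) d"
  proof (rule sector_walk)
    show "Ms cmap z \<in> orb (Ms cmap) d" if "z \<in> orb (Ms cmap) d" for z using m.s.orb_step that .
    show "g d \<in> orb (Ms cmap) d" using assms m.s.orb_refl by (simp add: g_def)
  qed (use assms in simp)
  thus ?thesis using c_Wt[of d] assms by (auto simp: vert_def)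
qed

lemma vert_mvert: assumes "h \<in> Wt" shows "vert cmap h \<inter> Wt = mvert T h"
proof -
  have sub: "orb (Ts T) h \<subseteq> Wt" by (rule t.orb_least[OF assms Ts_Wt])
  have "orb (fret (Ms cmap) Wt) h = orb (Ts T) h" by (rule orb_cong) (use sub fret_Ts in blast)
  moreover have "orb (fret (Ms cmap) Wt) h = orb (Ms cmap) h \<inter> Wt"
    using m.s.fret_orb[of Wt h] assms Wt_Nb by auto
  ultimately show ?thesis by (simp add: vert_def mvert_def)
qed

lemma verts_count: "card (verts cmap) = card (white_verts T)"
proof (rule bij_betw_same_card[of "\<lambda>v. v \<inter> Wt"])
  show "bij_betw (\<lambda>v. v \<inter> Wt) (verts cmap) (white_verts T)"
    unfolding bij_betw_def
  proof
    show "inj_on (\<lambda>v. v \<inter> Wt) (verts cmap)"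
    proof (rule inj_onI)
      fix u v assume a: "u \<in> verts cmap" "v \<in> verts cmap" "u \<inter> Wt = v \<inter> Wt"
      obtain x y where xy: "x \<in> Nb" "y \<in> Nb" "u = vert cmap x" "v = vert cmap y" using a by (auto simp: verts_def)
      have "u \<inter> v \<noteq> {}" using vert_Wt[OF xy(1)] xy a(3) by auto
      thus "u = v" using m.s.orb_disj[of x y] xy by (simp add: vert_def)
    qed
    show "(\<lambda>v. v \<inter> Wt) ` verts cmap = white_verts T"
    proof (intro equalityI subsetI)
      fix F assume "F \<in> (\<lambda>v. v \<inter> Wt) ` verts cmap"
      then obtain d where d: "d \<in> Nb" "F = vert cmap d \<inter> Wt" by (auto simp: verts_def)
      then obtain h where h: "h \<in> vert cmap d" "h \<in> Wt" using vert_Wt by blast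
      have "vert cmap h = vert cmap d" using m.vert_eq h d by simp
      hence "F = mvert T h" using vert_mvert[OF h(2)] d by simp
      thus "F \<in> white_verts T" using h by (auto simp: white_verts_def Wt_def)
    next
      fix F assume "F \<in> white_verts T"
      then obtain h where h: "h \<in> Wt" "F = mvert T h" by (auto simp: white_verts_def Wt_def)
      hence "F = vert cmap h \<inter> Wt" using vert_mvert by simp
      thus "F \<in> (\<lambda>v. v \<inter> Wt) ` verts cmap" using Wt_Nb h by (auto simp: verts_def)
    qed
  qed
qed

lemma euler_cmap: "2 * card (verts cmap) + 2 * card (faces cmap) = card (Md cmap) + 4"
  using verts_count faces_count tree card_mverts by simp

lemma conn_cmap: assumes "x \<in> Nb" "y \<in> Nb" shows "(x, y) \<in> (map_conn cmap)\<^sup>*"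
proof -
  let ?R = "(map_conn cmap)\<^sup>*"
  have Ma: "(z, Ta T z) \<in> ?R" if "z \<in> Nb" for z using that by (auto simp: map_conn_def)
  have orb: "(z, y) \<in> ?R" if "z \<in> Nb" "y \<in> orb (Ms cmap) z" for z y
  proof -
    have "{(x, Ms cmap x) |x. x \<in> Md cmap}\<^sup>* \<subseteq> ?R" by (rule rtrancl_mono) (auto simp: map_conn_def)
    thus ?thesis using m.s.orb_rtrancl[of y z] that by auto
  qed
  have phi: "(z, phi cmap z) \<in> ?R" if "z \<in> Nb" for z
    using Ma[OF that] orb[OF Ta_Nb(1)[OF that] m.s.orb_f] by (auto simp: phi_def intro: rtrancl_trans)
  have phi_orb: "(w, y) \<in> ?R" if w: "w \<in> Nb" and y: "y \<in> orb (phi cmap) w" for w y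
    using y
  proof (induction rule: m.p.orb_induct)
    case (step y)
    have "y \<in> Nb" using step(1) m.p.orb_sub[of w] w by auto
    from step(2) phi[OF this] show ?case by (rule rtrancl_trans)
  qed simp
  have phi_back: "(phi cmap z, z) \<in> ?R" if z: "z \<in> Nb" for z
    by (rule phi_orb[OF phi_Nb[OF z]]) (use m.p.orb_sym[OF _ m.p.orb_f] z in simp)
  \<comment> \<open>A white half-edge is its own dart, a black one is sent to the dart of the corner
    it points to. Adjacent half-edges of the mobile then have darts connected in the map.\<close>
  define pr where "pr x = (if Tblack T x then inv_into Nb E x else x)" for x
  have prN: "pr x \<in> Nb \<and> (Tblack T x \<longrightarrow> E (pr x) = x)" if x: "x \<in> Td T" for x
  proof (cases "Tblack T x")
    case True
    hence "x \<in> E ` Nb" using E_bij x by (auto simp: bij_betw_def Cod_def)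
    thus ?thesis using True inv_into_into[of x E Nb] f_inv_into_f[of x E Nb] by (simp add: pr_def)
  next
    case False thus ?thesis using x Wt_Nb by (auto simp: pr_def Wt_def)
  qed
  have prb: "pr x = Ta T x" if x: "x \<in> Nb" "Tblack T x" for x
  proof -
    have "E (Ta T x) = x" using Ta_Nb(2)[OF x(1)] x by (simp add: E_def e_def)
    thus ?thesis using prN[of x] x E_inj Ta_Nb(1)[OF x(1)] by auto
  qed
  have step: "(pr x, pr y) \<in> ?R" if "(x, y) \<in> mob_conn T" for x y
  proof -
    from that consider "x \<in> Nb" "y = Ta T x" | "x \<in> Td T" "y = Ts T x" "Tblack T x"
      | "x \<in> Wt" "y = Ts T x" by (auto simp: mob_conn_def Wt_def)
    thus ?thesis
    proof cases
      case 1
      have y: "y \<in> Nb" "Ta T y = x" using Ta_Nb 1 by auto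
      show ?thesis
        using 1 y prb[of x] prb[of y] Ma[of x] Ma[of y] by (cases "Tblack T x"; cases "Tblack T y") (auto simp: pr_def)
    next
      case 2
      have yT: "y \<in> Td T" "Tblack T y" using 2 t.mem col by auto
      have "E (phi cmap (pr y)) = tsi y" using E_phi_black[of "pr y"] prN[OF yT(1)] yT by simp
      also have "\<dots> = x" using 2 t.inv_f by simp
      finally have "phi cmap (pr y) = pr x" using E_inj[of "phi cmap (pr y)" "pr x"] phi_Nb prN[OF yT(1)] prN[of x] 2 by simp
      thus ?thesis using phi_back[of "pr y"] prN[OF yT(1)] by simp
    next
      case 3
      have "y \<in> vert cmap x" using vert_mvert[OF 3(1)] t.orb_f[of x] 3 by (auto simp: mvert_def)
      hence "(x, y) \<in> ?R" using orb Wt_Nb[OF 3(1)] by (simp add: vert_def)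
      thus ?thesis using 3 Ts_Wt[OF 3(1)] by (simp add: pr_def Wt_def)
    qed
  qed
  have "(x, y) \<in> (mob_conn T)\<^sup>* \<Longrightarrow> (pr x, pr y) \<in> ?R" for x y
  proof (induction rule: rtrancl_induct)
    case (step y z) thus ?case using \<open>\<And>y x. (x, y) \<in> mob_conn T \<Longrightarrow> (pr x, pr y) \<in> ?R\<close> rtrancl_trans by metis
  qed simp
  hence pxy: "(pr x, pr y) \<in> ?R" using connT[of x y] assms by (simp add: sim_def)
  have "(x, pr x) \<in> ?R" using prb[of x] Ma[of x] assms by (cases "Tblack T x") (auto simp: pr_def)
  moreover have "(pr y, y) \<in> ?R"
  proof (cases "Tblack T y")
    case True
    thus ?thesis using prb[of y] Ma[OF Ta_Nb(1)[OF assms(2)]] Ta_Nb(2)[OF assms(2)] assms by simp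
  qed (simp add: pr_def)
  ultimately show ?thesis using pxy by (meson rtrancl_trans)
qed

sublocale m: rmap cmap
  by unfold_locales (use conn_cmap euler_cmap in simp_all)

lemma root_Ta: assumes "h \<in> Wt" shows "Ta T h \<in> rootface cmap \<longleftrightarrow> Ts T h \<in> w.U"
proof -
  have hN: "h \<in> Nb" using Wt_Nb assms by blast
  have "Ta T h \<in> rootface cmap \<longleftrightarrow> e h \<in> w.U"
    using root_iff[OF Ta_Nb(1)[OF hN]] Ta_Nb(2)[OF hN] by (simp add: E_def)
  thus ?thesis using w.q_U_iff[OF e_Wt(1)[OF assms]] e_Wt(2)[OF assms] by simp
qed

text \<open>The predecessor of \<open>h\<close> is the half-edge \<open>h0\<close> with
  \<open>Ts T h0 = w.q (Ts T h)\<close>, so the backward path climbs the nesting of parentheses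
  until it meets an unmatched one.\<close>

lemma good_cmap: "(w.q ^^ n) (Ts T h) \<in> w.U \<Longrightarrow> h \<in> Wt \<Longrightarrow> good cmap h"
proof (induction n arbitrary: h)
  case 0
  show ?case by (rule good.root) (use 0 root_Ta ings_cmap in auto)
next
  case (Suc n)
  have hN: "h \<in> Nb" and yW: "Ts T h \<in> Wt" using Wt_Nb Ts_Wt Suc by blast+
  have qW: "w.q (Ts T h) \<in> Wt" unfolding w.q_def using c_Wt w.mem yW by (simp add: Wt_def)
  define h0 where "h0 = tsi (w.q (Ts T h))"
  have h0: "h0 \<in> Wt" "Ts T h0 = w.q (Ts T h)"
    using tsi_Wt[OF qW] t.f_inv qW by (auto simp: h0_def Wt_def)
  have "good cmap h0" using Suc.IH[of h0] Suc(2) h0 by (simp add: funpow_swap1)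
  moreover have "insec (Ms cmap) Wt h0 (Ta T h)"
  proof -
    have aN: "Ta T h \<in> Nb" using Ta_Nb hN by simp
    obtain h1 where h1: "h1 \<in> Wt" "insec (Ms cmap) Wt h1 (Ta T h)"
      using m.s.insec_exists[of "Ta T h" Wt] vert_Wt[OF aN] aN by (auto simp: vert_def)
    have "insec (Ms cmap) Wt h1 (w.c (Ta T h))" using insec_c[of "Ta T h" h1] h1 aN by (simp add: g_def)
    moreover have "w.c (Ta T h) = Ts T h0" using rho_Ts[of h] hN h0 by (simp add: w.q_def tap_def)
    ultimately have "h1 = h0" using m.s.insec_unique[OF _ insec_Ts[OF h0(1)] h1(1) h0(1)] Wt_Nb h1 h0 by simp
    thus ?thesis using h1 by simp
  qed
  ultimately show ?case using good.step[of cmap h0 h] ings_cmap h0 Suc(3) by simp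
qed

lemma gmap_cmap: "gmap cmap"
  unfolding gmap_def
proof (intro conjI ballI)
  show "is_map cmap" unfolding is_map_rmap by unfold_locales
  show "ing cmap (Ma cmap d)" if "d \<in> rootface cmap" for d
  proof -
    have "d \<in> Nb" using that m.root_sub by auto
    hence "Ta T d \<in> Wt" using E_U root_iff that by blast
    thus ?thesis using ings_cmap by (auto simp: ings_def)
  qed
  show "vert cmap d \<inter> ings cmap \<noteq> {}" if "d \<in> Md cmap" for d using vert_Wt ings_cmap that by simp
  show "good cmap h" if "h \<in> ings cmap" for h
  proof -
    have hW: "h \<in> Wt" using that ings_cmap by simp
    have "Ts T h \<in> Td T" "val (Ts T h) = 1" using Ts_Wt[OF hW] Wt_val by auto
    then obtain n where "(w.q ^^ n) (Ts T h) \<in> w.U" using w.reach_U by blast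
    thus ?thesis using good_cmap hW by blast
  qed
qed

section \<open>The first mapping sends the closure back to the mobile\<close>

definition psi :: "'a \<times> tag \<Rightarrow> 'a" where
  "psi x = (case x of (d, Wh) \<Rightarrow> d | (d, Bl) \<Rightarrow> E d)"

lemma psi_sel [simp]: "psi (d, Wh) = d" "psi (d, Bl) = E d"
  by (simp_all add: psi_def)

lemma E_nonroot: "d \<in> Nb \<Longrightarrow> d \<notin> rootface cmap \<longleftrightarrow> Tblack T (E d)"
  using root_iff E_Cod U_not_black by (auto simp: Cod_def)

lemma E_bud: assumes "d \<in> Nb" "d \<notin> rootface cmap" shows "E d \<in> Tbud T \<longleftrightarrow> \<not> Tblack T (Ta T d)"
proof (cases "Tblack T (Ta T d)")
  case True
  thus ?thesis using E_black[OF assms(1)] Ta_Nb(1)[OF assms(1)] by simp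
next
  case False
  hence "Ta T d \<in> Wt" using Ta_Nb(1)[OF assms(1)] by (auto simp: Wt_def)
  hence "E d \<in> w.V1" using e_Wt by (simp add: E_def)
  thus ?thesis using False V1_alt root_iff assms by auto
qed

lemma ing_cmap: "z \<in> Nb \<Longrightarrow> ing cmap z \<longleftrightarrow> \<not> Tblack T z"
  using ings_cmap by (auto simp: ings_def Wt_def)

lemma psi_iso: "mob_isof psi (PhiP cmap) T"
proof -
  have R: "rootface cmap \<subseteq> Nb" using m.root_sub by simp
  have Eim: "E ` (Nb - rootface cmap) = {x \<in> Td T. Tblack T x}"
  proof (intro equalityI subsetI)
    fix x assume "x \<in> E ` (Nb - rootface cmap)"
    thus "x \<in> {x \<in> Td T. Tblack T x}" using E_nonroot E_Cod Cod_Td by auto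
  next
    fix x assume x: "x \<in> {x \<in> Td T. Tblack T x}"
    then obtain d where "d \<in> Nb" "E d = x" using E_surj by (auto simp: Cod_def)
    thus "x \<in> E ` (Nb - rootface cmap)" using E_nonroot x by auto
  qed
  have Td: "psi ` Td (PhiP cmap) = Td T"
  proof -
    have "psi ` Td (PhiP cmap) = Wt \<union> E ` (Nb - rootface cmap)"
      unfolding Td_PhiP ings_cmap by (simp add: image_Un image_image)
    thus ?thesis unfolding Eim by (auto simp: Wt_def)
  qed
  have inj: "inj_on psi (Td (PhiP cmap))"
  proof (rule inj_onI)
    fix x y assume a: "x \<in> Td (PhiP cmap)" "y \<in> Td (PhiP cmap)" "psi x = psi y"
    obtain d t d' t' where xy: "x = (d, t)" "y = (d', t')" by (cases x; cases y)
    show "x = y"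
    proof (cases t; cases t')
      assume "t = Bl" "t' = Bl" thus ?thesis using a xy E_inj by auto
    next
      assume "t = Wh" "t' = Bl"
      thus ?thesis using a xy ings_cmap E_nonroot by (auto simp: Wt_def)
    next
      assume "t = Bl" "t' = Wh"
      thus ?thesis using a xy ings_cmap E_nonroot by (auto simp: Wt_def)
    qed (use a xy in auto)
  qed
  have bud: "psi ` Tbud (PhiP cmap) = Tbud T"
  proof -
    have "psi ` Tbud (PhiP cmap) = E ` {d \<in> Nb - rootface cmap. ing cmap (Ta T d)}"
      unfolding Tbud_PhiP by (simp add: image_image)
    also have "\<dots> = Tbud T"
    proof (intro equalityI subsetI)
      fix x assume "x \<in> E ` {d \<in> Nb - rootface cmap. ing cmap (Ta T d)}"
      thus "x \<in> Tbud T" using E_bud ing_cmap[OF Ta_Nb(1)] by auto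
    next
      fix x assume x: "x \<in> Tbud T"
      hence "x \<in> {x \<in> Td T. Tblack T x}" using bud_sub bud_black by auto
      then obtain d where d: "d \<in> Nb - rootface cmap" "x = E d" unfolding Eim[symmetric] by blast
      hence "ing cmap (Ta T d)" using E_bud x ing_cmap[OF Ta_Nb(1)] by simp
      thus "x \<in> E ` {d \<in> Nb - rootface cmap. ing cmap (Ta T d)}" using d by blast
    qed
    finally show ?thesis .
  qed
  have "psi (Ts (PhiP cmap) x) = Ts T (psi x) \<and> Tblack T (psi x) = Tblack (PhiP cmap) x"
    if x: "x \<in> Td (PhiP cmap)" for x
  proof -
    obtain d t where dt: "x = (d, t)" by (cases x)
    show ?thesis
    proof (cases t)
      case Wh
      hence "d \<in> Wt" using x dt ings_cmap by simp
      thus ?thesis using dt Wh nxt_Ts by (simp add: Wt_def)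
    next
      case Bl
      hence d: "d \<in> Nb" "d \<notin> rootface cmap" using x dt by auto
      have bl: "Tblack T (E d)" using E_nonroot d by blast
      let ?y = "phi_inv cmap d"
      have y: "?y \<in> Nb" "?y \<notin> rootface cmap" "phi cmap ?y = d"
        using m.phi_inv_mem[of d] m.root_phi_inv[of d] m.phi_phi_inv[of d] d by auto
      have by': "Tblack T (E ?y)" using E_nonroot y by blast
      have "E d = tsi (E ?y)" using E_phi_black[OF y(1) by'] y(3) by simp
      hence "Ts T (E d) = E ?y" using t.f_inv Cod_Td E_Cod y by simp
      thus ?thesis using dt Bl bl by simp
    qed
  qed
  moreover have "psi (Ta (PhiP cmap) x) = Ta T (psi x) \<and> Tw T (psi x) = Tw (PhiP cmap) x"
    if x: "x \<in> Td (PhiP cmap) - Tbud (PhiP cmap)" for x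
  proof -
    obtain d t where dt: "x = (d, t)" by (cases x)
    show ?thesis
    proof (cases t)
      case Wh
      hence d: "d \<in> Nb" using x dt ings_cmap Wt_Nb by simp
      show ?thesis using dt Wh E_black[OF d] ing_cmap[OF Ta_Nb(1)[OF d]] by auto
    next
      case Bl
      hence d: "d \<in> Nb" "d \<notin> rootface cmap" "\<not> ing cmap (Ta T d)" using x dt by auto
      have aN: "Ta T d \<in> Nb" "Ta T (Ta T d) = d" using Ta_Nb d by auto
      have bl: "Tblack T (Ta T d)" using d ing_cmap[OF aN(1)] by simp
      have Ed: "E d = Ta T d" by (rule E_black[OF d(1) bl])
      show ?thesis using dt Bl Ed aN E_black[OF aN(1)] ing_cmap[OF d(1)] wt[OF aN(1)] bl by auto
    qed
  qed
  ultimately show ?thesis unfolding mob_isof_def bij_betw_def using Td inj bud by blast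
qed

end

section \<open>Mobiles of negative excess\<close>

lemma mob_isof_trans:
  assumes "mob_isof f T U" "mob_isof h U V" "Tbud T \<subseteq> Td T" shows "mob_isof (h \<circ> f) T V"
proof -
  have f: "bij_betw f (Td T) (Td U)" "f ` Tbud T = Tbud U"
    "\<And>x. x \<in> Td T \<Longrightarrow> f (Ts T x) = Ts U (f x) \<and> Tblack U (f x) = Tblack T x"
    "\<And>x. x \<in> Td T \<Longrightarrow> x \<notin> Tbud T \<Longrightarrow> f (Ta T x) = Ta U (f x) \<and> Tw U (f x) = Tw T x"
    using assms(1) by (auto simp: mob_isof_def)
  have h: "bij_betw h (Td U) (Td V)" "h ` Tbud U = Tbud V"
    "\<And>x. x \<in> Td U \<Longrightarrow> h (Ts U x) = Ts V (h x) \<and> Tblack V (h x) = Tblack U x"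
    "\<And>x. x \<in> Td U \<Longrightarrow> x \<notin> Tbud U \<Longrightarrow> h (Ta U x) = Ta V (h x) \<and> Tw V (h x) = Tw U x"
    using assms(2) by (auto simp: mob_isof_def)
  have mem: "f x \<in> Td U" if "x \<in> Td T" for x using f(1) that by (auto simp: bij_betw_def)
  have nb: "f x \<notin> Tbud U" if "x \<in> Td T" "x \<notin> Tbud T" for x
    using f(1,2) that assms(3) by (metis bij_betw_imp_inj_on inj_on_image_mem_iff)
  have "bij_betw (h \<circ> f) (Td T) (Td V)" by (rule bij_betw_trans[OF f(1) h(1)])
  moreover have "(h \<circ> f) ` Tbud T = Tbud V" using f(2) h(2) image_comp[of h f "Tbud T"] by simp
  ultimately show ?thesis unfolding mob_isof_def using f(3,4) h(3,4) mem nb by simp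
qed

locale negmob = nmob T for T :: "nat mobile" +
  assumes neg: "excess T < 0"
begin

text \<open>The buds that remain unmatched; each of them receives a new white leaf.  The old half-edge x is
  coded by 2 * x and the leaf attached at the bud b by 2 * b + 1.\<close>
definition S :: "nat set" where
  "S = {b \<in> Tbud T. \<forall>n>0. w.P b n \<le> -1}"

definition lvs :: "nat set" where
  "lvs = (\<lambda>b. 2 * b + 1) ` S"

text \<open>All old buds get weight 0 because those in \<open>S\<close> turn into proper black
  half-edges, which must weigh 0; a new leaf weighs 1 as admissibility demands of the ingoing half
  of an outer edge.\<close>

definition grown :: "nat mobile" where
  "grown = \<lparr> Td = (\<lambda>x. 2 * x) ` Td T \<union> lvs, Tbud = (\<lambda>x. 2 * x) ` (Tbud T - S),
     Ta = (\<lambda>z. if odd z then z - 1 else if z div 2 \<in> S then z + 1 else 2 * Ta T (z div 2)),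
     Ts = (\<lambda>z. if odd z then z else 2 * Ts T (z div 2)),
     Tblack = (\<lambda>z. even z \<and> Tblack T (z div 2)),
     Tw = (\<lambda>z. if odd z then 1 else if z div 2 \<in> Tbud T then 0 else Tw T (z div 2)) \<rparr>"

text \<open>A copy of \<open>T\<close> on the even numbers, so that cutting the new leaves off again
  gives this mobile itself.\<close>

definition shrunk :: "nat mobile" where
  "shrunk = \<lparr> Td = (\<lambda>x. 2 * x) ` Td T, Tbud = (\<lambda>x. 2 * x) ` Tbud T,
     Ta = (\<lambda>z. 2 * Ta T (z div 2)), Ts = (\<lambda>z. 2 * Ts T (z div 2)),
     Tblack = (\<lambda>z. Tblack T (z div 2)), Tw = (\<lambda>z. Tw T (z div 2)) \<rparr>"

lemma S_bud: "b \<in> S \<Longrightarrow> b \<in> Tbud T"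
  by (simp add: S_def)

lemma S_Td: "b \<in> S \<Longrightarrow> b \<in> Td T"
  using S_bud bud_sub by auto

lemma fin_S: "finite S"
  using S_Td finT finite_subset by (metis subsetI)

lemma odd_neq: "2 * (x::nat) \<noteq> 2 * b + 1" "2 * (x::nat) \<noteq> Suc (2 * b)"
  "2 * b + 1 \<noteq> 2 * (x::nat)" "Suc (2 * b) \<noteq> 2 * (x::nat)"
  by presburger+

lemma grown_sel [simp]:
  "2 * x \<in> Td grown \<longleftrightarrow> x \<in> Td T" "Suc (2 * b) \<in> Td grown \<longleftrightarrow> b \<in> S"
  "2 * x \<in> Tbud grown \<longleftrightarrow> x \<in> Tbud T \<and> x \<notin> S" "Suc (2 * b) \<notin> Tbud grown"
  "Ta grown (2 * x) = (if x \<in> S then Suc (2 * x) else 2 * Ta T x)" "Ta grown (Suc (2 * b)) = 2 * b"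
  "Ts grown (2 * x) = 2 * Ts T x" "Ts grown (Suc (2 * b)) = Suc (2 * b)"
  "Tblack grown (2 * x) = Tblack T x" "\<not> Tblack grown (Suc (2 * b))"
  "Tw grown (2 * x) = (if x \<in> Tbud T then 0 else Tw T x)" "Tw grown (Suc (2 * b)) = 1"
  using odd_neq by (auto simp: grown_def lvs_def inj_image_mem_iff inj_def)

lemma grown_cases:
  assumes "z \<in> Td grown"
  obtains x where "z = 2 * x" "x \<in> Td T" | b where "z = Suc (2 * b)" "b \<in> S"
  using assms by (auto simp: grown_def lvs_def)

lemma premob_grown: "premob grown"
proof
  have f: "finite (Td grown)" using finT fin_S by (simp add: grown_def lvs_def)
  show "finite (Td grown)" by (rule f)
  show "Tbud grown \<subseteq> Td grown" using bud_sub by (auto simp: grown_def)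
  show "Ta grown z \<in> Td grown - Tbud grown \<and> Ta grown z \<noteq> z \<and> Ta grown (Ta grown z) = z"
    if z: "z \<in> Td grown - Tbud grown" for z
  proof -
    from z have "z \<in> Td grown" by simp
    thus ?thesis
    proof (cases rule: grown_cases)
      case (1 x)
      have "Ta T x \<notin> S \<and> Ta T x \<in> Td T - Tbud T \<and> Ta T x \<noteq> x \<and> Ta T (Ta T x) = x" if "x \<notin> S"
        using z 1 that Ta_props[of x] S_bud by auto
      thus ?thesis using 1 by auto
    next
      case (2 b) thus ?thesis using S_Td by auto
    qed
  qed
  have "fperm (Ts grown) (Td grown)"
  proof (rule fpermI[OF f])
    show "Ts grown z \<in> Td grown" if "z \<in> Td grown" for z
      using that t.mem by (cases rule: grown_cases) auto
    show "inj_on (Ts grown) (Td grown)"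
    proof (rule inj_onI)
      fix y z assume a: "y \<in> Td grown" "z \<in> Td grown" "Ts grown y = Ts grown z"
      from a(1) show "y = z"
      proof (cases rule: grown_cases)
        case y: (1 x)
        from a(2) show ?thesis by (cases rule: grown_cases) (use a(3) y t.inj odd_neq in auto)
      next
        case y: (2 b)
        from a(2) show ?thesis by (cases rule: grown_cases) (use a(3) y odd_neq in auto)
      qed
    qed
  qed
  thus "bij_betw (Ts grown) (Td grown) (Td grown)" by (simp add: fperm_def)
  show "Tblack grown (Ts grown z) = Tblack grown z" if "z \<in> Td grown" for z
    using that col by (cases rule: grown_cases) auto
  show "Tblack grown z" if "z \<in> Tbud grown" for z
    using that bud_black by (auto simp: grown_def)
qed

sublocale G: premob grown by (rule premob_grown)

lemma mvert_even: assumes "x \<in> Td T" shows "mvert grown (2 * x) = (\<lambda>x. 2 * x) ` mvert T x"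
  unfolding mvert_def by (rule orb_image) simp

lemma mvert_odd: "mvert grown (Suc (2 * b)) = {Suc (2 * b)}"
proof
  show "mvert grown (Suc (2 * b)) \<subseteq> {Suc (2 * b)}" unfolding mvert_def by (rule G.t.orb_least) auto
  show "{Suc (2 * b)} \<subseteq> mvert grown (Suc (2 * b))" unfolding mvert_def using G.t.orb_refl by auto
qed

lemma nmob_grown: "nmob grown"
proof
  have st: "G.sim (2 * x) (2 * y)" if "(x, y) \<in> mob_conn T" for x y
  proof -
    from that consider "x \<in> Td T - Tbud T" "y = Ta T x" | "x \<in> Td T" "y = Ts T x"
      by (auto simp: mob_conn_def)
    thus ?thesis
    proof cases
      case 1
      have "x \<notin> S" using 1 S_bud by auto
      thus ?thesis using G.sim_Ta[of "2 * x"] 1 by simp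
    next
      case 2 thus ?thesis using G.sim_Ts[of "2 * x"] by simp
    qed
  qed
  have "(x, y) \<in> (mob_conn T)\<^sup>* \<Longrightarrow> G.sim (2 * x) (2 * y)" for x y
  proof (induction rule: rtrancl_induct)
    case base show ?case by (rule G.sim_refl)
  next
    case (step y z) show ?case by (rule G.sim_trans[OF step(3) st[OF step(2)]])
  qed
  hence ev: "G.sim (2 * x) (2 * y)" if "x \<in> Td T" "y \<in> Td T" for x y
    using connT[OF that] by (simp add: sim_def)
  have rep: "\<exists>x\<in>Td T. G.sim z (2 * x)" if "z \<in> Td grown" for z
    using that
  proof (cases rule: grown_cases)
    case (1 x) thus ?thesis using G.sim_refl by auto
  next
    case (2 b)
    thus ?thesis using G.sim_Ta[of z] S_Td[of b] by (intro bexI[of _ b]) auto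
  qed
  show "G.sim y z" if "y \<in> Td grown" "z \<in> Td grown" for y z
    using rep[OF that(1)] rep[OF that(2)] ev G.sim_trans G.sim_sym by meson
  have mv: "mverts grown = (`) ((*) 2) ` mverts T \<union> (\<lambda>b. {Suc (2 * b)}) ` S"
  proof (intro equalityI subsetI)
    fix v assume "v \<in> mverts grown"
    then obtain z where z: "z \<in> Td grown" "v = mvert grown z" by (auto simp: mverts_def)
    from z(1) show "v \<in> (`) ((*) 2) ` mverts T \<union> (\<lambda>b. {Suc (2 * b)}) ` S"
      by (cases rule: grown_cases) (use z mvert_even mvert_odd in \<open>auto simp: mverts_def\<close>)
  next
    fix v assume "v \<in> (`) ((*) 2) ` mverts T \<union> (\<lambda>b. {Suc (2 * b)}) ` S"
    then consider x where "x \<in> Td T" "v = (\<lambda>x. 2 * x) ` mvert T x" | b where "b \<in> S" "v = {Suc (2 * b)}"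
      by (auto simp: mverts_def)
    thus "v \<in> mverts grown"
    proof cases
      case 1
      hence "v = mvert grown (2 * x)" using mvert_even by simp
      thus ?thesis using 1 grown_sel(1)[of x] unfolding mverts_def by blast
    next
      case 2
      hence "v = mvert grown (Suc (2 * b))" using mvert_odd by simp
      thus ?thesis using 2 grown_sel(2)[of b] unfolding mverts_def by blast
    qed
  qed
  have "card ((`) ((*) 2) ` mverts T) = card (mverts T)"
    by (rule card_image) (auto simp: inj_on_def inj_image_eq_iff)
  moreover have "card ((\<lambda>b. {Suc (2 * b)}) ` S) = card S" by (rule card_image) (auto simp: inj_on_def)
  moreover have "(`) ((*) 2) ` mverts T \<inter> (\<lambda>b. {Suc (2 * b)}) ` S = {}"
  proof (rule ccontr)
    assume "\<not> ?thesis"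
    then obtain v b where "(*) 2 ` v = {Suc (2 * b)}" by blast
    hence "Suc (2 * b) \<in> (*) 2 ` v" by simp
    thus False using odd_neq by auto
  qed
  ultimately have "card (mverts grown) = card (mverts T) + card S"
    unfolding mv using finT fin_S by (subst card_Un_disjoint) (auto simp: mverts_def)
  moreover have "card (Td grown - Tbud grown) = card (Td T - Tbud T) + 2 * card S"
  proof -
    have "Td grown - Tbud grown = ((*) 2) ` ((Td T - Tbud T) \<union> S) \<union> (\<lambda>b. Suc (2 * b)) ` S"
    proof (intro equalityI subsetI)
      fix z assume z: "z \<in> Td grown - Tbud grown"
      hence "z \<in> Td grown" by simp
      thus "z \<in> ((*) 2) ` ((Td T - Tbud T) \<union> S) \<union> (\<lambda>b. Suc (2 * b)) ` S"
        by (cases rule: grown_cases) (use z in auto)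
    next
      fix z assume "z \<in> ((*) 2) ` ((Td T - Tbud T) \<union> S) \<union> (\<lambda>b. Suc (2 * b)) ` S"
      thus "z \<in> Td grown - Tbud grown" using S_Td by auto
    qed
    moreover have "card (((*) 2) ` ((Td T - Tbud T) \<union> S)) = card ((Td T - Tbud T) \<union> S)"
      by (rule card_image) (auto simp: inj_on_def)
    moreover have "card ((Td T - Tbud T) \<union> S) = card (Td T - Tbud T) + card S"
      using finT fin_S S_bud by (intro card_Un_disjoint) auto
    moreover have "card ((\<lambda>b. Suc (2 * b)) ` S) = card S" by (rule card_image) (auto simp: inj_on_def)
    moreover have "((*) 2) ` ((Td T - Tbud T) \<union> S) \<inter> (\<lambda>b. Suc (2 * b)) ` S = {}" using odd_neq by auto
    ultimately show ?thesis using finT fin_S by (simp add: card_Un_disjoint)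
  qed
  ultimately show "2 * card (mverts grown) = card (Td grown - Tbud grown) + 2" using tree by simp
  show "(Tblack grown z \<longrightarrow> Tw grown z = 0) \<and> (\<not> Tblack grown z \<longrightarrow> 0 < Tw grown z)"
    if z: "z \<in> Td grown - Tbud grown" for z
  proof -
    from z have "z \<in> Td grown" by simp
    thus ?thesis by (cases rule: grown_cases) (use wt bud_black in auto)
  qed
qed

sublocale G: nmob grown by (rule nmob_grown)

text \<open>The tour is altered only where it passes a bud of \<open>S\<close> and now makes a
  detour to the leaf.\<close>

lemma rho_grown: assumes "x \<in> Td T" "rho x \<notin> S" shows "G.rho (2 * x) = 2 * rho x"
proof -
  obtain y where y: "y \<in> Td T" "Ts T y = x" using t.surj assms by blast
  have "G.rho (Ts grown (2 * y)) = G.tap (2 * y)" by (rule G.rho_Ts) (use y in simp)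
  moreover have r: "rho x = tap y" using rho_Ts y by auto
  moreover have "y \<notin> S"
  proof
    assume "y \<in> S"
    hence "tap y = y" using S_bud by (simp add: tap_def)
    thus False using assms r \<open>y \<in> S\<close> by simp
  qed
  ultimately show ?thesis using y by (simp add: G.tap_def tap_def)
qed

lemma val_grown: "x \<notin> S \<Longrightarrow> G.val (2 * x) = val x"
  by (simp add: G.val_def val_def)

lemma pow_grown:
  assumes "b \<in> Td T" "\<And>i. i \<le> n \<Longrightarrow> (rho ^^ i) b \<notin> S" "i \<le> n"
  shows "(G.rho ^^ i) (2 * b) = 2 * (rho ^^ i) b"
  using assms(3)
proof (induction i)
  case (Suc i)
  have "rho ((rho ^^ i) b) \<notin> S" using assms(2)[of "Suc i"] Suc by simp
  thus ?case using Suc rho_grown[OF w.pow_mem[OF assms(1)]] by simp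
qed simp

lemma P_grown:
  assumes "b \<in> Td T" "\<And>i. i \<le> n \<Longrightarrow> (rho ^^ i) b \<notin> S" "m \<le> Suc n"
  shows "G.w.P (2 * b) m = w.P b m"
  unfolding G.w.P_def w.P_def
proof (rule sum.cong[OF refl])
  fix i assume "i \<in> {..<m}"
  hence "i \<le> n" using assms(3) by simp
  thus "G.val ((G.rho ^^ i) (2 * b)) = val ((rho ^^ i) b)"
    using pow_grown[OF assms(1,2)] val_grown assms(2) by simp
qed

text \<open>All sums starting at a bud of \<open>S\<close> are negative, so an arc over such a bud
  could not close.\<close>

lemma arc_avoids:
  assumes "w.P b (Suc n) = 0" "\<forall>m. 0 < m \<and> m \<le> n \<longrightarrow> w.P b m \<le> -1" "i \<le> n"
  shows "(rho ^^ i) b \<notin> S"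
proof
  assume s: "(rho ^^ i) b \<in> S"
  have "w.P b (i + (Suc n - i)) = w.P b i + w.P ((rho ^^ i) b) (Suc n - i)" by (rule w.P_add)
  moreover have "w.P ((rho ^^ i) b) (Suc n - i) \<le> -1" using s assms(3) by (simp add: S_def)
  moreover have "w.P b i \<le> 0" using assms(2)[rule_format, of i] assms(3) by (cases i) auto
  ultimately show False using assms(1,3) by simp
qed

lemma arc_grown:
  assumes "b \<in> Td T" "w.arc b y" shows "G.w.arc (2 * b) (2 * y)" "b \<notin> S"
proof -
  obtain n where n: "(rho ^^ n) b = y" "w.P b (Suc n) = 0" "\<forall>m. 0 < m \<and> m \<le> n \<longrightarrow> w.P b m \<le> -1"
    using assms(2) unfolding w.arc_def by blast
  note av = arc_avoids[OF n(2,3)]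
  show "b \<notin> S" using av[of 0] by simp
  show "G.w.arc (2 * b) (2 * y)"
    unfolding G.w.arc_def
  proof (intro exI[of _ n] conjI allI impI)
    show "(G.rho ^^ n) (2 * b) = 2 * y" using pow_grown[OF assms(1) av, of n n] n by simp
    show "G.w.P (2 * b) (Suc n) = 0" using P_grown[OF assms(1) av, of n "Suc n"] n by simp
    show "G.w.P (2 * b) m \<le> -1" if "0 < m \<and> m \<le> n" for m
      using P_grown[OF assms(1) av, of n m] n(3) that by simp
  qed
qed

text \<open>The full turn ending at \<open>y\<close> has the negative total as its sum, so
  \<open>arc_ex\<close> finds a partner.\<close>

lemma white_matched:
  assumes "y \<in> Td T" "\<not> Tblack T y" shows "\<exists>b\<in>Tbud T - S. w.arc b y"
proof -
  have rX: "rho y \<in> Td T" using w.mem assms by simp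
  have "card (Td T) > 0" using finT assms by (auto simp: card_gt_0_iff)
  then obtain k where k: "card (Td T) = Suc k" by (cases "card (Td T)") auto
  have "(rho ^^ k) (rho y) = y" using w.enum(2)[OF assms(1)] k by (simp add: funpow_swap1)
  moreover have "w.P (rho y) (Suc k) \<le> 0" using w.P_total[OF rX] k sum_val neg by simp
  moreover have "val y = 1" using val_1 assms by simp
  ultimately obtain b where "b \<in> Td T" "val b = -1" "w.arc b y" using w.arc_ex assms rX by blast
  thus ?thesis using arc_grown(2) val_m1 by blast
qed

text \<open>Outside \<open>S\<close> the sums from \<open>b\<close> become nonnegative at some
  point. As letters are at most 1, the first time this happens the sum is exactly zero and the
  letter is a closing parenthesis.\<close>

lemma bud_matched:
  assumes "b \<in> Tbud T" "b \<notin> S" shows "\<exists>y\<in>Td T. \<not> Tblack T y \<and> w.arc b y"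
proof -
  have bT: "b \<in> Td T" using assms bud_sub by auto
  let ?Q = "\<lambda>n. 0 < n \<and> w.P b n \<ge> 0"
  have ex: "\<exists>n. ?Q n" using assms by (force simp: S_def)
  define n where "n = (LEAST n. ?Q n)"
  have n: "?Q n" unfolding n_def by (rule LeastI_ex[OF ex])
  have lt: "w.P b m \<le> -1" if "0 < m" "m < n" for m
    using not_less_Least[of m ?Q] that unfolding n_def by force
  obtain k where k: "n = Suc k" using n by (cases n) auto
  have "w.P b 1 = -1" using assms val_m1[of b] by (simp add: w.P_def)
  hence "k > 0" using n k by (cases k) auto
  hence Pk: "w.P b k \<le> -1" using lt k by simp
  have yT: "(rho ^^ k) b \<in> Td T" using w.pow_mem bT by simp
  have s: "w.P b n = w.P b k + val ((rho ^^ k) b)" using k by (simp add: w.P_Suc)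
  hence v: "val ((rho ^^ k) b) = 1" "w.P b (Suc k) = 0" using n Pk w.vals[OF yT] k by auto
  have "w.arc b ((rho ^^ k) b)"
    unfolding w.arc_def using v lt k by (intro exI[of _ k]) auto
  thus ?thesis using yT val_1[OF yT] v by blast
qed

text \<open>Matching is a bijection between the remaining buds and the white half-edges. So
  \<open>S\<close> has as many elements as the excess is below zero.\<close>

lemma card_S: "card {y \<in> Td T. \<not> Tblack T y} + card S = card (Tbud T)"
proof -
  define f where "f b = (SOME y. y \<in> Td T \<and> \<not> Tblack T y \<and> w.arc b y)" for b
  have f: "f b \<in> Td T \<and> \<not> Tblack T (f b) \<and> w.arc b (f b)" if "b \<in> Tbud T - S" for b
    unfolding f_def by (rule someI_ex) (use bud_matched that in blast)
  have "bij_betw f (Tbud T - S) {y \<in> Td T. \<not> Tblack T y}"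
    unfolding bij_betw_def
  proof
    show "inj_on f (Tbud T - S)"
    proof (rule inj_onI)
      fix x y assume xy: "x \<in> Tbud T - S" "y \<in> Tbud T - S" "f x = f y"
      hence "w.arc x (f x)" "w.arc y (f x)" using f by metis+
      thus "x = y" using w.arc_inj xy bud_sub by blast
    qed
    show "f ` (Tbud T - S) = {y \<in> Td T. \<not> Tblack T y}"
    proof
      show "f ` (Tbud T - S) \<subseteq> {y \<in> Td T. \<not> Tblack T y}" using f by blast
      show "{y \<in> Td T. \<not> Tblack T y} \<subseteq> f ` (Tbud T - S)"
      proof
        fix y assume "y \<in> {y \<in> Td T. \<not> Tblack T y}"
        then obtain b where b: "b \<in> Tbud T - S" "w.arc b y" using white_matched by blast
        hence "y = f b" using w.arc_fun f by blast
        thus "y \<in> f ` (Tbud T - S)" using b by blast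
      qed
    qed
  qed
  hence "card (Tbud T - S) = card {y \<in> Td T. \<not> Tblack T y}" by (rule bij_betw_same_card)
  moreover have "card (Tbud T - S) + card S = card (Tbud T)"
  proof -
    have "S \<subseteq> Tbud T" using S_bud by auto
    thus ?thesis using finite_subset[OF bud_sub finT] fin_S by (metis card_Diff_subset card_mono le_add_diff_inverse2)
  qed
  ultimately show ?thesis by simp
qed

lemma excess_grown: "0 < excess grown"
proof -
  have "{z \<in> Td grown. \<not> Tblack grown z} = (*) 2 ` {y \<in> Td T. \<not> Tblack T y} \<union> lvs"
  proof (intro equalityI subsetI)
    fix z assume z: "z \<in> {z \<in> Td grown. \<not> Tblack grown z}"
    hence "z \<in> Td grown" by simp
    thus "z \<in> (*) 2 ` {y \<in> Td T. \<not> Tblack T y} \<union> lvs"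
      by (cases rule: grown_cases) (use z in \<open>auto simp: lvs_def\<close>)
  next
    fix z assume "z \<in> (*) 2 ` {y \<in> Td T. \<not> Tblack T y} \<union> lvs"
    thus "z \<in> {z \<in> Td grown. \<not> Tblack grown z}" by (auto simp: lvs_def)
  qed
  moreover have "(*) 2 ` {y \<in> Td T. \<not> Tblack T y} \<inter> lvs = {}" using odd_neq by (auto simp: lvs_def)
  moreover have "card ((*) 2 ` {y \<in> Td T. \<not> Tblack T y}) = card {y \<in> Td T. \<not> Tblack T y}"
    by (rule card_image) (auto simp: inj_on_def)
  moreover have "card lvs = card S" unfolding lvs_def by (rule card_image) (auto simp: inj_on_def)
  moreover have "finite lvs" using fin_S by (simp add: lvs_def)
  ultimately have W: "card {z \<in> Td grown. \<not> Tblack grown z} = card {y \<in> Td T. \<not> Tblack T y} + card S"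
    using finT by (simp add: card_Un_disjoint)
  have "Tbud grown = (*) 2 ` (Tbud T - S)" by (simp add: grown_def)
  hence "card (Tbud grown) = card (Tbud T - S)" by (simp add: card_image inj_on_def)
  moreover have "card (Tbud T - S) \<le> card (Tbud T)" using finite_subset[OF bud_sub finT] by (intro card_mono) auto
  moreover have "card S > 0" using neg card_S by (simp add: excess_alt)
  moreover have "card (Tbud T - S) = card (Tbud T) - card S"
    using S_bud fin_S by (intro card_Diff_subset) auto
  ultimately show ?thesis unfolding G.excess_alt W using card_S by simp
qed

sublocale G: posmob grown by unfold_locales (rule excess_grown)

text \<open>Old arcs persist and match the remaining buds with all old white corners, which leaves
  exactly the new leaves unmatched. Through \<open>root_Ta\<close> they become the arrivals at the
  root face of the closure.\<close>

lemma U_grown: "z \<in> G.Wt \<Longrightarrow> z \<in> G.w.U \<longleftrightarrow> odd z"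
proof -
  assume z: "z \<in> G.Wt"
  hence zT: "z \<in> Td grown" "\<not> Tblack grown z" "G.val z = 1" using G.Wt_val by (auto simp: G.Wt_def)
  from zT(1) show ?thesis
  proof (cases rule: grown_cases)
    case (1 x)
    then obtain b where b: "b \<in> Tbud T - S" "w.arc b x" using white_matched zT by auto
    have "G.w.arc (2 * b) (2 * x)" using arc_grown(1) b bud_sub by blast
    moreover have "2 * b \<in> Td grown" "G.val (2 * b) = -1" using b bud_sub by (auto simp: G.val_m1)
    ultimately show ?thesis using 1 unfolding G.w.U_def by auto
  next
    case (2 b)
    have "\<not> G.w.arc c z" if c: "c \<in> Td grown" "G.val c = -1" for c
    proof
      assume a: "G.w.arc c z"
      have "c \<in> Tbud grown" using c G.val_m1 by simp
      then obtain d where d: "c = 2 * d" "d \<in> Tbud T" "d \<notin> S" by (auto simp: grown_def)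
      then obtain y where "w.arc d y" using bud_matched by blast
      hence "G.w.arc c (2 * y)" using arc_grown(1) d bud_sub by blast
      hence "z = 2 * y" using G.w.arc_fun a by blast
      thus False using 2 odd_neq by metis
    qed
    thus ?thesis using 2 zT unfolding G.w.U_def by auto
  qed
qed

lemma outs_grown: "outs G.cmap = lvs"
proof -
  interpret o: gm G.cmap by (rule gmap_gm[OF G.gmap_cmap])
  have iff: "h \<in> outs G.cmap \<longleftrightarrow> odd h" if h: "h \<in> G.Wt" for h
  proof -
    have "h \<in> outs G.cmap \<longleftrightarrow> Ts grown h \<in> G.w.U"
      using o.outs_iff[of h] G.root_Ta[OF h] G.Wt_Nb[OF h] by simp
    also have "\<dots> \<longleftrightarrow> odd (Ts grown h)" using U_grown G.Ts_Wt h by blast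
    also have "\<dots> \<longleftrightarrow> odd h" by (simp add: grown_def)
    finally show ?thesis .
  qed
  show ?thesis
  proof (intro equalityI subsetI)
    fix x assume x: "x \<in> outs G.cmap"
    hence xW: "x \<in> G.Wt" using o.outs_ings G.ings_cmap by auto
    hence "odd x" "x \<in> Td grown" using iff x by (auto simp: G.Wt_def)
    from \<open>x \<in> Td grown\<close> show "x \<in> lvs"
      by (cases rule: grown_cases) (use \<open>odd x\<close> in \<open>auto simp: lvs_def\<close>)
  next
    fix x assume "x \<in> lvs"
    then obtain b where b: "b \<in> S" "x = Suc (2 * b)" by (auto simp: lvs_def)
    hence "x \<in> G.Wt" by (simp add: G.Wt_def)
    thus "x \<in> outs G.cmap" using iff b by simp
  qed
qed

lemma adm_grown: "adm G.cmap"
proof -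
  interpret o: gm G.cmap by (rule gmap_gm[OF G.gmap_cmap])
  have "admissible G.cmap"
  proof (rule o.admissibleI)
    fix x assume "x \<in> outs G.cmap"
    then obtain b where b: "b \<in> S" "x = Suc (2 * b)" unfolding outs_grown lvs_def by auto
    have xW: "x \<in> G.Wt" using b by (simp add: G.Wt_def)
    have bl: "Tblack grown (2 * b)" using b S_bud bud_black by simp
    have "2 * b \<in> Td grown - Tbud grown" using b S_Td by simp
    hence "\<not> ing G.cmap (2 * b)" using G.ing_cmap bl by blast
    moreover have "vert G.cmap x \<inter> ings G.cmap = {x}"
      using G.vert_mvert[OF xW] mvert_odd b by (simp add: G.ings_cmap)
    ultimately show "\<not> ing G.cmap (Ma G.cmap x) \<and> Mw G.cmap x = 1 \<and> vert G.cmap x \<inter> ings G.cmap = {x}"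
      using b by simp
  qed
  thus ?thesis by unfold_locales
qed

lemma pruned_grown: "pruned grown lvs shrunk"
proof -
  have "Td grown - lvs = (\<lambda>x. 2 * x) ` Td T" using odd_neq by (auto simp: grown_def lvs_def)
  moreover have "Ta grown ` lvs = (\<lambda>x. 2 * x) ` S"
    unfolding lvs_def image_image by (rule image_cong) (auto simp: grown_def)
  moreover have "(\<lambda>x. 2 * x) ` (Tbud T - S) \<union> (\<lambda>x. 2 * x) ` S = (\<lambda>x. 2 * x) ` Tbud T"
    using S_bud by auto
  ultimately show ?thesis
    unfolding pruned_def using S_bud by (auto simp: shrunk_def grown_def)
qed

lemma shrunk_iso: "mob_isof (\<lambda>z. z div 2) shrunk T"
  unfolding mob_isof_def
  by (auto simp: shrunk_def bij_betw_def inj_on_def image_image)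

text \<open>The closure of the grown mobile is admissible and its leaves are the added ones, so
  pruning both sides of the isomorphism for the first mapping gives one for the second.\<close>

lemma PhiM_surj: "\<exists>M :: nat bmap. inBt M \<and> mob_iso (PhiM M) T"
proof -
  interpret o: adm G.cmap by (rule adm_grown)
  have "mob_isof G.psi (PhiM G.cmap) shrunk"
  proof (rule mob_isof_pruned[OF G.psi_iso o.pruned_PhiM pruned_grown])
    show "o.leaves \<subseteq> Td (PhiP G.cmap) - Tbud (PhiP G.cmap)" using o.Q.Lf_nb by blast
    show "G.psi ` o.leaves = lvs" unfolding o.leaves_def outs_grown by (simp add: image_image)
    show "Tbud (PhiM G.cmap) \<subseteq> Td (PhiP G.cmap)" using o.Q.Tbud'_sub o.Td_PhiM by blast
  qed
  hence "mob_isof ((\<lambda>z. z div 2) \<circ> G.psi) (PhiM G.cmap) T"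
    by (rule mob_isof_trans[OF _ shrunk_iso]) (rule o.Q.Tbud'_sub)
  moreover have "inBt G.cmap" using G.gmap_cmap o.adm by (simp add: inBt_def inB_iff_gmap)
  ultimately show ?thesis unfolding mob_iso_isof by blast
qed

end

section \<open>The bijections\<close>

lemma PhiP_inj:
  assumes "inB M1" "inB M2" "mob_iso (PhiP M1) (PhiP M2)" shows "map_iso M1 M2"
proof -
  have g: "gm M1" "gm M2" using assms by (simp_all add: inB_iff_gmap gmap_gm)
  have p: "pruned (PhiP M) ((\<lambda>x. (x, Wh)) ` {}) (PhiP M)" for M :: "'c bmap" by (simp add: pruned_def)
  obtain psiW psiB where "piso M1 M2 psiW psiB {} {}"
    using mob_iso_piso[OF g _ _ p p assms(3)] by (auto simp: leafset_def)
  then interpret piso0 M1 M2 psiW psiB by (rule piso0.intro)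
  show ?thesis by (rule iso)
qed

text \<open>The leaves are put back with \<open>extend\<close>, which leads to the situation of the
  first mapping, where no leaf is missing.\<close>

lemma PhiM_inj:
  assumes "inBt M1" "inBt M2" "mob_iso (PhiM M1) (PhiM M2)" shows "map_iso M1 M2"
proof -
  interpret A: adm M1 by (rule inBt_adm[OF assms(1)])
  interpret B: adm M2 by (rule inBt_adm[OF assms(2)])
  obtain psiW psiB where p: "piso M1 M2 psiW psiB (outs M1) (outs M2)"
    using mob_iso_piso[OF A.gm_axioms B.gm_axioms A.leafset_outs B.leafset_outs
      A.pruned_PhiM[unfolded A.leaves_def] B.pruned_PhiM[unfolded B.leaves_def] assms(3)] by blast
  have "piso M1 M2 (\<lambda>h. if h \<in> outs M1 then psiB h else psiW h) psiB {} {}"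
    by (rule piso.extend[OF p A.card_outs B.card_outs A.outs_props(2) B.outs_props(2)])
  then interpret piso0 M1 M2 "\<lambda>h. if h \<in> outs M1 then psiB h else psiW h" psiB by (rule piso0.intro)
  show ?thesis by (rule iso)
qed

lemma map_iso_mob_iso:
  assumes "premap M1" "premap M2" "map_iso M1 M2"
  shows "\<exists>\<psi>. mob_isof (\<lambda>(d, t). (\<psi> d, t)) (PhiP M1) (PhiP M2) \<and> \<psi> ` outs M1 = outs M2"
proof -
  obtain \<psi> where b: "bij_betw \<psi> (Md M1) (Md M2)"
    and x: "\<And>x. x \<in> Md M1 \<Longrightarrow> \<psi> (Ma M1 x) = Ma M2 (\<psi> x) \<and> \<psi> (Ms M1 x) = Ms M2 (\<psi> x) \<and> Mw M2 (\<psi> x) = Mw M1 x"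
    and r: "\<psi> ` rootface M1 = rootface M2"
    using assms(3) unfolding map_iso_def by blast
  have "mob_isof (\<lambda>(d, t). (\<psi> d, t)) (PhiP M1) (PhiP M2)"
    by (rule map_iso_PhiP[OF assms(1,2) b _ _ _ r]) (use x in auto)
  moreover have "\<psi> ` outs M1 = outs M2"
  proof -
    have "\<psi> ` Ma M1 ` rootface M1 = Ma M2 ` \<psi> ` rootface M1"
      unfolding image_image using x premap.root_sub[OF assms(1)] by (intro image_cong) auto
    thus ?thesis by (simp add: outs_def r)
  qed
  ultimately show ?thesis by blast
qed

theorem theorem11:
  shows
  "((\<forall>M :: nat bmap. inB M \<longrightarrow>
       is_N_mobile (PhiP M) \<and> 0 < excess (PhiP M)
     \<and> excess (PhiP M) = int (card (rootface M))
     \<and> (\<exists>g. bij_betw g (inner_faces M) (black_verts (PhiP M))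
           \<and> (\<forall>f\<in>inner_faces M. card (g f) = card f))
     \<and> (\<exists>g. bij_betw g (verts M) (white_verts (PhiP M))
           \<and> (\<forall>v\<in>verts M. sum (Tw (PhiP M)) (g v - Tbud (PhiP M)) = sum (Mw M) v))
     \<and> (\<exists>g. bij_betw g (edges M) (medges (PhiP M))
           \<and> (\<forall>e\<in>edges M. sum (Tw (PhiP M)) (g e) = sum (Mw M) e)))
   \<and> (\<forall>(M1 :: nat bmap) (M2 :: nat bmap). inB M1 \<longrightarrow> inB M2 \<longrightarrow>
        (mob_iso (PhiP M1) (PhiP M2) \<longleftrightarrow> map_iso M1 M2))
   \<and> (\<forall>T :: nat mobile. is_N_mobile T \<and> 0 < excess T \<longrightarrow>
        (\<exists>M :: nat bmap. inB M \<and> mob_iso (PhiP M) T)))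
 \<and> ((\<forall>M :: nat bmap. inBt M \<longrightarrow>
       is_N_mobile (PhiM M) \<and> excess (PhiM M) < 0
     \<and> excess (PhiM M) = - int (card (rootface M))
     \<and> (\<exists>g. bij_betw g (inner_faces M) (black_verts (PhiM M))
           \<and> (\<forall>f\<in>inner_faces M. card (g f) = card f))
     \<and> (\<exists>g. bij_betw g (inner_verts M) (white_verts (PhiM M))
           \<and> (\<forall>v\<in>inner_verts M. sum (Tw (PhiM M)) (g v - Tbud (PhiM M)) = sum (Mw M) v))
     \<and> (\<exists>g. bij_betw g (inner_edges M) (medges (PhiM M))
           \<and> (\<forall>e\<in>inner_edges M. sum (Tw (PhiM M)) (g e) = sum (Mw M) e)))
   \<and> (\<forall>(M1 :: nat bmap) (M2 :: nat bmap). inBt M1 \<longrightarrow> inBt M2 \<longrightarrow>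
        (mob_iso (PhiM M1) (PhiM M2) \<longleftrightarrow> map_iso M1 M2))
   \<and> (\<forall>T :: nat mobile. is_N_mobile T \<and> excess T < 0 \<longrightarrow>
        (\<exists>M :: nat bmap. inBt M \<and> mob_iso (PhiM M) T)))"
proof (rule conjI; intro conjI allI impI; (elim conjE)?)
  fix M :: "nat bmap" assume "inB M"
  then interpret gm M by (simp add: inB_iff_gmap gmap_gm)
  show "is_N_mobile (PhiP M)" using nmob_PhiP by (simp add: is_N_mobile_nmob)
  show e: "excess (PhiP M) = int (card (rootface M))" by (rule excess_PhiP)
  show "0 < excess (PhiP M)" using e card_root_pos by simp
  show "\<exists>g. bij_betw g (inner_faces M) (black_verts (PhiP M)) \<and> (\<forall>f\<in>inner_faces M. card (g f) = card f)"
    using faces_bij by (intro exI[of _ "\<lambda>f. (\<lambda>d. (d, Bl)) ` f"]) (simp add: card_image inj_on_def)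
  show "\<exists>g. bij_betw g (verts M) (white_verts (PhiP M))
      \<and> (\<forall>v\<in>verts M. sum (Tw (PhiP M)) (g v - Tbud (PhiP M)) = sum (Mw M) v)"
    using verts_bij vert_weight by blast
  show "\<exists>g. bij_betw g (edges M) (medges (PhiP M))
      \<and> (\<forall>e\<in>edges M. sum (Tw (PhiP M)) (g e) = sum (Mw M) e)"
    using edges_bij edge_weight by blast
next
  fix M1 M2 :: "nat bmap" assume B: "inB M1" "inB M2"
  show "mob_iso (PhiP M1) (PhiP M2) \<longleftrightarrow> map_iso M1 M2"
  proof
    assume i: "map_iso M1 M2"
    have "premap M1" "premap M2" using B by (auto simp: inB_def is_map_rmap rmap_def)
    thus "mob_iso (PhiP M1) (PhiP M2)" using map_iso_mob_iso[OF _ _ i] unfolding mob_iso_isof by blast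
  qed (rule PhiP_inj[OF B])
next
  fix T :: "nat mobile" assume T: "is_N_mobile T" "0 < excess T"
  interpret nmob T using T by (simp add: is_N_mobile_nmob)
  interpret posmob T by unfold_locales (rule T)
  show "\<exists>M :: nat bmap. inB M \<and> mob_iso (PhiP M) T"
    using gmap_cmap psi_iso unfolding mob_iso_isof inB_iff_gmap by blast
next
  fix M :: "nat bmap" assume "inBt M"
  then interpret adm M by (rule inBt_adm)
  show "is_N_mobile (PhiM M)" using Q.nmob' by (simp add: is_N_mobile_nmob)
  show e: "excess (PhiM M) = - int (card (rootface M))" by (rule excess_PhiM)
  show "excess (PhiM M) < 0" using e card_root_pos by simp
  show "\<exists>g. bij_betw g (inner_faces M) (black_verts (PhiM M)) \<and> (\<forall>f\<in>inner_faces M. card (g f) = card f)"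
    unfolding black_verts_PhiM
    using faces_bij by (intro exI[of _ "\<lambda>f. (\<lambda>d. (d, Bl)) ` f"]) (simp add: card_image inj_on_def)
  show "\<exists>g. bij_betw g (inner_verts M) (white_verts (PhiM M))
      \<and> (\<forall>v\<in>inner_verts M. sum (Tw (PhiM M)) (g v - Tbud (PhiM M)) = sum (Mw M) v)"
    using inner_verts_bij inner_vert_weight by blast
  show "\<exists>g. bij_betw g (inner_edges M) (medges (PhiM M))
      \<and> (\<forall>e\<in>inner_edges M. sum (Tw (PhiM M)) (g e) = sum (Mw M) e)"
    using inner_edges_bij inner_edge_weight by blast
next
  fix M1 M2 :: "nat bmap" assume B: "inBt M1" "inBt M2"
  interpret A: adm M1 by (rule inBt_adm[OF B(1)])
  interpret B: adm M2 by (rule inBt_adm[OF B(2)])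
  show "mob_iso (PhiM M1) (PhiM M2) \<longleftrightarrow> map_iso M1 M2"
  proof
    assume "map_iso M1 M2"
    then obtain \<psi> where i: "mob_isof (\<lambda>(d, t). (\<psi> d, t)) (PhiP M1) (PhiP M2)" "\<psi> ` outs M1 = outs M2"
      using map_iso_mob_iso[OF A.premap_axioms B.premap_axioms] by blast
    \<comment> \<open>An isomorphism of maps respects the root face, hence sends leaves to leaves
      and is compatible with pruning.\<close>
    have "mob_isof (\<lambda>(d, t). (\<psi> d, t)) (PhiM M1) (PhiM M2)"
    proof (rule mob_isof_pruned[OF i(1) A.pruned_PhiM B.pruned_PhiM])
      show "A.leaves \<subseteq> Td (PhiP M1) - Tbud (PhiP M1)" using A.Q.Lf_nb by blast
      show "(\<lambda>(d, t). (\<psi> d, t)) ` A.leaves = B.leaves"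
        unfolding A.leaves_def B.leaves_def i(2)[symmetric] by (simp add: image_image)
      show "Tbud (PhiM M1) \<subseteq> Td (PhiP M1)" using A.Q.Tbud'_sub A.Td_PhiM by blast
    qed
    thus "mob_iso (PhiM M1) (PhiM M2)" unfolding mob_iso_isof by blast
  qed (rule PhiM_inj[OF B])
next
  fix T :: "nat mobile" assume T: "is_N_mobile T" "excess T < 0"
  interpret nmob T using T by (simp add: is_N_mobile_nmob)
  interpret negmob T by unfold_locales (rule T)
  show "\<exists>M :: nat bmap. inBt M \<and> mob_iso (PhiM M) T" by (rule PhiM_surj)
qed

end
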